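(* Let $M$ be a supermanifold (possibly an ordinary manifold), let $\mathfrak{V}(M)$ be its algebra of densities, and let $\varepsilon\in\{0,1\}$ be a parity. There is a one-to-one correspondence between brackets of weight $0$ and parity $\varepsilon$ in $\mathfrak{V}(M)$ and second order differential operators $\Delta$ of parity $\varepsilon$ in $\mathfrak{V}(M)$, i.e. quadratic pencils $\Delta_w$, normalized by $\Delta(1)=0$ and satisfying the self-adjointness condition $(\Delta_w)^*=\Delta_{1-w}$ (an operator $\Delta$ corresponding to the bracket that it generates). To the bracket with the matrix $$(\hat S^{\hat a\hat b})=\begin{pmatrix} S^{ab} & t\gamma^a\\ t\gamma^a & t^2\theta\end{pmatrix}$$ there corresponds the "canonical pencil", given in local coordinates by $$\Delta_w=\tfrac12\Bigl(S^{ab}\partial_b\partial_a+\bigl(\partial_bS^{ba}(-1)^{\tilde b(\varepsilon+1)}+(2w-1)\gamma^a\bigr)\partial_a+w\,\partial_a\gamma^a(-1)^{\tilde a(\varepsilon+1)}+w(w-1)\,\theta\Bigr).$$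
   Context: Tilde denotes parity: $\tilde a$ is the parity of the local coordinate $x^a$, $\tilde f$ that of $f$; $\partial_a=\partial/\partial x^a$. On ordinary manifolds all sign factors are $1$ and $\varepsilon=0$. Algebra of densities. $\mathfrak{V}(M)$ is the algebra of formal (finite) linear combinations of densities of arbitrary weights $w\in\mathbb{R}$ on $M$, with the natural multiplication (weights add) and unit $1$. In local coordinates an element $\sum_w\psi_w(x)(Dx)^w$ is represented by the generating function $\boldsymbol\psi(x,t)=\sum_w t^w\psi_w(x)$, where $t$ is an even variable standing for $Dx$; under a change of coordinates $t'=Jt$, with $J=Dx'/Dx$ the Jacobian (Berezinian in the super case). The pairs $(x^a,t)$ are local coordinates $x^{\hat a}$ on a manifold $\hat M$. The invariant scalar product is $\langle\boldsymbol\psi,\boldsymbol\chi\rangle=\int_M\operatorname{Res}\bigl(t^{-2}\boldsymbol\psi(x,t)\boldsymbol\chi(x,t)\bigr)Dx$ (defined whenever the integral makes sense, e.g. for compact supports), i.e. the integral of the weight-$1$ component of the product. Brackets. A bracket of parity $\varepsilon$ in a commutative superalgebra is a symmetric bi-derivation: $\{f,g\}=(-1)^{\tilde f\tilde g}\{g,f\}$ and $\{f,gh\}=\{f,g\}h+(-1)^{(\varepsilon+\tilde f)\tilde g}g\{f,h\}$. A bracket in $\mathfrak{V}(M)$ has weight $0$ if the bracket of a $w_1$-density and a $w_2$-density is a $(w_1+w_2)$-density. Such brackets are specified by symmetric tensors $\hat S^{\hat a\hat b}$ on $\hat M$ of the matrix form displayed in the claim, via $\{\boldsymbol\psi,\boldsymbol\chi\}=\hat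 S^{\hat a\hat b}\,\partial_{\hat b}\boldsymbol\psi\,\partial_{\hat a}\boldsymbol\chi\,(-1)^{\tilde{\hat a}\tilde{\boldsymbol\psi}}$, where $S^{ab},\gamma^a,\theta$ depend only on $x$. Here $S^{ab}$ is a symmetric tensor on $M$ (giving the bracket $\{f,g\}=S^{ab}\partial_bf\,\partial_ag(-1)^{\tilde a\tilde f}$ on functions), $\gamma^a$ is an upper connection in the bundle of volume forms associated with $S^{ab}$, i.e. $\gamma^{a'}=(\gamma^a+S^{ab}\partial_b\ln J)\,\partial x^{a'}/\partial x^a$, and $\theta'=\theta+2\gamma^a\partial_a\ln J+S^{ab}\partial_b\ln J\,\partial_a\ln J$ (the transformation laws expressing that $\hat S^{\hat a\hat b}$ is a tensor on $\hat M$). Operators. A second order (i.e. order $\leqslant 2$) differential operator $\Delta$ in $\mathfrak{V}(M)$ is represented by an operator pencil $\Delta_w$, where $\Delta_w$ is the restriction of $\Delta$ to $w$-densities, taking $w$-densities to $w$-densities; in local coordinates it is quadratic in $w$: $\Delta_w=\Delta_0+wA+w^2B$, where $\Delta_0$ is an operator of order $\leqslant2$ on functions, and $A$, $B$ are differential operators of orders $\leqslant1$ and $0$. The adjoint $(\Delta_w)^*$, acting on $(1-w)$-densities, is taken with respect to the scalar product $\langle\ ,\ \rangle$: $\langle\Delta\boldsymbol\psi,\boldsymbol\chi\rangle=(-1)^{\varepsilon\tilde{\boldsymbol\psi}}\langle\boldsymbol\psi,\Delta^*\boldsymbol\chi\rangle$. The bracket generated by $\Delta$ of parity $\varepsilon$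 with $\Delta(1)=0$ is $\{\boldsymbol\psi,\boldsymbol\chi\}=\Delta(\boldsymbol\psi\boldsymbol\chi)-(\Delta\boldsymbol\psi)\boldsymbol\chi-(-1)^{\varepsilon\tilde{\boldsymbol\psi}}\boldsymbol\psi(\Delta\boldsymbol\chi)$. *)

theory Defs
  imports
    "HOL-Analysis.Analysis"
    "HOL-Combinatorics.Permutations"
    "HOL-Library.Function_Algebras"
    "HOL-Library.Poly_Mapping"
begin

section \<open>Grassmann numbers\<close>

text \<open>
  An element is the family of its coefficients at the ordered monomials \<open>\<xi>\<^sub>I\<close>, where \<open>I\<close> runs over the
  finite sets of (natural number) labels of odd generators.
\<close>

typedef grassmann = "{g :: nat set \<Rightarrow> real. \<forall>I. infinite I \<longrightarrow> g I = 0}"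
  morphisms gcoeff Abs_grassmann
  by auto

setup_lifting type_definition_grassmann

definition inversions :: "nat set \<Rightarrow> nat set \<Rightarrow> nat" where
  "inversions J K = card {(j, k). j \<in> J \<and> k \<in> K \<and> k < j}"

lemma inversions_Un_left:
  assumes "finite J" "finite K" "finite L" "J \<inter> K = {}"
  shows "inversions (J \<union> K) L = inversions J L + inversions K L"
proof -
  have eq: "{(j, k). j \<in> J \<union> K \<and> k \<in> L \<and> k < j} =
      {(j, k). j \<in> J \<and> k \<in> L \<and> k < j} \<union> {(j, k). j \<in> K \<and> k \<in> L \<and> k < j}"
    by auto
  have "finite {(j, k). j \<in> J \<and> k \<in> L \<and> k < j}" "finite {(j, k). j \<in> K \<and> k \<in> L \<and> k < j}"
    using assms by (auto intro: finite_subset[of _ "J \<times> L"] finite_subset[of _ "K \<times> L"])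
  then show ?thesis
    unfolding inversions_def eq using assms by (intro card_Un_disjoint) auto
qed

lemma inversions_Un_right:
  assumes "finite J" "finite K" "finite L" "K \<inter> L = {}"
  shows "inversions J (K \<union> L) = inversions J K + inversions J L"
proof -
  have eq: "{(j, k). j \<in> J \<and> k \<in> K \<union> L \<and> k < j} =
      {(j, k). j \<in> J \<and> k \<in> K \<and> k < j} \<union> {(j, k). j \<in> J \<and> k \<in> L \<and> k < j}"
    by auto
  have "finite {(j, k). j \<in> J \<and> k \<in> K \<and> k < j}" "finite {(j, k). j \<in> J \<and> k \<in> L \<and> k < j}"
    using assms by (auto intro: finite_subset[of _ "J \<times> K"] finite_subset[of _ "J \<times> L"])
  then show ?thesis
    unfolding inversions_def eq using assms by (intro card_Un_disjoint) auto
qed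

lemma inversions_empty [simp]: "inversions {} K = 0" "inversions J {} = 0"
  by (simp_all add: inversions_def)

instantiation grassmann :: real_algebra_1
begin

lift_definition zero_grassmann :: grassmann is "\<lambda>I. 0" by simp
lift_definition one_grassmann :: grassmann is "\<lambda>I. if I = {} then 1 else 0" by auto
lift_definition plus_grassmann :: "grassmann \<Rightarrow> grassmann \<Rightarrow> grassmann" is "\<lambda>g h I. g I + h I" by simp
lift_definition minus_grassmann :: "grassmann \<Rightarrow> grassmann \<Rightarrow> grassmann" is "\<lambda>g h I. g I - h I" by simp
lift_definition uminus_grassmann :: "grassmann \<Rightarrow> grassmann" is "\<lambda>g I. - g I" by simp
lift_definition scaleR_grassmann :: "real \<Rightarrow> grassmann \<Rightarrow> grassmann" is "\<lambda>r g I. r * g I" by simp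
lift_definition times_grassmann :: "grassmann \<Rightarrow> grassmann \<Rightarrow> grassmann" is
  "\<lambda>g h I. if finite I then \<Sum>J\<in>Pow I. (-1) ^ inversions J (I - J) * g J * h (I - J) else 0"
  by simp

instance
proof
  fix a b c :: grassmann and r s :: real
  show "a + b + c = a + (b + c)" "a + b = b + a" "0 + a = a" "- a + a = 0" "a - b = a + - b"
    by (transfer; auto)+
  show "r *\<^sub>R (a + b) = r *\<^sub>R a + r *\<^sub>R b" "(r + s) *\<^sub>R a = r *\<^sub>R a + s *\<^sub>R a"
       "r *\<^sub>R s *\<^sub>R a = (r * s) *\<^sub>R a" "1 *\<^sub>R a = a"
    by (transfer; auto simp: algebra_simps)+
  show "(a + b) * c = a * c + b * c" "a * (b + c) = a * b + a * c"
    by (transfer; auto simp: algebra_simps sum.distrib)+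
  show "r *\<^sub>R a * b = r *\<^sub>R (a * b)" "a * r *\<^sub>R b = r *\<^sub>R (a * b)"
    by (transfer; auto simp: algebra_simps sum_distrib_left intro!: ext sum.cong)+
  show "(0::grassmann) \<noteq> 1"
    by transfer (metis zero_neq_one)
  show "1 * a = a"
  proof (transfer, rule ext)
    fix a :: "nat set \<Rightarrow> real" and I :: "nat set"
    assume a: "\<forall>I. infinite I \<longrightarrow> a I = 0"
    have "finite I \<Longrightarrow> (\<Sum>J\<in>Pow I. (-1) ^ inversions J (I - J) * (if J = {} then 1 else 0) * a (I - J)) =
        (\<Sum>J\<in>Pow I. if J = {} then a I else 0)"
      by (intro sum.cong) auto
    then show "(if finite I then \<Sum>J\<in>Pow I. (-1) ^ inversions J (I - J) * (if J = {} then 1 else 0) * a (I - J)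
        else 0) = a I"
      using a by (simp add: sum.delta)
  qed
  show "a * 1 = a"
  proof (transfer, rule ext)
    fix a :: "nat set \<Rightarrow> real" and I :: "nat set"
    assume a: "\<forall>I. infinite I \<longrightarrow> a I = 0"
    have "finite I \<Longrightarrow> (\<Sum>J\<in>Pow I. (-1) ^ inversions J (I - J) * a J * (if I - J = {} then 1 else 0)) =
        (\<Sum>J\<in>Pow I. if J = I then a I else 0)"
      by (intro sum.cong) auto
    then show "(if finite I then \<Sum>J\<in>Pow I. (-1) ^ inversions J (I - J) * a J * (if I - J = {} then 1 else 0)
        else 0) = a I"
      using a by (simp add: sum.delta)
  qed
  show "a * b * c = a * (b * c)"
  proof (transfer, rule ext)
    fix a b c :: "nat set \<Rightarrow> real" and I :: "nat set"
    let ?s = "\<lambda>J K. (-1) ^ inversions J K :: real"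
    let ?m = "\<lambda>g h I. if finite I then \<Sum>J\<in>Pow I. ?s J (I - J) * g J * h (I - J) else 0"
    show "?m (?m a b) c I = ?m a (?m b c) I"
    proof (cases "finite I")
      case True
      have fin: "finite J" if "J \<subseteq> I" for J
        using True that by (rule finite_subset[rotated])
      have "?m (?m a b) c I =
          (\<Sum>J\<in>Pow I. \<Sum>K\<in>Pow J. ?s J (I - J) * ?s K (J - K) * a K * b (J - K) * c (I - J))"
        using True fin
        by (auto simp: sum_distrib_left sum_distrib_right algebra_simps intro!: sum.cong)
      also have "\<dots> = (\<Sum>(J, K)\<in>Sigma (Pow I) Pow.
          ?s J (I - J) * ?s K (J - K) * a K * b (J - K) * c (I - J))"
        using True fin by (intro sum.Sigma) auto
      also have "\<dots> = (\<Sum>(K, L)\<in>Sigma (Pow I) (\<lambda>K. Pow (I - K)).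
          ?s K (I - K) * ?s L (I - K - L) * a K * b L * c (I - K - L))"
      proof (rule sum.reindex_bij_witness[where i = "\<lambda>(K, L). (K \<union> L, K)" and j = "\<lambda>(J, K). (K, J - K)"])
        fix x assume "x \<in> Sigma (Pow I) Pow"
        then obtain J K where x: "x = (J, K)" "J \<subseteq> I" "K \<subseteq> J" by auto
        have f: "finite I" "finite J" "finite K" using True x fin by auto
        have J: "J = K \<union> (J - K)" and IK: "I - K = (J - K) \<union> (I - J)" and IJ: "I - K - (J - K) = I - J"
          using x by auto
        have "inversions J (I - J) + inversions K (J - K) =
            inversions K (I - J) + inversions (J - K) (I - J) + inversions K (J - K)"
          using inversions_Un_left[of K "J - K" "I - J"] f J by simp
        also have "\<dots> = inversions K (I - K) + inversions (J - K) (I - J)"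
          unfolding IK by (subst inversions_Un_right) (use f in auto)
        finally have "?s J (I - J) * ?s K (J - K) = ?s K (I - K) * ?s (J - K) (I - J)"
          by (simp flip: power_add)
        then show "(case case x of (J, K) \<Rightarrow> (K, J - K) of
            (K, L) \<Rightarrow> ?s K (I - K) * ?s L (I - K - L) * a K * b L * c (I - K - L)) =
          (case x of (J, K) \<Rightarrow> ?s J (I - J) * ?s K (J - K) * a K * b (J - K) * c (I - J))"
          using x IJ by simp
      qed auto
      also have "\<dots> = (\<Sum>K\<in>Pow I. \<Sum>L\<in>Pow (I - K).
          ?s K (I - K) * ?s L (I - K - L) * a K * b L * c (I - K - L))"
        using True by (intro sum.Sigma[symmetric]) auto
      also have "\<dots> = ?m a (?m b c) I"
        using True by (auto simp: sum_distrib_left algebra_simps intro!: sum.cong)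
      finally show ?thesis .
    qed simp
  qed
qed

end

lift_definition grassmann_of :: "(nat set \<Rightarrow> real) \<Rightarrow> grassmann" is
  "\<lambda>g I. if finite I then g I else 0"
  by simp

definition gbody :: "grassmann \<Rightarrow> real" where
  "gbody g = gcoeff g {}"

definition ggen :: "nat \<Rightarrow> grassmann" where
  "ggen a = grassmann_of (\<lambda>I. if I = {a} then 1 else 0)"

text \<open>Left derivative with respect to the \<open>a\<close>-th odd generator.\<close>

definition gderiv :: "nat \<Rightarrow> grassmann \<Rightarrow> grassmann" where
  "gderiv a g = grassmann_of (\<lambda>I. if a \<in> I then 0 else (-1) ^ card {j \<in> I. j < a} * gcoeff g (insert a I))"

definition gparity :: "nat \<Rightarrow> grassmann \<Rightarrow> bool" where
  "gparity p g \<longleftrightarrow> (\<forall>I. gcoeff g I \<noteq> 0 \<longrightarrow> even (card I + p))"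

text \<open>\<open>gsign k\<close> multiplies the component of parity \<open>p\<close> by \<open>(-1)\<^sup>k\<^sup>p\<close>.\<close>

definition gsign :: "nat \<Rightarrow> grassmann \<Rightarrow> grassmann" where
  "gsign k g = grassmann_of (\<lambda>I. (-1) ^ (k * card I) * gcoeff g I)"

definition ginv :: "grassmann \<Rightarrow> grassmann" where
  "ginv g = (SOME h. g * h = 1)"

text \<open>
  \<open>gabs_powr m g w\<close> is \<open>\<bar>g\<bar>\<^sup>w\<close> for an even \<open>g\<close> with invertible body \<open>b\<close> in the Grassmann algebra on \<open>m\<close>
  generators, i.e. \<open>\<bar>b\<bar>\<^sup>w (1 + (g - b)/b)\<^sup>w\<close> expanded in the nilpotent \<open>(g - b)/b\<close>.
\<close>

definition gabs_powr :: "nat \<Rightarrow> grassmann \<Rightarrow> real \<Rightarrow> grassmann" where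
  "gabs_powr m g w =
     (\<bar>gbody g\<bar> powr w) *\<^sub>R
       (\<Sum>k\<le>m. (w gchoose k) *\<^sub>R ((1 / gbody g) *\<^sub>R (g - of_real (gbody g))) ^ k)"

definition gdet :: "nat \<Rightarrow> (nat \<Rightarrow> nat \<Rightarrow> grassmann) \<Rightarrow> grassmann" where
  "gdet k A = (\<Sum>\<pi> | \<pi> permutes {..<k}. of_int (sign \<pi>) * prod_list (map (\<lambda>i. A i (\<pi> i)) [0..<k]))"

definition gmatrix_inv :: "nat \<Rightarrow> (nat \<Rightarrow> nat \<Rightarrow> grassmann) \<Rightarrow> nat \<Rightarrow> nat \<Rightarrow> grassmann" where
  "gmatrix_inv k D = (SOME E. \<forall>i<k. \<forall>j<k. (\<Sum>l<k. D i l * E l j) = (if i = j then 1 else 0))"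

text \<open>
  Berezinian of an even matrix with row and column indices below \<open>n + m\<close>, the first \<open>n\<close> being even:
  \<open>det (A - B D\<^sup>-\<^sup>1 C) (det D)\<^sup>-\<^sup>1\<close> in block form.
\<close>

definition berezinian :: "nat \<Rightarrow> nat \<Rightarrow> (nat \<Rightarrow> nat \<Rightarrow> grassmann) \<Rightarrow> grassmann" where
  "berezinian n m P =
     (let D = (\<lambda>k l. P (n + k) (n + l)); E = gmatrix_inv m D
      in gdet n (\<lambda>i j. P i j - (\<Sum>k<m. \<Sum>l<m. P i (n + k) * E k l * P (n + l) j)) * ginv (gdet m D))"

section \<open>Superdomains\<close>

text \<open>
  Coordinates of a superdomain of dimension \<open>n|m\<close> are labelled by \<open>a < n + m\<close>; those with \<open>a < n\<close> are even,
  the others are odd and coincide with the Grassmann generators of the same label.  Functions on an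
  open set \<open>V\<close> of \<^term>\<open>Euclidean_space n\<close> are total functions that vanish outside \<open>V\<close>, so that
  equality of functions on \<open>V\<close> is equality.
\<close>

type_synonym sfun = "(nat \<Rightarrow> real) \<Rightarrow> grassmann"

definition partial :: "nat \<Rightarrow> ((nat \<Rightarrow> real) \<Rightarrow> real) \<Rightarrow> (nat \<Rightarrow> real) \<Rightarrow> real" where
  "partial i g x = deriv (\<lambda>s. g (x(i := s))) (x i)"

definition smooth_fun :: "nat \<Rightarrow> (nat \<Rightarrow> real) set \<Rightarrow> ((nat \<Rightarrow> real) \<Rightarrow> real) \<Rightarrow> bool" where
  "smooth_fun n V g \<longleftrightarrow>
     (\<forall>is. set is \<subseteq> {..<n} \<longrightarrow>
        continuous_map (subtopology (Euclidean_space n) V) euclideanreal (foldr partial is g) \<and>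
        (\<forall>i<n. \<forall>x\<in>V. (\<lambda>s. foldr partial is g (x(i := s))) differentiable (at (x i))))"

definition superfunctions :: "nat \<Rightarrow> nat \<Rightarrow> (nat \<Rightarrow> real) set \<Rightarrow> sfun set" where
  "superfunctions n m V =
     {f. (\<forall>x. x \<notin> V \<longrightarrow> f x = 0) \<and>
         (\<forall>x I. gcoeff (f x) I \<noteq> 0 \<longrightarrow> I \<subseteq> {n..<n + m}) \<and>
         (\<forall>I. smooth_fun n V (\<lambda>x. gcoeff (f x) I))}"

definition srestrict :: "(nat \<Rightarrow> real) set \<Rightarrow> sfun \<Rightarrow> sfun" where
  "srestrict V f = (\<lambda>x. if x \<in> V then f x else 0)"

definition sscale :: "real \<Rightarrow> sfun \<Rightarrow> sfun" (infixr "*\<^sub>S" 75) where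
  "r *\<^sub>S f = (\<lambda>x. r *\<^sub>R f x)"

definition sparity :: "nat \<Rightarrow> sfun \<Rightarrow> bool" where
  "sparity p f \<longleftrightarrow> (\<forall>x. gparity p (f x))"

definition scoord :: "nat \<Rightarrow> (nat \<Rightarrow> real) set \<Rightarrow> nat \<Rightarrow> sfun" where
  "scoord n V a = srestrict V (\<lambda>x. if a < n then of_real (x a) else ggen a)"

definition sderiv :: "nat \<Rightarrow> (nat \<Rightarrow> real) set \<Rightarrow> nat \<Rightarrow> sfun \<Rightarrow> sfun" where
  "sderiv n V a f = srestrict V
     (\<lambda>x. if a < n then grassmann_of (\<lambda>I. partial a (\<lambda>y. gcoeff (f y) I) x) else gderiv a (f x))"

text \<open>Berezin integral: Lebesgue integral of the coefficient at the product of all odd coordinates.\<close>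

definition sintegral :: "nat \<Rightarrow> nat \<Rightarrow> sfun \<Rightarrow> real" where
  "sintegral n m f =
     (\<integral>x. gcoeff (f (\<lambda>i. if i < n then x i else 0)) {n..<n + m} \<partial>(Pi\<^sub>M {..<n} (\<lambda>_. lborel)))"

section \<open>Supermanifolds\<close>

text \<open>
  \<open>trans M c d W\<close> is the change of coordinates over an open subset \<open>W\<close> of the overlap of the charts \<open>c\<close> and
  \<open>d\<close>, given as the pullback homomorphism: it re-expresses a function of the coordinates of \<open>d\<close> as a
  function of the coordinates of \<open>c\<close>.
\<close>

record ('p, 'c) superatlas =
  underlying :: "'p topology"
  evdim :: nat
  odddim :: nat
  charts :: "'c set"
  dom :: "'c \<Rightarrow> 'p set"
  crd :: "'c \<Rightarrow> 'p \<Rightarrow> nat \<Rightarrow> real"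
  trans :: "'c \<Rightarrow> 'c \<Rightarrow> 'p set \<Rightarrow> sfun \<Rightarrow> sfun"

definition sections :: "('p, 'c) superatlas \<Rightarrow> 'c \<Rightarrow> 'p set \<Rightarrow> sfun set" where
  "sections M c W = superfunctions (evdim M) (odddim M) (crd M c ` W)"

definition superalgebra_pullback ::
  "('p, 'c) superatlas \<Rightarrow> 'c \<Rightarrow> 'c \<Rightarrow> 'p set \<Rightarrow> (sfun \<Rightarrow> sfun) \<Rightarrow> bool" where
  "superalgebra_pullback M c d W F \<longleftrightarrow>
     (\<forall>f\<in>sections M d W. F f \<in> sections M c W) \<and>
     (\<forall>f\<in>sections M d W. \<forall>g\<in>sections M d W. F (f + g) = F f + F g \<and> F (f * g) = F f * F g) \<and>
     (\<forall>f\<in>sections M d W. \<forall>r. F (r *\<^sub>S f) = r *\<^sub>S F f) \<and>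
     F (srestrict (crd M d ` W) 1) = srestrict (crd M c ` W) 1 \<and>
     (\<forall>f\<in>sections M d W. \<forall>p. sparity p f \<longrightarrow> sparity p (F f)) \<and>
     (\<forall>f\<in>sections M d W. \<forall>x\<in>W. gbody (F f (crd M c x)) = gbody (f (crd M d x)))"

definition supermanifold :: "('p, 'c) superatlas \<Rightarrow> bool" where
  "supermanifold M \<longleftrightarrow>
     Hausdorff_space (underlying M) \<and>
     (\<exists>\<B>. countable \<B> \<and> (\<forall>B\<in>\<B>. openin (underlying M) B) \<and>
          (\<forall>W. openin (underlying M) W \<longrightarrow> (\<exists>\<C>\<subseteq>\<B>. W = \<Union>\<C>))) \<and>
     (\<Union>c\<in>charts M. dom M c) = topspace (underlying M) \<and>
     (\<forall>c\<in>charts M.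
        openin (underlying M) (dom M c) \<and>
        openin (Euclidean_space (evdim M)) (crd M c ` dom M c) \<and>
        homeomorphic_map (subtopology (underlying M) (dom M c))
          (subtopology (Euclidean_space (evdim M)) (crd M c ` dom M c)) (crd M c)) \<and>
     (\<forall>c\<in>charts M. \<forall>d\<in>charts M. \<forall>W. openin (underlying M) W \<and> W \<subseteq> dom M c \<inter> dom M d \<longrightarrow>
        superalgebra_pullback M c d W (trans M c d W) \<and>
        (\<forall>W' f. openin (underlying M) W' \<and> W' \<subseteq> W \<and> f \<in> sections M d W \<longrightarrow>
           trans M c d W' (srestrict (crd M d ` W') f) = srestrict (crd M c ` W') (trans M c d W f))) \<and>
     (\<forall>c\<in>charts M. \<forall>W. openin (underlying M) W \<and> W \<subseteq> dom M c \<longrightarrow>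
        (\<forall>f\<in>sections M c W. trans M c c W f = f)) \<and>
     (\<forall>c\<in>charts M. \<forall>d\<in>charts M. \<forall>e\<in>charts M.
        \<forall>W. openin (underlying M) W \<and> W \<subseteq> dom M c \<inter> dom M d \<inter> dom M e \<longrightarrow>
          (\<forall>f\<in>sections M e W. trans M c d W (trans M d e W f) = trans M c e W f))"

definition codom :: "('p, 'c) superatlas \<Rightarrow> 'c \<Rightarrow> (nat \<Rightarrow> real) set" where
  "codom M c = crd M c ` dom M c"

text \<open>
  The coordinates \<open>x\<^sup>a\<close> have labels \<open>a < evdim M + odddim M\<close>; the label \<open>evdim M + odddim M\<close> is used for
  the additional even coordinate \<open>t\<close>.
\<close>

definition coords :: "('p, 'c) superatlas \<Rightarrow> nat set" where
  "coords M = {..<evdim M + odddim M}"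

definition hat_coords :: "('p, 'c) superatlas \<Rightarrow> nat set" where
  "hat_coords M = {..evdim M + odddim M}"

definition coord_parity :: "('p, 'c) superatlas \<Rightarrow> nat \<Rightarrow> nat" where
  "coord_parity M a = (if a \<in> {evdim M..<evdim M + odddim M} then 1 else 0)"

definition cderiv :: "('p, 'c) superatlas \<Rightarrow> 'c \<Rightarrow> nat \<Rightarrow> sfun \<Rightarrow> sfun" where
  "cderiv M c = sderiv (evdim M) (codom M c)"

text \<open>
  Jacobian \<open>J = Dx'/Dx\<close>, where \<open>x'\<close> are the coordinates of \<open>d\<close> and \<open>x\<close> those of \<open>c\<close>; rows are labelled by
  \<open>x\<close>, so that the chain rule for left derivatives \<open>\<partial>\<^sub>a = (\<partial>\<^sub>a x\<^sup>a\<^sup>') \<partial>\<^sub>a\<^sub>'\<close> is a matrix product.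
\<close>

definition jacobian :: "('p, 'c) superatlas \<Rightarrow> 'c \<Rightarrow> 'c \<Rightarrow> sfun" where
  "jacobian M c d =
     (let W = dom M c \<inter> dom M d
      in (\<lambda>x. berezinian (evdim M) (odddim M)
        (\<lambda>a b. sderiv (evdim M) (crd M c ` W) a
           (trans M c d W (scoord (evdim M) (crd M d ` W) b)) x)))"

section \<open>The algebra of densities\<close>

text \<open>
  A \<open>w\<close>-density \<open>f c (Dx\<^sub>c)\<^sup>w\<close> is given by its coefficients \<open>f c\<close> in all charts.  As \<open>w\<close> is an arbitrary real
  number, it is \<open>\<bar>J\<bar>\<^sup>w\<close> that appears in the transformation law (the same as \<open>J\<^sup>w\<close> where \<open>J > 0\<close>).
\<close>

definition densities :: "('p, 'c) superatlas \<Rightarrow> real \<Rightarrow> ('c \<Rightarrow> sfun) set" where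
  "densities M w =
     {f. (\<forall>c. c \<notin> charts M \<longrightarrow> f c = 0) \<and>
         (\<forall>c\<in>charts M. f c \<in> sections M c (dom M c)) \<and>
         (\<forall>c\<in>charts M. \<forall>d\<in>charts M.
            let W = dom M c \<inter> dom M d
            in srestrict (crd M c ` W) (f c) =
               trans M c d W (srestrict (crd M d ` W) (f d)) *
               (\<lambda>x. gabs_powr (odddim M) (jacobian M c d x) w))}"

text \<open>
  Elements of \<open>\<VV>(M)\<close> are finitely supported families, indexed by the weight; the multiplication of
  \<^type>\<open>poly_mapping\<close> is the one in which weights add and components multiply chartwise.
\<close>

type_synonym 'c dens = "real \<Rightarrow>\<^sub>0 ('c \<Rightarrow> sfun)"

definition density_algebra :: "('p, 'c) superatlas \<Rightarrow> 'c dens set" where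
  "density_algebra M = {\<psi>. \<forall>w. Poly_Mapping.lookup \<psi> w \<in> densities M w}"

definition density_one :: "('p, 'c) superatlas \<Rightarrow> 'c dens" where
  "density_one M = Poly_Mapping.single 0 (\<lambda>c. if c \<in> charts M then srestrict (codom M c) 1 else 0)"

definition density_scale :: "real \<Rightarrow> 'c dens \<Rightarrow> 'c dens" where
  "density_scale r = Poly_Mapping.map (\<lambda>f c. r *\<^sub>S f c)"

definition density_parity :: "nat \<Rightarrow> 'c dens \<Rightarrow> bool" where
  "density_parity p \<psi> \<longleftrightarrow> (\<forall>w c. sparity p (Poly_Mapping.lookup \<psi> w c))"

definition density_sign :: "nat \<Rightarrow> 'c dens \<Rightarrow> 'c dens" where
  "density_sign k = Poly_Mapping.map (\<lambda>f c x. gsign k (f c x))"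

text \<open>The generating function \<open>\<Sum>\<^sub>w t\<^sup>w \<psi>\<^sub>w(x)\<close> in a chart, a polynomial in \<open>t\<close> with real exponents.\<close>

definition local_rep :: "'c \<Rightarrow> 'c dens \<Rightarrow> (real \<Rightarrow>\<^sub>0 sfun)" where
  "local_rep c = Poly_Mapping.map (\<lambda>f. f c)"

definition hat_deriv :: "('p, 'c) superatlas \<Rightarrow> 'c \<Rightarrow> nat \<Rightarrow> (real \<Rightarrow>\<^sub>0 sfun) \<Rightarrow> (real \<Rightarrow>\<^sub>0 sfun)" where
  "hat_deriv M c a F =
     (if a \<in> coords M then Poly_Mapping.map (cderiv M c a) F
      else (\<Sum>w\<in>Poly_Mapping.keys F. Poly_Mapping.single (w - 1) (w *\<^sub>S Poly_Mapping.lookup F w)))"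

section \<open>The scalar product\<close>

text \<open>
  The integral of \<open>Res (t\<^sup>-\<^sup>2 \<psi> \<phi>)\<close> computed in the chart \<open>c\<close>; it is used only when one factor has compact
  support inside the domain of \<open>c\<close>.
\<close>

definition scalar_product :: "('p, 'c) superatlas \<Rightarrow> 'c \<Rightarrow> 'c dens \<Rightarrow> 'c dens \<Rightarrow> real" where
  "scalar_product M c \<psi> \<phi> =
     sintegral (evdim M) (odddim M)
       (Poly_Mapping.lookup (Poly_Mapping.single (-2) 1 * local_rep c \<psi> * local_rep c \<phi>) (-1))"

definition compact_support_in :: "('p, 'c) superatlas \<Rightarrow> 'c \<Rightarrow> ('c \<Rightarrow> sfun) \<Rightarrow> bool" where
  "compact_support_in M c f \<longleftrightarrow>
     (\<exists>K. compactin (underlying M) K \<and> K \<subseteq> dom M c \<and>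
        (\<forall>d\<in>charts M. \<forall>x\<in>dom M d - K. f d (crd M d x) = 0))"

text \<open>
  \<open>Q\<close> is the adjoint of the operator \<open>P\<close> of parity \<open>\<epsilon>\<close> on \<open>w\<close>-densities.  By partitions of unity the
  compactly supported densities are the finite sums of those admitted here for \<open>f\<close>, and for these the
  integral over the supermanifold is a coordinate integral.  The coordinate integrals agree up to the
  (locally constant) sign of the odd-odd block of the Jacobian, which does not affect adjoints.
\<close>

definition is_adjoint ::
  "('p, 'c) superatlas \<Rightarrow> nat \<Rightarrow> real \<Rightarrow>
   (('c \<Rightarrow> sfun) \<Rightarrow> ('c \<Rightarrow> sfun)) \<Rightarrow> (('c \<Rightarrow> sfun) \<Rightarrow> ('c \<Rightarrow> sfun)) \<Rightarrow> bool" where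
  "is_adjoint M \<epsilon> w P Q \<longleftrightarrow>
     (\<forall>c\<in>charts M. \<forall>p. \<forall>f\<in>densities M w. \<forall>g\<in>densities M (1 - w).
        density_parity p (Poly_Mapping.single w f) \<and> compact_support_in M c f \<longrightarrow>
        scalar_product M c (Poly_Mapping.single w (P f)) (Poly_Mapping.single (1 - w) g) =
        (-1) ^ (\<epsilon> * p) *
        scalar_product M c (Poly_Mapping.single w f) (Poly_Mapping.single (1 - w) (Q g)))"

section \<open>Brackets\<close>

definition hat_matrix ::
  "('p, 'c) superatlas \<Rightarrow> (nat \<Rightarrow> nat \<Rightarrow> sfun) \<Rightarrow> (nat \<Rightarrow> sfun) \<Rightarrow> sfun \<Rightarrow> nat \<Rightarrow> nat \<Rightarrow> (real \<Rightarrow>\<^sub>0 sfun)" where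
  "hat_matrix M S \<gamma> \<theta> a b =
     (if a \<in> coords M
      then if b \<in> coords M then Poly_Mapping.single 0 (S a b) else Poly_Mapping.single 1 (\<gamma> a)
      else if b \<in> coords M then Poly_Mapping.single 1 (\<gamma> b) else Poly_Mapping.single 2 \<theta>)"

definition has_bracket_matrix ::
  "('p, 'c) superatlas \<Rightarrow> nat \<Rightarrow> ('c dens \<Rightarrow> 'c dens \<Rightarrow> 'c dens) \<Rightarrow> 'c \<Rightarrow>
   (nat \<Rightarrow> nat \<Rightarrow> sfun) \<Rightarrow> (nat \<Rightarrow> sfun) \<Rightarrow> sfun \<Rightarrow> bool" where
  "has_bracket_matrix M \<epsilon> B c S \<gamma> \<theta> \<longleftrightarrow>
     (\<forall>a\<in>coords M. \<forall>b\<in>coords M.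
        S a b \<in> sections M c (dom M c) \<and>
        sparity (\<epsilon> + coord_parity M a + coord_parity M b) (S a b) \<and>
        S a b = (-1) ^ (coord_parity M a * coord_parity M b) * S b a) \<and>
     (\<forall>a\<in>coords M. \<gamma> a \<in> sections M c (dom M c) \<and> sparity (\<epsilon> + coord_parity M a) (\<gamma> a)) \<and>
     \<theta> \<in> sections M c (dom M c) \<and> sparity \<epsilon> \<theta> \<and>
     (\<forall>\<psi>\<in>density_algebra M. \<forall>\<phi>\<in>density_algebra M. \<forall>p. density_parity p \<psi> \<longrightarrow>
        local_rep c (B \<psi> \<phi>) =
        (\<Sum>a\<in>hat_coords M. \<Sum>b\<in>hat_coords M.
           hat_matrix M S \<gamma> \<theta> a b * hat_deriv M c b (local_rep c \<psi>) * hat_deriv M c a (local_rep c \<phi>) *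
           (-1) ^ (coord_parity M a * p)))"

text \<open>
  The last conjunct makes brackets be of first order in \<open>t\<close> as well as in \<open>x\<close>.  It is not implied by the
  others: for an additive but not linear \<open>h : \<real> \<rightarrow> \<real>\<close> also \<open>h(w\<^sub>1) h(w\<^sub>2) \<psi> \<phi>\<close> is an algebraic bi-derivation.
\<close>

definition brackets :: "('p, 'c) superatlas \<Rightarrow> nat \<Rightarrow> ('c dens \<Rightarrow> 'c dens \<Rightarrow> 'c dens) set" where
  "brackets M \<epsilon> =
     {B. B \<in> density_algebra M \<rightarrow>\<^sub>E (density_algebra M \<rightarrow>\<^sub>E density_algebra M) \<and>
       (\<forall>\<psi>\<in>density_algebra M. \<forall>\<phi>\<in>density_algebra M. \<forall>\<omega>\<in>density_algebra M.
          B (\<psi> + \<phi>) \<omega> = B \<psi> \<omega> + B \<phi> \<omega> \<and> B \<psi> (\<phi> + \<omega>) = B \<psi> \<phi> + B \<psi> \<omega>) \<and>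
       (\<forall>r. \<forall>\<psi>\<in>density_algebra M. \<forall>\<phi>\<in>density_algebra M.
          B (density_scale r \<psi>) \<phi> = density_scale r (B \<psi> \<phi>) \<and>
          B \<psi> (density_scale r \<phi>) = density_scale r (B \<psi> \<phi>)) \<and>
       (\<forall>p q. \<forall>\<psi>\<in>density_algebra M. \<forall>\<phi>\<in>density_algebra M.
          density_parity p \<psi> \<and> density_parity q \<phi> \<longrightarrow>
          density_parity (\<epsilon> + p + q) (B \<psi> \<phi>) \<and>
          B \<psi> \<phi> = (-1) ^ (p * q) * B \<phi> \<psi> \<and>
          (\<forall>\<omega>\<in>density_algebra M.
             B \<psi> (\<phi> * \<omega>) = B \<psi> \<phi> * \<omega> + (-1) ^ ((\<epsilon> + p) * q) * (\<phi> * B \<psi> \<omega>))) \<and>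
       (\<forall>w\<^sub>1 w\<^sub>2. \<forall>f\<in>densities M w\<^sub>1. \<forall>g\<in>densities M w\<^sub>2.
          Poly_Mapping.keys (B (Poly_Mapping.single w\<^sub>1 f) (Poly_Mapping.single w\<^sub>2 g)) \<subseteq> {w\<^sub>1 + w\<^sub>2}) \<and>
       (\<forall>c\<in>charts M. \<exists>S \<gamma> \<theta>. has_bracket_matrix M \<epsilon> B c S \<gamma> \<theta>)}"

section \<open>Operators\<close>

text \<open>
  In every chart \<open>\<Delta>\<^sub>w = \<Delta>\<^sub>0 + w A + w\<^sup>2 B\<close> with \<open>\<Delta>\<^sub>0\<close>, \<open>A\<close>, \<open>B\<close> of orders at most 2, 1, 0.
\<close>

definition second_order_operators :: "('p, 'c) superatlas \<Rightarrow> nat \<Rightarrow> ('c dens \<Rightarrow> 'c dens) set" where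
  "second_order_operators M \<epsilon> =
     {\<Delta>. \<Delta> \<in> density_algebra M \<rightarrow>\<^sub>E density_algebra M \<and>
       (\<forall>p. \<forall>\<psi>\<in>density_algebra M. density_parity p \<psi> \<longrightarrow> density_parity (\<epsilon> + p) (\<Delta> \<psi>)) \<and>
       (\<forall>c\<in>charts M. \<exists>D2 D1 D0 A1 A0 B0.
          (\<forall>a\<in>coords M. \<forall>b\<in>coords M. D2 a b \<in> sections M c (dom M c)) \<and>
          (\<forall>a\<in>coords M. D1 a \<in> sections M c (dom M c) \<and> A1 a \<in> sections M c (dom M c)) \<and>
          {D0, A0, B0} \<subseteq> sections M c (dom M c) \<and>
          (\<forall>\<psi>\<in>density_algebra M. \<forall>w. let f = Poly_Mapping.lookup \<psi> w c in
             Poly_Mapping.lookup (\<Delta> \<psi>) w c =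
               ((\<Sum>a\<in>coords M. \<Sum>b\<in>coords M. D2 a b * cderiv M c b (cderiv M c a f)) +
                (\<Sum>a\<in>coords M. D1 a * cderiv M c a f) + D0 * f) +
               w *\<^sub>S ((\<Sum>a\<in>coords M. A1 a * cderiv M c a f) + A0 * f) +
               w\<^sup>2 *\<^sub>S (B0 * f)))}"

definition pencil :: "('c dens \<Rightarrow> 'c dens) \<Rightarrow> real \<Rightarrow> ('c \<Rightarrow> sfun) \<Rightarrow> ('c \<Rightarrow> sfun)" where
  "pencil \<Delta> w f = Poly_Mapping.lookup (\<Delta> (Poly_Mapping.single w f)) w"

definition self_adjoint_pencil :: "('p, 'c) superatlas \<Rightarrow> nat \<Rightarrow> ('c dens \<Rightarrow> 'c dens) \<Rightarrow> bool" where
  "self_adjoint_pencil M \<epsilon> \<Delta> \<longleftrightarrow> (\<forall>w. is_adjoint M \<epsilon> w (pencil \<Delta> w) (pencil \<Delta> (1 - w)))"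

definition normalized_self_adjoint_operators ::
  "('p, 'c) superatlas \<Rightarrow> nat \<Rightarrow> ('c dens \<Rightarrow> 'c dens) set" where
  "normalized_self_adjoint_operators M \<epsilon> =
     {\<Delta> \<in> second_order_operators M \<epsilon>. \<Delta> (density_one M) = 0 \<and> self_adjoint_pencil M \<epsilon> \<Delta>}"

definition generated_bracket ::
  "('p, 'c) superatlas \<Rightarrow> nat \<Rightarrow> ('c dens \<Rightarrow> 'c dens) \<Rightarrow> ('c dens \<Rightarrow> 'c dens \<Rightarrow> 'c dens)" where
  "generated_bracket M \<epsilon> \<Delta> =
     (\<lambda>\<psi>\<in>density_algebra M. \<lambda>\<phi>\<in>density_algebra M.
        \<Delta> (\<psi> * \<phi>) - \<Delta> \<psi> * \<phi> - density_sign \<epsilon> \<psi> * \<Delta> \<phi>)"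

definition canonical_pencil ::
  "('p, 'c) superatlas \<Rightarrow> nat \<Rightarrow> 'c \<Rightarrow> (nat \<Rightarrow> nat \<Rightarrow> sfun) \<Rightarrow> (nat \<Rightarrow> sfun) \<Rightarrow> sfun \<Rightarrow>
   real \<Rightarrow> sfun \<Rightarrow> sfun" where
  "canonical_pencil M \<epsilon> c S \<gamma> \<theta> w f =
     (1 / 2) *\<^sub>S
       ((\<Sum>a\<in>coords M. \<Sum>b\<in>coords M. S a b * cderiv M c b (cderiv M c a f)) +
        (\<Sum>a\<in>coords M.
           ((\<Sum>b\<in>coords M. cderiv M c b (S b a) * (-1) ^ (coord_parity M b * (\<epsilon> + 1))) + (2 * w - 1) *\<^sub>S \<gamma> a)
             * cderiv M c a f) +
        w *\<^sub>S (\<Sum>a\<in>coords M. cderiv M c a (\<gamma> a) * (-1) ^ (coord_parity M a * (\<epsilon> + 1))) * f +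
        (w * (w - 1)) *\<^sub>S \<theta> * f)"

end

theory Submission
  imports Defs "Jordan_Normal_Form.Determinant"
begin

text \<open>
  Write a bracket as \<open>{f, g} = X\<^sub>f g + w \<lambda>\<^sub>f g\<close> for \<open>g\<close> of weight \<open>w\<close>.  The canonical pencil applied to \<open>f\<close>
  is half the divergence of the vector field \<open>X\<^sub>f + \<lambda>\<^sub>f t \<partial>\<^sub>t\<close>; it is independent of coordinates by Liouville's
  formula for the Berezinian, generates the bracket by a direct computation, and is self-adjoint since
  \<open>\<integral> \<Delta>f \<cdot> g = - \<onehalf> \<integral> {f, g}\<close> by partial integration.  Conversely, if \<open>\<Delta>\<close> is self-adjoint and \<open>\<Delta> 1 = 0\<close>,
  then \<open>\<integral> \<Delta>(f g) = 0\<close>, and self-adjointness again gives \<open>\<integral> \<Delta>f \<cdot> g = - \<onehalf> \<integral> {f, g}\<close>, so that the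
  bracket determines \<open>\<Delta>\<close>.
\<close>

section \<open>Grassmann numbers\<close>

text \<open>A change of coordinates is given only as a homomorphism of superalgebras compatible with
  restriction and with bodies. That it obeys the chain rule is therefore a theorem, and so is its
  compatibility with Berezinians and with real powers; densities cannot be handled before this is
  known. The transformation laws of the matrix of a bracket are never computed. The bracket is known
  to map densities to densities, so it is evaluated on cut-off coordinate functions and coordinate
  volumes, and the identities obtained are exactly the hypotheses under which a divergence
  transforms as a density. Likewise no change of variables in an integral occurs: one factor has
  compact support in a single chart, where partial integration suffices, and the locality of the
  operators carries uniqueness over to all densities. Signs are meaningful for homogeneous elements
  only; general ones are split into their two parity components.\<close>

lemmas gcoeff_simps [simp] = zero_grassmann.rep_eq one_grassmann.rep_eq plus_grassmann.rep_eq
  minus_grassmann.rep_eq uminus_grassmann.rep_eq scaleR_grassmann.rep_eq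

lemma gcoeff_infinite: "infinite I ==> gcoeff g I = 0"
  using gcoeff[of g] by simp

lemma grassmann_eqI: "(!!I. finite I ==> gcoeff g I = gcoeff h I) ==> g = h"
  by (metis gcoeff_infinite gcoeff_inject ext)

lemma gcoeff_sum: "gcoeff (\<Sum>x\<in>A. f x) I = (\<Sum>x\<in>A. gcoeff (f x) I)"
  by (induction A rule: infinite_finite_induct) auto

lemma gcoeff_mult:
  "finite I ==> gcoeff (g * h) I = (\<Sum>J\<in>Pow I. (-1) ^ inversions J (I - J) * gcoeff g J * gcoeff h (I - J))"
  by (simp add: times_grassmann.rep_eq)

lemma gcoeff_of: "gcoeff (grassmann_of f) I = (if finite I then f I else 0)"
  by (simp add: grassmann_of.rep_eq)

lemma gcoeff_of_real: "gcoeff (of_real r) I = (if I = {} then r else 0)"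
  by (simp add: of_real_def)

lemma minus_one_power_grassmann: "(-1) ^ k * (g :: grassmann) = ((-1) ^ k :: real) *\<^sub>R g"
  by (simp add: minus_one_power_iff)

section \<open>Supports, parity and the filtration by the number of odd generators\<close>

definition gsupp :: "nat set => grassmann => bool" where
  "gsupp L g \<longleftrightarrow> (\<forall>I. gcoeff g I \<noteq> 0 \<longrightarrow> I \<subseteq> L)"

text \<open>Plays the role of the k-th power of the nilpotent ideal. Nilpotency arguments end with
  \<open>glow_eq_0\<close>: such an element vanishes as soon as fewer than k generators are
  available.\<close>

definition glow :: "nat => grassmann => bool" where
  "glow k g \<longleftrightarrow> (\<forall>I. card I < k \<longrightarrow> gcoeff g I = 0)"

lemma gsupp_iff: "gsupp L g \<longleftrightarrow> (\<forall>I. \<not> I \<subseteq> L \<longrightarrow> gcoeff g I = 0)"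
  by (auto simp: gsupp_def)

lemma gparity_iff: "gparity p g \<longleftrightarrow> (\<forall>I. odd (card I + p) \<longrightarrow> gcoeff g I = 0)"
  by (auto simp: gparity_def)

lemma gcoeff_mult_nonzeroD:
  assumes "gcoeff (g * h) I \<noteq> 0"
  obtains J K where "finite I" "I = J \<union> K" "J \<inter> K = {}" "gcoeff g J \<noteq> 0" "gcoeff h K \<noteq> 0"
    "card I = card J + card K"
proof -
  have f: "finite I" using assms gcoeff_infinite by blast
  with assms have "(\<Sum>J\<in>Pow I. (-1) ^ inversions J (I - J) * gcoeff g J * gcoeff h (I - J)) \<noteq> 0"
    by (simp add: gcoeff_mult)
  then obtain J where J: "J \<subseteq> I" "gcoeff g J \<noteq> 0" "gcoeff h (I - J) \<noteq> 0"
    by (metis (no_types, lifting) PowD mult_eq_0_iff sum.neutral)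
  then have "card I = card J + card (I - J)"
    by (metis card_Un_disjoint Diff_disjoint Diff_partition f finite_Diff finite_subset)
  with J f show ?thesis by (intro that[of J "I - J"]) auto
qed

lemma gsupp_mono: "gsupp L g ==> L \<subseteq> L' ==> gsupp L' g"
  by (auto simp: gsupp_def)
lemma gsupp_0 [simp]: "gsupp L 0" and gsupp_1 [simp]: "gsupp L 1"
  and gsupp_of_real [simp]: "gsupp L (of_real r)"
  by (auto simp: gsupp_def gcoeff_of_real split: if_splits)
lemma gsupp_add: "gsupp L g ==> gsupp L h ==> gsupp L (g + h)"
  and gsupp_diff: "gsupp L g ==> gsupp L h ==> gsupp L (g - h)"
  by (simp_all add: gsupp_iff)
lemma gsupp_uminus: "gsupp L g ==> gsupp L (- g)" and gsupp_scaleR: "gsupp L g ==> gsupp L (r *\<^sub>R g)"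
  by (auto simp: gsupp_def)
lemma gsupp_mult: "gsupp L g ==> gsupp L h ==> gsupp L (g * h)"
  unfolding gsupp_def by (blast elim: gcoeff_mult_nonzeroD)
lemma gsupp_sum: "(!!x. x \<in> A ==> gsupp L (f x)) ==> gsupp L (sum f A)"
  by (induction A rule: infinite_finite_induct) (auto intro: gsupp_add)
lemma gsupp_power: "gsupp L g ==> gsupp L (g ^ k)"
  by (induction k) (auto intro: gsupp_mult)
lemma gsupp_sign: "gsupp L g ==> gsupp L ((-1) ^ k * g)"
  by (simp add: minus_one_power_grassmann gsupp_scaleR)

lemma gparity_0 [simp]: "gparity p 0" and gparity_1 [simp]: "even p ==> gparity p 1"
  and gparity_of_real [simp]: "even p ==> gparity p (of_real r)"
  by (auto simp: gparity_def gcoeff_of_real split: if_splits)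
lemma gparity_add: "gparity p g ==> gparity p h ==> gparity p (g + h)"
  and gparity_diff: "gparity p g ==> gparity p h ==> gparity p (g - h)"
  by (simp_all add: gparity_iff)
lemma gparity_uminus: "gparity p g ==> gparity p (- g)" and gparity_scaleR: "gparity p g ==> gparity p (r *\<^sub>R g)"
  by (auto simp: gparity_def)
lemma gparity_mult: "gparity p g ==> gparity q h ==> gparity (p + q) (g * h)"
  unfolding gparity_def by (fastforce elim!: gcoeff_mult_nonzeroD)
lemma gparity_sum: "(!!x. x \<in> A ==> gparity p (f x)) ==> gparity p (sum f A)"
  by (induction A rule: infinite_finite_induct) (auto intro: gparity_add)
lemma gparity_cong: "even (p + q) ==> gparity p g ==> gparity q g"
  by (auto simp: gparity_def)
lemma gparity_mult_cong: "gparity p g ==> gparity q h ==> even (p + q + r) ==> gparity r (g * h)"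
  using gparity_mult gparity_cong by blast
lemma gparity_power: "gparity 0 g ==> gparity 0 (g ^ k)"
  by (induction k) (auto intro: gparity_mult_cong)

lemma glow_0 [simp]: "glow 0 g" "glow k 0"
  by (auto simp: glow_def)
lemma glow_add: "glow k g ==> glow k h ==> glow k (g + h)"
  and glow_diff: "glow k g ==> glow k h ==> glow k (g - h)"
  by (auto simp: glow_def)
lemma glow_scaleR: "glow k g ==> glow k (r *\<^sub>R g)" and glow_uminus: "glow k g ==> glow k (- g)"
  by (auto simp: glow_def)
lemma glow_mult: "glow j g ==> glow k h ==> glow (j + k) (g * h)"
  unfolding glow_def
proof (intro allI impI, rule ccontr)
  fix I assume a: "\<forall>I. card I < j \<longrightarrow> gcoeff g I = 0" "\<forall>I. card I < k \<longrightarrow> gcoeff h I = 0"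
    "card I < j + k" "gcoeff (g * h) I \<noteq> 0"
  from a(4) obtain J K where "gcoeff g J \<noteq> 0" "gcoeff h K \<noteq> 0" "card I = card J + card K"
    by (elim gcoeff_mult_nonzeroD)
  moreover then have "\<not> card J < j" "\<not> card K < k" using a by auto
  ultimately show False using a(3) by linarith
qed
lemma glow_power: "glow 1 g ==> glow k (g ^ k)"
  by (induction k) (use glow_mult in fastforce)+
lemma glow_1_iff: "glow 1 g \<longleftrightarrow> gbody g = 0"
  unfolding glow_def gbody_def
  by (metis card.empty card_eq_0_iff gcoeff_infinite less_one)
lemma glow_eq_0: "gsupp L g ==> finite L ==> glow k g ==> card L < k ==> g = 0"
  by (rule grassmann_eqI) (metis card_mono glow_def gcoeff_simps(1) gsupp_def le_less_trans)

lemma gbody_simps [simp]: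
  "gbody 0 = 0" "gbody 1 = 1" "gbody (g + h) = gbody g + gbody h" "gbody (g - h) = gbody g - gbody h"
  "gbody (- g) = - gbody g" "gbody (r *\<^sub>R g) = r * gbody g" "gbody (of_real r) = r"
  "gbody (g * h) = gbody g * gbody h"
  by (auto simp: gbody_def gcoeff_of_real gcoeff_mult)
lemma gbody_sum: "gbody (sum f A) = (\<Sum>x\<in>A. gbody (f x))"
  by (simp add: gbody_def gcoeff_sum)
lemma gbody_power: "gbody (g ^ k) = gbody g ^ k"
  by (induction k) auto
lemma gbody_odd: "gparity p g ==> odd p ==> gbody g = 0"
  by (auto simp: gparity_def gbody_def)

section \<open>Supercommutativity and parity components\<close>

lemma inversions_swap:
  assumes "finite J" "finite K" "J \<inter> K = {}"
  shows "inversions J K + inversions K J = card J * card K"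
proof -
  let ?A = "{(j, k). j \<in> J \<and> k \<in> K \<and> k < j}" and ?B = "{(j, k). j \<in> J \<and> k \<in> K \<and> j < k}"
  have "inversions K J = card ?B"
    unfolding inversions_def
    by (rule bij_betw_same_card[of prod.swap]) (auto simp: bij_betw_def inj_on_def image_iff)
  moreover have "?A \<union> ?B = J \<times> K" "?A \<inter> ?B = {}"
    using assms(3) by (auto simp: neq_iff)
  moreover have "finite ?A" "finite ?B"
    using assms by (auto intro: finite_subset[of _ "J \<times> K"])
  ultimately show ?thesis
    using card_Un_disjoint[of ?A ?B] by (simp add: inversions_def card_cartesian_product)
qed

text \<open>Passing from J to I - J in the sum exchanges the factors. By
  \<open>inversions_swap\<close> the two reordering signs differ by the parity of card J * card (I -
  J), which is that of p * q wherever both coefficients are nonzero.\<close>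

lemma grassmann_supercommute:
  assumes "gparity p g" "gparity q h"
  shows "g * h = (-1) ^ (p * q) * (h * g)"
proof (rule grassmann_eqI)
  fix I :: "nat set" assume I: "finite I"
  have "gcoeff (g * h) I =
      (\<Sum>J\<in>Pow I. (-1) ^ inversions (I - J) J * gcoeff g (I - J) * gcoeff h J)"
    unfolding gcoeff_mult[OF I]
    by (rule sum.reindex_bij_witness[of _ "\<lambda>J. I - J" "\<lambda>J. I - J"]) (auto simp: double_diff)
  also have "\<dots> = (\<Sum>J\<in>Pow I. (-1) ^ (p * q) * ((-1) ^ inversions J (I - J) * gcoeff h J * gcoeff g (I - J)))"
  proof (rule sum.cong[OF refl])
    fix J assume J: "J \<in> Pow I"
    show "(-1) ^ inversions (I - J) J * gcoeff g (I - J) * gcoeff h J =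
        (-1) ^ (p * q) * ((-1) ^ inversions J (I - J) * gcoeff h J * gcoeff g (I - J))"
    proof (cases "gcoeff g (I - J) = 0 \<or> gcoeff h J = 0")
      case False
      then have e: "even (card (I - J) + p)" "even (card J + q)"
        using assms by (auto simp: gparity_def)
      have "inversions J (I - J) + inversions (I - J) J = card J * card (I - J)"
        using I J by (intro inversions_swap) (auto intro: finite_subset)
      then have "even (inversions (I - J) J) = even (inversions J (I - J) + p * q)"
        using e by (metis even_add even_mult_iff)
      then show ?thesis by (auto simp: minus_one_power_iff)
    qed auto
  qed
  also have "\<dots> = gcoeff ((-1) ^ (p * q) * (h * g)) I"
    by (simp add: minus_one_power_grassmann gcoeff_mult[OF I] sum_distrib_left)
  finally show "gcoeff (g * h) I = gcoeff ((-1) ^ (p * q) * (h * g)) I" .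
qed

text \<open>\<open>h\<close> need not be homogeneous, but both of its parity components commute with
  the even \<open>g\<close>.\<close>

lemma grassmann_even_commute: "gparity 0 g ==> g * h = h * g"
proof -
  assume g: "gparity 0 g"
  obtain h0 h1 where h: "h = h0 + h1" "gparity 0 h0" "gparity 1 h1"
  proof
    let ?P = "\<lambda>q. grassmann_of (\<lambda>I. if even (card I + q) then gcoeff h I else 0)"
    show "h = ?P 0 + ?P 1"
      by (rule grassmann_eqI) (auto simp: gcoeff_of)
    show "gparity 0 (?P 0)" "gparity 1 (?P 1)"
      by (auto simp: gparity_def gcoeff_of)
  qed
  have "g * h0 = h0 * g" "g * h1 = h1 * g"
    using grassmann_supercommute[OF g h(2)] grassmann_supercommute[OF g h(3)] by simp_all
  then show ?thesis by (simp add: h(1) distrib_left distrib_right)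
qed

definition gpart :: "nat => grassmann => grassmann" where
  "gpart q g = grassmann_of (\<lambda>I. if even (card I + q) then gcoeff g I else 0)"

lemma gcoeff_gpart [simp]: "gcoeff (gpart q g) I = (if even (card I + q) then gcoeff g I else 0)"
  by (auto simp: gpart_def gcoeff_of gcoeff_infinite)
lemma gpart_sum: "g = gpart 0 g + gpart 1 g"
  by (rule grassmann_eqI) auto
lemma gparity_gpart: "gparity q (gpart q g)"
  by (auto simp: gparity_def)
lemma gpart_same: "gparity p g ==> gpart q g = (if even (p + q) then g else 0)"
  by (rule grassmann_eqI) (auto simp: gparity_iff)
lemma gpart_add: "gpart q (g + h) = gpart q g + gpart q h" and gpart_0 [simp]: "gpart q 0 = 0"
  by (auto intro!: grassmann_eqI)
lemma gpart_mod: "even (p + q) ==> gpart p g = gpart q g"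
  by (auto intro!: grassmann_eqI)
lemma gpart_Suc_Suc [simp]: "gpart (Suc (Suc q)) g = gpart q g"
  by (auto intro!: grassmann_eqI)
lemma gpart_mult_right:
  assumes "gparity p h" shows "gpart q (g * h) = gpart (q + p) g * h"
proof -
  have a: "gpart q (gpart r g * h) = (if even (r + p + q) then gpart r g * h else 0)" for r
    by (rule gpart_same[OF gparity_mult[OF gparity_gpart assms]])
  have "gpart q (g * h) = gpart q (gpart 0 g * h) + gpart q (gpart 1 g * h)"
    by (metis gpart_sum gpart_add distrib_right)
  also have "\<dots> = gpart (q + p) g * h"
    unfolding a by (auto intro!: arg_cong[where f = "\<lambda>x. x * h"] gpart_mod)
  finally show ?thesis .
qed

lemma gcoeff_gsign [simp]: "gcoeff (gsign k g) I = (-1) ^ (k * card I) * gcoeff g I"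
  by (auto simp: gsign_def gcoeff_of gcoeff_infinite)
lemma gsign_parity: "gparity p g ==> gsign k g = (-1) ^ (k * p) * g"
  by (rule grassmann_eqI) (auto simp: minus_one_power_grassmann gparity_def minus_one_power_iff)
lemma gsign_gpart: "gsign k g = gpart 0 g + (-1) ^ k * gpart 1 g"
  by (rule grassmann_eqI) (auto simp: minus_one_power_grassmann minus_one_power_iff)
lemma gsign_0 [simp]: "gsign k 0 = 0" and gsign_add: "gsign k (g + h) = gsign k g + gsign k h"
  by (auto intro!: grassmann_eqI simp: algebra_simps)

section \<open>Odd derivatives\<close>

lemma gcoeff_ggen [simp]: "gcoeff (ggen a) I = (if I = {a} then 1 else 0)"
  by (auto simp: ggen_def gcoeff_of)
lemma gparity_ggen: "gparity 1 (ggen a)" and gsupp_ggen: "a \<in> L ==> gsupp L (ggen a)"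
  and gbody_ggen [simp]: "gbody (ggen a) = 0"
  by (auto simp: gparity_def gsupp_def gbody_def split: if_splits)

lemma gcoeff_gderiv:
  "gcoeff (gderiv a g) I =
    (if finite I \<and> a \<notin> I then (-1) ^ card {j \<in> I. j < a} * gcoeff g (insert a I) else 0)"
  by (auto simp: gderiv_def gcoeff_of)

lemma gderiv_add: "gderiv a (g + h) = gderiv a g + gderiv a h"
  and gderiv_diff: "gderiv a (g - h) = gderiv a g - gderiv a h"
  and gderiv_uminus: "gderiv a (- g) = - gderiv a g"
  and gderiv_scaleR: "gderiv a (r *\<^sub>R g) = r *\<^sub>R gderiv a g"
  and gderiv_0 [simp]: "gderiv a 0 = 0" and gderiv_of_real [simp]: "gderiv a (of_real r) = 0"
  by (auto intro!: grassmann_eqI simp: gcoeff_gderiv gcoeff_of_real algebra_simps)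
lemma gderiv_ggen: "gderiv a (ggen b) = (if a = b then 1 else 0)"
  by (rule grassmann_eqI) (auto simp: gcoeff_gderiv)
lemma gparity_gderiv: "gparity p g ==> gparity (p + 1) (gderiv a g)"
  by (fastforce simp: gparity_def gcoeff_gderiv split: if_splits)
lemma gsupp_gderiv: "gsupp L g ==> gsupp L (gderiv a g)"
  by (fastforce simp: gsupp_def gcoeff_gderiv split: if_splits)

text \<open>Supercommutativity when the second factor has no definite parity: the sign acts on its
  components through \<open>gsign\<close>. In this form the Leibniz rules need no homogeneity of the
  first factor.\<close>

lemma gsign_commute: "gparity p h ==> h * f = gsign p f * h"
proof -
  assume h: "gparity p h"
  have "h * gpart 0 f = gpart 0 f * h" "h * gpart 1 f = (-1) ^ p * gpart 1 f * h"
    using grassmann_supercommute[OF h gparity_gpart[of 0 f]] grassmann_supercommute[OF h gparity_gpart[of 1 f]]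
    by (simp_all add: mult.assoc)
  then show ?thesis unfolding gsign_gpart by (metis gpart_sum distrib_left distrib_right)
qed
lemma gsign_gsign: "gsign p (gsign q f) = gsign (p + q) f"
  by (rule grassmann_eqI) (simp add: power_add algebra_simps)
lemma gsign_even: "even p ==> gsign p f = f"
  by (rule grassmann_eqI) simp
lemma gsign_mod: "even (p + q) ==> gsign p f = gsign q f"
  by (rule grassmann_eqI) (simp add: minus_one_power_iff; auto)

lemma gcoeff_ggen_mult:
  assumes I: "finite I"
  shows "gcoeff (ggen a * g) I = (if a \<in> I then (-1) ^ card {j \<in> I. j < a} * gcoeff g (I - {a}) else 0)"
proof -
  have "inversions {a} (I - {a}) = card {j \<in> I. j < a}"
    unfolding inversions_def
    by (rule bij_betw_same_card[of snd]) (auto simp: bij_betw_def inj_on_def image_iff)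
  moreover have "gcoeff (ggen a * g) I =
      (\<Sum>J\<in>Pow I. if J = {a} then (-1) ^ inversions {a} (I - {a}) * gcoeff g (I - {a}) else 0)"
    unfolding gcoeff_mult[OF I] by (rule sum.cong) auto
  ultimately show ?thesis using I by (simp add: sum.delta)
qed

lemma gsupp_gderiv_same: "gsupp (- {a}) (gderiv a g)"
  by (auto simp: gsupp_def gcoeff_gderiv)
lemma gderiv_eq_0: "gsupp L g ==> a \<notin> L ==> gderiv a g = 0"
  by (rule grassmann_eqI) (auto simp: gcoeff_gderiv gsupp_def)
lemma gderiv_ggen_mult: "gsupp (- {a}) g ==> gderiv a (ggen a * g) = g"
proof (rule grassmann_eqI)
  fix I :: "nat set" assume "gsupp (- {a}) g" "finite I"
  moreover have "{j. (j = a \<or> j \<in> I) \<and> j < a} = {j \<in> I. j < a}" by auto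
  ultimately show "gcoeff (gderiv a (ggen a * g)) I = gcoeff g I"
    by (auto simp: gcoeff_gderiv gcoeff_ggen_mult gsupp_def power_add[symmetric] mult.assoc[symmetric])
qed

text \<open>The odd coordinates may be split off one at a time, since \<open>g = (g - \<xi> \<partial>g) + \<xi> \<partial>g\<close>.\<close>

lemma gsupp_remainder_same: "gsupp (- {a}) (g - ggen a * gderiv a g)"
  unfolding gsupp_def
proof (intro allI impI, rule ccontr)
  fix I assume n: "gcoeff (g - ggen a * gderiv a g) I \<noteq> 0" and "\<not> I \<subseteq> - {a}"
  then have "a \<in> I" "finite I" using gcoeff_infinite by blast+
  moreover have "{j \<in> I - {a}. j < a} = {j \<in> I. j < a}" by auto
  ultimately show False using n
    by (simp add: gcoeff_gderiv gcoeff_ggen_mult insert_absorb power_add[symmetric] mult.assoc[symmetric])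
qed
lemma gsupp_remainder: "gsupp L g ==> a \<in> L ==> gsupp (L - {a}) (g - ggen a * gderiv a g)"
proof -
  assume "gsupp L g" "a \<in> L"
  then have "gsupp L (g - ggen a * gderiv a g)" by (intro gsupp_diff gsupp_mult gsupp_ggen gsupp_gderiv)
  with gsupp_remainder_same[of a g] show ?thesis by (fastforce simp: gsupp_def)
qed
lemma gsupp_gderiv_eq_0: "gsupp L g ==> gderiv a g = 0 ==> gsupp (L - {a}) g"
  using gsupp_remainder_same[of a g] by (fastforce simp: gsupp_def)

lemma ggen_ggen: "ggen a * ggen a = 0"
  by (rule grassmann_eqI) (auto simp: gcoeff_ggen_mult)

text \<open>Let x be the generator, g = g0 + x * g1 and h = h0 + x * h1 with g0, g1, h0, h1 free of
  x. Since x * x = 0, the coefficient of x in g * h is gsign 1 g0 * h1 + g1 * h0; the sign operator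
  appears when x moves to the left of g0.\<close>

lemma gderiv_mult: "gderiv a (g * h) = gderiv a g * h + gsign 1 g * gderiv a h"
proof -
  define x g1 h1 g0 h0 where "x = ggen a" and "g1 = gderiv a g" and "h1 = gderiv a h"
    and "g0 = g - x * g1" and "h0 = h - x * h1"
  have gh: "g = g0 + x * g1" "h = h0 + x * h1" by (simp_all add: g0_def h0_def)
  have s: "gsupp (- {a}) g1" "gsupp (- {a}) h1" "gsupp (- {a}) g0" "gsupp (- {a}) h0"
    using gsupp_gderiv_same gsupp_remainder_same by (simp_all add: x_def g1_def h1_def g0_def h0_def)
  have x: "f * x = x * gsign 1 f" for f
    using gsign_commute[OF gparity_ggen, of a "gsign 1 f"] by (simp add: x_def gsign_gsign gsign_even)
  have xx: "x * x = 0" by (simp add: x_def ggen_ggen)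
  have sx: "gsign 1 (x * f) = - (x * gsign 1 f)" for f unfolding x_def
  proof (rule grassmann_eqI)
    fix I :: "nat set" assume "finite I"
    then show "gcoeff (gsign 1 (ggen a * f)) I = gcoeff (- (ggen a * gsign 1 f)) I"
      by (cases "card I") (auto simp: gcoeff_ggen_mult)
  qed
  have e: "g * h = g0 * h0 + x * (gsign 1 g0 * h1 + g1 * h0)"
    unfolding gh distrib_left distrib_right mult.assoc
    using x xx by (simp add: mult.assoc[symmetric])
  have s1: "gsupp (- {a}) (gsign 1 g0)" using s(3) by (auto simp: gsupp_def)
  have "gderiv a (g * h) = gsign 1 g0 * h1 + g1 * h0"
    unfolding e gderiv_add x_def using s s1
    by (subst gderiv_ggen_mult) (auto intro!: gsupp_add gsupp_mult gderiv_eq_0[OF gsupp_mult])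
  also have "\<dots> = g1 * h + gsign 1 g * h1"
    unfolding gh gsign_add sx using x[of g1] by (simp add: algebra_simps) (metis mult.assoc)
  finally show ?thesis by (simp add: g1_def h1_def)
qed

lemma gderiv_gderiv: "gderiv a (gderiv b g) = - gderiv b (gderiv a g)"
proof (rule grassmann_eqI)
  fix I :: "nat set" assume I: "finite I"
  show "gcoeff (gderiv a (gderiv b g)) I = gcoeff (- gderiv b (gderiv a g)) I"
  proof (cases "a = b \<or> a \<in> I \<or> b \<in> I")
    case False
    \<comment> \<open>Of the two counts of smaller labels exactly one grows by one when the other
      label is inserted; this is the relative sign of the two orders.\<close>
    have c: "card {j \<in> insert a I. j < b} = card {j \<in> I. j < b} + (if a < b then 1 else 0)"
      "card {j \<in> insert b I. j < a} = card {j \<in> I. j < a} + (if b < a then 1 else 0)"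
    proof -
      have "{j \<in> insert a I. j < b} = (if a < b then insert a {j \<in> I. j < b} else {j \<in> I. j < b})"
        "{j \<in> insert b I. j < a} = (if b < a then insert b {j \<in> I. j < a} else {j \<in> I. j < a})" by auto
      then show "card {j \<in> insert a I. j < b} = card {j \<in> I. j < b} + (if a < b then 1 else 0)"
        "card {j \<in> insert b I. j < a} = card {j \<in> I. j < a} + (if b < a then 1 else 0)"
        using False I by auto
    qed
    have "a < b \<or> b < a" using False by auto
    then show ?thesis using False I
      by (elim disjE) (auto simp: gcoeff_gderiv c[simplified] minus_one_power_iff insert_commute)
  qed (use I in \<open>auto simp: gcoeff_gderiv\<close>)
qed

text \<open>A label whose derivative vanishes can be removed from the support, so no nonempty
  monomial survives.\<close>

lemma gderiv_all_0:
  assumes "finite L" "gsupp L g" "!!a. a \<in> L ==> gderiv a g = 0"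
  shows "g = of_real (gbody g)"
proof (rule grassmann_eqI)
  fix I :: "nat set" assume I: "finite I"
  have "gcoeff g I = 0" if "I \<noteq> {}"
  proof (rule ccontr)
    assume n: "gcoeff g I \<noteq> 0"
    then have "I \<subseteq> L" using assms by (auto simp: gsupp_def)
    obtain a where a: "a \<in> I" using \<open>I \<noteq> {}\<close> by auto
    then have "gsupp (L - {a}) g" using assms \<open>I \<subseteq> L\<close> by (intro gsupp_gderiv_eq_0) auto
    with n a show False by (auto simp: gsupp_def)
  qed
  then show "gcoeff g I = gcoeff (of_real (gbody g)) I"
    by (auto simp: gcoeff_of_real gbody_def)
qed

section \<open>Inverses by the terminating geometric series\<close>

lemma geometric_inverse:
  fixes x :: grassmann
  assumes "gsupp L x" "finite L" "gbody x = 0"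
  shows "\<exists>h. gsupp L h \<and> (1 + x) * h = 1 \<and> h * (1 + x) = 1"
proof -
  let ?k = "Suc (card L)"
  \<comment> \<open>The exponent card L + 1 is the first to exceed the number of generators
    available to x.\<close>
  have z: "(- x) ^ ?k = 0"
    by (rule glow_eq_0[of L _ ?k], intro gsupp_power gsupp_uminus assms, rule assms,
        intro glow_power glow_uminus) (use assms glow_1_iff in auto)
  let ?h = "\<Sum>i<?k. (- x) ^ i"
  have c: "(- x) ^ n * x = x * (- x) ^ n" for n
    by (induction n) (simp_all add: mult.assoc)
  have "(1 + x) * (\<Sum>i<k. (- x) ^ i) = 1 - (- x) ^ k" for k
    by (induction k) (simp_all add: algebra_simps c)
  then have "(1 + x) * ?h = 1" using z by (metis diff_zero)
  moreover have "(1 + x) * ?h = ?h * (1 + x)"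
    by (simp only: sum_distrib_left sum_distrib_right sum.distrib[symmetric] distrib_left distrib_right c mult_1_left mult_1_right)
  moreover have "gsupp L ?h" by (intro gsupp_sum gsupp_power gsupp_uminus assms)
  ultimately show ?thesis by metis
qed

lemma grassmann_inverse:
  assumes "gsupp L g" "finite L" "gbody g \<noteq> 0"
  shows "\<exists>h. gsupp L h \<and> g * h = 1 \<and> h * g = 1"
proof -
  let ?b = "gbody g" let ?x = "(1 / ?b) *\<^sub>R g - 1"
  obtain h where h: "gsupp L h" "(1 + ?x) * h = 1" "h * (1 + ?x) = 1"
    using geometric_inverse[of L ?x] assms by (auto simp: gsupp_diff gsupp_scaleR)
  then show ?thesis using assms by (intro exI[of _ "(1 / ?b) *\<^sub>R h"]) (auto intro: gsupp_scaleR)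
qed

lemma ginv_eq: "g * h = 1 ==> h * g = 1 ==> ginv g = h"
proof -
  assume a: "g * h = 1" "h * g = 1"
  have "g * ginv g = 1" unfolding ginv_def by (rule someI[of "\<lambda>h. g * h = 1" h], rule a)
  then show "ginv g = h" using a by (metis mult.assoc mult_1_left mult_1_right)
qed

subsection \<open>Real powers\<close>

definition gbinom :: "nat => real => grassmann => grassmann" where
  "gbinom m w y = (\<Sum>k\<le>m. (w gchoose k) *\<^sub>R y ^ k)"

text \<open>Identities with real exponents are reduced to natural ones: for a fixed nilpotent
  argument every coefficient is a polynomial in the exponent, and two polynomials that agree at all
  natural numbers are equal (\<open>is_polyfun_eq\<close>).\<close>

definition is_polyfun :: "(real => real) => bool" where
  "is_polyfun f \<longleftrightarrow> (\<exists>p. f = poly p)"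

lemma is_polyfun_const: "is_polyfun (\<lambda>w. c)"
  unfolding is_polyfun_def by (rule exI[of _ "[:c:]"]) auto
lemma is_polyfun_add: "is_polyfun f ==> is_polyfun g ==> is_polyfun (\<lambda>w. f w + g w)"
  and is_polyfun_mult: "is_polyfun f ==> is_polyfun g ==> is_polyfun (\<lambda>w. f w * g w)"
  unfolding is_polyfun_def by (auto simp flip: poly_add poly_mult)
lemma is_polyfun_sum: "(!!x. x \<in> A ==> is_polyfun (f x)) ==> is_polyfun (\<lambda>w. \<Sum>x\<in>A. f x w)"
  by (induction A rule: infinite_finite_induct) (auto intro: is_polyfun_add is_polyfun_const)
lemma is_polyfun_shift: "is_polyfun (\<lambda>w. w - c)"
  unfolding is_polyfun_def by (rule exI[of _ "[:-c, 1:]"]) auto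
lemma is_polyfun_gbinomial: "is_polyfun (\<lambda>w. w gchoose k)"
proof (induction k)
  case (Suc k)
  have "(w gchoose Suc k) = (w gchoose k) * ((w - of_nat k) * (1 / of_nat (Suc k)))" for w :: real
    using gbinomial_mult_1[of w k] by (simp add: field_simps)
  then have "(\<lambda>w. w gchoose Suc k) = (\<lambda>w::real. (w gchoose k) * ((w - of_nat k) * (1 / of_nat (Suc k))))"
    by (rule ext)
  then show ?case
    using Suc by (simp only:) (intro is_polyfun_mult is_polyfun_shift is_polyfun_const)
qed (simp add: is_polyfun_const)

lemma is_polyfun_eq:
  assumes "is_polyfun f" "is_polyfun g" "!!N::nat. f (real N) = g (real N)"
  shows "f w = g w"
proof -
  obtain p q where pq: "f = poly p" "g = poly q" using assms by (auto simp: is_polyfun_def)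
  have "range real \<subseteq> {x. poly (p - q) x = 0}" using assms(3) by (auto simp: pq)
  moreover have "infinite (range real)" by (rule range_inj_infinite) (simp add: inj_def)
  ultimately have "infinite {x. poly (p - q) x = 0}" using finite_subset by blast
  then have "p - q = 0" using poly_roots_finite by blast
  with pq show ?thesis by simp
qed

lemma is_polyfun_gbinom: "is_polyfun (\<lambda>w. gcoeff (gbinom m w y) I)"
  unfolding gbinom_def gcoeff_sum
  by (auto intro!: is_polyfun_sum is_polyfun_mult is_polyfun_gbinomial is_polyfun_const)

lemma is_polyfun_gcoeff_mult:
  assumes "!!I. is_polyfun (\<lambda>w. gcoeff (g w) I)" "!!I. is_polyfun (\<lambda>w. gcoeff (h w) I)"
  shows "is_polyfun (\<lambda>w. gcoeff (g w * h w) I)"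
proof (cases "finite I")
  case True
  show ?thesis unfolding gcoeff_mult[OF True]
    by (intro is_polyfun_sum is_polyfun_mult is_polyfun_const assms)
qed (simp add: gcoeff_infinite is_polyfun_const)

text \<open>With at most m generators the powers beyond m of a nilpotent element vanish, so the
  binomial series cut off at m, as in \<open>gabs_powr\<close>, is the whole series.\<close>

locale nilpotent_grassmann =
  fixes m :: nat and L :: "nat set"
  assumes L: "finite L" "card L \<le> m"
begin

definition nil :: "grassmann => bool" where
  "nil y \<longleftrightarrow> gsupp L y \<and> gbody y = 0"

lemma nil_power_eq_0: "nil y ==> m < k ==> y ^ k = 0"
  unfolding nil_def using L by (intro glow_eq_0[of L _ k]) (auto intro!: gsupp_power glow_power simp: glow_1_iff[unfolded One_nat_def])

text \<open>Pascal's rule involves powers of y alone, so it is valid in the noncommutative ring. The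
  upper limit N can be exchanged for m because binomial coefficients vanish beyond N and powers of y
  beyond m.\<close>

lemma gbinom_nat: "nil y ==> gbinom m (real N) y = (1 + y) ^ N"
proof -
  assume y: "nil y"
  have c: "1 * y = y * 1" by simp
  let ?f = "\<lambda>k. (real N gchoose k) *\<^sub>R y ^ k"
  have "(1 + y) ^ N = (\<Sum>k\<le>N. of_nat (N choose k) * y ^ k)"
  proof (induction N)
    case (Suc N)
    have "(1 + y) ^ Suc N = (\<Sum>k\<le>N. of_nat (N choose k) * y ^ k) + (\<Sum>k\<le>N. of_nat (N choose k) * y ^ Suc k)"
      unfolding power_Suc Suc distrib_right mult_1_left
      by (simp add: sum_distrib_left mult.assoc mult_of_nat_commute power_commutes)
    also have "(\<Sum>k\<le>N. of_nat (N choose k) * y ^ k) = (\<Sum>k\<le>Suc N. of_nat (N choose k) * y ^ k)"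
      by (simp add: binomial_eq_0)
    also have "\<dots> = 1 + (\<Sum>k\<le>N. of_nat (N choose Suc k) * y ^ Suc k)"
      by (simp only: sum.atMost_Suc_shift) simp
    finally have "(1 + y) ^ Suc N = 1 + (\<Sum>k\<le>N. of_nat (Suc N choose Suc k) * y ^ Suc k)"
      by (simp only: add.assoc sum.distrib[symmetric] distrib_right[symmetric] of_nat_add[symmetric]
          binomial_Suc_Suc add.commute[of "N choose Suc _"])
    then show ?case
      by (simp only: sum.atMost_Suc_shift) simp
  qed simp
  also have "\<dots> = (\<Sum>k\<le>N. ?f k)"
    by (intro sum.cong refl) (simp add: binomial_gbinomial[symmetric] scaleR_conv_of_real)
  also have "\<dots> = (\<Sum>k\<le>max N m. ?f k)"
    by (intro sum.mono_neutral_left) (auto simp: binomial_gbinomial[symmetric] binomial_eq_0)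
  also have "\<dots> = (\<Sum>k\<le>m. ?f k)"
    by (intro sum.mono_neutral_right) (use nil_power_eq_0[OF y] in auto)
  finally show ?thesis by (simp add: gbinom_def)
qed

text \<open>Interpolation is used twice: first in u with v a natural number, then in v with u
  arbitrary.\<close>

lemma gbinom_add: "nil y ==> gbinom m (u + v) y = gbinom m u y * gbinom m v y"
proof (rule grassmann_eqI)
  fix I assume y: "nil y"
  have sh: "is_polyfun (\<lambda>w. gcoeff (gbinom m (w + c) y) I)" for c I
  proof -
    obtain p where p: "(\<lambda>w. gcoeff (gbinom m w y) I) = poly p"
      using is_polyfun_gbinom unfolding is_polyfun_def by blast
    have "gcoeff (gbinom m (w + c) y) I = poly (pcompose p [:c, 1:]) w" for w
      using fun_cong[OF p, of "w + c"] by (simp add: poly_pcompose add.commute)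
    then show ?thesis unfolding is_polyfun_def by blast
  qed
  have 1: "gcoeff (gbinom m (u + real N) y) I = gcoeff (gbinom m u y * gbinom m (real N) y) I" for N u
    by (rule is_polyfun_eq[where w = u], rule sh, rule is_polyfun_gcoeff_mult)
      (auto simp: is_polyfun_gbinom is_polyfun_const gbinom_nat[OF y] power_add simp flip: of_nat_add)
  have "gcoeff (gbinom m (v + u) y) I = gcoeff (gbinom m u y * gbinom m v y) I"
    by (rule is_polyfun_eq[where w = v], rule sh, rule is_polyfun_gcoeff_mult)
      (auto simp: is_polyfun_gbinom is_polyfun_const 1 add.commute[of _ u])
  then show "gcoeff (gbinom m (u + v) y) I = gcoeff (gbinom m u y * gbinom m v y) I"
    by (simp add: add.commute)
qed

text \<open>For natural exponents both sides are ((1 + x) * (1 + y)) ^ N, which splits because x and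
  y commute; the exponent is then interpolated.\<close>

lemma gbinom_mult:
  assumes "nil x" "nil y" "x * y = y * x"
  shows "gbinom m w x * gbinom m w y = gbinom m w (x + y + x * y)"
proof (rule grassmann_eqI)
  fix I
  have n: "nil (x + y + x * y)" using assms by (auto simp: nil_def intro!: gsupp_add gsupp_mult)
  have c: "(1 + x) ^ N * (1 + y) ^ N = (1 + (x + y + x * y)) ^ N" for N
  proof -
    have "(1 + x) * (1 + y) = (1 + y) * (1 + x)" using assms(3) by (simp add: algebra_simps)
    then have "((1 + x) * (1 + y)) ^ N = (1 + x) ^ N * (1 + y) ^ N"
    proof (induction N)
      case (Suc N)
      have c: "(1 + y) * (1 + x) ^ N = (1 + x) ^ N * (1 + y)"
        using power_commuting_commutes[OF Suc.prems, of N] by simp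
      have "((1 + x) * (1 + y)) ^ Suc N = (1 + x) * ((1 + y) * (1 + x) ^ N) * (1 + y) ^ N"
        using Suc.IH[OF Suc.prems] by (simp only: power_Suc mult.assoc)
      then show ?case unfolding c by (simp only: power_Suc mult.assoc)
    qed simp
    moreover have "(1 + x) * (1 + y) = 1 + (x + y + x * y)" by (simp add: algebra_simps)
    ultimately show ?thesis by simp
  qed
  show "gcoeff (gbinom m w x * gbinom m w y) I = gcoeff (gbinom m w (x + y + x * y)) I"
    by (rule is_polyfun_eq[where w = w], rule is_polyfun_gcoeff_mult)
      (simp_all only: is_polyfun_gbinom gbinom_nat[OF n] gbinom_nat[OF assms(1)] gbinom_nat[OF assms(2)] c)
qed

end

context nilpotent_grassmann
begin

lemma nil_scaled_soul:
  assumes "gsupp L g" "gbody g \<noteq> 0"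
  shows "nil ((1 / gbody g) *\<^sub>R (g - of_real (gbody g)))"
  using assms by (auto simp: nil_def intro!: gsupp_scaleR gsupp_diff)

lemma gabs_powr_alt:
  "gabs_powr m g w = (\<bar>gbody g\<bar> powr w) *\<^sub>R gbinom m w ((1 / gbody g) *\<^sub>R (g - of_real (gbody g)))"
  by (simp add: gabs_powr_def gbinom_def)

lemma gabs_powr_add:
  assumes "gsupp L g" "gbody g \<noteq> 0"
  shows "gabs_powr m g (u + v) = gabs_powr m g u * gabs_powr m g v"
  by (simp add: gabs_powr_alt gbinom_add[OF nil_scaled_soul[OF assms]] powr_add mult_ac)

lemma gabs_powr_mult:
  assumes "gsupp L g" "gbody g \<noteq> 0" "gsupp L h" "gbody h \<noteq> 0" "gparity 0 g"
  shows "gabs_powr m (g * h) w = gabs_powr m g w * gabs_powr m h w"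
proof -
  let ?y = "\<lambda>g. (1 / gbody g) *\<^sub>R (g - of_real (gbody g))"
  have c: "?y g * ?y h = ?y h * ?y g"
    by (rule grassmann_even_commute) (auto intro!: gparity_scaleR gparity_diff assms)
  \<comment> \<open>Division by the body turns g into 1 + x and h into 1 + y. Their product has
    nilpotent part x + y + x * y, the argument that \<open>gbinom_mult\<close> produces.\<close>
  have e: "?y g + ?y h + ?y g * ?y h = ?y (g * h)"
  proof -
    have o: "(1 / gbody g) *\<^sub>R (g - of_real (gbody g)) = (1 / gbody g) *\<^sub>R g - 1" if "gbody g \<noteq> 0" for g
      using that by (simp add: scaleR_diff_right of_real_def)
    have gh: "gbody (g * h) \<noteq> 0" using assms by simp
    have "(1 / gbody (g * h)) *\<^sub>R (g * h) = (1 / gbody g) *\<^sub>R g * (1 / gbody h) *\<^sub>R h" by simp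
    then show ?thesis
      unfolding o[OF assms(2)] o[OF assms(4)] o[OF gh] by (simp add: algebra_simps)
  qed
  show ?thesis
    using gbinom_mult[OF nil_scaled_soul[OF assms(1,2)] nil_scaled_soul[OF assms(3,4)] c, of w]
    unfolding e gabs_powr_alt by (simp add: abs_mult powr_mult mult.commute)
qed

lemma gabs_powr_0: "gbody g \<noteq> 0 ==> gabs_powr m g 0 = 1"
proof -
  have "(0 gchoose k) *\<^sub>R (y :: grassmann) ^ k = (if k = 0 then 1 else 0)" for k y
    by (cases k) (auto simp: gbinomial_0_left)
  then show "gbody g \<noteq> 0 ==> gabs_powr m g 0 = 1" by (simp add: gabs_powr_def)
qed

lemma gparity_gabs_powr: "gparity 0 g ==> gparity 0 (gabs_powr m g w)"
  unfolding gabs_powr_def by (intro gparity_scaleR gparity_sum gparity_power gparity_diff) auto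

lemma gbody_gabs_powr: "gbody (gabs_powr m g w) = \<bar>gbody g\<bar> powr w"
proof -
  have "(\<Sum>k\<le>m. (w gchoose k) * 0 ^ k) = (\<Sum>k\<le>m. if k = 0 then 1 else 0 :: real)"
    by (rule sum.cong) auto
  then show ?thesis by (simp add: gabs_powr_def gbody_sum gbody_power)
qed

end

section \<open>Berezinians\<close>

text \<open>The even Grassmann numbers form a commutative ring, to which the theory of determinants applies.\<close>

typedef geven = "{g. gparity 0 g}"
  morphisms of_geven to_geven
  by (rule exI[of _ 0]) simp

setup_lifting type_definition_geven

instantiation geven :: comm_ring_1
begin
lift_definition zero_geven :: geven is 0 by simp
lift_definition one_geven :: geven is 1 by simp
lift_definition plus_geven :: "geven => geven => geven" is "(+)" by (rule gparity_add)
lift_definition minus_geven :: "geven => geven => geven" is "(-)" by (rule gparity_diff)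
lift_definition uminus_geven :: "geven => geven" is uminus by (rule gparity_uminus)
lift_definition times_geven :: "geven => geven => geven" is "(*)"
  by (rule gparity_mult_cong[where p = 0 and q = 0]) auto
instance
  by standard (transfer; simp add: algebra_simps grassmann_even_commute)+
end

interpretation of_geven: ring_hom of_geven
  by standard (simp_all add: zero_geven.rep_eq one_geven.rep_eq plus_geven.rep_eq times_geven.rep_eq)

lemma gparity_of_geven: "gparity 0 (of_geven g)"
  using of_geven by simp

lemma of_to_geven: "gparity 0 g ==> of_geven (to_geven g) = g"
  by (simp add: to_geven_inverse)

section \<open>Determinants of matrices with even entries\<close>

definition gmdet :: "grassmann mat => grassmann" where
  "gmdet A = of_geven (det (map_mat to_geven A))"

text \<open>In an even supermatrix the diagonal blocks belong to parity 0 and the off-diagonal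
  blocks to parity 1. Determinants are taken of the former only.\<close>

definition pmat :: "nat => nat => nat => grassmann mat set" where
  "pmat p r c = {A. A \<in> carrier_mat r c \<and> (\<forall>i<r. \<forall>j<c. gparity p (A $$ (i, j)))}"

lemma pmat_lift: "A \<in> pmat 0 r c ==> \<exists>A'. A' \<in> carrier_mat r c \<and> A = map_mat of_geven A'"
  by (rule exI[of _ "map_mat to_geven A"]) (auto simp: pmat_def of_to_geven)

lemma gmdet_of: "gmdet (map_mat of_geven A) = of_geven (det A)"
proof -
  have "map_mat to_geven (map_mat of_geven A) = A" by (rule eq_matI) (auto simp: of_geven_inverse)
  then show ?thesis by (simp add: gmdet_def)
qed

lemma gparity_gmdet: "gparity 0 (gmdet A)"
  by (simp add: gmdet_def gparity_of_geven)

lemma gmdet_mult: "A \<in> pmat 0 n n ==> B \<in> pmat 0 n n ==> gmdet (A * B) = gmdet A * gmdet B"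
proof -
  assume "A \<in> pmat 0 n n" "B \<in> pmat 0 n n"
  then obtain A' B' where *: "A' \<in> carrier_mat n n" "B' \<in> carrier_mat n n"
    "A = map_mat of_geven A'" "B = map_mat of_geven B'" using pmat_lift by metis
  then have "A * B = map_mat of_geven (A' * B')"
    by (simp add: of_geven.mat_hom_mult)
  then show ?thesis using * by (simp add: gmdet_of det_mult of_geven.hom_mult)
qed

lemma gmdet_one: "gmdet (1\<^sub>m n) = 1"
  using gmdet_of[of "1\<^sub>m n"] by (simp add: of_geven.mat_hom_one)

text \<open>Cramer's rule: \<open>u\<close> times the adjugate, formed in the commutative ring of
  even elements.\<close>

lemma gmdet_inverse:
  assumes "A \<in> pmat 0 n n" "gmdet A * u = 1" "gparity 0 u"
  shows "\<exists>G \<in> pmat 0 n n. A * G = 1\<^sub>m n \<and> G * A = 1\<^sub>m n"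
proof -
  obtain A' where A: "A' \<in> carrier_mat n n" "A = map_mat of_geven A'" using pmat_lift assms by blast
  define v where "v = to_geven u"
  have "of_geven (det A' * v) = of_geven 1" using assms A by (simp add: gmdet_of of_geven.hom_mult v_def of_to_geven)
  then have d: "det A' * v = 1" by (simp only: of_geven_inject)
  define G where "G = v \<cdot>\<^sub>m adj_mat A'"
  have adj: "adj_mat A' \<in> carrier_mat n n" "A' * adj_mat A' = det A' \<cdot>\<^sub>m 1\<^sub>m n" "adj_mat A' * A' = det A' \<cdot>\<^sub>m 1\<^sub>m n"
    using adj_mat[OF A(1)] by auto
  have s: "v \<cdot>\<^sub>m (det A' \<cdot>\<^sub>m 1\<^sub>m n) = 1\<^sub>m n"
    using d by (intro eq_matI) (auto simp: mult.commute)
  have "A' * G = 1\<^sub>m n" "G * A' = 1\<^sub>m n" "G \<in> carrier_mat n n"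
    using A adj by (simp_all add: G_def mult_smult_distrib[OF A(1) adj(1)] mult_smult_assoc_mat[OF adj(1) A(1)] s)
  then show ?thesis
    using A by (intro bexI[of _ "map_mat of_geven G"])
      (auto simp: pmat_def gparity_of_geven of_geven.mat_hom_one simp flip: of_geven.mat_hom_mult)
qed

lemma prod_list_of_geven: "prod_list (map (\<lambda>i. of_geven (f i)) [0..<k]) = of_geven (\<Prod>i = 0..<k. f i)"
  by (induction k) (auto simp: of_geven.hom_mult)

text \<open>Links the ordered products of \<open>gdet\<close> with determinants over a commutative
  ring; since the entries are even, the order of the factors is immaterial.\<close>

lemma gdet_gmdet:
  assumes "!!i j. i < k ==> j < k ==> gparity 0 (A i j)"
  shows "gdet k A = gmdet (mat k k (\<lambda>(i, j). A i j))"
proof -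
  define A' where "A' = mat k k (\<lambda>(i, j). to_geven (A i j))"
  have 1: "mat k k (\<lambda>(i, j). A i j) = map_mat of_geven A'"
    by (rule eq_matI) (auto simp: A'_def of_to_geven assms)
  have A': "A' \<in> carrier_mat k k" by (simp add: A'_def)
  have "gdet k A = (\<Sum>p | p permutes {0..<k}. of_geven (signof p * (\<Prod>i = 0..<k. A' $$ (i, p i))))"
    unfolding gdet_def atLeast0LessThan[symmetric]
  proof (rule sum.cong[OF refl])
    fix p assume "p \<in> {p. p permutes {0..<k}}"
    then have p: "p i < k" if "i < k" for i using that permutes_in_image[of p "{0..<k}" i] by auto
    have "map (\<lambda>i. A i (p i)) [0..<k] = map (\<lambda>i. of_geven (A' $$ (i, p i))) [0..<k]"
      using p by (auto simp: A'_def of_to_geven assms)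
    then have "prod_list (map (\<lambda>i. A i (p i)) [0..<k]) = of_geven (\<Prod>i = 0..<k. A' $$ (i, p i))"
      by (simp only: prod_list_of_geven)
    moreover have "of_int (sign p) = of_geven (signof p)"
      by (auto simp: sign_def uminus_geven.rep_eq one_geven.rep_eq)
    ultimately show "of_int (sign p) * prod_list (map (\<lambda>i. A i (p i)) [0..<k]) = of_geven (signof p * (\<Prod>i = 0..<k. A' $$ (i, p i)))"
      by (simp add: prod_list_of_geven of_geven.hom_mult)
  qed
  also have "\<dots> = of_geven (det A')"
    by (simp add: det_def'[OF A'] of_geven.hom_sum)
  finally show ?thesis by (simp add: 1 gmdet_of)
qed

lemma gsupp_gdet:
  assumes "!!i j. i < k ==> j < k ==> gsupp L (A i j)"
  shows "gsupp L (gdet k A)"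
proof -
  have 1: "gsupp L (prod_list xs)" if "!!x. x \<in> set xs ==> gsupp L x" for xs
    using that by (induction xs) (auto intro: gsupp_mult)
  have 2: "gsupp L (of_int i)" for i
    by (metis gsupp_of_real of_real_of_int_eq)
  have 3: "gsupp L (prod_list (map (\<lambda>i. A i (p i)) [0..<k]))" if "p permutes {..<k}" for p
    by (rule 1) (use permutes_in_image[OF that] assms in auto)
  show ?thesis unfolding gdet_def
    by (rule gsupp_sum, rule gsupp_mult) (use 2 3 in auto)
qed

lemma gbody_gmdet: "gbody (gmdet A) = det (map_mat gbody A)" if "A \<in> pmat 0 n n"
proof -
  obtain A' where A: "A = map_mat of_geven A'" using pmat_lift \<open>A \<in> pmat 0 n n\<close> by blast
  interpret b: comm_ring_hom "\<lambda>g. gbody (of_geven g)"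
    by standard (simp_all add: of_geven.hom_mult of_geven.hom_add)
  have "map_mat gbody A = map_mat (\<lambda>g. gbody (of_geven g)) A'"
    unfolding A by (rule eq_matI) auto
  then show ?thesis by (simp add: A gmdet_of)
qed

text \<open>A permutation other than the identity moves at least two indices, hence one in a row
  that agrees with the identity matrix, and there it meets a zero.\<close>

lemma det_identity_except_row:
  fixes A :: "'a :: comm_ring_1 mat"
  assumes A: "A \<in> carrier_mat n n" "i < n"
    and I: "!!r j. r < n ==> j < n ==> r \<noteq> i ==> A $$ (r, j) = (if r = j then 1 else 0)"
  shows "det A = A $$ (i, i)"
proof -
  have "det A = (\<Sum>p | p permutes {0..<n}. if p = id then A $$ (i, i) else 0)"
    unfolding det_def'[OF A(1)]
  proof (rule sum.cong[OF refl])
    fix p assume "p \<in> {p. p permutes {0..<n}}"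
    then have p: "p permutes {0..<n}" by simp
    show "signof p * (\<Prod>r = 0..<n. A $$ (r, p r)) = (if p = id then A $$ (i, i) else 0)"
    proof (cases "p = id")
      case True
      have "(\<Prod>r = 0..<n. A $$ (r, r)) = (\<Prod>r = 0..<n. if r = i then A $$ (i, i) else 1)"
        using I by (intro prod.cong) auto
      also have "\<dots> = A $$ (i, i)" using A by (simp add: prod.delta)
      finally show ?thesis using True by simp
    next
      case False
      have "\<exists>r<n. r \<noteq> i \<and> p r \<noteq> r"
      proof (rule ccontr)
        assume *: "\<not> (\<exists>r<n. r \<noteq> i \<and> p r \<noteq> r)"
        have "p i = i"
        proof (rule ccontr)
          assume "p i \<noteq> i"
          moreover have "p i < n" using permutes_in_image[OF p, of i] A by auto
          ultimately have "p (p i) = p i" using * by auto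
          then show False using \<open>p i \<noteq> i\<close> permutes_inj[OF p] by (meson injD)
        qed
        then have "p r = r" for r using * p by (cases "r < n") (auto simp: permutes_def)
        then show False using False by auto
      qed
      then obtain r where r: "r < n" "r \<noteq> i" "p r \<noteq> r" by auto
      moreover have "p r < n" using permutes_in_image[OF p, of r] r by auto
      ultimately have "A $$ (r, p r) = 0" using I by auto
      then have "(\<Prod>r = 0..<n. A $$ (r, p r)) = 0" using r by (intro prod_zero) auto
      then show ?thesis using False by simp
    qed
  qed
  also have "\<dots> = A $$ (i, i)" by (simp add: finite_permutations permutes_id)
  finally show ?thesis .
qed

lemma gmdet_identity_except_row:
  assumes "A \<in> pmat 0 n n" "i < n" "!!r j. r < n ==> j < n ==> r \<noteq> i ==> A $$ (r, j) = (if r = j then 1 else 0)"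
  shows "gmdet A = A $$ (i, i)"
proof -
  obtain A' where A: "A' \<in> carrier_mat n n" "A = map_mat of_geven A'" using pmat_lift assms by blast
  have "A' $$ (r, j) = (if r = j then 1 else 0)" if "r < n" "j < n" "r \<noteq> i" for r j
  proof -
    have "of_geven (A' $$ (r, j)) = of_geven (if r = j then 1 else 0)" using assms(3)[OF that] A that by auto
    then show ?thesis by (simp only: of_geven_inject)
  qed
  then have "det A' = A' $$ (i, i)" by (intro det_identity_except_row[OF A(1) assms(2)])
  then show ?thesis using A assms by (simp add: gmdet_of)
qed

lemma gmdet_transpose: "A \<in> pmat 0 n n ==> gmdet (transpose_mat A) = gmdet A"
proof -
  assume "A \<in> pmat 0 n n"
  then obtain A' where A: "A' \<in> carrier_mat n n" "A = map_mat of_geven A'" using pmat_lift by blast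
  have "transpose_mat A = map_mat of_geven (transpose_mat A')" using A by (intro eq_matI) auto
  then show ?thesis using A by (simp add: gmdet_of det_transpose)
qed

lemma pmat_mult: "A \<in> pmat p r k ==> B \<in> pmat q k c ==> even (p + q + s) ==> A * B \<in> pmat s r c"
  unfolding pmat_def by (auto simp: scalar_prod_def intro!: gparity_sum gparity_mult_cong[of p _ q])
lemma pmat_add: "A \<in> pmat p r k ==> B \<in> pmat p r k ==> A + B \<in> pmat p r k"
  unfolding pmat_def by (auto intro!: gparity_add)
lemma pmat_one: "1\<^sub>m n \<in> pmat 0 n n"
  by (auto simp: pmat_def)
lemma pmat_carrier: "A \<in> pmat p r c ==> A \<in> carrier_mat r c"
  by (simp add: pmat_def)

text \<open>With a single entry b in B, the matrix 1 + B * C differs from the identity in row i only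
  and 1 + C * B in column k only. Writing c for the opposite entry of C, the determinants are 1 + b
  * c and 1 + c * b = 1 - b * c, and their product is 1 because b * b = 0.\<close>

lemma gmdet_odd_elementary:
  assumes C: "C \<in> pmat 1 m n" and b: "gparity 1 b" and ik: "i < n" "k < m"
  defines "B \<equiv> mat n m (\<lambda>(r, c). if r = i \<and> c = k then b else 0)"
  shows "gmdet (1\<^sub>m n + B * C) * gmdet (1\<^sub>m m + C * B) = 1"
proof -
  have B: "B \<in> pmat 1 n m" using b by (auto simp: B_def pmat_def)
  have c: "gparity 1 (C $$ (k, i))" using C ik by (auto simp: pmat_def)
  have BC: "1\<^sub>m n + B * C \<in> pmat 0 n n" "1\<^sub>m m + C * B \<in> pmat 0 m m"
    by (auto intro!: pmat_add pmat_one pmat_mult[OF B C] pmat_mult[OF C B])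
  have Cd: "dim_row C = m" "dim_col C = n" and Bd: "dim_row B = n" "dim_col B = m"
    using B C by (auto simp: pmat_def)
  have e1: "(B * C) $$ (r, j) = (if r = i then b * C $$ (k, j) else 0)" if "r < n" "j < n" for r j
  proof -
    have "(B * C) $$ (r, j) = (\<Sum>l = 0..<m. (if r = i \<and> l = k then b else 0) * C $$ (l, j))"
      using that Cd by (simp add: B_def scalar_prod_def)
    also have "\<dots> = (\<Sum>l = 0..<m. if l = k then (if r = i then b * C $$ (k, j) else 0) else 0)"
      by (rule sum.cong) auto
    finally show ?thesis using ik by (simp add: sum.delta)
  qed
  have e2: "(C * B) $$ (r, j) = (if j = k then C $$ (r, i) * b else 0)" if "r < m" "j < m" for r j
  proof -
    have "(C * B) $$ (r, j) = (\<Sum>l = 0..<n. C $$ (r, l) * (if l = i \<and> j = k then b else 0))"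
      using that Cd by (simp add: B_def scalar_prod_def)
    also have "\<dots> = (\<Sum>l = 0..<n. if l = i then (if j = k then C $$ (r, i) * b else 0) else 0)"
      by (rule sum.cong) auto
    finally show ?thesis using ik by (simp add: sum.delta)
  qed
  have d1: "gmdet (1\<^sub>m n + B * C) = 1 + b * C $$ (k, i)"
    using ik by (subst gmdet_identity_except_row[OF BC(1) ik(1)]) (auto simp: e1 Bd Cd simp del: index_mult_mat(1))
  have "gmdet (transpose_mat (1\<^sub>m m + C * B)) = transpose_mat (1\<^sub>m m + C * B) $$ (k, k)"
    using BC(2) ik by (intro gmdet_identity_except_row[of _ m]) (auto simp: pmat_def e2 Bd Cd simp del: index_mult_mat(1))
  then have d2: "gmdet (1\<^sub>m m + C * B) = 1 + C $$ (k, i) * b"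
    unfolding gmdet_transpose[OF BC(2)] using ik by (simp add: e2 Bd Cd del: index_mult_mat(1))
  have cb: "C $$ (k, i) * b = - (b * C $$ (k, i))" and "b * b = - (b * b)"
    using grassmann_supercommute[OF c b] grassmann_supercommute[OF b b] by auto
  then have "b * b = 0" by (metis add_eq_0_iff scaleR_2 scaleR_eq_0_iff zero_neq_numeral)
  then have "b * C $$ (k, i) * (b * C $$ (k, i)) = 0"
    by (metis cb mult.assoc mult_minus_left mult_minus_right mult_zero_left minus_zero)
  then show ?thesis unfolding d1 d2 cb by (simp add: algebra_simps)
qed

text \<open>
  The super analogue of \<open>det (1 + B C) = det (1 + C B)\<close>, by splitting off the nonzero entries of \<open>B\<close> one at
  a time.
\<close>

lemma gmdet_odd_odd:
  assumes "B \<in> pmat 1 n m" "C \<in> pmat 1 m n"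
  shows "gmdet (1\<^sub>m n + B * C) * gmdet (1\<^sub>m m + C * B) = 1"
  using assms
proof (induction "card {(i, k). i < n \<and> k < m \<and> B $$ (i, k) \<noteq> 0}" arbitrary: B C rule: less_induct)
  case less
  note B = less.prems(1) and C = less.prems(2)
  let ?S = "\<lambda>B::grassmann mat. {(i, k). i < n \<and> k < m \<and> B $$ (i, k) \<noteq> 0}"
  have fin: "finite (?S B)" for B by (rule finite_subset[of _ "{..<n} \<times> {..<m}"]) auto
  show ?case
  proof (cases "?S B = {}")
    case True
    then have "B = 0\<^sub>m n m" using B by (intro eq_matI) (auto simp: pmat_def)
    then have "B * C = 0\<^sub>m n n" "C * B = 0\<^sub>m m m" using C by (auto simp: pmat_def)
    then show ?thesis by (simp add: gmdet_one)
  next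
    case False
    then obtain i k where ik: "i < n" "k < m" "B $$ (i, k) \<noteq> 0" by auto
    define b where "b = B $$ (i, k)"
    define B1 where "B1 = mat n m (\<lambda>(r, c). if r = i \<and> c = k then 0 else B $$ (r, c))"
    define B2 where "B2 = mat n m (\<lambda>(r, c). if r = i \<and> c = k then b else 0)"
    have b: "gparity 1 b" using B ik by (simp add: b_def pmat_def)
    have B12: "B = B1 + B2" using B by (intro eq_matI) (auto simp: B1_def B2_def b_def pmat_def)
    have B1: "B1 \<in> pmat 1 n m" and B2: "B2 \<in> pmat 1 n m" using B b by (auto simp: B1_def B2_def pmat_def)
    have "?S B1 \<subseteq> ?S B" by (auto simp: B1_def split: if_splits)
    moreover have "(i, k) \<in> ?S B - ?S B1" using ik by (simp add: B1_def)
    ultimately have "?S B1 \<subset> ?S B" by blast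
    then have IH: "gmdet (1\<^sub>m n + B1 * C) * gmdet (1\<^sub>m m + C * B1) = 1"
      by (intro less.hyps psubset_card_mono fin B1 C)
    have E: "1\<^sub>m n + B1 * C \<in> pmat 0 n n" "1\<^sub>m m + C * B1 \<in> pmat 0 m m"
      by (auto intro!: pmat_add pmat_one pmat_mult[OF B1 C] pmat_mult[OF C B1])
    \<comment> \<open>The induction hypothesis exhibits the determinant as a unit, which provides
      the inverse matrix.\<close>
    obtain G where G: "G \<in> pmat 0 n n" "(1\<^sub>m n + B1 * C) * G = 1\<^sub>m n" "G * (1\<^sub>m n + B1 * C) = 1\<^sub>m n"
      using gmdet_inverse[OF E(1) IH gparity_gmdet] by auto
    define C' where "C' = C * G"
    have C': "C' \<in> pmat 1 m n" unfolding C'_def by (rule pmat_mult[OF C G(1)]) simp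
    note cB1 = pmat_carrier[OF B1] and cB2 = pmat_carrier[OF B2] and cC = pmat_carrier[OF C]
      and cC' = pmat_carrier[OF C'] and cG = pmat_carrier[OF G(1)]
      and cE = pmat_carrier[OF E(1)] pmat_carrier[OF E(2)]
    note p1 = mult_carrier_mat[OF cB1 cC] and p2 = mult_carrier_mat[OF cB2 cC] and p3 = mult_carrier_mat[OF cC cB1]
      and p4 = mult_carrier_mat[OF cC cB2] and p5 = mult_carrier_mat[OF cB2 cC'] and p6 = mult_carrier_mat[OF cC' cB2]
    \<comment> \<open>\<open>C'\<close> is made so that C' * (1 + B1 * C) = C; hence the entry that
      was split off comes out as a left factor.\<close>
    have f1: "1\<^sub>m n + B * C = (1\<^sub>m n + B2 * C') * (1\<^sub>m n + B1 * C)"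
    proof -
      have "B2 * C' * (1\<^sub>m n + B1 * C) = B2 * (C * (G * (1\<^sub>m n + B1 * C)))"
        unfolding C'_def by (simp add: assoc_mult_mat[OF cB2 mult_carrier_mat[OF cC cG] cE(1)] assoc_mult_mat[OF cC cG cE(1)])
      then have "B2 * C' * (1\<^sub>m n + B1 * C) = B2 * C" using cC by (simp add: G(3))
      then have "(1\<^sub>m n + B2 * C') * (1\<^sub>m n + B1 * C) = (1\<^sub>m n + B1 * C) + B2 * C"
        by (simp only: add_mult_distrib_mat[OF one_carrier_mat p5 cE(1)] left_mult_one_mat[OF cE(1)])
      also have "\<dots> = 1\<^sub>m n + B * C"
        by (simp add: B12 add_mult_distrib_mat[OF cB1 cB2 cC] assoc_add_mat[OF one_carrier_mat p1 p2])
      finally show ?thesis by simp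
    qed
    \<comment> \<open>The same \<open>C'\<close> serves on the other side by the push-through
      identity (1 + C * B1) * C = C * (1 + B1 * C).\<close>
    have f2: "1\<^sub>m m + C * B = (1\<^sub>m m + C * B1) * (1\<^sub>m m + C' * B2)"
    proof -
      have "(1\<^sub>m m + C * B1) * C = C * (1\<^sub>m n + B1 * C)"
        using cC by (simp add: mult_add_distrib_mat[OF cC one_carrier_mat p1]
            add_mult_distrib_mat[OF one_carrier_mat p3 cC] assoc_mult_mat[OF cC cB1 cC])
      then have "(1\<^sub>m m + C * B1) * C' = C * ((1\<^sub>m n + B1 * C) * G)"
        unfolding C'_def by (metis assoc_mult_mat[OF cE(2) cC cG] assoc_mult_mat[OF cC cE(1) cG])
      then have *: "(1\<^sub>m m + C * B1) * C' = C" using cC by (simp add: G(2))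
      have "(1\<^sub>m m + C * B1) * (1\<^sub>m m + C' * B2) = (1\<^sub>m m + C * B1) + C * B2"
        by (simp only: mult_add_distrib_mat[OF cE(2) one_carrier_mat p6]
            assoc_mult_mat[OF cE(2) cC' cB2, symmetric] * right_mult_one_mat[OF cE(2)])
      also have "\<dots> = 1\<^sub>m m + C * B"
        by (simp add: B12 mult_add_distrib_mat[OF cC cB1 cB2] assoc_add_mat[OF one_carrier_mat p3 p4])
      finally show ?thesis by simp
    qed
    have E': "1\<^sub>m n + B2 * C' \<in> pmat 0 n n" "1\<^sub>m m + C' * B2 \<in> pmat 0 m m"
      by (auto intro!: pmat_add pmat_one pmat_mult[OF B2 C'] pmat_mult[OF C' B2])
    have el: "gmdet (1\<^sub>m n + B2 * C') * gmdet (1\<^sub>m m + C' * B2) = 1"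
      unfolding B2_def by (rule gmdet_odd_elementary[OF C' b ik(1,2)])
    have "gmdet (1\<^sub>m n + B * C) * gmdet (1\<^sub>m m + C * B) =
        gmdet (1\<^sub>m n + B2 * C') * (gmdet (1\<^sub>m n + B1 * C) * gmdet (1\<^sub>m m + C * B1)) * gmdet (1\<^sub>m m + C' * B2)"
      unfolding f1 f2 gmdet_mult[OF E'(1) E(1)] gmdet_mult[OF E(2) E'(2)] by (simp add: mult.assoc)
    then show ?thesis by (simp add: IH el)
  qed
qed

section \<open>Even supermatrices and the Berezinian\<close>

definition spar :: "nat => nat => nat" where
  "spar n a = (if n \<le> a then 1 else 0)"

definition smat_even :: "nat => nat => (nat => nat => grassmann) => bool" where
  "smat_even n m P \<longleftrightarrow> (\<forall>i<n + m. \<forall>j<n + m. gparity (spar n i + spar n j) (P i j))"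

definition smat_mult :: "nat => (nat => nat => grassmann) => (nat => nat => grassmann) => nat => nat => grassmann" where
  "smat_mult N P Q = (\<lambda>i j. \<Sum>l<N. P i l * Q l j)"

definition smat_inverse :: "nat => nat => (nat => nat => grassmann) => (nat => nat => grassmann) => bool" where
  "smat_inverse n m P Y \<longleftrightarrow> smat_even n m P \<and> smat_even n m Y \<and>
     (\<forall>i<n + m. \<forall>j<n + m. smat_mult (n + m) P Y i j = (if i = j then 1 else 0) \<and>
        smat_mult (n + m) Y P i j = (if i = j then 1 else 0))"

definition smat_supp :: "nat => nat => nat set => (nat => nat => grassmann) => bool" where
  "smat_supp n m L P \<longleftrightarrow> finite L \<and> (\<forall>i<n + m. \<forall>j<n + m. gsupp L (P i j))"

text \<open>
  The Berezinian of \<open>P\<close> in terms of \<open>P\<close> and its inverse \<open>Y\<close>: no inversion inside the Grassmann algebra is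
  needed, hence this expression is natural under homomorphisms.
\<close>

definition ber2 :: "nat => nat => (nat => nat => grassmann) => (nat => nat => grassmann) => grassmann" where
  "ber2 n m P Y = gdet n P * gdet m (\<lambda>i j. Y (n + i) (n + j))"

definition blk :: "nat => nat => nat => nat => (nat => nat => grassmann) => grassmann mat" where
  "blk r c i0 j0 P = mat r c (\<lambda>(i, j). P (i0 + i) (j0 + j))"

lemma blk_carrier [simp]: "blk r c i0 j0 P \<in> carrier_mat r c"
  and blk_dim [simp]: "dim_row (blk r c i0 j0 P) = r" "dim_col (blk r c i0 j0 P) = c"
  and blk_index [simp]: "i < r ==> j < c ==> blk r c i0 j0 P $$ (i, j) = P (i0 + i) (j0 + j)"
  by (auto simp: blk_def)

lemma sum_lessThan_add: "(\<Sum>l<n + m. f l) = (\<Sum>l<n. f l) + (\<Sum>l<m. f (n + l) :: 'a :: comm_monoid_add)" for n m :: nat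
  by (induction m) (simp_all add: add.assoc)

lemma blk_mult:
  "blk r c i0 j0 (smat_mult (n + m) P Q) =
    blk r n i0 0 P * blk n c 0 j0 Q + blk r m i0 n P * blk m c n j0 Q"
  by (rule eq_matI)
    (auto simp: smat_mult_def sum_lessThan_add scalar_prod_def atLeast0LessThan intro!: arg_cong2[of _ _ _ _ "(+)"] sum.cong)

lemma smat_inverse_sym: "smat_inverse n m P Y ==> smat_inverse n m Y P"
  by (auto simp: smat_inverse_def)

lemma blk_pmat:
  assumes "smat_even n m P"
  shows "blk n n 0 0 P \<in> pmat 0 n n" "blk n m 0 n P \<in> pmat 1 n m"
    "blk m n n 0 P \<in> pmat 1 m n" "blk m m n n P \<in> pmat 0 m m"
proof -
  have g: "gparity (spar n i + spar n j) (P i j)" if "i < n + m" "j < n + m" for i j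
    using assms that by (simp add: smat_even_def)
  have "gparity 0 (P i j)" if "i < n" "j < n" for i j using g[of i j] that by (simp add: spar_def)
  then show "blk n n 0 0 P \<in> pmat 0 n n" by (simp add: pmat_def)
  have "gparity 1 (P i (n + j))" if "i < n" "j < m" for i j using g[of i "n + j"] that by (simp add: spar_def)
  then show "blk n m 0 n P \<in> pmat 1 n m" by (simp add: pmat_def)
  have "gparity 1 (P (n + i) j)" if "i < m" "j < n" for i j using g[of "n + i" j] that by (simp add: spar_def)
  then show "blk m n n 0 P \<in> pmat 1 m n" by (simp add: pmat_def)
  have "gparity 0 (P (n + i) (n + j))" if "i < m" "j < m" for i j
    using gparity_cong[OF _ g[of "n + i" "n + j"], of 0] that by (simp add: spar_def)
  then show "blk m m n n P \<in> pmat 0 m m" by (simp add: pmat_def)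
qed

lemma blk_inverse:
  assumes "smat_inverse n m P Y"
  shows "blk n n 0 0 P * blk n n 0 0 Y + blk n m 0 n P * blk m n n 0 Y = 1\<^sub>m n"
    "blk n n 0 0 P * blk n m 0 n Y + blk n m 0 n P * blk m m n n Y = 0\<^sub>m n m"
    "blk m n n 0 P * blk n n 0 0 Y + blk m m n n P * blk m n n 0 Y = 0\<^sub>m m n"
    "blk m n n 0 P * blk n m 0 n Y + blk m m n n P * blk m m n n Y = 1\<^sub>m m"
  using assms unfolding blk_mult[symmetric] by (auto simp: smat_inverse_def intro!: eq_matI)

lemma ber2_gmdet:
  assumes "smat_even n m P" "smat_even n m Y"
  shows "ber2 n m P Y = gmdet (blk n n 0 0 P) * gmdet (blk m m n n Y)"
proof -
  have "gdet n P = gmdet (blk n n 0 0 P)"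
    by (subst gdet_gmdet) (use blk_pmat(1)[OF assms(1)] in \<open>auto simp: pmat_def blk_def\<close>)
  moreover have "gdet m (\<lambda>i j. Y (n + i) (n + j)) = gmdet (blk m m n n Y)"
    by (subst gdet_gmdet) (use blk_pmat(4)[OF assms(2)] in \<open>auto simp: pmat_def blk_def\<close>)
  ultimately show ?thesis by (simp add: ber2_def)
qed

interpretation gbody: semiring_hom gbody
  by standard simp_all

text \<open>Multiplication by an even element respects parity components, so the even part of an
  inverse is again an inverse.\<close>

lemma even_inverse:
  assumes "gsupp L g" "finite L" "gbody g \<noteq> 0" "gparity 0 g"
  shows "\<exists>u. gparity 0 u \<and> g * u = 1 \<and> u * g = 1"
proof -
  obtain u where u: "g * u = 1" "u * g = 1" using grassmann_inverse[OF assms(1-3)] by blast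
  have "gpart 0 (u * g) = gpart 0 u * g" using gpart_mult_right[OF assms(4), of 0 u] by simp
  then have "gpart 0 u * g = 1" by (simp add: u gpart_same[of 0])
  then show ?thesis
    by (intro exI[of _ "gpart 0 u"]) (simp add: gparity_gpart grassmann_even_commute[OF assms(4)])
qed

text \<open>Odd blocks have no body. Taking bodies in P * Y = 1 therefore shows that the bodies of
  the diagonal blocks of P and Y are inverse to each other, so the determinants of the diagonal
  blocks of P have nonzero body and are units.\<close>

lemma smat_corner_inverse:
  assumes PY: "smat_inverse n m P Y" and L: "smat_supp n m L P"
  shows "\<exists>u. gparity 0 u \<and> gmdet (blk n n 0 0 P) * u = 1 \<and> u * gmdet (blk n n 0 0 P) = 1"
    "\<exists>u. gparity 0 u \<and> gmdet (blk m m n n P) * u = 1 \<and> u * gmdet (blk m m n n P) = 1"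
proof -
  have P: "smat_even n m P" and Y: "smat_even n m Y" using PY by (auto simp: smat_inverse_def)
  have z: "map_mat gbody A = 0\<^sub>m r c" if "A \<in> pmat 1 r c" for A r c
    using that by (intro eq_matI) (auto simp: pmat_def gbody_odd[of "Suc 0"])
  have mh: "map_mat gbody (A + B) = map_mat gbody A + map_mat gbody B"
    if "A \<in> carrier_mat r c" "B \<in> carrier_mat r c" for A B r c
    using that by (intro eq_matI) auto
  have nz: "gbody (gmdet A) \<noteq> 0"
    if "A \<in> pmat 0 r r" "B \<in> pmat 0 r r" "C \<in> pmat 1 r c" "D \<in> pmat 1 c r" "A * B + C * D = 1\<^sub>m r" for A B C D r c
  proof -
    note cs = that(1-4)[THEN pmat_carrier]
    have "map_mat gbody A * map_mat gbody B + map_mat gbody C * map_mat gbody D = map_mat gbody (A * B + C * D)"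
      using cs by (simp add: mh[of _ r r] gbody.mat_hom_mult[of _ r r] gbody.mat_hom_mult[of _ r c])
    then have "map_mat gbody A * map_mat gbody B = 1\<^sub>m r"
      using cs by (simp add: that(5) gbody.mat_hom_one z[OF that(3)] z[OF that(4)])
    then have "det (map_mat gbody A) * det (map_mat gbody B) = 1"
      using cs by (metis det_mult det_one map_carrier_mat)
    then show ?thesis by (auto simp: gbody_gmdet[OF that(1)])
  qed
  have "blk m m n n P * blk m m n n Y + blk m n n 0 P * blk n m 0 n Y = 1\<^sub>m m"
    using blk_inverse(4)[OF PY] comm_add_mat[OF mult_carrier_mat[OF blk_carrier blk_carrier] mult_carrier_mat[OF blk_carrier blk_carrier]]
    by metis
  then have b: "gbody (gmdet (blk n n 0 0 P)) \<noteq> 0" "gbody (gmdet (blk m m n n P)) \<noteq> 0"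
    using nz[OF blk_pmat(1)[OF P] blk_pmat(1)[OF Y] blk_pmat(2)[OF P] blk_pmat(3)[OF Y] blk_inverse(1)[OF PY]]
      nz[OF blk_pmat(4)[OF P] blk_pmat(4)[OF Y] blk_pmat(3)[OF P] blk_pmat(2)[OF Y]] by auto
  have "gdet n P = gmdet (blk n n 0 0 P)" "gdet m (\<lambda>i j. P (n + i) (n + j)) = gmdet (blk m m n n P)"
    by (subst gdet_gmdet; use blk_pmat(1,4)[OF P] in \<open>auto simp: pmat_def blk_def\<close>)+
  moreover have "gsupp L (gdet n P)" "gsupp L (gdet m (\<lambda>i j. P (n + i) (n + j)))"
    using L by (auto simp: smat_supp_def intro!: gsupp_gdet)
  ultimately have "gsupp L (gmdet (blk n n 0 0 P))" "gsupp L (gmdet (blk m m n n P))" by simp_all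
  with b L show "\<exists>u. gparity 0 u \<and> gmdet (blk n n 0 0 P) * u = 1 \<and> u * gmdet (blk n n 0 0 P) = 1"
    "\<exists>u. gparity 0 u \<and> gmdet (blk m m n n P) * u = 1 \<and> u * gmdet (blk m m n n P) = 1"
    by (auto intro!: even_inverse gparity_gmdet simp: smat_supp_def)
qed

lemma mat_mult_minus_minus:
  fixes A :: "grassmann mat"
  assumes "A \<in> carrier_mat r k" "X \<in> carrier_mat r k" "B \<in> carrier_mat k c" "W \<in> carrier_mat k c"
    and AX: "A + X = 0\<^sub>m r k" and BW: "B + W = 0\<^sub>m k c"
  shows "A * B = X * W"
proof -
  have a: "A $$ (i, j) = - X $$ (i, j)" if "i < r" "j < k" for i j
  proof -
    have "(A + X) $$ (i, j) = 0" using that by (simp add: AX)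
    then show ?thesis using assms(1,2) that by (simp add: eq_neg_iff_add_eq_0)
  qed
  have b: "B $$ (i, j) = - W $$ (i, j)" if "i < k" "j < c" for i j
  proof -
    have "(B + W) $$ (i, j) = 0" using that by (simp add: BW)
    then show ?thesis using assms(3,4) that by (simp add: eq_neg_iff_add_eq_0)
  qed
  show ?thesis using assms(1-4) by (intro eq_matI) (auto simp: scalar_prod_def a b)
qed

lemma smat_even_mult: "smat_even n m P ==> smat_even n m Q ==> smat_even n m (smat_mult (n + m) P Q)"
  unfolding smat_even_def smat_mult_def
  by (auto intro!: gparity_sum gparity_mult_cong[of "spar n _ + spar n _" _ "spar n _ + spar n _"])

text \<open>Number the blocks 0 to 3 row by row, and put P1 = P0 * B and Q2 = C * Q0. Then block 0
  of P * Q is P0 * (1 + B * C) * Q0, and block 3 of the inverse Z * Y is Z3 * (1 + C * B) * Y3. The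
  two middle determinants cancel by \<open>gmdet_odd_odd\<close>.\<close>

lemma ber2_mult:
  assumes PY: "smat_inverse n m P Y" and QZ: "smat_inverse n m Q Z"
    and L: "smat_supp n m L P" "smat_supp n m L Q"
  shows "ber2 n m (smat_mult (n + m) P Q) (smat_mult (n + m) Z Y) = ber2 n m P Y * ber2 n m Q Z"
proof -
  have e: "smat_even n m P" "smat_even n m Y" "smat_even n m Q" "smat_even n m Z"
    using PY QZ by (auto simp: smat_inverse_def)
  let ?P0 = "blk n n 0 0 P" and ?P1 = "blk n m 0 n P"
  let ?Q0 = "blk n n 0 0 Q" and ?Q2 = "blk m n n 0 Q"
  let ?Y1 = "blk n m 0 n Y" and ?Y3 = "blk m m n n Y"
  let ?Z2 = "blk m n n 0 Z" and ?Z3 = "blk m m n n Z"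
  note pm = blk_pmat[OF e(1)] blk_pmat[OF e(2)] blk_pmat[OF e(3)] blk_pmat[OF e(4)]
  obtain G where G: "G \<in> pmat 0 n n" "?P0 * G = 1\<^sub>m n" "G * ?P0 = 1\<^sub>m n"
    using smat_corner_inverse(1)[OF PY L(1)] gmdet_inverse[OF pm(1)] by blast
  obtain H where H: "H \<in> pmat 0 n n" "?Q0 * H = 1\<^sub>m n" "H * ?Q0 = 1\<^sub>m n"
    using smat_corner_inverse(1)[OF QZ L(2)] gmdet_inverse[OF pm(9)] by blast
  define B where "B = G * ?P1"
  define C where "C = ?Q2 * H"
  have B: "B \<in> pmat 1 n m" unfolding B_def by (rule pmat_mult[OF G(1) pm(2)]) simp
  have C: "C \<in> pmat 1 m n" unfolding C_def by (rule pmat_mult[OF pm(11) H(1)]) simp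
  have BC: "1\<^sub>m n + B * C \<in> pmat 0 n n" "1\<^sub>m m + C * B \<in> pmat 0 m m"
    by (auto intro!: pmat_add pmat_one pmat_mult[OF B C] pmat_mult[OF C B])
  note cG = pmat_carrier[OF G(1)] and cH = pmat_carrier[OF H(1)] and cB = pmat_carrier[OF B] and cC = pmat_carrier[OF C]
  have P1: "?P0 * B = ?P1"
    by (simp add: B_def G(2) flip: assoc_mult_mat[OF blk_carrier cG blk_carrier])
  have Q2: "C * ?Q0 = ?Q2"
    by (simp add: C_def H(3) assoc_mult_mat[OF blk_carrier cH blk_carrier])
  have PQ: "blk n n 0 0 (smat_mult (n + m) P Q) = ?P0 * ((1\<^sub>m n + B * C) * ?Q0)"
  proof -
    have "?P1 * ?Q2 = ?P0 * (B * C * ?Q0)"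
      by (simp add: P1[symmetric] Q2[symmetric] assoc_mult_mat[OF cB cC blk_carrier]
          assoc_mult_mat[OF blk_carrier cB mult_carrier_mat[OF cC blk_carrier]])
    then show ?thesis
      by (simp add: blk_mult add_mult_distrib_mat[OF one_carrier_mat mult_carrier_mat[OF cB cC] blk_carrier]
          left_mult_one_mat[OF blk_carrier]
          mult_add_distrib_mat[OF blk_carrier blk_carrier mult_carrier_mat[OF mult_carrier_mat[OF cB cC] blk_carrier]])
  qed
  \<comment> \<open>The off-diagonal blocks of P * Y = 1 and Z * Q = 1 express Y1 as -B * Y3 and Z2
    as -Z3 * C, with the same B and C as above.\<close>
  have "G * (?P0 * ?Y1 + ?P1 * ?Y3) = G * 0\<^sub>m n m" using blk_inverse(2)[OF PY] by simp
  then have Y1: "?Y1 + B * ?Y3 = 0\<^sub>m n m"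
    using cG by (simp add: mult_add_distrib_mat[OF cG mult_carrier_mat[OF blk_carrier blk_carrier] mult_carrier_mat[OF blk_carrier blk_carrier]]
        assoc_mult_mat[OF cG blk_carrier blk_carrier, symmetric] G(3) B_def[symmetric] left_mult_one_mat[OF blk_carrier])
  have "(?Z2 * ?Q0 + ?Z3 * ?Q2) * H = 0\<^sub>m m n * H" using blk_inverse(3)[OF smat_inverse_sym[OF QZ]] by simp
  then have Z2: "?Z2 + ?Z3 * C = 0\<^sub>m m n"
    using cH by (simp add: add_mult_distrib_mat[OF mult_carrier_mat[OF blk_carrier blk_carrier] mult_carrier_mat[OF blk_carrier blk_carrier] cH]
        assoc_mult_mat[OF blk_carrier blk_carrier cH] H(2) C_def[symmetric] right_mult_one_mat[OF blk_carrier])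
  have ZY: "blk m m n n (smat_mult (n + m) Z Y) = ?Z3 * ((1\<^sub>m m + C * B) * ?Y3)"
  proof -
    have "?Z2 * ?Y1 = (?Z3 * C) * (B * ?Y3)"
      by (rule mat_mult_minus_minus[OF _ _ _ _ Z2 Y1]) (auto intro!: mult_carrier_mat[OF _ cC] mult_carrier_mat[OF cB])
    also have "\<dots> = ?Z3 * (C * B * ?Y3)"
      by (simp add: assoc_mult_mat[OF cC cB blk_carrier] assoc_mult_mat[OF blk_carrier cC mult_carrier_mat[OF cB blk_carrier]])
    finally have 1: "?Z2 * ?Y1 = ?Z3 * (C * B * ?Y3)" .
    note cp = mult_carrier_mat[OF mult_carrier_mat[OF cC cB] blk_carrier[of m m n n Y]]
    show ?thesis
      unfolding blk_mult 1 add_mult_distrib_mat[OF one_carrier_mat mult_carrier_mat[OF cC cB] blk_carrier]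
        left_mult_one_mat[OF blk_carrier] mult_add_distrib_mat[OF blk_carrier blk_carrier cp]
      by (rule comm_add_mat[OF mult_carrier_mat[OF blk_carrier cp] mult_carrier_mat[OF blk_carrier blk_carrier]])
  qed
  let ?d = gmdet
  have "ber2 n m (smat_mult (n + m) P Q) (smat_mult (n + m) Z Y) =
      (?d ?P0 * (?d (1\<^sub>m n + B * C) * ?d ?Q0)) * (?d ?Z3 * (?d (1\<^sub>m m + C * B) * ?d ?Y3))"
    by (simp add: ber2_gmdet smat_even_mult e PQ ZY gmdet_mult[OF pm(1) pmat_mult[OF BC(1) pm(9)]]
        gmdet_mult[OF BC(1) pm(9)] gmdet_mult[OF pm(16) pmat_mult[OF BC(2) pm(8)]] gmdet_mult[OF BC(2) pm(8)])
  also have "\<dots> = (?d ?P0 * ?d ?Y3) * (?d ?Q0 * ?d ?Z3) * (?d (1\<^sub>m n + B * C) * ?d (1\<^sub>m m + C * B))"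
    unfolding gmdet_def of_geven.hom_mult[symmetric] by (simp only: mult_ac)
  finally show ?thesis by (simp add: gmdet_odd_odd[OF B C] ber2_gmdet e)
qed

lemma ber2_cong:
  assumes "!!i j. i < n + m ==> j < n + m ==> P i j = P' i j" "!!i j. i < n + m ==> j < n + m ==> Y i j = Y' i j"
  shows "ber2 n m P Y = ber2 n m P' Y'"
proof -
  have g: "gdet k A = gdet k A'" if "!!i j. i < k ==> j < k ==> A i j = A' i j" for k A A'
    unfolding gdet_def
  proof (rule sum.cong[OF refl])
    fix p assume "p \<in> {p. p permutes {..<k}}"
    then have "p i < k" if "i < k" for i using that permutes_in_image[of p "{..<k}" i] by auto
    then have "map (\<lambda>i. A i (p i)) [0..<k] = map (\<lambda>i. A' i (p i)) [0..<k]" using that by auto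
    then show "of_int (sign p) * prod_list (map (\<lambda>i. A i (p i)) [0..<k]) = of_int (sign p) * prod_list (map (\<lambda>i. A' i (p i)) [0..<k])"
      by (simp only:)
  qed
  have "gdet n P = gdet n P'" "gdet m (\<lambda>i j. Y (n + i) (n + j)) = gdet m (\<lambda>i j. Y' (n + i) (n + j))"
    by (rule g; use assms in simp)+
  then show ?thesis by (simp add: ber2_def)
qed

lemma ber2_identity:
  assumes "!!i j. i < n + m ==> j < n + m ==> P i j = (if i = j then 1 else 0)"
    "!!i j. i < n + m ==> j < n + m ==> Y i j = (if i = j then 1 else 0)"
  shows "ber2 n m P Y = 1"
proof -
  have "smat_even n m P" "smat_even n m Y" using assms by (auto simp: smat_even_def)
  moreover have "blk n n 0 0 P = 1\<^sub>m n" "blk m m n n Y = 1\<^sub>m m"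
    by (rule eq_matI; use assms in simp)+
  ultimately show ?thesis by (simp add: ber2_gmdet gmdet_one)
qed

lemma ber2_inverse:
  assumes "smat_inverse n m P Y" "smat_supp n m L P" "smat_supp n m L Y"
  shows "ber2 n m P Y * ber2 n m Y P = 1"
proof -
  have "ber2 n m (smat_mult (n + m) P Y) (smat_mult (n + m) P Y) = 1"
    by (rule ber2_identity) (use assms(1) in \<open>auto simp: smat_inverse_def\<close>)
  then show ?thesis using ber2_mult[OF assms(1) smat_inverse_sym[OF assms(1)] assms(2,3)] by simp
qed

lemma gparity_ber2: "smat_even n m P ==> smat_even n m Y ==> gparity 0 (ber2 n m P Y)"
  by (simp add: ber2_gmdet gparity_mult_cong[OF gparity_gmdet gparity_gmdet])

lemma gsupp_ber2: "smat_supp n m L P ==> smat_supp n m L Y ==> gsupp L (ber2 n m P Y)"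
  unfolding ber2_def by (intro gsupp_mult gsupp_gdet) (auto simp: smat_supp_def)

text \<open>The Schur complement S in the definition of \<open>berezinian\<close> is inverse to the
  upper left block Y0 of Y. Since \<open>ber2 n m Y P\<close> is det Y0 * det D, the inverse of this
  product is on the one hand det S * (det D)^-1 and on the other hand
  \<open>ber2 n m P Y\<close>.\<close>

lemma berezinian_ber2:
  assumes PY: "smat_inverse n m P Y" and L: "smat_supp n m L P" "smat_supp n m L Y"
  shows "berezinian n m P = ber2 n m P Y"
proof -
  have e: "smat_even n m P" "smat_even n m Y" using PY by (auto simp: smat_inverse_def)
  note pm = blk_pmat[OF e(1)] blk_pmat[OF e(2)]
  let ?A = "blk n n 0 0 P" and ?B = "blk n m 0 n P" and ?C = "blk m n n 0 P" and ?D = "blk m m n n P"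
  let ?Y0 = "blk n n 0 0 Y" and ?Y2 = "blk m n n 0 Y"
  obtain v where v: "gparity 0 v" "gmdet ?D * v = 1" "v * gmdet ?D = 1"
    using smat_corner_inverse(2)[OF PY L(1)] by blast
  obtain G where G: "G \<in> pmat 0 m m" "?D * G = 1\<^sub>m m" "G * ?D = 1\<^sub>m m"
    using gmdet_inverse[OF pm(4) v(2,1)] by blast
  note cG = pmat_carrier[OF G(1)]
  define D where "D = (\<lambda>k l. P (n + k) (n + l))"
  define E where "E = gmatrix_inv m D"
  have "\<exists>E. \<forall>i<m. \<forall>j<m. (\<Sum>l<m. D i l * E l j) = (if i = j then 1 else 0)"
  proof (intro exI allI impI)
    fix i j assume ij: "i < m" "j < m"
    have "(?D * G) $$ (i, j) = (\<Sum>l<m. D i l * G $$ (l, j))"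
      using ij cG by (simp add: scalar_prod_def D_def atLeast0LessThan)
    then show "(\<Sum>l<m. D i l * G $$ (l, j)) = (if i = j then 1 else 0)" using G(2) ij by simp
  qed
  then have E: "\<forall>i<m. \<forall>j<m. (\<Sum>l<m. D i l * E l j) = (if i = j then 1 else 0)"
    unfolding E_def gmatrix_inv_def by (rule someI_ex)
  define Em where "Em = mat m m (\<lambda>(i, j). E i j)"
  have cE: "Em \<in> carrier_mat m m" by (simp add: Em_def)
  \<comment> \<open>\<open>gmatrix_inv\<close> chooses some right inverse on the relevant indices;
    as D has a two-sided inverse, the choice is forced there.\<close>
  have "?D * Em = 1\<^sub>m m"
    using E by (intro eq_matI) (auto simp: Em_def scalar_prod_def D_def atLeast0LessThan)
  then have "Em = G"
    using assoc_mult_mat[OF cG blk_carrier[of m m n n P] cE] by (simp add: G(3) left_mult_one_mat[OF cE] right_mult_one_mat[OF cG])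
  then have EG: "E k l = G $$ (k, l)" if "k < m" "l < m" for k l using that by (auto simp: Em_def)
  define H where "H = - (G * ?C)"
  have H: "H \<in> pmat 1 m n"
    using pmat_mult[OF G(1) pm(3), of 1] by (auto simp: H_def pmat_def gparity_uminus)
  note cH = pmat_carrier[OF H]
  define S where "S = ?A + ?B * H"
  have S: "S \<in> pmat 0 n n" unfolding S_def by (intro pmat_add pm(1) pmat_mult[OF pm(2) H]) simp
  have S_eq: "mat n n (\<lambda>(i, j). P i j - (\<Sum>k<m. \<Sum>l<m. P i (n + k) * E k l * P (n + l) j)) = S"
  proof (rule eq_matI)
    fix i j assume "i < dim_row S" "j < dim_col S"
    then have ij: "i < n" "j < n" using S by (auto simp: pmat_def)
    have Hi: "H $$ (k, j) = - (\<Sum>l<m. G $$ (k, l) * P (n + l) j)" if "k < m" for k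
      using that ij cG by (simp add: H_def scalar_prod_def atLeast0LessThan)
    have "S $$ (i, j) = P i j + (\<Sum>k<m. P i (n + k) * H $$ (k, j))"
      using ij cH by (simp add: S_def scalar_prod_def atLeast0LessThan)
    then show "mat n n (\<lambda>(i, j). P i j - (\<Sum>k<m. \<Sum>l<m. P i (n + k) * E k l * P (n + l) j)) $$ (i, j) = S $$ (i, j)"
      using ij by (simp add: Hi EG sum_distrib_left sum_negf mult.assoc)
  qed (use S in \<open>auto simp: pmat_def\<close>)
  have "G * (?C * ?Y0 + ?D * ?Y2) = G * 0\<^sub>m m n" using blk_inverse(3)[OF PY] by simp
  then have "G * ?C * ?Y0 + ?Y2 = 0\<^sub>m m n"
    using cG by (simp add: mult_add_distrib_mat[OF cG mult_carrier_mat[OF blk_carrier blk_carrier] mult_carrier_mat[OF blk_carrier blk_carrier]]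
        assoc_mult_mat[OF cG blk_carrier blk_carrier, symmetric] G(3) left_mult_one_mat[OF blk_carrier])
  note gc = this
  have "?Y2 = H * ?Y0"
  proof (rule eq_matI)
    fix i j assume "i < dim_row (H * ?Y0)" "j < dim_col (H * ?Y0)"
    then have ij: "i < m" "j < n" using cH by auto
    have "(G * ?C * ?Y0) $$ (i, j) + ?Y2 $$ (i, j) = 0"
      using arg_cong[OF gc, of "\<lambda>M. M $$ (i, j)"] ij cG by simp
    moreover have "(H * ?Y0) $$ (i, j) = - ((G * ?C * ?Y0) $$ (i, j))"
      using ij cG by (simp add: H_def scalar_prod_def sum_negf)
    ultimately show "?Y2 $$ (i, j) = (H * ?Y0) $$ (i, j)" by (simp add: add_eq_0_iff)
  qed (use cH in auto)
  then have "S * ?Y0 = 1\<^sub>m n"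
    using blk_inverse(1)[OF PY] unfolding S_def
    by (simp add: add_mult_distrib_mat[OF blk_carrier mult_carrier_mat[OF blk_carrier cH] blk_carrier]
        assoc_mult_mat[OF blk_carrier cH blk_carrier])
  then have sy: "gmdet S * gmdet ?Y0 = 1" using gmdet_mult[OF S pm(5)] by (simp add: gmdet_one)
  have gS: "gdet n (\<lambda>i j. P i j - (\<Sum>k<m. \<Sum>l<m. P i (n + k) * E k l * P (n + l) j)) = gmdet S"
    unfolding S_eq[symmetric]
  proof (rule gdet_gmdet)
    fix i j assume "i < n" "j < n"
    then show "gparity 0 (P i j - (\<Sum>k<m. \<Sum>l<m. P i (n + k) * E k l * P (n + l) j))"
      using S unfolding S_eq[symmetric] by (auto simp: pmat_def)
  qed
  have gD: "gdet m D = gmdet ?D"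
    unfolding D_def by (subst gdet_gmdet) (use pm(4) in \<open>auto simp: pmat_def blk_def\<close>)
  have r: "ber2 n m P Y * (gmdet ?Y0 * gmdet ?D) = 1"
    using ber2_inverse[OF PY L] by (simp add: ber2_gmdet e)
  have g0: "gparity 0 (ber2 n m P Y)" by (rule gparity_ber2[OF e])
  have "berezinian n m P = gmdet S * v"
    unfolding berezinian_def Let_def D_def[symmetric] E_def[symmetric] gS gD ginv_eq[OF v(2,3)] by simp
  also have "\<dots> = gmdet S * v * (ber2 n m P Y * (gmdet ?Y0 * gmdet ?D))" by (simp add: r)
  also have "\<dots> = ber2 n m P Y * (gmdet S * gmdet ?Y0) * (gmdet ?D * v)"
    by (metis (no_types, lifting) grassmann_even_commute[OF gparity_gmdet] grassmann_even_commute[OF g0] mult.assoc)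
  finally show ?thesis by (simp add: sy v)
qed

section \<open>Liouville's formula for the Berezinian\<close>

lemma det_one_plus_infinitesimal:
  fixes W :: "'a :: comm_ring_1 mat"
  assumes W: "W \<in> carrier_mat n n"
    and z: "!!i j k l. i < n ==> j < n ==> k < n ==> l < n ==> W $$ (i, j) * W $$ (k, l) = 0"
  shows "det (1\<^sub>m n + W) = 1 + (\<Sum>i<n. W $$ (i, i))"
proof -
  let ?A = "1\<^sub>m n + W"
  have A: "?A \<in> carrier_mat n n" using W by simp
  have id: "(\<Prod>i = 0..<k. ?A $$ (i, i)) = 1 + (\<Sum>i<k. W $$ (i, i))" if "k \<le> n" for k
    using that
  proof (induction k)
    case (Suc k)
    have "(\<Sum>i<k. W $$ (i, i)) * W $$ (k, k) = 0"
      using Suc.prems by (auto simp: sum_distrib_right intro!: sum.neutral z)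
    then show ?case using Suc W by (simp add: algebra_simps)
  qed simp
  have "det ?A = (\<Sum>p | p permutes {0..<n}. if p = id then 1 + (\<Sum>i<n. W $$ (i, i)) else 0)"
    unfolding det_def'[OF A]
  proof (rule sum.cong[OF refl])
    fix p assume "p \<in> {p. p permutes {0..<n}}"
    then have p: "p permutes {0..<n}" by simp
    show "signof p * (\<Prod>r = 0..<n. ?A $$ (r, p r)) = (if p = id then 1 + (\<Sum>i<n. W $$ (i, i)) else 0)"
    proof (cases "p = id")
      case True
      then show ?thesis using id[of n] by simp
    next
      case False
      \<comment> \<open>If i is moved, then so is p i. The product thus contains two off-diagonal
        entries, both taken from W, and their product is zero.\<close>
      then obtain i where i: "p i \<noteq> i" by (metis eq_id_iff)
      define j where "j = p i"
      have j: "p j \<noteq> j" using i permutes_inj[OF p] by (metis injD j_def)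
      have b: "i < n" "j < n" "p j < n"
        using i j p permutes_in_image[OF p] by (auto simp: permutes_def j_def)
      have "(\<Prod>r = 0..<n. ?A $$ (r, p r)) = ?A $$ (i, p i) * (?A $$ (j, p j) * (\<Prod>r \<in> {0..<n} - {i} - {j}. ?A $$ (r, p r)))"
        using b i by (simp add: prod.remove[of "{0..<n}" i] prod.remove[of "{0..<n} - {i}" j] j_def)
      also have "\<dots> = W $$ (i, p i) * W $$ (j, p j) * (\<Prod>r \<in> {0..<n} - {i} - {j}. ?A $$ (r, p r))"
        using b i j W by (simp add: j_def mult.assoc)
      also have "\<dots> = 0" using b by (simp add: z j_def)
      finally show ?thesis using False by simp
    qed
  qed
  also have "\<dots> = 1 + (\<Sum>i<n. W $$ (i, i))" by (simp add: finite_permutations permutes_id)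
  finally show ?thesis .
qed

lemma gmdet_one_plus_infinitesimal:
  assumes W: "W \<in> pmat 0 n n"
    and z: "!!i j k l. i < n ==> j < n ==> k < n ==> l < n ==> W $$ (i, j) * W $$ (k, l) = 0"
  shows "gmdet (1\<^sub>m n + W) = 1 + (\<Sum>i<n. W $$ (i, i))"
proof -
  obtain W' where W': "W' \<in> carrier_mat n n" "W = map_mat of_geven W'" using pmat_lift[OF W] by blast
  have "W' $$ (i, j) * W' $$ (k, l) = 0" if "i < n" "j < n" "k < n" "l < n" for i j k l
  proof -
    have "of_geven (W' $$ (i, j) * W' $$ (k, l)) = of_geven 0"
      using z[OF that] W' that by (simp add: of_geven.hom_mult)
    then show ?thesis by (simp only: of_geven_inject)
  qed
  then have "det (1\<^sub>m n + W') = 1 + (\<Sum>i<n. W' $$ (i, i))" by (rule det_one_plus_infinitesimal[OF W'(1)])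
  moreover have "1\<^sub>m n + W = map_mat of_geven (1\<^sub>m n + W')"
    using W' by (intro eq_matI) (auto simp: of_geven.hom_add)
  ultimately show ?thesis
    using W' by (simp add: gmdet_of of_geven.hom_add of_geven.hom_sum)
qed

text \<open>The labels N and N + 1 lie beyond those of the domain, so the parameter is independent
  of everything there. An even parameter of square zero is the product of two odd ones.\<close>

definition infinitesimal :: "nat => nat => grassmann" where
  "infinitesimal N q = (if even q then ggen N * ggen (Suc N) else ggen N)"

lemma gparity_infinitesimal: "gparity q (infinitesimal N q)"
  using gparity_mult[OF gparity_ggen gparity_ggen, of N "Suc N"]
  by (auto simp: infinitesimal_def intro: gparity_cong[of "1 + 1"] gparity_cong[OF _ gparity_ggen])

lemma gsupp_infinitesimal: "gsupp {..<N + 2} (infinitesimal N q)"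
  by (auto simp: infinitesimal_def intro!: gsupp_mult gsupp_ggen)

lemma ggen_cancel: "gsupp L g ==> a \<notin> L ==> ggen a * g = 0 ==> g = 0"
  using gderiv_mult[of a "ggen a" g] by (simp add: gderiv_ggen gderiv_eq_0)

text \<open>Coefficients of the parameter can be compared, because its generators do not occur in g
  and may be stripped off one at a time by differentiation.\<close>

lemma infinitesimal_cancel:
  assumes g: "gsupp {..<N} g" and z: "infinitesimal N q * g = 0" shows "g = 0"
proof (cases "even q")
  case True
  have "ggen (Suc N) * g = 0"
    by (rule ggen_cancel[of "{..<N} \<union> {Suc N}" _ N])
      (use z True in \<open>auto simp: infinitesimal_def mult.assoc intro!: gsupp_mult gsupp_ggen gsupp_mono[OF g]\<close>)
  then show ?thesis using ggen_cancel[OF g, of "Suc N"] by simp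
qed (use ggen_cancel[OF g, of N] z in \<open>simp add: infinitesimal_def\<close>)

lemma infinitesimal_mult: "infinitesimal N q * infinitesimal N q = 0"
proof -
  have "ggen N * ggen (Suc N) * (ggen N * ggen (Suc N)) = ggen N * (ggen (Suc N) * ggen N) * ggen (Suc N)"
    by (simp add: mult.assoc)
  also have "\<dots> = - (ggen N * ggen N * (ggen (Suc N) * ggen (Suc N)))"
    using grassmann_supercommute[OF gparity_ggen gparity_ggen, of "Suc N" N] by (simp add: mult.assoc)
  finally show ?thesis by (simp add: infinitesimal_def ggen_ggen)
qed

lemma infinitesimal_mult_mult:
  assumes "gparity p z" shows "infinitesimal N q * z * (infinitesimal N q * w) = 0"
proof -
  have "z * infinitesimal N q = (-1) ^ (p * q) * (infinitesimal N q * z)"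
    by (rule grassmann_supercommute[OF assms gparity_infinitesimal])
  then have "infinitesimal N q * z * (infinitesimal N q * w) =
      ((-1) ^ (p * q)) * ((infinitesimal N q * infinitesimal N q) * z * w)"
    by (cases "even (p * q)") (simp_all add: mult.assoc flip: mult.assoc[of z])
  then show ?thesis by (simp add: infinitesimal_mult)
qed

text \<open>
  Liouville's formula \<open>\<partial> ln Ber P = str (\<partial>P P\<^sup>-\<^sup>1)\<close>; the derivation \<open>\<partial>\<close> of parity \<open>q\<close> is encoded by the
  homomorphism \<open>f \<mapsto> f + \<eta> \<partial>f\<close>, where \<open>\<eta>\<close> is a new infinitesimal parameter of the same parity.
\<close>

lemma ber2_liouville:
  fixes P Y dP dY :: "nat => nat => grassmann" and n m q :: nat
  defines "\<eta> \<equiv> infinitesimal (n + m) q"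
  assumes PY: "smat_inverse n m P Y"
    and PYh: "smat_inverse n m (\<lambda>i j. P i j + \<eta> * dP i j) (\<lambda>i j. Y i j + \<eta> * dY i j)"
    and dP: "!!i j. i < n + m ==> j < n + m ==> gparity (q + spar n i + spar n j) (dP i j)"
    and L: "smat_supp n m {..<n + m} P" "smat_supp n m {..<n + m} Y" "smat_supp n m {..<n + m} dP"
    and J: "ber2 n m (\<lambda>i j. P i j + \<eta> * dP i j) (\<lambda>i j. Y i j + \<eta> * dY i j) = ber2 n m P Y + \<eta> * dJ"
    and dJ: "gsupp {..<n + m} dJ"
  shows "dJ = (\<Sum>a<n + m. (-1) ^ spar n a * smat_mult (n + m) dP Y a a) * ber2 n m P Y"
proof -
  let ?N = "n + m" and ?\<Sigma> = "\<lambda>Z. \<Sum>a<n + m. (-1) ^ spar n a * Z a a"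
  define hP where "hP = (\<lambda>i j. P i j + \<eta> * dP i j)"
  define hY where "hY = (\<lambda>i j. Y i j + \<eta> * dY i j)"
  define Z where "Z = smat_mult ?N dP Y"
  define W where "W = (\<lambda>i j. \<eta> * Z i j)"
  note PYh = PYh[folded hP_def hY_def]
  have e: "smat_even n m P" "smat_even n m Y" "smat_even n m hP" "smat_even n m hY"
    using PY PYh by (auto simp: smat_inverse_def)
  have Z: "gparity (q + spar n i + spar n j) (Z i j)" if "i < ?N" "j < ?N" for i j
    unfolding Z_def smat_mult_def
  proof (rule gparity_sum)
    fix l assume "l \<in> {..<?N}"
    then have "gparity (spar n l + spar n j) (Y l j)" "l < ?N" using e(2) that by (auto simp: smat_even_def)
    then show "gparity (q + spar n i + spar n j) (dP i l * Y l j)"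
      by (intro gparity_mult_cong[OF dP[OF that(1)]]) (assumption, assumption, presburger)
  qed
  have We: "gparity (spar n i + spar n j) (W i j)" if "i < ?N" "j < ?N" for i j
    unfolding W_def \<eta>_def by (rule gparity_mult_cong[OF gparity_infinitesimal Z[OF that]]) presburger
  have WW: "W i j * W k l = 0" if "i < ?N" "j < ?N" for i j k l
    unfolding W_def \<eta>_def by (rule infinitesimal_mult_mult[OF Z[OF that]])
  have A: "smat_mult ?N hP Y i j = (if i = j then 1 else 0) + W i j" if "i < ?N" "j < ?N" for i j
  proof -
    have "smat_mult ?N hP Y i j = smat_mult ?N P Y i j + W i j"
      by (simp add: smat_mult_def hP_def W_def Z_def distrib_right sum.distrib sum_distrib_left mult.assoc)
    then show ?thesis using PY that by (simp add: smat_inverse_def)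
  qed
  \<comment> \<open>Obtained from hP * hY = 1 and the vanishing of terms of second order in \<eta>;
    the derivative of the inverse matrix never has to be computed.\<close>
  have B: "smat_mult ?N P hY i j = (if i = j then 1 else 0) - W i j" if "i < ?N" "j < ?N" for i j
  proof -
    have "\<eta> * dP i l * (\<eta> * dY l j) = 0" if "l < ?N" for l
      unfolding \<eta>_def by (rule infinitesimal_mult_mult[OF dP[OF \<open>i < ?N\<close> that]])
    then have "smat_mult ?N hP hY i j = smat_mult ?N P hY i j + W i j"
      by (simp add: smat_mult_def hP_def hY_def W_def Z_def distrib_left distrib_right sum.distrib sum_distrib_left mult.assoc)
    then show ?thesis using PYh that by (simp add: smat_inverse_def eq_diff_eq)
  qed
  define U where "U = {..<?N + 2}"
  have "gsupp {..<?N} g ==> gsupp U g" "gsupp U \<eta>" "finite U" for g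
    unfolding U_def \<eta>_def by (auto simp only: gsupp_infinitesimal intro!: gsupp_mono[of "{..<?N}"])
  then have sup: "smat_supp n m U hP" "smat_supp n m U Y"
    using L unfolding smat_supp_def hP_def by (auto intro!: gsupp_add gsupp_mult)
  \<comment> \<open>\<open>ber2\<close> takes the upper left block of hP * Y and the lower right
    block of its inverse P * hY. The two traces of W enter with opposite signs, and this is the
    supertrace.\<close>
  have "ber2 n m (smat_mult ?N hP Y) (smat_mult ?N P hY) = (1 + (\<Sum>i<n. W i i)) * (1 + (\<Sum>i<m. - W (n + i) (n + i)))"
  proof -
    have "blk n n 0 0 (smat_mult ?N hP Y) = 1\<^sub>m n + mat n n (\<lambda>(i, j). W i j)"
      "blk m m n n (smat_mult ?N P hY) = 1\<^sub>m m + mat m m (\<lambda>(i, j). - W (n + i) (n + j))"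
      by (rule eq_matI; simp add: A B)+
    moreover have "gparity 0 (W i j)" if "i < n" "j < n" for i j
      using We[of i j] that by (simp add: spar_def)
    then have "gmdet (1\<^sub>m n + mat n n (\<lambda>(i, j). W i j)) = 1 + (\<Sum>i<n. mat n n (\<lambda>(i, j). W i j) $$ (i, i))"
      by (intro gmdet_one_plus_infinitesimal) (use WW in \<open>auto simp: pmat_def\<close>)
    moreover have "gparity 0 (W (n + i) (n + j))" if "i < m" "j < m" for i j
      using gparity_cong[OF _ We[of "n + i" "n + j"], of 0] that by (simp add: spar_def)
    then have "gmdet (1\<^sub>m m + mat m m (\<lambda>(i, j). - W (n + i) (n + j))) = 1 + (\<Sum>i<m. mat m m (\<lambda>(i, j). - W (n + i) (n + j)) $$ (i, i))"
      by (intro gmdet_one_plus_infinitesimal) (use WW in \<open>auto simp: pmat_def intro!: gparity_uminus\<close>)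
    ultimately show ?thesis by (simp add: ber2_gmdet smat_even_mult e)
  qed
  also have "\<dots> = 1 + (\<Sum>i<n. W i i) + (\<Sum>i<m. - W (n + i) (n + i))"
  proof -
    have "(\<Sum>i<n. W i i) * (\<Sum>i<m. - W (n + i) (n + i)) = 0"
      unfolding sum_distrib_left sum_distrib_right by (intro sum.neutral ballI) (simp add: WW)
    then show ?thesis by (simp add: algebra_simps)
  qed
  also have "\<dots> = 1 + \<eta> * ?\<Sigma> Z"
    by (simp add: sum_lessThan_add spar_def W_def sum_negf right_diff_distrib sum_distrib_left)
  finally have "ber2 n m hP hY * ber2 n m Y P = 1 + \<eta> * ?\<Sigma> Z"
    using ber2_mult[OF PYh smat_inverse_sym[OF PY] sup] by simp
  then have "(1 + \<eta> * ?\<Sigma> Z) * ber2 n m P Y = ber2 n m hP hY * (ber2 n m Y P * ber2 n m P Y)"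
    by (simp only: mult.assoc[symmetric])
  also have "\<dots> = ber2 n m P Y + \<eta> * dJ"
    using ber2_inverse[OF smat_inverse_sym[OF PY] L(2,1)] J by (simp add: hP_def hY_def)
  finally have z: "\<eta> * (dJ - ?\<Sigma> Z * ber2 n m P Y) = 0"
    by (simp add: right_diff_distrib distrib_right mult.assoc)
  have "gsupp {..<?N} (dJ - ?\<Sigma> Z * ber2 n m P Y)"
    using L dJ by (intro gsupp_diff gsupp_mult gsupp_sum gsupp_sign gsupp_ber2)
      (auto simp: smat_supp_def Z_def smat_mult_def intro!: gsupp_sum gsupp_mult)
  from infinitesimal_cancel[OF this z[unfolded \<eta>_def]] show ?thesis by (simp add: Z_def)
qed

section \<open>Smooth functions of even coordinates\<close>

abbreviation espace :: "nat => (nat => real) set" where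
  "espace n \<equiv> {x. \<forall>i\<ge>n. x i = 0}"

lemma openin_Euclidean_space: "openin (Euclidean_space n) V \<longleftrightarrow> (\<exists>Q. open Q \<and> V = Q \<inter> espace n)"
  unfolding Euclidean_space_def euclidean_product_topology openin_subtopology by simp

lemma openin_Euclidean_subset: "openin (Euclidean_space n) V ==> V \<subseteq> espace n"
  by (auto simp: openin_Euclidean_space)

lemma Euclidean_continuous_map_iff:
  "openin (Euclidean_space n) V ==>
    continuous_map (subtopology (Euclidean_space n) V) euclideanreal g \<longleftrightarrow> continuous_on V g"
proof -
  assume "openin (Euclidean_space n) V"
  then have "espace n \<inter> V = V" using openin_Euclidean_subset by auto
  then show ?thesis
    by (simp add: Euclidean_space_def subtopology_subtopology euclidean_product_topology)
qed

lemma continuous_on_coord: "continuous_on S (\<lambda>x :: nat => real. x i)"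
  by (rule continuous_on_subset[OF continuous_on_product_coordinates]) auto

lemma continuous_on_update:
  fixes f :: "'z :: topological_space => nat => real"
  assumes "continuous_on S f" "continuous_on S g"
  shows "continuous_on S (\<lambda>u. (f u)(i := g u))"
proof (rule continuous_on_coordinatewise_then_product)
  show "continuous_on S (\<lambda>u. ((f u)(i := g u)) j)" for j
    using assms(2) continuous_on_product_then_coordinatewise[OF assms(1), of j] by (cases "j = i") auto
qed

locale coord_domain =
  fixes n :: nat and V :: "(nat => real) set"
  assumes openV: "openin (Euclidean_space n) V"
begin

lemma V_espace: "x \<in> V ==> i \<ge> n ==> x i = 0"
  using openin_Euclidean_subset[OF openV] by auto

lemma open_update:
  assumes "i < n" "x \<in> V" shows "open {s. x(i := s) \<in> V}"
proof -
  obtain Q where Q: "open Q" "V = Q \<inter> espace n" using openV unfolding openin_Euclidean_space by blast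
  have c: "continuous_on UNIV (\<lambda>s. x(i := s))"
    by (intro continuous_on_update continuous_on_const continuous_on_id)
  have "x(i := s) \<in> espace n" for s using assms Q by auto
  then have "{s. x(i := s) \<in> V} = (\<lambda>s. x(i := s)) -` Q" using Q by auto
  then show ?thesis using open_vimage[OF Q(1) c] by simp
qed

lemma eventually_update:
  assumes "i < n" "x \<in> V" shows "\<forall>\<^sub>F s in nhds (x i). x(i := s) \<in> V"
  using open_update[OF assms] assms unfolding eventually_nhds by (intro exI[of _ "{s. x(i := s) \<in> V}"]) auto

lemma smooth_iff:
  "smooth_fun n V g \<longleftrightarrow> (\<forall>is. set is \<subseteq> {..<n} \<longrightarrow> continuous_on V (foldr partial is g) \<and>
     (\<forall>i<n. \<forall>x\<in>V. (\<lambda>s. foldr partial is g (x(i := s))) differentiable (at (x i))))"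
  by (simp add: smooth_fun_def Euclidean_continuous_map_iff[OF openV])

lemma smooth_continuous: "smooth_fun n V g ==> continuous_on V g"
  unfolding smooth_iff by (drule spec[of _ "[]"]) simp

lemma smooth_partial: "smooth_fun n V g ==> i < n ==> smooth_fun n V (partial i g)"
  unfolding smooth_iff
proof (intro allI impI)
  fix "is" assume *: "\<forall>is. set is \<subseteq> {..<n} \<longrightarrow> continuous_on V (foldr partial is g) \<and>
     (\<forall>i<n. \<forall>x\<in>V. (\<lambda>s. foldr partial is g (x(i := s))) differentiable (at (x i)))" "i < n" "set is \<subseteq> {..<n}"
  show "continuous_on V (foldr partial is (partial i g)) \<and>
     (\<forall>ia<n. \<forall>x\<in>V. (\<lambda>s. foldr partial is (partial i g) (x(ia := s))) differentiable (at (x ia)))"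
    using *(1)[rule_format, of "is @ [i]"] *(2,3) by simp
qed

lemma smooth_has_derivative:
  "smooth_fun n V g ==> i < n ==> x \<in> V ==>
    ((\<lambda>s. g (x(i := s))) has_real_derivative partial i g x) (at (x i))"
  unfolding smooth_iff partial_def DERIV_deriv_iff_real_differentiable
  by (drule spec[of _ "[]"]) simp

lemma partial_cong:
  "(!!x. x \<in> V ==> g x = h x) ==> i < n ==> x \<in> V ==> partial i g x = partial i h x"
  unfolding partial_def
  by (rule deriv_cong_ev) (auto intro: eventually_mono[OF eventually_update])

lemma partial_eqI:
  "((\<lambda>s. g (x(i := s))) has_real_derivative D) (at (x i)) ==> partial i g x = D"
  unfolding partial_def by (rule DERIV_imp_deriv)

text \<open>A coinduction principle: for a class of continuous functions that is closed under
  partial derivatives up to equality on V, iterated derivatives need not be examined again.\<close>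

lemma smooth_coinduct:
  assumes F: "!!g. g \<in> F ==> continuous_on V g"
    "!!g i. g \<in> F ==> i < n ==> \<exists>h\<in>F. \<forall>x\<in>V. ((\<lambda>s. g (x(i := s))) has_real_derivative h x) (at (x i))"
    and g: "g \<in> F"
  shows "smooth_fun n V g"
proof -
  have *: "\<exists>h\<in>F. \<forall>x\<in>V. foldr partial is g x = h x" if "set is \<subseteq> {..<n}" for "is"
    using that
  proof (induction "is")
    case (Cons i "is")
    then obtain h where h: "h \<in> F" "\<forall>x\<in>V. foldr partial is g x = h x" by auto
    have i: "i < n" using Cons by auto
    obtain h' where h': "h' \<in> F" "\<forall>x\<in>V. ((\<lambda>s. h (x(i := s))) has_real_derivative h' x) (at (x i))"
      using F(2)[OF h(1) i] by auto
    have "foldr partial (i # is) g x = h' x" if "x \<in> V" for x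
    proof -
      have "foldr partial (i # is) g x = partial i h x"
        using partial_cong[OF _ i that, of "foldr partial is g" h] h by simp
      then show ?thesis using h' that by (simp add: partial_eqI)
    qed
    then show ?case using h' by blast
  qed (use g in auto)
  show ?thesis
    unfolding smooth_iff
  proof (intro allI impI conjI ballI)
    fix "is" assume "set is \<subseteq> {..<n}"
    then obtain h where h: "h \<in> F" "\<forall>x\<in>V. foldr partial is g x = h x" using * by blast
    show "continuous_on V (foldr partial is g)"
      using F(1)[OF h(1)] h(2) by (simp cong: continuous_on_cong)
    fix i x assume i: "i < n" and x: "x \<in> V"
    obtain h' where h': "((\<lambda>s. h (x(i := s))) has_real_derivative h') (at (x i))"
      using F(2)[OF h(1) i] x by blast
    have "\<forall>\<^sub>F s in nhds (x i). foldr partial is g (x(i := s)) = h (x(i := s))"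
      using eventually_update[OF i x] by eventually_elim (use h in auto)
    from DERIV_cong_ev[OF refl this refl] h'
    have "((\<lambda>s. foldr partial is g (x(i := s))) has_real_derivative h') (at (x i))" by simp
    then show "(\<lambda>s. foldr partial is g (x(i := s))) differentiable (at (x i))"
      using real_differentiable_def by blast
  qed
qed

lemma smooth_cong:
  assumes "smooth_fun n V h" "!!x. x \<in> V ==> g x = h x" shows "smooth_fun n V g"
proof (rule smooth_coinduct[of "{g. \<exists>h. smooth_fun n V h \<and> (\<forall>x\<in>V. g x = h x)}"])
  fix g assume "g \<in> {g. \<exists>h. smooth_fun n V h \<and> (\<forall>x\<in>V. g x = h x)}"
  then obtain h where h: "smooth_fun n V h" "!!x. x \<in> V ==> g x = h x" by auto
  show "continuous_on V g" using smooth_continuous[OF h(1)] h(2) by (simp cong: continuous_on_cong)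
  fix i assume i: "i < n"
  have "((\<lambda>s. g (x(i := s))) has_real_derivative partial i h x) (at (x i))" if x: "x \<in> V" for x
  proof -
    have "\<forall>\<^sub>F s in nhds (x i). g (x(i := s)) = h (x(i := s))"
      using eventually_update[OF i x] by eventually_elim (use h in auto)
    from DERIV_cong_ev[OF refl this refl] smooth_has_derivative[OF h(1) i x] show ?thesis by simp
  qed
  then show "\<exists>h\<in>{g. \<exists>h. smooth_fun n V h \<and> (\<forall>x\<in>V. g x = h x)}.
      \<forall>x\<in>V. ((\<lambda>s. g (x(i := s))) has_real_derivative h x) (at (x i))"
    using smooth_partial[OF h(1) i] by (intro bexI[of _ "partial i h"]) auto
qed (use assms in auto)

lemma smooth_const: "smooth_fun n V (\<lambda>x. c)"
  by (rule smooth_coinduct[of "range (\<lambda>c x. c)"]) (auto intro!: continuous_intros exI[of _ 0])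

lemma smooth_coordinate: "smooth_fun n V (\<lambda>x. x i)"
proof (rule smooth_coinduct[of "insert (\<lambda>x. x i) (range (\<lambda>c x. c))"])
  fix g :: "(nat => real) => real" and j assume g: "g \<in> insert (\<lambda>x. x i) (range (\<lambda>c x. c))"
  show "continuous_on V g"
    using g by (auto intro!: continuous_intros continuous_on_coord)
  show "\<exists>h\<in>insert (\<lambda>x. x i) (range (\<lambda>c x. c)). \<forall>x\<in>V. ((\<lambda>s. g (x(j := s))) has_real_derivative h x) (at (x j))"
  proof (cases "g = (\<lambda>x. x i)")
    case True
    then show ?thesis
      by (intro bexI[of _ "\<lambda>x. if i = j then 1 else 0"]) (auto intro!: derivative_eq_intros)
  next
    case False
    then obtain c where "g = (\<lambda>x. c)" using g by auto
    then show ?thesis by (intro bexI[of _ "\<lambda>x. 0"]) auto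
  qed
qed auto

end

text \<open>The standard flat function exp (-1/t), multiplied by powers of 1/t so that the family is
  closed under differentiation up to linear combinations.\<close>

definition flat :: "nat => real => real" where
  "flat k t = (if t \<le> 0 then 0 else exp (- inverse t) * inverse t ^ k)"

lemma flat_tendsto: "(flat k \<longlongrightarrow> 0) (at 0)"
proof (rule filterlim_split_at)
  show "(flat k \<longlongrightarrow> 0) (at_left 0)"
    by (rule tendsto_eventually) (auto simp: flat_def eventually_at_filter)
  have "((\<lambda>t. inverse t ^ k / exp (inverse t)) \<longlongrightarrow> 0) (at_right (0::real))"
    by (rule filterlim_compose[OF tendsto_power_div_exp_0 filterlim_inverse_at_top_right])
  then show "(flat k \<longlongrightarrow> 0) (at_right 0)"
    by (rule Lim_transform_eventually) (auto simp: flat_def eventually_at_filter exp_minus divide_inverse)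
qed

lemma flat_derivative: "(flat k has_real_derivative (flat (k + 2) t - real k * flat (k + 1) t)) (at t)"
proof -
  consider "t < 0" | "t = 0" | "t > 0" by linarith
  then show ?thesis
  proof cases
    case 1
    have ev: "\<forall>\<^sub>F s in nhds t. flat k s = 0"
      using eventually_nhds_in_open[of "{..<0}" t] 1 by (auto simp: flat_def elim: eventually_mono)
    have "flat j t = 0" for j using 1 by (simp add: flat_def)
    then show ?thesis using DERIV_cong_ev[OF refl ev refl, of 0] by simp
  next
    case 2
    \<comment> \<open>At the origin the difference quotient of \<open>flat k\<close> is
      \<open>flat (k + 1)\<close> itself.\<close>
    have "((\<lambda>h. flat (k + 1) h) \<longlongrightarrow> 0) (at 0)" by (rule flat_tendsto)
    moreover have "flat (k + 1) h = (flat k (0 + h) - flat k 0) / h" for h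
      by (simp add: flat_def divide_inverse)
    ultimately have "(flat k has_real_derivative 0) (at 0)"
      unfolding DERIV_def by simp
    moreover have "flat j t = 0" for j using 2 by (simp add: flat_def)
    ultimately show ?thesis using 2 by simp
  next
    case 3
    have ev: "\<forall>\<^sub>F s in nhds t. flat k s = exp (- inverse s) * inverse s ^ k"
      using eventually_nhds_in_open[of "{0<..}" t] 3 by (auto simp: flat_def elim: eventually_mono)
    have "((\<lambda>s. exp (- inverse s) * inverse s ^ k) has_real_derivative
        (flat (k + 2) t - real k * flat (k + 1) t)) (at t)"
    proof -
      have "((\<lambda>s. exp (- inverse s) * inverse s ^ k) has_real_derivative
        (exp (- inverse t) * (inverse t * inverse t)) * inverse t ^ k +
          (real k * inverse t ^ (k - 1) * (- (inverse t * inverse t))) * exp (- inverse t)) (at t)"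
        using 3 by (auto intro!: derivative_eq_intros simp: power2_eq_square)
      moreover have "(exp (- inverse t) * (inverse t * inverse t)) * inverse t ^ k +
          (real k * inverse t ^ (k - 1) * (- (inverse t * inverse t))) * exp (- inverse t) =
          flat (k + 2) t - real k * flat (k + 1) t"
        using 3 by (cases k) (simp_all add: flat_def algebra_simps power2_eq_square)
      ultimately show ?thesis by (simp only:)
    qed
    with DERIV_cong_ev[OF refl ev refl] show ?thesis by (rule iffD2)
  qed
qed

lemma abs_powr_derivative:
  fixes y :: real
  assumes "y \<noteq> 0"
  shows "((\<lambda>y. \<bar>y\<bar> powr w) has_real_derivative w * \<bar>y\<bar> powr w * inverse y) (at y)"
proof (cases "y > 0")
  case True
  have "((\<lambda>y. y powr w) has_real_derivative w * y powr (w - 1)) (at y)"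
    using has_real_derivative_powr[OF True, of w] by simp
  moreover have ev: "\<forall>\<^sub>F y in nhds y. \<bar>y\<bar> powr w = y powr w"
    using eventually_nhds_in_open[of "{0<..}" y] True by (auto elim: eventually_mono)
  ultimately have "((\<lambda>y. \<bar>y\<bar> powr w) has_real_derivative w * y powr (w - 1)) (at y)"
    using DERIV_cong_ev[OF refl ev refl] by blast
  then show ?thesis using True by (simp add: powr_diff divide_inverse mult.assoc)
next
  case False
  then have neg: "- y > 0" using assms by simp
  have "((\<lambda>y. (- y) powr w) has_real_derivative (w * (- y) powr (w - 1)) * (- 1)) (at y)"
    by (rule DERIV_chain2[of "\<lambda>y. y powr w" _ "\<lambda>y. - y"])
      (use has_real_derivative_powr[OF neg, of w] in \<open>auto intro!: derivative_eq_intros\<close>)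
  moreover have ev: "\<forall>\<^sub>F y in nhds y. \<bar>y\<bar> powr w = (- y) powr w"
    using eventually_nhds_in_open[of "{..<0}" y] neg by (auto elim: eventually_mono)
  ultimately have "((\<lambda>y. \<bar>y\<bar> powr w) has_real_derivative (w * (- y) powr (w - 1)) * (- 1)) (at y)"
    using DERIV_cong_ev[OF refl ev refl] by blast
  then show ?thesis using neg assms by (simp add: powr_diff divide_inverse mult.assoc)
qed

lemma continuous_on_flat: "continuous_on UNIV (flat k)"
  using flat_derivative by (auto intro!: continuous_at_imp_continuous_on DERIV_isCont)

section \<open>Closure properties of smooth functions\<close>

context coord_domain
begin

text \<open>All closure properties come from one application of \<open>smooth_coinduct\<close>: the
  derivatives of sums, products, powers, inverses and flat functions are again built from these
  operations.\<close>

inductive_set smooth_closure :: "((nat => real) => real) set" where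
  base: "smooth_fun n V g ==> g \<in> smooth_closure"
| add: "g \<in> smooth_closure ==> h \<in> smooth_closure ==> (\<lambda>x. g x + h x) \<in> smooth_closure"
| mult: "g \<in> smooth_closure ==> h \<in> smooth_closure ==> (\<lambda>x. g x * h x) \<in> smooth_closure"
| powr: "smooth_fun n V g ==> (!!x. x \<in> V ==> g x \<noteq> 0) ==> (\<lambda>x. \<bar>g x\<bar> powr w) \<in> smooth_closure"
| inverse: "smooth_fun n V g ==> (!!x. x \<in> V ==> g x \<noteq> 0) ==> (\<lambda>x. inverse (g x)) \<in> smooth_closure"
| flat: "smooth_fun n V g ==> (\<lambda>x. flat k (g x)) \<in> smooth_closure"

lemma smooth_closure_smooth: "g \<in> smooth_closure ==> smooth_fun n V g"
proof (erule smooth_coinduct[rotated -1])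
  show "continuous_on V g" if "g \<in> smooth_closure" for g
    using that
  proof induction
    case (flat g k)
    then show ?case
      using continuous_on_compose2[OF continuous_on_flat smooth_continuous[OF flat]] by simp
  qed (auto intro!: continuous_intros dest: smooth_continuous)
  fix g i assume g: "g \<in> smooth_closure" and i: "i < n"
  show "\<exists>h\<in>smooth_closure. \<forall>x\<in>V. ((\<lambda>s. g (x(i := s))) has_real_derivative h x) (at (x i))"
    using g
  proof induction
    case (base g)
    show ?case
      by (intro bexI[of _ "partial i g"] ballI smooth_has_derivative smooth_closure.base smooth_partial base i)
  next
    case (add g h)
    then obtain g' h' where *: "g' \<in> smooth_closure" "h' \<in> smooth_closure"
      "\<forall>x\<in>V. ((\<lambda>s. g (x(i := s))) has_real_derivative g' x) (at (x i))"
      "\<forall>x\<in>V. ((\<lambda>s. h (x(i := s))) has_real_derivative h' x) (at (x i))" by blast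
    show ?case
      by (intro bexI[of _ "\<lambda>x. g' x + h' x"] ballI DERIV_add smooth_closure.add *(1,2) *(3,4)[rule_format])
  next
    case (mult g h)
    then obtain g' h' where *: "g' \<in> smooth_closure" "h' \<in> smooth_closure"
      "\<forall>x\<in>V. ((\<lambda>s. g (x(i := s))) has_real_derivative g' x) (at (x i))"
      "\<forall>x\<in>V. ((\<lambda>s. h (x(i := s))) has_real_derivative h' x) (at (x i))" by blast
    have "((\<lambda>s. g (x(i := s)) * h (x(i := s))) has_real_derivative g' x * h x + h' x * g x) (at (x i))" if "x \<in> V" for x
      using DERIV_mult[OF *(3)[rule_format, OF that] *(4)[rule_format, OF that]] by simp
    then show ?case
      by (intro bexI[of _ "\<lambda>x. g' x * h x + h' x * g x"] ballI)
        (assumption, intro smooth_closure.add smooth_closure.mult * mult.hyps)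
  next
    case (powr g w)
    have "((\<lambda>s. \<bar>g (x(i := s))\<bar> powr w) has_real_derivative w * \<bar>g x\<bar> powr w * (inverse (g x) * partial i g x)) (at (x i))"
      if x: "x \<in> V" for x
    proof -
      have d: "((\<lambda>s. g (x(i := s))) has_real_derivative partial i g x) (at (x i))"
        by (rule smooth_has_derivative[OF powr(1) i x])
      have nz: "g x \<noteq> 0" using powr x by auto
      from abs_powr_derivative[OF nz]
      have "((\<lambda>y. \<bar>y\<bar> powr w) has_real_derivative w * \<bar>g x\<bar> powr w * inverse (g x)) (at (g (x(i := x i))))"
        by simp
      from DERIV_chain2[OF this d] show ?thesis by (simp add: mult.assoc)
    qed
    then show ?case
      by (rule bexI[of _ "\<lambda>x. w * \<bar>g x\<bar> powr w * (inverse (g x) * partial i g x)", OF ballI])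
        (assumption, rule smooth_closure.mult[OF smooth_closure.mult[OF smooth_closure.base[OF smooth_const] smooth_closure.powr[OF powr]]
            smooth_closure.mult[OF smooth_closure.inverse[OF powr] smooth_closure.base[OF smooth_partial[OF powr(1) i]]]])
  next
    case (inverse g)
    have "((\<lambda>s. inverse (g (x(i := s)))) has_real_derivative inverse (g x) * (inverse (g x) * (- 1 * partial i g x))) (at (x i))"
      if x: "x \<in> V" for x
      using inverse x by (auto intro!: derivative_eq_intros smooth_has_derivative i simp: power2_eq_square)
    then show ?case
      by (rule bexI[of _ "\<lambda>x. inverse (g x) * (inverse (g x) * (- 1 * partial i g x))", OF ballI])
        (assumption, rule smooth_closure.mult[OF smooth_closure.inverse[OF inverse] smooth_closure.mult[OF smooth_closure.inverse[OF inverse]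
            smooth_closure.mult[OF smooth_closure.base[OF smooth_const] smooth_closure.base[OF smooth_partial[OF inverse(1) i]]]]])
  next
    case (flat g k)
    have "((\<lambda>s. flat k (g (x(i := s)))) has_real_derivative (flat (k + 2) (g x) + (- real k) * flat (k + 1) (g x)) * partial i g x) (at (x i))"
      if x: "x \<in> V" for x
      using DERIV_chain2[of "flat k" _ "\<lambda>s. g (x(i := s))" "x i", OF _ smooth_has_derivative[OF flat i x]] flat_derivative[of k "g x"] by simp
    then show ?case
      by (rule bexI[of _ "\<lambda>x. (flat (k + 2) (g x) + (- real k) * flat (k + 1) (g x)) * partial i g x", OF ballI])
        (assumption, rule smooth_closure.mult[OF smooth_closure.add[OF smooth_closure.flat[OF flat] smooth_closure.mult[OF
              smooth_closure.base[OF smooth_const] smooth_closure.flat[OF flat]]] smooth_closure.base[OF smooth_partial[OF flat i]]])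
  qed
qed

lemma smooth_add: "smooth_fun n V g ==> smooth_fun n V h ==> smooth_fun n V (\<lambda>x. g x + h x)"
  and smooth_mult: "smooth_fun n V g ==> smooth_fun n V h ==> smooth_fun n V (\<lambda>x. g x * h x)"
  and smooth_powr: "smooth_fun n V g ==> (!!x. x \<in> V ==> g x \<noteq> 0) ==> smooth_fun n V (\<lambda>x. \<bar>g x\<bar> powr w)"
  and smooth_inverse: "smooth_fun n V g ==> (!!x. x \<in> V ==> g x \<noteq> 0) ==> smooth_fun n V (\<lambda>x. inverse (g x))"
  and smooth_flat: "smooth_fun n V g ==> smooth_fun n V (\<lambda>x. flat k (g x))"
  by (rule smooth_closure_smooth, rule smooth_closure.intros; (erule smooth_closure.base | simp))+

lemma smooth_cmult: "smooth_fun n V g ==> smooth_fun n V (\<lambda>x. c * g x)"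
  by (intro smooth_mult smooth_const)
lemma smooth_diff: "smooth_fun n V g ==> smooth_fun n V h ==> smooth_fun n V (\<lambda>x. g x - h x)"
  using smooth_add[of g "\<lambda>x. - 1 * h x"] smooth_cmult[of h "- 1"] by simp
lemma smooth_sum: "(!!a. a \<in> A ==> smooth_fun n V (g a)) ==> smooth_fun n V (\<lambda>x. \<Sum>a\<in>A. g a x)"
  by (induction A rule: infinite_finite_induct) (auto intro: smooth_add smooth_const)
lemma smooth_prod: "(!!a. a \<in> A ==> smooth_fun n V (g a)) ==> smooth_fun n V (\<lambda>x. \<Prod>a\<in>A. g a x)"
  by (induction A rule: infinite_finite_induct) (auto intro: smooth_mult smooth_const)

lemma partial_mult:
  assumes "smooth_fun n V g" "smooth_fun n V h" "i < n" "x \<in> V"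
  shows "partial i (\<lambda>x. g x * h x) x = partial i g x * h x + g x * partial i h x"
  by (rule partial_eqI)
    (use DERIV_mult[OF smooth_has_derivative[OF assms(1,3,4)] smooth_has_derivative[OF assms(2,3,4)]] in \<open>simp add: mult.commute\<close>)

lemma partial_abs_powr:
  assumes g: "smooth_fun n V g" and nz: "g x \<noteq> 0" and i: "i < n" and x: "x \<in> V"
  shows "partial i (\<lambda>x. \<bar>g x\<bar> powr w) x = w * \<bar>g x\<bar> powr w * inverse (g x) * partial i g x"
proof (rule partial_eqI)
  have "((\<lambda>y. \<bar>y\<bar> powr w) has_real_derivative w * \<bar>g x\<bar> powr w * inverse (g x)) (at (g (x(i := x i))))"
    using abs_powr_derivative[OF nz] by simp
  from DERIV_chain2[OF this smooth_has_derivative[OF g i x]]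
  show "((\<lambda>s. \<bar>g (x(i := s))\<bar> powr w) has_real_derivative w * \<bar>g x\<bar> powr w * inverse (g x) * partial i g x) (at (x i))" .
qed

lemma partial_sum:
  assumes "finite A" "!!a. a \<in> A ==> smooth_fun n V (g a)" "i < n" "x \<in> V"
  shows "partial i (\<lambda>x. \<Sum>a\<in>A. g a x) x = (\<Sum>a\<in>A. partial i (g a) x)"
  by (rule partial_eqI, rule DERIV_sum) (use assms smooth_has_derivative in auto)

lemma partial_add:
  assumes "smooth_fun n V g" "smooth_fun n V h" "i < n" "x \<in> V"
  shows "partial i (\<lambda>x. g x + h x) x = partial i g x + partial i h x"
  by (rule partial_eqI, rule DERIV_add) (use assms smooth_has_derivative in auto)

lemma partial_cmult:
  assumes "smooth_fun n V g" "i < n" "x \<in> V"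
  shows "partial i (\<lambda>x. c * g x) x = c * partial i g x"
  by (rule partial_eqI, rule DERIV_cmult) (use assms smooth_has_derivative in auto)

end

lemma partial_const [simp]: "partial i (\<lambda>x. c) = (\<lambda>x. 0)"
  by (auto simp: partial_def fun_eq_iff)

lemma partial_coordinate: "partial i (\<lambda>x. x j) x = (if i = j then 1 else 0)"
  unfolding partial_def by (rule DERIV_imp_deriv) (auto intro!: derivative_eq_intros)

lemma smooth_subset:
  assumes "coord_domain n V" "coord_domain n V'" "V' \<subseteq> V" "smooth_fun n V g"
  shows "smooth_fun n V' g"
  using assms unfolding coord_domain.smooth_iff[OF assms(1)] coord_domain.smooth_iff[OF assms(2)]
  by (blast intro: continuous_on_subset)

text \<open>Smoothness is local. This is what glues a function to its extension by zero outside a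
  compact or closed set.\<close>

lemma smooth_Un:
  assumes "coord_domain n U" "coord_domain n V" "smooth_fun n U g" "smooth_fun n V g"
  shows "smooth_fun n (U \<union> V) g"
proof -
  have UV: "coord_domain n (U \<union> V)" using assms(1,2) by (simp add: coord_domain_def openin_Un)
  have c: "continuous_on (U \<union> V) g" if "continuous_on U g" "continuous_on V g" for g
  proof -
    have "openin (top_of_set (U \<union> V)) U" "openin (top_of_set (U \<union> V)) V"
    proof -
      obtain Q where "open Q" "U = Q \<inter> espace n" using assms(1) unfolding coord_domain_def openin_Euclidean_space by blast
      then have "U = (U \<union> V) \<inter> Q" using openin_Euclidean_subset assms(2) by (fastforce simp: coord_domain_def)
      then show "openin (top_of_set (U \<union> V)) U" using \<open>open Q\<close> by (metis openin_open)
      obtain Q where "open Q" "V = Q \<inter> espace n" using assms(2) unfolding coord_domain_def openin_Euclidean_space by blast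
      then have "V = (U \<union> V) \<inter> Q" using openin_Euclidean_subset assms(1) by (fastforce simp: coord_domain_def)
      then show "openin (top_of_set (U \<union> V)) V" using \<open>open Q\<close> by (metis openin_open)
    qed
    from continuous_on_cases_local_open[OF this that, of "\<lambda>_. True"] show ?thesis by simp
  qed
  show ?thesis
    using assms(3,4) c unfolding coord_domain.smooth_iff[OF assms(1)] coord_domain.smooth_iff[OF assms(2)] coord_domain.smooth_iff[OF UV]
    by blast
qed

subsection \<open>Bump functions\<close>

abbreviation closed_box :: "nat => (nat => real) => real => (nat => real) set" where
  "closed_box n q r \<equiv> {x \<in> espace n. \<forall>i<n. \<bar>x i - q i\<bar> \<le> r}"

abbreviation open_box :: "nat => (nat => real) => real => (nat => real) set" where
  "open_box n q r \<equiv> {x \<in> espace n. \<forall>i<n. \<bar>x i - q i\<bar> < r}"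

lemma openin_open_box: "openin (Euclidean_space n) (open_box n q r)"
proof -
  have "open {x :: nat => real. \<bar>x i - q i\<bar> < r}" for i
    by (intro open_Collect_less continuous_intros continuous_on_product_coordinates)
  then have "open (\<Inter>i<n. {x :: nat => real. \<bar>x i - q i\<bar> < r})" by (intro open_INT) auto
  moreover have "open_box n q r = (\<Inter>i<n. {x. \<bar>x i - q i\<bar> < r}) \<inter> espace n" by auto
  ultimately show ?thesis unfolding openin_Euclidean_space by blast
qed

lemma compactin_closed_box: "compactin (Euclidean_space n) (closed_box n q r)"
proof -
  have "closed_box n q r = PiE UNIV (\<lambda>i. if i < n then {q i - r..q i + r} else {0})"
    by (force simp: PiE_def Pi_def abs_le_iff split: if_splits)
  then have "compactin (product_topology (\<lambda>i. euclideanreal) UNIV) (closed_box n q r)"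
    by (auto simp: compactin_PiE)
  then show ?thesis
    by (auto simp: Euclidean_space_def compactin_subtopology)
qed

lemma box_in_open:
  assumes "openin (Euclidean_space n) V" "q \<in> V"
  obtains r where "r > 0" "closed_box n q r \<subseteq> V"
proof -
  obtain Q where Q: "open Q" "V = Q \<inter> espace n" using assms(1) unfolding openin_Euclidean_space by blast
  have "openin (product_topology (\<lambda>i. euclideanreal) UNIV) Q"
    using Q by (simp add: euclidean_product_topology)
  moreover have "q \<in> Q" using Q assms by auto
  ultimately obtain U where U: "\<forall>i\<in>UNIV. openin euclideanreal (U i)" "q \<in> PiE UNIV U" "PiE UNIV U \<subseteq> Q"
    unfolding openin_product_topology_alt by blast
  have Uo: "open (U i)" and Uq: "q i \<in> U i" for i using U by (auto simp: PiE_def Pi_def)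
  have "\<exists>r>0. \<forall>s. \<bar>s - q i\<bar> \<le> r \<longrightarrow> s \<in> U i" for i
  proof -
    obtain e where "e > 0" "ball (q i) e \<subseteq> U i" using openE[OF Uo Uq] by metis
    then show ?thesis by (intro exI[of _ "e / 2"]) (auto simp: subset_eq dist_real_def abs_minus_commute)
  qed
  then obtain \<rho> where \<rho>: "!!i. \<rho> i > 0" "!!i s. \<bar>s - q i\<bar> \<le> \<rho> i ==> s \<in> U i" by metis
  \<comment> \<open>The inserted 1 keeps the set nonempty when n = 0.\<close>
  define r where "r = Min (insert 1 (\<rho> ` {..<n}))"
  have r: "r > 0" "!!i. i < n ==> r \<le> \<rho> i" using \<rho>(1) by (auto simp: r_def)
  have "x \<in> V" if "x \<in> closed_box n q r" for x
  proof -
    have "x i \<in> U i" for i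
    proof (cases "i < n")
      case True
      then show ?thesis using that r(2)[OF True] by (intro \<rho>(2)) force
    next
      case False
      then have "x i = q i" using that Q assms by auto
      then show ?thesis using Uq by simp
    qed
    then have "x \<in> Q" using U(3) by (auto simp: PiE_def)
    then show ?thesis using that Q by auto
  qed
  with r(1) show ?thesis using that by blast
qed

text \<open>In each coordinate v is the squared distance from q, smooth unlike the absolute value.
  The quotient of \<open>flat 0\<close> at r^2 - v by the sum with \<open>flat 0\<close> at v -
  (r/2)^2 is the usual step from 1 to 0; its denominator is positive because r/2 < r.\<close>

lemma bump_function:
  assumes "r > 0"
  obtains \<beta> where "!!V. openin (Euclidean_space n) V ==> smooth_fun n V \<beta>" "!!x. 0 \<le> \<beta> x"
    "!!x. x \<in> espace n ==> x \<notin> closed_box n q r ==> \<beta> x = 0"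
    "!!x. x \<in> closed_box n q (r / 2) ==> \<beta> x = 1"
proof
  define v where "v i x = (x i - q i) * (x i - q i)" for i and x :: "nat => real"
  let ?d = "\<lambda>i x. flat 0 (r\<^sup>2 - v i x) + flat 0 (v i x - (r / 2)\<^sup>2)"
  define \<beta> where "\<beta> x = (\<Prod>i<n. flat 0 (r\<^sup>2 - v i x) * inverse (?d i x))" for x
  have fl: "flat 0 t \<ge> 0" "flat 0 t > 0 \<longleftrightarrow> t > 0" "t \<le> 0 ==> flat 0 t = 0" for t by (auto simp: flat_def)
  have "(r / 2)\<^sup>2 < r\<^sup>2" using assms by (simp add: power_divide)
  then have pos: "?d i x > 0" for i x
    using fl(1)[of "r\<^sup>2 - v i x"] fl(1)[of "v i x - (r / 2)\<^sup>2"] fl(2)[of "r\<^sup>2 - v i x"] fl(2)[of "v i x - (r / 2)\<^sup>2"]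
    by (cases "v i x < r\<^sup>2") (auto intro: add_pos_nonneg add_nonneg_pos)
  show "smooth_fun n V \<beta>" if "openin (Euclidean_space n) V" for V
  proof -
    interpret coord_domain n V using that by unfold_locales
    have v: "smooth_fun n V (v i)" for i
      unfolding v_def by (intro smooth_mult smooth_diff smooth_coordinate smooth_const)
    show ?thesis unfolding \<beta>_def
      using pos by (intro smooth_prod smooth_mult smooth_inverse smooth_add smooth_flat smooth_diff v smooth_const) (metis less_irrefl)
  qed
  show "0 \<le> \<beta> x" for x unfolding \<beta>_def
    using pos fl(1) by (intro prod_nonneg) (auto intro!: mult_nonneg_nonneg simp: less_imp_le)
  show "\<beta> x = 0" if "x \<in> espace n" "x \<notin> closed_box n q r" for x
  proof -
    have "\<not> (\<forall>i<n. \<bar>x i - q i\<bar> \<le> r)" using that by simp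
    then obtain i where i: "i < n" "\<bar>x i - q i\<bar> > r" by (meson not_le)
    then have "r\<^sup>2 \<le> \<bar>x i - q i\<bar>\<^sup>2" using assms by (intro power_mono) auto
    then have "flat 0 (r\<^sup>2 - v i x) = 0" by (intro fl) (simp add: v_def power2_eq_square flip: abs_mult)
    then show ?thesis using i by (auto simp: \<beta>_def)
  qed
  show "\<beta> x = 1" if "x \<in> closed_box n q (r / 2)" for x
    unfolding \<beta>_def
  proof (rule prod.neutral, intro ballI)
    fix i assume "i \<in> {..<n}"
    then have "\<bar>x i - q i\<bar>\<^sup>2 \<le> (r / 2)\<^sup>2" using that by (intro power_mono) auto
    then have z: "flat 0 (v i x - (r / 2)\<^sup>2) = 0" by (intro fl) (simp add: v_def power2_eq_square flip: abs_mult)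
    show "flat 0 (r\<^sup>2 - v i x) * inverse (?d i x) = 1" using pos[of i x] unfolding z by simp
  qed
qed

subsection \<open>Symmetry of second derivatives\<close>

text \<open>Schwarz's argument: by the mean value theorem, applied twice in either order, the second
  difference over a square of side t is t^2 times a value of either mixed derivative near the
  corner. Continuity makes the two values agree in the limit.\<close>

lemma mixed_partials_eq:
  fixes F :: "real => real => real"
  assumes "\<delta> > 0"
    and d: "!!a b. \<bar>a - a0\<bar> < \<delta> ==> \<bar>b - b0\<bar> < \<delta> ==> ((\<lambda>a. F a b) has_real_derivative Fa a b) (at a)"
      "!!a b. \<bar>a - a0\<bar> < \<delta> ==> \<bar>b - b0\<bar> < \<delta> ==> ((\<lambda>b. F a b) has_real_derivative Fb a b) (at b)"
      "!!a b. \<bar>a - a0\<bar> < \<delta> ==> \<bar>b - b0\<bar> < \<delta> ==> ((\<lambda>b. Fa a b) has_real_derivative Fab a b) (at b)"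
      "!!a b. \<bar>a - a0\<bar> < \<delta> ==> \<bar>b - b0\<bar> < \<delta> ==> ((\<lambda>a. Fb a b) has_real_derivative Fba a b) (at a)"
    and c: "isCont (\<lambda>p. Fab (fst p) (snd p)) (a0, b0)" "isCont (\<lambda>p. Fba (fst p) (snd p)) (a0, b0)"
  shows "Fab a0 b0 = Fba a0 b0"
proof (rule ccontr)
  assume ne: "Fab a0 b0 \<noteq> Fba a0 b0"
  define e where "e = \<bar>Fab a0 b0 - Fba a0 b0\<bar> / 2"
  have e: "e > 0" using ne by (simp add: e_def)
  obtain r1 where r1: "r1 > 0" "!!p. dist p (a0, b0) < r1 ==> \<bar>Fab (fst p) (snd p) - Fab a0 b0\<bar> < e"
    using c(1) e unfolding continuous_at_eps_delta by (force simp: dist_real_def)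
  obtain r2 where r2: "r2 > 0" "!!p. dist p (a0, b0) < r2 ==> \<bar>Fba (fst p) (snd p) - Fba a0 b0\<bar> < e"
    using c(2) e unfolding continuous_at_eps_delta by (force simp: dist_real_def)
  \<comment> \<open>The distance from the corner is below 2 * t, so a third of the radii leaves
    room.\<close>
  define t where "t = min \<delta> (min r1 r2) / 3"
  have t: "t > 0" "t < \<delta>" "2 * t < r1" "2 * t < r2" using assms(1) r1 r2 by (auto simp: t_def)
  have near: "dist (z, y) (a0, b0) < r1" "dist (z, y) (a0, b0) < r2" if "a0 < z" "z < a0 + t" "b0 < y" "y < b0 + t" for z y
  proof -
    have "dist (z, y) (a0, b0) \<le> \<bar>z - a0\<bar> + \<bar>y - b0\<bar>"
      unfolding dist_prod_def by (rule order_trans[OF sqrt_sum_squares_le_sum_abs]) (auto simp: dist_real_def)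
    then show "dist (z, y) (a0, b0) < r1" "dist (z, y) (a0, b0) < r2" using that t by auto
  qed
  let ?S = "F (a0 + t) (b0 + t) - F (a0 + t) b0 - (F a0 (b0 + t) - F a0 b0)"
  have mvt: "\<exists>z>a. z < a + t \<and> f (a + t) - f a = t * f' z"
    if "!!x. a \<le> x ==> x \<le> a + t ==> (f has_real_derivative f' x) (at x)" for f f' :: "real => real" and a
    using MVT2[of a "a + t" f f'] that t(1) by auto
  obtain z where z: "a0 < z" "z < a0 + t" "?S = t * (Fa z (b0 + t) - Fa z b0)"
    using mvt[of a0 "\<lambda>a. F a (b0 + t) - F a b0" "\<lambda>a. Fa a (b0 + t) - Fa a b0", OF DERIV_diff[OF d(1) d(1)]] t by auto
  obtain y where y: "b0 < y" "y < b0 + t" "Fa z (b0 + t) - Fa z b0 = t * Fab z y"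
    using mvt[of b0 "\<lambda>b. Fa z b" "\<lambda>b. Fab z b", OF d(3)] t z by auto
  obtain y' where y': "b0 < y'" "y' < b0 + t"
    "F (a0 + t) (b0 + t) - F a0 (b0 + t) - (F (a0 + t) b0 - F a0 b0) = t * (Fb (a0 + t) y' - Fb a0 y')"
    using mvt[of b0 "\<lambda>b. F (a0 + t) b - F a0 b" "\<lambda>b. Fb (a0 + t) b - Fb a0 b", OF DERIV_diff[OF d(2) d(2)]] t by auto
  obtain z' where z': "a0 < z'" "z' < a0 + t" "Fb (a0 + t) y' - Fb a0 y' = t * Fba z' y'"
    using mvt[of a0 "\<lambda>a. Fb a y'" "\<lambda>a. Fba a y'", OF d(4)] t y' by auto
  have "t * (t * Fab z y) = t * (t * Fba z' y')" using z(3) y'(3) unfolding y(3) z'(3) by linarith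
  then have "Fab z y = Fba z' y'" using t by simp
  moreover have "\<bar>Fab z y - Fab a0 b0\<bar> < e" using r1(2)[OF near(1)] z y by auto
  moreover have "\<bar>Fba z' y' - Fba a0 b0\<bar> < e" using r2(2)[OF near(2)] z' y' by auto
  ultimately show False unfolding e_def by (smt (verit) field_sum_of_halves)
qed

context coord_domain
begin

text \<open>The previous lemma on the slice in which only coordinates i and j vary, inside a box
  contained in V.\<close>

lemma partial_commute:
  assumes g: "smooth_fun n V g" and i: "i < n" and j: "j < n" and x: "x \<in> V"
  shows "partial i (partial j g) x = partial j (partial i g) x"
proof (cases "i = j")
  case False
  obtain r where r: "r > 0" "closed_box n x r \<subseteq> V" using box_in_open[OF openV x] .
  define X where "X a b = x(i := a, j := b)" for a b
  have X: "X a b \<in> V" if "\<bar>a - x i\<bar> < r" "\<bar>b - x j\<bar> < r" for a b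
    using r(2) that r(1) x V_espace[OF x] i j by (auto simp: X_def subset_eq)
  have Xj: "(X a b)(j := s) = X a s" "X a b j = b" and Xi: "(X a b)(i := s) = X s b" "X a b i = a" for a b s
    using False by (auto simp: X_def)
  have cont: "isCont (\<lambda>p. h (X (fst p) (snd p))) (x i, x j)" if h: "smooth_fun n V h" for h
  proof -
    let ?B = "{p :: real \<times> real. \<bar>fst p - x i\<bar> < r \<and> \<bar>snd p - x j\<bar> < r}"
    have "open ?B" by (intro open_Collect_conj open_Collect_less continuous_intros)
    moreover have "continuous_on ?B (\<lambda>p. h (X (fst p) (snd p)))"
    proof (rule continuous_on_compose2[OF smooth_continuous[OF h]])
      show "continuous_on ?B (\<lambda>p. X (fst p) (snd p))"
        unfolding X_def by (intro continuous_on_update continuous_intros)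
    qed (use X in auto)
    ultimately show ?thesis using r(1) by (auto simp: continuous_on_eq_continuous_at)
  qed
  have dj: "((\<lambda>b. h (X a b)) has_real_derivative partial j h (X a b)) (at b)"
    and di: "((\<lambda>a. h (X a b)) has_real_derivative partial i h (X a b)) (at a)"
    if h: "smooth_fun n V h" and ab: "\<bar>a - x i\<bar> < r" "\<bar>b - x j\<bar> < r" for h a b
    using smooth_has_derivative[OF h j X[OF ab]] smooth_has_derivative[OF h i X[OF ab]] by (simp_all add: Xi Xj)
  have "partial j (partial i g) (X (x i) (x j)) = partial i (partial j g) (X (x i) (x j))"
    by (rule mixed_partials_eq[where F = "\<lambda>a b. g (X a b)" and Fa = "\<lambda>a b. partial i g (X a b)" and
          Fb = "\<lambda>a b. partial j g (X a b)", OF r(1)])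
      (auto intro!: di dj cont g smooth_partial i j)
  then show ?thesis by (simp add: X_def)
qed simp

end

subsection \<open>Hadamard's lemma\<close>

text \<open>g is the mean of \<open>partial i f\<close> over the segment that joins x to the
  hyperplane where coordinate i equals q i. A box contains these segments.\<close>

lemma hadamard:
  assumes q: "q \<in> espace n" and r: "r > 0" and i: "i < n" and f: "smooth_fun n (open_box n q r) f"
  obtains g where "smooth_fun n (open_box n q r) g" "smooth_fun n (open_box n q r) (\<lambda>x. f (x(i := q i)))"
    "!!x. x \<in> open_box n q r ==> f x = f (x(i := q i)) + (x i - q i) * g x"
proof
  let ?B = "open_box n q r"
  interpret coord_domain n ?B by unfold_locales (rule openin_open_box)
  define X where "X s x = x(i := q i + s * (x i - q i))" for s and x :: "nat => real"
  have X: "X s x \<in> ?B" if "x \<in> ?B" "0 \<le> s" "s \<le> 1" for s x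
  proof -
    have "\<bar>s * (x i - q i)\<bar> \<le> 1 * \<bar>x i - q i\<bar>" unfolding abs_mult using that by (intro mult_right_mono) auto
    moreover have "\<bar>x i - q i\<bar> < r" using that i by auto
    ultimately show ?thesis using that i by (auto simp: X_def)
  qed
  \<comment> \<open>Differentiation in direction i brings out one more factor s, in the other
    directions none. With the weights s^k the integrals form a class to which
    \<open>smooth_coinduct\<close> applies.\<close>
  define G where "G k h x = integral {0..1} (\<lambda>s. s ^ k * h (X s x))" for k :: nat and h :: "(nat => real) => real" and x
  have cX: "continuous_on (U \<times> {0..1}) (\<lambda>(u, s). X s (Y u))" if "continuous_on U Y" for U :: "'z::topological_space set" and Y
  proof -
    have c: "continuous_on (U \<times> {0..1::real}) (\<lambda>p. Y (fst p))"
      by (rule continuous_on_compose2[OF that continuous_on_fst[OF continuous_on_id]]) auto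
    show ?thesis
      unfolding X_def split_beta
      by (intro continuous_on_update c continuous_intros continuous_on_product_then_coordinatewise[OF c])
  qed
  have ch: "continuous_on (U \<times> {0..1}) (\<lambda>(u, s). s ^ k * h (X s (Y u)))"
    if "continuous_on U Y" "!!u. u \<in> U ==> Y u \<in> ?B" "smooth_fun n ?B h" for U :: "'z::topological_space set" and Y h k
  proof -
    have "continuous_on (U \<times> {0..1}) (\<lambda>p. h (X (snd p) (Y (fst p))))"
      by (rule continuous_on_compose2[OF smooth_continuous[OF that(3)]])
        (use cX[OF that(1)] X that(2) in \<open>auto simp: split_beta\<close>)
    then show ?thesis unfolding split_beta by (intro continuous_intros)
  qed
  have ci: "continuous_on {0..1} (\<lambda>s. s ^ k * h (X s x))" if "x \<in> ?B" "smooth_fun n ?B h" for k h x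
  proof -
    have "continuous_on {0..1} (\<lambda>s. (\<lambda>(u, s). s ^ k * h (X s ((\<lambda>_. x) u))) (0::real, s))"
      by (rule continuous_on_compose2[OF ch[of UNIV "\<lambda>_::real. x"]]) (use that in \<open>auto intro!: continuous_intros\<close>)
    then show ?thesis by simp
  qed
  have dG: "((\<lambda>u. G k h (x(j := u))) has_real_derivative G (if j = i then k + 1 else k) (partial j h) x) (at (x j))"
    if h: "smooth_fun n ?B h" and x: "x \<in> ?B" and j: "j < n" for h k j x
  proof -
    let ?U = "{q j - r<..<q j + r}" and ?k = "if j = i then k + 1 else k"
    have xU: "x(j := u) \<in> ?B" if "u \<in> ?U" for u using x that j by (auto simp: abs_less_iff)
    have xj: "x j \<in> ?U" using x j by (auto simp: abs_less_iff)
    have "((\<lambda>u. integral (cbox 0 1) (\<lambda>s. s ^ k * h (X s (x(j := u))))) has_real_derivative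
        integral (cbox 0 1) (\<lambda>s. s ^ ?k * partial j h (X s (x(j := x j))))) (at (x j) within ?U)"
    proof (rule leibniz_rule_field_derivative)
      fix u s :: real assume u: "u \<in> ?U" and s: "s \<in> cbox 0 1"
      have XB: "X s (x(j := u)) \<in> ?B" using X[OF xU[OF u]] s by simp
      note D = smooth_has_derivative[OF h j XB]
      show "((\<lambda>u. s ^ k * h (X s (x(j := u)))) has_real_derivative s ^ ?k * partial j h (X s (x(j := u)))) (at u within ?U)"
      proof (cases "j = i")
        case True
        have "((\<lambda>u. h (X s (x(j := u)))) has_real_derivative partial j h (X s (x(j := u))) * s) (at u)"
        proof -
          have D': "((\<lambda>t. h (x(i := t))) has_real_derivative partial j h (X s (x(j := u)))) (at (q i + s * (u - q i)))"
            using D by (simp add: True X_def)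
          have "((\<lambda>u. q i + s * (u - q i)) has_real_derivative s) (at u)"
            by (auto intro!: derivative_eq_intros)
          with D' have "((\<lambda>u. h (x(i := q i + s * (u - q i)))) has_real_derivative partial j h (X s (x(j := u))) * s) (at u)"
            by (rule DERIV_chain2)
          then show ?thesis by (simp add: True X_def)
        qed
        then have "((\<lambda>u. s ^ k * h (X s (x(j := u)))) has_real_derivative s ^ k * (partial j h (X s (x(j := u))) * s)) (at u)"
          by (rule DERIV_cmult)
        then show ?thesis using True by (auto intro!: has_field_derivative_at_within simp: mult_ac)
      next
        case False
        have e: "X s (x(j := u')) = (X s (x(j := u)))(j := u')" "X s (x(j := u)) j = u" for u'
          using False by (auto simp: X_def fun_eq_iff)
        have "((\<lambda>u'. h (X s (x(j := u')))) has_real_derivative partial j h (X s (x(j := u)))) (at u)"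
          using D by (simp add: e(2)) (simp flip: e(1))
        then show ?thesis using False by (auto intro!: has_field_derivative_at_within DERIV_cmult)
      qed
    next
      fix u assume "u \<in> ?U"
      then show "(\<lambda>s. s ^ k * h (X s (x(j := u)))) integrable_on cbox 0 1"
        using ci[OF xU h] by (auto intro!: integrable_continuous_real simp: cbox_interval)
    next
      have "continuous_on (?U \<times> {0..1}) (\<lambda>(u, s). s ^ ?k * partial j h (X s (x(j := u))))"
        by (rule ch) (intro continuous_on_update continuous_intros, erule xU, intro smooth_partial h j)
      then show "continuous_on (?U \<times> cbox 0 1) (\<lambda>(u, s). s ^ ?k * partial j h (X s (x(j := u))))" by simp
    qed (use xj in auto)
    then show ?thesis
      unfolding G_def using at_within_open[OF xj] by simp
  qed
  have sG: "smooth_fun n ?B (G k h)" if "smooth_fun n ?B h" for k h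
  proof (rule smooth_coinduct[of "{G k h | k h. smooth_fun n ?B h}"])
    fix g assume "g \<in> {G k h | k h. smooth_fun n ?B h}"
    then obtain k h where g: "g = G k h" "smooth_fun n ?B h" by auto
    have "continuous_on ?B (\<lambda>x. integral (cbox 0 1) (\<lambda>s. s ^ k * h (X s x)))"
      by (rule integral_continuous_on_param) (use ch[of ?B "\<lambda>x. x" h k] g in auto)
    then show "continuous_on ?B g" by (simp add: g G_def)
    fix j assume j: "j < n"
    show "\<exists>h\<in>{G k h | k h. smooth_fun n ?B h}. \<forall>x\<in>?B. ((\<lambda>s. g (x(j := s))) has_real_derivative h x) (at (x j))"
      using dG[OF g(2) _ j] smooth_partial[OF g(2) j] unfolding g(1)
      by (intro bexI[of _ "G (if j = i then k + 1 else k) (partial j h)"]) auto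
  qed (use that in auto)
  show g: "smooth_fun n ?B (G 0 (partial i f))" by (intro sG smooth_partial f i)
  show eq: "f x = f (x(i := q i)) + (x i - q i) * G 0 (partial i f) x" if x: "x \<in> ?B" for x
  proof -
    have "((\<lambda>s. f (X s x)) has_vector_derivative (x i - q i) * partial i f (X s x)) (at s within {0..1})" if "s \<in> {0..1}" for s
    proof -
      have D: "((\<lambda>t. f ((X s x)(i := t))) has_real_derivative partial i f (X s x)) (at (X s x i))"
        using smooth_has_derivative[OF f i X[OF x]] that by auto
      have "((\<lambda>s. f (X s x)) has_real_derivative partial i f (X s x) * (x i - q i)) (at s)"
      proof -
        have D': "((\<lambda>t. f (x(i := t))) has_real_derivative partial i f (X s x)) (at (q i + s * (x i - q i)))"
          using D by (simp add: X_def)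
        have "((\<lambda>s. q i + s * (x i - q i)) has_real_derivative (x i - q i)) (at s)"
          by (auto intro!: derivative_eq_intros)
        with D' have "((\<lambda>s. f (x(i := q i + s * (x i - q i)))) has_real_derivative partial i f (X s x) * (x i - q i)) (at s)"
          by (rule DERIV_chain2)
        then show ?thesis by (simp add: X_def)
      qed
      then show ?thesis
        by (auto simp: has_real_derivative_iff_has_vector_derivative mult.commute intro: has_vector_derivative_at_within)
    qed
    then have "((\<lambda>s. (x i - q i) * partial i f (X s x)) has_integral f (X 1 x) - f (X 0 x)) {0..1}"
      by (intro fundamental_theorem_of_calculus) auto
    then have "f (X 1 x) - f (X 0 x) = integral {0..1} (\<lambda>s. (x i - q i) * partial i f (X s x))"
      by (rule integral_unique[symmetric])
    also have "\<dots> = (x i - q i) * G 0 (partial i f) x" by (simp add: G_def)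
    finally show ?thesis by (simp add: X_def)
  qed
  \<comment> \<open>Read off from the identity just proved, whose other terms are smooth.\<close>
  show "smooth_fun n ?B (\<lambda>x. f (x(i := q i)))"
  proof (rule smooth_cong[OF smooth_diff[OF f smooth_mult[OF smooth_diff[OF smooth_coordinate[of i] smooth_const[of "q i"]] g]]])
    fix x assume "x \<in> ?B"
    from eq[OF this] show "f (x(i := q i)) = f x - (x i - q i) * G 0 (partial i f) x" by simp
  qed
qed

section \<open>Superfunctions\<close>

declare plus_fun_apply [simp del] times_fun_apply [simp del] zero_fun_apply [simp del] one_fun_apply [simp del]
  minus_apply [simp del] uminus_apply [simp del]

lemma sscale_apply: "(r *\<^sub>S f) x = r *\<^sub>R f x"
  by (simp add: sscale_def)

lemma sum_sfun_apply: "(\<Sum>a\<in>A. f a) x = (\<Sum>a\<in>A. f a x :: grassmann)" for f :: "'z => sfun"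
  by (induction A rule: infinite_finite_induct) (simp_all add: plus_fun_apply zero_fun_apply)

lemma power_sfun_apply: "(f ^ k) x = f x ^ k" for f :: sfun
  by (induction k) (simp_all add: times_fun_apply one_fun_apply)

lemmas sfun_apply = plus_fun_apply times_fun_apply zero_fun_apply one_fun_apply minus_apply uminus_apply
  sscale_apply sum_sfun_apply power_sfun_apply

lemma sscale_simps: "r *\<^sub>S (f + g) = r *\<^sub>S f + r *\<^sub>S g" "(r + s) *\<^sub>S f = r *\<^sub>S f + s *\<^sub>S f"
  "r *\<^sub>S s *\<^sub>S f = (r * s) *\<^sub>S f" "1 *\<^sub>S f = f" "r *\<^sub>S 0 = 0" "0 *\<^sub>S f = 0"
  "(r *\<^sub>S f) * g = r *\<^sub>S (f * g)" "f * (r *\<^sub>S g) = r *\<^sub>S (f * g)" "r *\<^sub>S (- f) = - (r *\<^sub>S f)"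
  "r *\<^sub>S (f - g) = r *\<^sub>S f - r *\<^sub>S g"
  by (auto simp: fun_eq_iff algebra_simps sfun_apply)

lemma sscale_sum: "r *\<^sub>S (\<Sum>a\<in>A. f a) = (\<Sum>a\<in>A. r *\<^sub>S f a)"
  by (rule ext) (simp add: sfun_apply scaleR_sum_right)

lemma minus_one_power_sfun_apply: "((-1) ^ k * f) x = (-1) ^ k * (f x :: grassmann)" for f :: sfun
  by (simp add: sfun_apply)

lemma srestrict_simps [simp]:
  "srestrict V (f + g) = srestrict V f + srestrict V g" "srestrict V (f - g) = srestrict V f - srestrict V g"
  "srestrict V (f * g) = srestrict V f * srestrict V g" "srestrict V (r *\<^sub>S f) = r *\<^sub>S srestrict V f"
  "srestrict V 0 = 0" "srestrict V (- f) = - srestrict V f"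
  by (auto simp: srestrict_def fun_eq_iff sfun_apply)

lemma srestrict_srestrict: "srestrict V (srestrict U f) = srestrict (V \<inter> U) f"
  by (auto simp: srestrict_def fun_eq_iff)

lemma srestrict_sum: "srestrict V (\<Sum>a\<in>A. f a) = (\<Sum>a\<in>A. srestrict V (f a))"
  by (rule ext) (simp add: srestrict_def sfun_apply)

lemma srestrict_apply: "x \<in> V ==> srestrict V f x = f x"
  by (simp add: srestrict_def)

lemma srestrict_eq_iff: "srestrict V f = srestrict V g \<longleftrightarrow> (\<forall>x\<in>V. f x = g x)"
  by (auto simp: srestrict_def fun_eq_iff)

lemma sparity_0 [simp]: "sparity p 0"
  and sparity_add: "sparity p f ==> sparity p g ==> sparity p (f + g)"
  and sparity_diff: "sparity p f ==> sparity p g ==> sparity p (f - g)"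
  and sparity_mult: "sparity p f ==> sparity q g ==> sparity (p + q) (f * g)"
  and sparity_scale: "sparity p f ==> sparity p (r *\<^sub>S f)"
  and sparity_restrict: "sparity p f ==> sparity p (srestrict V f)"
  and sparity_cong: "even (p + q) ==> sparity p f ==> sparity q f"
  and sparity_uminus: "sparity p f ==> sparity p (- f)"
  and sparity_one: "sparity 0 (srestrict V 1)"
  by (auto simp: sparity_def srestrict_def sfun_apply
      intro: gparity_add gparity_diff gparity_mult gparity_scaleR gparity_cong gparity_uminus)

lemma sparity_mult_cong: "sparity p f ==> sparity q g ==> even (p + q + r) ==> sparity r (f * g)"
  using sparity_mult sparity_cong by blast

lemma sparity_sum: "(!!a. a \<in> A ==> sparity p (f a)) ==> sparity p (\<Sum>a\<in>A. f a)"
  by (auto simp: sparity_def sfun_apply intro: gparity_sum)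

lemma sfun_supercommute:
  assumes "sparity p f" "sparity q g" shows "f * g = (-1) ^ (p * q) * (g * f)"
proof (rule ext)
  fix x
  have "f x * g x = (-1) ^ (p * q) * (g x * f x)"
    by (rule grassmann_supercommute) (use assms in \<open>auto simp: sparity_def\<close>)
  then show "(f * g) x = ((-1) ^ (p * q) * (g * f)) x" by (metis minus_one_power_sfun_apply times_fun_apply)
qed

lemma sfun_even_commute: "sparity 0 f ==> f * g = g * (f :: sfun)"
  by (rule ext) (simp add: sparity_def sfun_apply grassmann_even_commute[of "f _"])

definition spart :: "nat => sfun => sfun" where
  "spart q f = (\<lambda>x. gpart q (f x))"

lemma sparity_spart: "sparity q (spart q f)" and spart_sum: "f = spart 0 f + spart 1 f"
  and spart_add: "spart q (f + g) = spart q f + spart q g" and spart_0 [simp]: "spart q 0 = 0"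
  unfolding sparity_def spart_def fun_eq_iff sfun_apply
  by (simp_all only: gparity_gpart gpart_add gpart_0 simp_thms) (use gpart_sum in simp)

lemma spart_same: "sparity p f ==> spart q f = (if even (p + q) then f else 0)"
  by (rule ext) (simp add: sparity_def spart_def gpart_same[of p "f _"] sfun_apply)

lemma spart_mult_right: "sparity p h ==> spart q (g * h) = spart (q + p) g * h"
  by (rule ext) (simp add: sparity_def spart_def gpart_mult_right[of p] sfun_apply)

lemma spart_sum_left: "spart q (\<Sum>a\<in>A. f a) = (\<Sum>a\<in>A. spart q (f a))"
proof -
  have "gpart q (\<Sum>a\<in>A. g a) = (\<Sum>a\<in>A. gpart q (g a))" for g :: "'a => grassmann"
    by (induction A rule: infinite_finite_induct) (auto simp: gpart_add)
  then show ?thesis by (simp add: spart_def fun_eq_iff sfun_apply)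
qed

lemma spart_scale: "spart q (r *\<^sub>S f) = r *\<^sub>S spart q f"
  by (auto simp: spart_def fun_eq_iff sfun_apply intro!: grassmann_eqI)

section \<open>Superfunctions on a coordinate domain\<close>

locale superdomain = coord_domain +
  fixes m :: nat
begin

abbreviation S :: "sfun set" where "S \<equiv> superfunctions n m V"
abbreviation L :: "nat set" where "L \<equiv> {n..<n + m}"

sublocale nilpotent_grassmann m L
  by unfold_locales auto

text \<open>Membership in \<open>S\<close> without the condition of vanishing outside V.
  Intermediate expressions such as constants or powers of a body do not vanish there, and only their
  values on V matter.\<close>

definition sloc :: "sfun => bool" where
  "sloc f \<longleftrightarrow> (\<forall>x\<in>V. gsupp L (f x)) \<and> (\<forall>I. smooth_fun n V (\<lambda>x. gcoeff (f x) I))"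

lemma S_iff: "f \<in> S \<longleftrightarrow> (\<forall>x. x \<notin> V \<longrightarrow> f x = 0) \<and> sloc f"
proof -
  have 1: "f \<in> S \<longleftrightarrow> (\<forall>x. x \<notin> V \<longrightarrow> f x = 0) \<and> (\<forall>x. gsupp L (f x)) \<and> (\<forall>I. smooth_fun n V (\<lambda>x. gcoeff (f x) I))"
    by (simp add: superfunctions_def gsupp_def)
  have 2: "(\<forall>x. gsupp L (f x)) \<longleftrightarrow> (\<forall>x\<in>V. gsupp L (f x))" if "\<forall>x. x \<notin> V \<longrightarrow> f x = 0"
    using that by (metis gsupp_0)
  show ?thesis unfolding 1 sloc_def using 2 by blast
qed

lemma S_outside: "f \<in> S ==> x \<notin> V ==> f x = 0" and S_sloc: "f \<in> S ==> sloc f"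
  by (auto simp: S_iff)

lemma S_supp: "f \<in> S ==> gsupp L (f x)"
  by (auto simp: superfunctions_def gsupp_def)

lemma sloc_supp: "sloc f ==> x \<in> V ==> gsupp L (f x)" and sloc_smooth: "sloc f ==> smooth_fun n V (\<lambda>x. gcoeff (f x) I)"
  by (auto simp: sloc_def)

lemma S_restrict: "f \<in> S ==> srestrict V f = f"
  by (auto simp: S_iff srestrict_def fun_eq_iff)

lemma sloc_cong: "sloc f ==> (!!x. x \<in> V ==> f x = g x) ==> sloc g"
  unfolding sloc_def using smooth_cong by (metis (mono_tags, lifting))

lemma srestrict_S: "srestrict V f \<in> S \<longleftrightarrow> sloc f"
proof
  assume "srestrict V f \<in> S"
  then show "sloc f" by (rule sloc_cong[OF S_sloc]) (simp add: srestrict_def)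
next
  assume "sloc f"
  then have "sloc (srestrict V f)" by (rule sloc_cong) (auto simp: srestrict_def)
  then show "srestrict V f \<in> S" by (auto simp: S_iff srestrict_def)
qed

lemma sloc_add: "sloc f ==> sloc g ==> sloc (\<lambda>x. f x + g x)"
  by (auto simp: sloc_def intro: gsupp_add smooth_add)
lemma sloc_diff: "sloc f ==> sloc g ==> sloc (\<lambda>x. f x - g x)"
  by (auto simp: sloc_def intro: gsupp_diff smooth_diff)
lemma sloc_const: "gsupp L c ==> sloc (\<lambda>x. c)"
  by (auto simp: sloc_def intro: smooth_const)
lemma sloc_real_mult: "smooth_fun n V g ==> sloc f ==> sloc (\<lambda>x. g x *\<^sub>R f x)"
  by (auto simp: sloc_def intro: gsupp_scaleR smooth_mult)
lemma sloc_mult: "sloc f ==> sloc g ==> sloc (\<lambda>x. f x * g x)"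
proof -
  assume a: "sloc f" "sloc g"
  have "smooth_fun n V (\<lambda>x. gcoeff (f x * g x) I)" for I
  proof (cases "finite I")
    case True
    show ?thesis unfolding gcoeff_mult[OF True]
      by (intro smooth_sum smooth_mult smooth_const sloc_smooth a)
  qed (simp add: gcoeff_infinite smooth_const)
  then show ?thesis using a by (auto simp: sloc_def intro: gsupp_mult)
qed
lemma sloc_power: "sloc f ==> sloc (\<lambda>x. f x ^ k)"
  by (induction k) (auto intro: sloc_const sloc_mult)
lemma sloc_sum: "(!!a. a \<in> A ==> sloc (f a)) ==> sloc (\<lambda>x. \<Sum>a\<in>A. f a x)"
  by (induction A rule: infinite_finite_induct) (auto intro: sloc_const sloc_add)
lemma sloc_of_real: "smooth_fun n V g ==> sloc (\<lambda>x. of_real (g x))"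
  unfolding of_real_def by (intro sloc_real_mult sloc_const) auto
lemma sloc_body: "sloc f ==> smooth_fun n V (\<lambda>x. gbody (f x))"
  by (simp add: gbody_def sloc_smooth)

lemma S_0 [simp]: "0 \<in> S"
  using sloc_const[of 0] by (simp add: S_iff zero_fun_def)
lemma S_add: "f \<in> S ==> g \<in> S ==> f + g \<in> S" and S_diff: "f \<in> S ==> g \<in> S ==> f - g \<in> S"
  and S_scale: "f \<in> S ==> r *\<^sub>S f \<in> S" and S_mult: "f \<in> S ==> g \<in> S ==> f * g \<in> S"
  using sloc_add[of f g] sloc_diff[of f g] sloc_mult[of f g] sloc_real_mult[OF smooth_const, of f r]
  by (auto simp: S_iff plus_fun_def fun_diff_def times_fun_def sscale_def)
lemma S_uminus: "f \<in> S ==> - f \<in> S"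
  using S_scale[of f "-1"] by (simp add: sscale_def fun_Compl_def)
lemma S_sign: "f \<in> S ==> (-1) ^ k * f \<in> S"
  by (cases "even k") (simp_all add: S_uminus)
lemma S_sum: "(!!a. a \<in> A ==> f a \<in> S) ==> (\<Sum>a\<in>A. f a) \<in> S"
  by (induction A rule: infinite_finite_induct) (auto intro: S_add)
lemma S_one: "srestrict V 1 \<in> S"
  unfolding srestrict_S one_fun_def by (rule sloc_const) simp
lemma S_one_mult: "f \<in> S ==> srestrict V 1 * f = f" "f \<in> S ==> f * srestrict V 1 = f"
  by (auto simp: S_iff srestrict_def fun_eq_iff sfun_apply)
lemma S_part: "f \<in> S ==> spart q f \<in> S"
proof -
  assume f: "f \<in> S"
  have "smooth_fun n V (\<lambda>x. gcoeff (gpart q (f x)) I)" for I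
    using sloc_smooth[OF S_sloc[OF f], of I] by (cases "even (card I + q)") (simp_all add: smooth_const)
  then show ?thesis
    using f unfolding S_iff sloc_def spart_def by (auto simp: gsupp_def)
qed
lemma S_gsign: "f \<in> S ==> (\<lambda>x. gsign k (f x)) \<in> S"
  unfolding S_iff sloc_def
  by (auto simp: gsupp_def smooth_cmult)
lemma S_scoord: "a < n + m ==> scoord n V a \<in> S"
  unfolding scoord_def srestrict_S
  by (cases "a < n") (auto intro!: sloc_of_real smooth_coordinate sloc_const gsupp_ggen)

lemma sloc_powr:
  assumes f: "sloc f" and nz: "!!x. x \<in> V ==> gbody (f x) \<noteq> 0"
  shows "sloc (\<lambda>x. gabs_powr m (f x) w)"
proof -
  note b = sloc_body[OF f]
  show ?thesis unfolding gabs_powr_def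
    by (intro sloc_real_mult[OF smooth_powr[OF b nz]] sloc_sum sloc_real_mult[OF smooth_const] sloc_power
        sloc_real_mult[OF smooth_inverse[OF b nz], unfolded inverse_eq_divide] sloc_diff f sloc_of_real b)
qed

lemma S_powr:
  "sloc f ==> (!!x. x \<in> V ==> gbody (f x) \<noteq> 0) ==> srestrict V (\<lambda>x. gabs_powr m (f x) w) \<in> S"
  by (simp add: srestrict_S sloc_powr)

subsection \<open>Derivatives\<close>

abbreviation d :: "nat => sfun => sfun" where "d a \<equiv> sderiv n V a"

lemma d_even_coeff: "a < n ==> x \<in> V ==> gcoeff (d a f x) I = partial a (\<lambda>y. gcoeff (f y) I) x"
  by (simp add: sderiv_def srestrict_def gcoeff_of gcoeff_infinite)
lemma d_odd: "n \<le> a ==> x \<in> V ==> d a f x = gderiv a (f x)"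
  by (simp add: sderiv_def srestrict_def)
lemma d_outside: "x \<notin> V ==> d a f x = 0"
  by (simp add: sderiv_def srestrict_def)

lemma d_sloc:
  assumes f: "sloc f" and a: "a < n + m" shows "d a f \<in> S"
proof -
  have "sloc (d a f)"
  proof (cases "a < n")
    case True
    have "gsupp L (d a f x)" if x: "x \<in> V" for x
      unfolding gsupp_iff
    proof (intro allI impI)
      fix I assume "\<not> I \<subseteq> L"
      then have "gcoeff (f y) I = 0" if "y \<in> V" for y using sloc_supp[OF f that] by (auto simp: gsupp_iff)
      then have "partial a (\<lambda>y. gcoeff (f y) I) x = partial a (\<lambda>y. 0) x"
        by (intro partial_cong[OF _ True x])
      then show "gcoeff (d a f x) I = 0" by (simp add: d_even_coeff[OF True x])
    qed
    moreover have "smooth_fun n V (\<lambda>x. gcoeff (d a f x) I)" for I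
      by (rule smooth_cong[OF smooth_partial[OF sloc_smooth[OF f, of I] True]]) (rule d_even_coeff[OF True])
    ultimately show ?thesis by (simp add: sloc_def)
  next
    case False
    have "smooth_fun n V (\<lambda>x. gcoeff (gderiv a (f x)) I)" for I
      unfolding gcoeff_gderiv
      by (cases "finite I \<and> a \<notin> I") (simp_all add: smooth_const smooth_cmult sloc_smooth[OF f] cong: conj_cong)
    then have "sloc (\<lambda>x. gderiv a (f x))" using f by (auto simp: sloc_def intro: gsupp_gderiv)
    then show ?thesis using False by (rule_tac sloc_cong) (auto simp: d_odd)
  qed
  then show ?thesis by (simp add: S_iff d_outside)
qed

lemma d_S: "f \<in> S ==> a < n + m ==> d a f \<in> S"
  by (simp add: d_sloc S_sloc)

lemma d_cong: "(!!x. x \<in> V ==> f x = g x) ==> d a f = d a g"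
  unfolding sderiv_def srestrict_eq_iff
  by (auto intro!: arg_cong[where f = grassmann_of] ext partial_cong)

lemma d_add:
  assumes "sloc f" "sloc g" shows "d a (\<lambda>x. f x + g x) = d a f + d a g"
proof (rule ext)
  fix x
  show "d a (\<lambda>x. f x + g x) x = (d a f + d a g) x"
  proof (cases "x \<in> V")
    case True
    show ?thesis
    proof (cases "a < n")
      case a: True
      show ?thesis
        by (rule grassmann_eqI) (use partial_add[OF sloc_smooth[OF assms(1)] sloc_smooth[OF assms(2)] a True] in
            \<open>simp add: d_even_coeff[OF a True] sfun_apply\<close>)
    qed (use True in \<open>simp add: d_odd gderiv_add sfun_apply\<close>)
  qed (simp add: d_outside sfun_apply)
qed

text \<open>For an odd coordinate this is \<open>gderiv_mult\<close>; for an even one the Leibniz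
  rule is applied to every term of the coefficient formula. \<open>gsign\<close> allows
  \<open>f\<close> without definite parity.\<close>

lemma d_mult_sloc:
  assumes f: "sloc f" and g: "sloc g" shows "d a (\<lambda>x. f x * g x) = d a f * g + (\<lambda>x. gsign (spar n a) (f x)) * d a g"
proof (rule ext)
  fix x
  show "d a (\<lambda>x. f x * g x) x = (d a f * g + (\<lambda>x. gsign (spar n a) (f x)) * d a g) x"
  proof (cases "x \<in> V")
    case x: True
    show ?thesis
    proof (cases "a < n")
      case a: True
      have s0: "gsign 0 h = h" for h by (rule grassmann_eqI) simp
      show ?thesis
      proof (rule grassmann_eqI)
        fix I :: "nat set" assume I: "finite I"
        have "gcoeff (d a (\<lambda>x. f x * g x) x) I =
            partial a (\<lambda>y. \<Sum>J\<in>Pow I. ((-1) ^ inversions J (I - J) * gcoeff (f y) J) * gcoeff (g y) (I - J)) x"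
          by (simp add: d_even_coeff[OF a x] gcoeff_mult[OF I])
        also have "\<dots> = (\<Sum>J\<in>Pow I. partial a (\<lambda>y. ((-1) ^ inversions J (I - J) * gcoeff (f y) J) * gcoeff (g y) (I - J)) x)"
          using I by (intro partial_sum smooth_mult smooth_const sloc_smooth f g a x) auto
        also have "\<dots> = (\<Sum>J\<in>Pow I. ((-1) ^ inversions J (I - J) * partial a (\<lambda>y. gcoeff (f y) J) x) * gcoeff (g x) (I - J) +
            ((-1) ^ inversions J (I - J) * gcoeff (f x) J) * partial a (\<lambda>y. gcoeff (g y) (I - J)) x)"
        proof (rule sum.cong[OF refl])
          fix J
          have "partial a (\<lambda>y. ((-1) ^ inversions J (I - J) * gcoeff (f y) J) * gcoeff (g y) (I - J)) x =
            partial a (\<lambda>y. (-1) ^ inversions J (I - J) * gcoeff (f y) J) x * gcoeff (g x) (I - J) +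
            ((-1) ^ inversions J (I - J) * gcoeff (f x) J) * partial a (\<lambda>y. gcoeff (g y) (I - J)) x"
            by (rule partial_mult[OF smooth_cmult[OF sloc_smooth[OF f]] sloc_smooth[OF g] a x])
          then show "partial a (\<lambda>y. ((-1) ^ inversions J (I - J) * gcoeff (f y) J) * gcoeff (g y) (I - J)) x =
            ((-1) ^ inversions J (I - J) * partial a (\<lambda>y. gcoeff (f y) J) x) * gcoeff (g x) (I - J) +
            ((-1) ^ inversions J (I - J) * gcoeff (f x) J) * partial a (\<lambda>y. gcoeff (g y) (I - J)) x"
            by (simp only: partial_cmult[OF sloc_smooth[OF f] a x])
        qed
        also have "\<dots> = gcoeff ((d a f * g + (\<lambda>x. gsign (spar n a) (f x)) * d a g) x) I"
          using a by (simp add: gcoeff_mult[OF I] d_even_coeff[OF a x] sum.distrib spar_def s0 sfun_apply)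
        finally show "gcoeff (d a (\<lambda>x. f x * g x) x) I = gcoeff ((d a f * g + (\<lambda>x. gsign (spar n a) (f x)) * d a g) x) I" .
      qed
    qed (use x in \<open>simp add: d_odd gderiv_mult spar_def sfun_apply\<close>)
  qed (simp add: d_outside sfun_apply)
qed

lemma d_plus: "f \<in> S ==> g \<in> S ==> d a (f + g) = d a f + d a g"
  using d_add[OF S_sloc S_sloc] by (simp add: plus_fun_def)
lemma d_const: "d a (\<lambda>x. of_real c) = 0"
proof (rule ext)
  fix x
  show "d a (\<lambda>x. of_real c) x = 0 x"
    by (cases "x \<in> V"; cases "a < n")
      (auto simp: d_outside d_odd d_even_coeff gcoeff_of_real sfun_apply intro!: grassmann_eqI)
qed
lemma d_zero [simp]: "d a 0 = 0"
  using d_const[of a 0] by (simp add: zero_fun_def)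
lemma d_one: "d a (srestrict V 1) = 0"
  using d_const[of a 1] d_cong[of "srestrict V 1" "\<lambda>x. of_real 1" a] by (simp add: srestrict_def sfun_apply)
lemma d_scale: "f \<in> S ==> d a (r *\<^sub>S f) = r *\<^sub>S d a f"
proof -
  assume f: "f \<in> S"
  have "d a (\<lambda>x. of_real r * f x) = d a (\<lambda>x. of_real r) * f + (\<lambda>x. gsign (spar n a) (of_real r)) * d a f"
    by (rule d_mult_sloc[OF sloc_const S_sloc[OF f]]) simp
  moreover have "gsign k (of_real r) = of_real r" for k by (rule grassmann_eqI) (auto simp: gcoeff_of_real)
  ultimately show ?thesis
    by (simp add: d_const sscale_def scaleR_conv_of_real) (simp add: fun_eq_iff sfun_apply)
qed
lemma d_sum: "(!!b. b \<in> A ==> f b \<in> S) ==> d a (\<Sum>b\<in>A. f b) = (\<Sum>b\<in>A. d a (f b))"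
  by (induction A rule: infinite_finite_induct) (auto simp: d_plus S_sum)

lemma d_mult: "f \<in> S ==> g \<in> S ==> sparity p f ==> d a (f * g) = d a f * g + (-1) ^ (spar n a * p) * (f * d a g)"
  using d_mult_sloc[OF S_sloc S_sloc, of f g a]
  by (simp add: fun_eq_iff sfun_apply times_fun_def[of f g] sparity_def gsign_parity[of p] mult.assoc)

lemma d_parity: "sparity p f ==> sparity (p + spar n a) (d a f)"
proof -
  assume p: "sparity p f"
  have "gparity (p + spar n a) (d a f x)" for x
  proof (cases "x \<in> V")
    case True
    show ?thesis
    proof (cases "a < n")
      case a: True
      have "gcoeff (d a f x) I = 0" if "odd (card I + p)" for I
      proof -
        have "(\<lambda>y. gcoeff (f y) I) = (\<lambda>y. 0)" using p that by (auto simp: sparity_def gparity_iff)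
        then show ?thesis by (simp add: d_even_coeff[OF a True])
      qed
      then show ?thesis using a by (simp add: gparity_iff spar_def)
    qed (use True p in \<open>auto simp: d_odd spar_def sparity_def intro: gparity_gderiv[unfolded Suc_eq_plus1[symmetric]]\<close>)
  qed (simp add: d_outside)
  then show ?thesis by (simp add: sparity_def)
qed

text \<open>Two even derivatives commute by Schwarz, two odd ones anticommute by
  \<open>gderiv_gderiv\<close>. In the mixed case the odd one only shifts coefficients with constant
  signs, which the even one passes.\<close>

lemma d_commute:
  assumes f: "f \<in> S" and a: "a < n + m" and b: "b < n + m"
  shows "d a (d b f) = (-1) ^ (spar n a * spar n b) * d b (d a f)"
proof -
  have f': "sloc f" by (rule S_sloc[OF f])
  have mix: "d a (d b f) = d b (d a f)" if a: "a < n" and b: "b \<ge> n" for a b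
  proof (rule ext)
    fix x
    show "d a (d b f) x = d b (d a f) x"
    proof (cases "x \<in> V")
      case x: True
      show ?thesis
      proof (rule grassmann_eqI)
        fix I :: "nat set" assume I: "finite I"
        have "gcoeff (d a (d b f) x) I = partial a (\<lambda>y. gcoeff (gderiv b (f y)) I) x"
          unfolding d_even_coeff[OF a x] by (rule partial_cong[OF _ a x]) (simp add: d_odd b)
        also have "\<dots> = gcoeff (gderiv b (d a f x)) I"
          using partial_cmult[OF sloc_smooth[OF f'] a x] I by (simp add: gcoeff_gderiv d_even_coeff[OF a x])
        finally show "gcoeff (d a (d b f) x) I = gcoeff (d b (d a f) x) I" by (simp add: d_odd b x)
      qed
    qed (simp add: d_outside)
  qed
  consider "a < n" "b < n" | "a < n" "b \<ge> n" | "a \<ge> n" "b < n" | "a \<ge> n" "b \<ge> n" by linarith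
  then show ?thesis
  proof cases
    case 1
    have "d a (d b f) x = d b (d a f) x" for x
    proof (cases "x \<in> V")
      case x: True
      show ?thesis
      proof (rule grassmann_eqI)
        fix I :: "nat set"
        let ?g = "\<lambda>y. gcoeff (f y) I"
        have "gcoeff (d a (d b f) x) I = partial a (partial b ?g) x"
          unfolding d_even_coeff[OF 1(1) x] by (rule partial_cong[OF _ 1(1) x]) (simp add: d_even_coeff[OF 1(2)])
        also have "\<dots> = partial b (partial a ?g) x"
          by (rule partial_commute[OF sloc_smooth[OF f'] 1 x])
        also have "\<dots> = gcoeff (d b (d a f) x) I"
          unfolding d_even_coeff[OF 1(2) x] by (rule partial_cong[OF _ 1(2) x]) (simp add: d_even_coeff[OF 1(1)])
        finally show "gcoeff (d a (d b f) x) I = gcoeff (d b (d a f) x) I" .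
      qed
    qed (simp add: d_outside)
    then show ?thesis using 1 by (simp add: spar_def fun_eq_iff)
  next
    case 2
    then show ?thesis using mix by (simp add: spar_def)
  next
    case 3
    then show ?thesis using mix[of b a] by (simp add: spar_def)
  next
    case 4
    have "d a (d b f) x = - d b (d a f) x" for x
      by (cases "x \<in> V") (simp_all add: d_outside d_odd 4 gderiv_gderiv[of a])
    then show ?thesis using 4 by (simp add: spar_def fun_eq_iff sfun_apply)
  qed
qed

lemma d_scoord: "d a (scoord n V b) = (if a = b then srestrict V 1 else 0)"
proof (rule ext)
  fix x
  show "d a (scoord n V b) x = (if a = b then srestrict V 1 else 0) x"
  proof (cases "x \<in> V")
    case x: True
    define c where "c = (\<lambda>y. if b < n then of_real (y b) else ggen b :: grassmann)"
    have "d a (scoord n V b) = d a c" by (rule d_cong) (simp add: scoord_def srestrict_def c_def)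
    moreover have "d a c x = (if a = b then 1 else 0)"
    proof (cases "a < n")
      case a: True
      have "gcoeff (d a c x) I = gcoeff (if a = b then 1 else 0) I" for I
      proof (cases "b < n \<and> I = {}")
        case True
        then show ?thesis by (simp add: d_even_coeff[OF a x] c_def gcoeff_of_real partial_coordinate)
      next
        case False
        then have "(\<lambda>y. gcoeff (c y) I) = (\<lambda>y. gcoeff (c x) I)" by (auto simp: c_def gcoeff_of_real)
        then have "gcoeff (d a c x) I = 0" by (simp add: d_even_coeff[OF a x])
        then show ?thesis using False a by auto
      qed
      then show ?thesis by (intro grassmann_eqI)
    next
      case False
      then show ?thesis using x by (auto simp: d_odd c_def gderiv_ggen)
    qed
    ultimately show ?thesis using x by (simp add: srestrict_def sfun_apply)
  qed (simp add: d_outside srestrict_def sfun_apply)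
qed

end

lemma superdomain_subset:
  assumes "superdomain n V" "openin (Euclidean_space n) U" "U \<subseteq> V"
  shows "f \<in> superfunctions n m V ==> srestrict U f \<in> superfunctions n m U"
    "sderiv n U a (srestrict U f) = srestrict U (sderiv n V a f)"
proof -
  interpret V: superdomain n V m by (rule assms(1))
  interpret U: superdomain n U m by unfold_locales (rule assms(2))
  have c: "coord_domain n V" "coord_domain n U" by unfold_locales
  show "srestrict U f \<in> superfunctions n m U" if "f \<in> superfunctions n m V"
    unfolding U.srestrict_S U.sloc_def
    using V.S_sloc[OF that] assms(3) smooth_subset[OF c assms(3)] by (auto simp: V.sloc_def)
  have "U.d a (srestrict U f) x = srestrict U (V.d a f) x" for x
  proof (cases "x \<in> U")
    case x: True
    have "U.d a (srestrict U f) = U.d a f" by (rule U.d_cong) (simp add: srestrict_def)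
    moreover have "U.d a f x = V.d a f x" using x assms(3) by (auto simp: sderiv_def srestrict_def)
    ultimately show ?thesis using x by (simp add: srestrict_def)
  qed (simp add: U.d_outside srestrict_def)
  then show "U.d a (srestrict U f) = srestrict U (V.d a f)" by auto
qed

lemma superfunctions_Un:
  assumes "openin (Euclidean_space n) U" "openin (Euclidean_space n) V"
    and "srestrict U f \<in> superfunctions n m U" "srestrict V f \<in> superfunctions n m V"
    and "!!x. x \<notin> U \<union> V ==> f x = 0"
  shows "f \<in> superfunctions n m (U \<union> V)"
proof -
  interpret V: superdomain n V m by unfold_locales (rule assms(2))
  interpret U: superdomain n U m by unfold_locales (rule assms(1))
  interpret UV: superdomain n "U \<union> V" m by unfold_locales (intro openin_Un assms)
  have c: "coord_domain n U" "coord_domain n V" by unfold_locales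
  show ?thesis
    using assms(3,4,5) unfolding UV.S_iff V.srestrict_S U.srestrict_S
    by (auto simp: V.sloc_def U.sloc_def UV.sloc_def intro!: smooth_Un[OF c])
qed

subsection \<open>Derivatives of real powers\<close>

lemma (in superdomain) d_mult_even:
  assumes "sloc f" "sloc g" "!!x. x \<in> V ==> gparity 0 (f x)" "x \<in> V"
  shows "d a (\<lambda>x. f x * g x) x = d a f x * g x + f x * d a g x"
  using d_mult_sloc[OF assms(1,2), of a] gsign_parity[OF assms(3)[OF assms(4)], of "spar n a"]
  by (simp add: fun_eq_iff sfun_apply)

lemma (in superdomain) d_powr:
  assumes f: "sloc f" and ev: "!!x. x \<in> V ==> gparity 0 (f x)" and nz: "!!x. x \<in> V ==> gbody (f x) \<noteq> 0"
    and x: "x \<in> V"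
  shows "f x * d a (\<lambda>x. gabs_powr m (f x) w) x = w *\<^sub>R (gabs_powr m (f x) w * d a f x)"
proof -
  define b where "b = (\<lambda>x. gbody (f x))"
  define y where "y = (\<lambda>x. (1 / b x) *\<^sub>R (f x - of_real (b x)))"
  define B where "B = (\<lambda>x. of_real (b x) :: grassmann)"
  define p where "p = (\<lambda>x. \<bar>b x\<bar> powr w)"
  have b: "smooth_fun n V b" unfolding b_def by (rule sloc_body[OF f])
  have bnz: "b x \<noteq> 0" if "x \<in> V" for x using nz[OF that] by (simp add: b_def)
  have p: "smooth_fun n V p" unfolding p_def by (rule smooth_powr[OF b bnz])
  have sB: "sloc B" unfolding B_def by (rule sloc_of_real[OF b])
  have sy: "sloc y" unfolding y_def
    using sloc_real_mult[OF smooth_inverse[OF b bnz] sloc_diff[OF f sB]] by (simp add: inverse_eq_divide B_def)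
  have ey: "gparity 0 (y x)" if "x \<in> V" for x
    unfolding y_def by (intro gparity_scaleR gparity_diff ev that) simp
  have ny: "nil (y x)" if "x \<in> V" for x
    unfolding y_def b_def by (rule nil_scaled_soul[OF sloc_supp[OF f that] nz[OF that]])
  have fB: "f x = B x * (1 + y x)" if "x \<in> V" for x
    using bnz[OF that] by (simp add: B_def y_def distrib_left of_real_def)
  have s1y: "sloc (\<lambda>x. 1 + y x)" by (intro sloc_add sloc_const sy) simp
  have d1y: "d a (\<lambda>x. 1 + y x) = d a y"
    using d_add[OF sloc_const[OF gsupp_1] sy, of a] d_const[of a 1] by simp
  let ?D = "\<lambda>g. d a g x" and ?y = "y x"
  have Df: "?D f = ?D B * (1 + ?y) + B x * ?D y"
  proof -
    have "?D f = ?D (\<lambda>x. B x * (1 + y x))" using d_cong[of f "\<lambda>x. B x * (1 + y x)" a] fB by simp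
    then show ?thesis
      using d_mult_even[OF sB s1y _ x, of a] by (simp add: B_def d1y)
  qed
  have spow: "sloc (\<lambda>x. y x ^ k)" "sloc (\<lambda>x. (1 + y x) ^ k)" for k by (rule sloc_power[OF sy], rule sloc_power[OF s1y])
  have Dpow: "?D (\<lambda>x. (1 + y x) ^ k) = real k *\<^sub>R ((1 + ?y) ^ (k - 1) * ?D y)" for k
  proof (induction k)
    case 0
    then show ?case using d_const[of a 1] by (simp add: sfun_apply)
  next
    case (Suc k)
    have e: "gparity 0 (1 + y x)" if "x \<in> V" for x using ey[OF that] by (simp add: gparity_add)
    have "?D (\<lambda>x. (1 + y x) ^ Suc k) = ?D y * (1 + ?y) ^ k + (1 + ?y) * ?D (\<lambda>x. (1 + y x) ^ k)"
      using d_mult_even[OF s1y spow(2)[of k] e x, of a] by (simp add: d1y)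
    also have "?D y * (1 + ?y) ^ k = (1 + ?y) ^ k * ?D y"
      by (rule grassmann_even_commute[symmetric, OF gparity_power[OF e[OF x]]])
    also have "(1 + ?y) * ?D (\<lambda>x. (1 + y x) ^ k) = real k *\<^sub>R ((1 + ?y) ^ k * ?D y)"
      unfolding Suc by (cases k) (simp_all add: mult.assoc)
    finally show ?case by (simp add: scaleR_left_distrib)
  qed
  have lin: "?D (\<lambda>x. gbinom M v (y x)) = (\<Sum>k\<le>M. (v gchoose k) *\<^sub>R ?D (\<lambda>x. y x ^ k))" for M v
  proof (induction M)
    case 0
    then show ?case using d_const[of a 1] by (simp add: gbinom_def sfun_apply)
  next
    case (Suc M)
    let ?c = "of_real (v gchoose Suc M) :: grassmann"
    have c: "sloc (\<lambda>x. ?c)" by (intro sloc_const) simp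
    have sM: "sloc (\<lambda>x. gbinom M v (y x))" unfolding gbinom_def
      by (intro sloc_sum sloc_real_mult smooth_const spow(1))
    have "?D (\<lambda>x. ?c * y x ^ Suc M) = ?c * ?D (\<lambda>x. y x ^ Suc M)"
      using d_mult_even[OF c spow(1)[of "Suc M"] _ x, of a] d_const by (simp add: sfun_apply del: power_Suc gbinomial_Suc)
    then show ?case
      using d_add[OF sM sloc_mult[OF c spow(1)[of "Suc M"]], of a] Suc
      by (simp add: sfun_apply gbinom_def scaleR_conv_of_real del: power_Suc gbinomial_Suc)
  qed
  \<comment> \<open>For natural w this is the power rule for (1 + y)^N, and both sides are
    polynomial in w since the truncated series is differentiated term by term.\<close>
  have key: "(1 + ?y) * ?D (\<lambda>x. gbinom m w (y x)) = w *\<^sub>R (gbinom m w ?y * ?D y)"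
  proof (rule grassmann_eqI)
    fix I
    have 1: "(1 + ?y) * ?D (\<lambda>x. gbinom m (real N) (y x)) = real N *\<^sub>R (gbinom m (real N) ?y * ?D y)" for N
    proof -
      have "?D (\<lambda>x. gbinom m (real N) (y x)) = ?D (\<lambda>x. (1 + y x) ^ N)"
        by (rule fun_cong[OF d_cong]) (simp add: gbinom_nat[OF ny])
      then have "?D (\<lambda>x. gbinom m (real N) (y x)) = real N *\<^sub>R ((1 + ?y) ^ (N - 1) * ?D y)"
        unfolding Dpow .
      then show ?thesis by (cases N) (simp_all add: gbinom_nat[OF ny[OF x]] mult.assoc del: of_nat_Suc)
    qed
    have 2: "is_polyfun (\<lambda>w. gcoeff ((1 + ?y) * ?D (\<lambda>x. gbinom m w (y x))) I)"
      unfolding lin by (intro is_polyfun_gcoeff_mult is_polyfun_const)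
        (auto simp: gcoeff_sum intro!: is_polyfun_sum is_polyfun_mult is_polyfun_gbinomial is_polyfun_const)
    have 3: "is_polyfun (\<lambda>w. gcoeff (w *\<^sub>R (gbinom m w ?y * ?D y)) I)"
      using is_polyfun_mult[OF is_polyfun_shift[of 0] is_polyfun_gcoeff_mult[OF is_polyfun_gbinom is_polyfun_const]] by simp
    show "gcoeff ((1 + ?y) * ?D (\<lambda>x. gbinom m w (y x))) I = gcoeff (w *\<^sub>R (gbinom m w ?y * ?D y)) I"
      by (rule is_polyfun_eq[OF 2 3]) (simp only: 1)
  qed
  have Dp: "?D (\<lambda>x. of_real (p x)) = of_real (w * p x / b x) * ?D B"
  proof (cases "a < n")
    case True
    show ?thesis
    proof (rule grassmann_eqI)
      fix I :: "nat set"
      have "gcoeff (of_real (w * p x / b x) * ?D B) I = (w * p x / b x) * partial a (\<lambda>y. gcoeff (B y) I) x"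
        by (simp add: scaleR_conv_of_real[symmetric] d_even_coeff[OF True x] del: of_real_mult of_real_divide)
      then show "gcoeff (?D (\<lambda>x. of_real (p x))) I = gcoeff (of_real (w * p x / b x) * ?D B) I"
        using partial_abs_powr[OF b bnz[OF x] True x, of w]
        by (cases "I = {}") (simp_all add: d_even_coeff[OF True x] B_def gcoeff_of_real p_def divide_inverse)
    qed
  qed (simp add: d_odd x B_def)
  have rB: "?D B * h = h * ?D B" for h
  proof -
    have "gparity 0 (?D B)"
      using d_parity[of 0 B a] by (cases "a < n") (auto simp: sparity_def spar_def d_odd x B_def)
    then show ?thesis by (rule grassmann_even_commute)
  qed
  have F: "gabs_powr m (f x) w = of_real (p x) * gbinom m w (y x)" for x
    by (simp add: gabs_powr_alt p_def b_def y_def scaleR_conv_of_real)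
  have sbin: "sloc (\<lambda>x. gbinom m w (y x))" unfolding gbinom_def
    by (intro sloc_sum sloc_real_mult smooth_const spow(1))
  let ?P = "gbinom m w ?y"
  have eP: "gparity 0 ?P" unfolding gbinom_def by (intro gparity_sum gparity_scaleR gparity_power ey x)
  have cP: "?P * h = h * ?P" and cy: "(1 + ?y) * h = h * (1 + ?y)" for h
    by (rule grassmann_even_commute[OF eP], rule grassmann_even_commute, intro gparity_add ey x) simp
  have DF: "?D (\<lambda>x. gabs_powr m (f x) w) = of_real (w * p x / b x) * ?D B * ?P + of_real (p x) * ?D (\<lambda>x. gbinom m w (y x))"
    unfolding F using d_mult_even[OF sloc_of_real[OF p] sbin _ x, of a] by (simp add: Dp)
  have rm: "of_real r * h = r *\<^sub>R h" and Bm: "B x * h = b x *\<^sub>R h" for r and h :: grassmann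
    by (simp_all add: B_def scaleR_conv_of_real)
  have fm: "f x * h = b x *\<^sub>R ((1 + ?y) * h)" for h
    by (simp add: fB[OF x] mult.assoc Bm)
  have "f x * ?D (\<lambda>x. gabs_powr m (f x) w) =
      (b x * (w * p x / b x)) *\<^sub>R ((1 + ?y) * ?D B * ?P) + (b x * p x) *\<^sub>R ((1 + ?y) * ?D (\<lambda>x. gbinom m w (y x)))"
    unfolding DF fm by (simp only: distrib_left[of "1 + ?y"] scaleR_right_distrib mult_scaleR_right mult_scaleR_left
        scaleR_scaleR mult.assoc rm)
  also have "b x * (w * p x / b x) = w * p x" using bnz[OF x] by simp
  also have "(1 + ?y) * ?D (\<lambda>x. gbinom m w (y x)) = w *\<^sub>R (?P * ?D y)" by (rule key)
  also have "(w * p x) *\<^sub>R ((1 + ?y) * ?D B * ?P) + (b x * p x) *\<^sub>R w *\<^sub>R (?P * ?D y) =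
      (w * p x) *\<^sub>R (?P * ((1 + ?y) * ?D B) + b x *\<^sub>R (?P * ?D y))"
    by (simp add: scaleR_right_distrib cP[of "(1 + ?y) * ?D B"] mult_ac)
  also have "\<dots> = w *\<^sub>R (gabs_powr m (f x) w * ?D f)"
    unfolding F Df cy[of "?D B"] mult.assoc Bm rm
    by (simp only: distrib_left[of ?P] scaleR_right_distrib mult_scaleR_right mult_scaleR_left scaleR_scaleR
        mult.commute[of "b x"] mult.assoc)
  finally show ?thesis .
qed

subsection \<open>Vector fields\<close>

lemma prod_list_sfun_apply: "prod_list fs x = prod_list (map (\<lambda>f. f x :: grassmann) fs)" for fs :: "sfun list"
  by (induction fs) (simp_all add: sfun_apply)

context superdomain
begin

text \<open>Determinants commute with maps that preserve sums, products and the unit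
  \<open>u\<close> of \<open>S\<close>. The factor \<open>u\<close> stands in for the constant 1,
  which is not in \<open>S\<close> because it does not vanish outside V. It is applied to evaluation
  at a point, to f + \<eta> X f, and to pullbacks.\<close>

lemma hom_gdet:
  fixes h :: "sfun => grassmann"
  defines "u \<equiv> srestrict V 1"
  assumes h: "!!f g. f \<in> S ==> g \<in> S ==> h (f + g) = h f + h g" "!!f g. f \<in> S ==> g \<in> S ==> h (f * g) = h f * h g"
      "h u = 1"
    and A: "!!i j. i < k ==> j < k ==> A i j \<in> S"
  shows "(\<lambda>x. gdet k (\<lambda>i j. A i j x)) * u \<in> S" "h ((\<lambda>x. gdet k (\<lambda>i j. A i j x)) * u) = gdet k (\<lambda>i j. h (A i j))"
proof -
  have h0: "h 0 = 0" using h(1)[OF S_0 S_0] by simp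
  have hm: "h (- f) = - h f" if "f \<in> S" for f
    using h(1)[OF that S_uminus[OF that]] h0 by (simp add: eq_neg_iff_add_eq_0 add.commute)
  have pl: "prod_list fs * u \<in> S \<and> h (prod_list fs * u) = prod_list (map h fs)" if "set fs \<subseteq> S" for fs
    using that
  proof (induction fs)
    case (Cons f fs)
    then show ?case using S_mult h(2) by (simp add: mult.assoc)
  qed (use h S_one in \<open>auto simp: u_def S_one_mult\<close>)
  define t where "t p = (if evenperm p then 1 else - 1) * (prod_list (map (\<lambda>i. A i (p i)) [0..<k]) * u)" for p
  have t: "t p \<in> S" "h (t p) = of_int (sign p) * prod_list (map (\<lambda>i. h (A i (p i))) [0..<k])" if "p permutes {..<k}" for p
  proof -
    have "set (map (\<lambda>i. A i (p i)) [0..<k]) \<subseteq> S"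
      using permutes_in_image[OF that] A by auto
    from pl[OF this] show "t p \<in> S" "h (t p) = of_int (sign p) * prod_list (map (\<lambda>i. h (A i (p i))) [0..<k])"
      by (auto simp: t_def sign_def o_def hm S_uminus)
  qed
  have sm: "(\<Sum>p\<in>Q. t p) \<in> S \<and> h (\<Sum>p\<in>Q. t p) = (\<Sum>p\<in>Q. h (t p))" if "Q \<subseteq> {p. p permutes {..<k}}" for Q
    using that
    by (induction Q rule: infinite_finite_induct) (use h0 t(1) S_add h(1) in auto)
  have e: "(\<lambda>x. gdet k (\<lambda>i j. A i j x)) * u = (\<Sum>p | p permutes {..<k}. t p)"
  proof (rule ext)
    fix x
    have "of_int (sign p) * prod_list (map (\<lambda>i. A i (p i) x) [0..<k]) * u x = t p x" for p
    proof -
      have "prod_list (map (\<lambda>i. A i (p i)) [0..<k]) x = prod_list (map (\<lambda>i. A i (p i) x) [0..<k])"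
        unfolding prod_list_sfun_apply by (simp add: o_def)
      then show ?thesis by (simp add: t_def sign_def sfun_apply)
    qed
    then show "((\<lambda>x. gdet k (\<lambda>i j. A i j x)) * u) x = (\<Sum>p | p permutes {..<k}. t p) x"
      by (simp add: sfun_apply gdet_def sum_distrib_right)
  qed
  show "(\<lambda>x. gdet k (\<lambda>i j. A i j x)) * u \<in> S" using sm[OF order_refl] e by simp
  have "h ((\<lambda>x. gdet k (\<lambda>i j. A i j x)) * u) = (\<Sum>p | p permutes {..<k}. h (t p))"
    using sm[OF order_refl] by (simp add: e)
  also have "\<dots> = gdet k (\<lambda>i j. h (A i j))"
    unfolding gdet_def by (rule sum.cong) (simp_all add: t(2))
  finally show "h ((\<lambda>x. gdet k (\<lambda>i j. A i j x)) * u) = gdet k (\<lambda>i j. h (A i j))" .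
qed

definition vf :: "(nat => sfun) => sfun => sfun" where
  "vf X f = (\<Sum>a<n + m. X a * d a f)"

lemma vf_S: "(!!a. a < n + m ==> X a \<in> S) ==> f \<in> S ==> vf X f \<in> S"
  unfolding vf_def by (intro S_sum S_mult d_S) auto

lemma vf_add: "f \<in> S ==> g \<in> S ==> vf X (f + g) = vf X f + vf X g"
  by (simp add: vf_def d_plus distrib_left sum.distrib)

lemma vf_scale: "f \<in> S ==> vf X (r *\<^sub>S f) = r *\<^sub>S vf X f"
  by (simp add: vf_def d_scale sscale_simps sscale_sum)

lemma vf_one: "vf X (srestrict V 1) = 0"
  by (simp add: vf_def d_one)

lemma vf_parity:
  assumes "!!a. a < n + m ==> sparity (q + spar n a) (X a)" "sparity p f"
  shows "sparity (q + p) (vf X f)"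
  unfolding vf_def
proof (rule sparity_sum)
  fix a assume "a \<in> {..<n + m}"
  then show "sparity (q + p) (X a * d a f)"
  proof -
    have "even (q + spar n a + (p + spar n a) + (q + p))" by presburger
    with \<open>a \<in> {..<n + m}\<close> show ?thesis by (intro sparity_mult_cong[OF assms(1) d_parity[OF assms(2)]]) auto
  qed
qed

lemma vf_mult_gsign:
  assumes X: "!!a. a < n + m ==> sparity (q + spar n a) (X a)" and f: "f \<in> S" and g: "g \<in> S"
  shows "vf X (f * g) x = vf X f x * g x + gsign q (f x) * vf X g x"
proof (cases "x \<in> V")
  case True
  have "X a x * d a (f * g) x = X a x * d a f x * g x + gsign q (f x) * (X a x * d a g x)" if "a < n + m" for a
  proof -
    have "X a x * gsign (spar n a) (f x) = gsign q (f x) * X a x"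
    proof -
      have "gsign (q + spar n a + spar n a) (f x) = gsign q (f x)" by (rule gsign_mod) presburger
      then show ?thesis
        using gsign_commute[of "q + spar n a" "X a x" "gsign (spar n a) (f x)"] X[OF that]
        by (simp add: sparity_def gsign_gsign)
    qed
    then show ?thesis
      using d_mult_sloc[OF S_sloc[OF f] S_sloc[OF g], of a]
      by (simp add: times_fun_def[of f g] sfun_apply distrib_left mult.assoc[symmetric])
  qed
  then show ?thesis
    by (simp add: vf_def sfun_apply sum_distrib_left sum_distrib_right sum.distrib)
qed (use S_outside[OF f] S_outside[OF g] in \<open>simp add: vf_def sfun_apply d_outside\<close>)

lemma vf_mult:
  assumes X: "!!a. a < n + m ==> sparity (q + spar n a) (X a)" and f: "f \<in> S" "sparity p f" and g: "g \<in> S"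
  shows "vf X (f * g) = vf X f * g + (-1) ^ (q * p) * (f * vf X g)"
  using vf_mult_gsign[OF X f(1) g] f(2)
  by (simp add: fun_eq_iff sfun_apply sparity_def gsign_parity[of p] mult.assoc)

text \<open>\<open>ber2_liouville\<close> at each point of V. The Berezinian is D1 * D2, a
  polynomial in the entries of P and Y, so its deformation along X is the Berezinian of the deformed
  matrices.\<close>

lemma vf_liouville:
  assumes X: "!!a. a < n + m ==> X a \<in> S" "!!a. a < n + m ==> sparity (q + spar n a) (X a)"
    and PS: "!!i j. i < n + m ==> j < n + m ==> P i j \<in> S" "!!i j. i < n + m ==> j < n + m ==> Y i j \<in> S"
    and ev: "!!i j. i < n + m ==> j < n + m ==> sparity (spar n i + spar n j) (P i j)"
      "!!i j. i < n + m ==> j < n + m ==> sparity (spar n i + spar n j) (Y i j)"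
    and inv: "!!i j. i < n + m ==> j < n + m ==> (\<Sum>l<n + m. P i l * Y l j) = (if i = j then srestrict V 1 else 0)"
      "!!i j. i < n + m ==> j < n + m ==> (\<Sum>l<n + m. Y i l * P l j) = (if i = j then srestrict V 1 else 0)"
  defines "J \<equiv> srestrict V (\<lambda>x. ber2 n m (\<lambda>i j. P i j x) (\<lambda>i j. Y i j x))"
  shows "J \<in> S" "sparity 0 J" "vf X J = (\<Sum>a<n + m. (-1) ^ spar n a * (\<Sum>l<n + m. vf X (P a l) * Y l a)) * J"
proof -
  let ?N = "n + m" and ?u = "srestrict V 1"
  have inv_at: "smat_inverse n m (\<lambda>i j. P i j x) (\<lambda>i j. Y i j x)" if x: "x \<in> V" for x
    using ev fun_cong[OF inv(1), of _ _ x] fun_cong[OF inv(2), of _ _ x] x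
    by (auto simp: smat_inverse_def smat_even_def smat_mult_def sparity_def sfun_apply srestrict_def)
  define D1 where "D1 = (\<lambda>x. gdet n (\<lambda>i j. P i j x)) * ?u"
  define D2 where "D2 = (\<lambda>x. gdet m (\<lambda>i j. Y (n + i) (n + j) x)) * ?u"
  have JD: "J = D1 * D2"
    by (auto simp: J_def D1_def D2_def ber2_def srestrict_def fun_eq_iff sfun_apply)
  have D: "D1 \<in> S \<and> D2 \<in> S \<and> h D1 = gdet n (\<lambda>i j. h (P i j)) \<and> h D2 = gdet m (\<lambda>i j. h (Y (n + i) (n + j)))"
    if "!!f g. f \<in> S ==> g \<in> S ==> h (f + g) = h f + h g" "!!f g. f \<in> S ==> g \<in> S ==> h (f * g) = h f * h g"
      "h ?u = 1" for h
    using hom_gdet[of h n P] hom_gdet[of h m "\<lambda>i j. Y (n + i) (n + j)"] that PS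
    unfolding D1_def D2_def by simp
  \<comment> \<open>Membership does not involve h, but \<open>hom_gdet\<close> asks for some
    homomorphism. Evaluation at a point serves, which is why empty V is treated separately.\<close>
  have DS: "D1 \<in> S \<and> D2 \<in> S"
  proof (cases "V = {}")
    case True
    then have "D1 = 0" "D2 = 0" by (auto simp: D1_def D2_def srestrict_def fun_eq_iff sfun_apply)
    then show ?thesis by simp
  next
    case False
    then obtain x where "x \<in> V" by auto
    then show ?thesis using D[of "\<lambda>f. f x"] by (auto simp: sfun_apply srestrict_def)
  qed
  then show JS: "J \<in> S" by (simp add: JD S_mult)
  have "gparity 0 (J x)" for x
    using gparity_ber2[of n m "\<lambda>i j. P i j x" "\<lambda>i j. Y i j x"] inv_at[of x]
    by (cases "x \<in> V") (auto simp: J_def srestrict_def smat_inverse_def)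
  then show "sparity 0 J" by (simp add: sparity_def)
  show "vf X J = (\<Sum>a<?N. (-1) ^ spar n a * (\<Sum>l<?N. vf X (P a l) * Y l a)) * J"
  proof (rule ext)
    fix x
    show "vf X J x = ((\<Sum>a<?N. (-1) ^ spar n a * (\<Sum>l<?N. vf X (P a l) * Y l a)) * J) x"
    proof (cases "x \<in> V")
      case x: True
      define \<eta> where "\<eta> = infinitesimal ?N q"
      \<comment> \<open>Multiplicative: the parameter has the parity of X, so moving it past f x
        cancels the sign in the Leibniz rule, and terms with two parameters vanish.\<close>
      define h where "h f = f x + \<eta> * vf X f x" for f
      have \<eta>: "\<eta> * z * (\<eta> * w) = 0" for z w
      proof -
        have "\<eta> * gpart r z * (\<eta> * w) = 0" for r
          unfolding \<eta>_def by (rule infinitesimal_mult_mult[OF gparity_gpart])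
        then have "\<eta> * (gpart 0 z + gpart 1 z) * (\<eta> * w) = 0" by (simp only: distrib_left distrib_right) simp
        then show ?thesis by (simp only: gpart_sum[symmetric])
      qed
      have h1: "h (f + g) = h f + h g" if "f \<in> S" "g \<in> S" for f g
        using that by (simp add: h_def vf_add sfun_apply distrib_left)
      have h2: "h (f * g) = h f * h g" if "f \<in> S" "g \<in> S" for f g
      proof -
        have "\<eta> * gsign q (f x) = f x * \<eta>"
          using gsign_commute[OF gparity_infinitesimal[of q ?N], of "gsign q (f x)"]
          by (simp add: \<eta>_def gsign_gsign gsign_even)
        then have "\<eta> * (gsign q (f x) * vf X g x) = f x * (\<eta> * vf X g x)" by (simp flip: mult.assoc)
        then show ?thesis
          using \<eta> by (simp add: h_def vf_mult_gsign[OF X(2) that] sfun_apply distrib_left distrib_right mult.assoc)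
      qed
      have h3: "h ?u = 1" unfolding h_def vf_one using x by (simp add: sfun_apply srestrict_def)
      have h0: "h 0 = 0" using h1[of 0 0] by simp
      have hs: "h (\<Sum>l\<in>A. f l) = (\<Sum>l\<in>A. h (f l))" if "!!l. l \<in> A ==> f l \<in> S" for A :: "nat set" and f
        using that by (induction A rule: infinite_finite_induct) (auto simp: h0 h1 S_sum)
      note Dh = D[of h, OF h1 h2 h3]
      have "h J = ber2 n m (\<lambda>i j. h (P i j)) (\<lambda>i j. h (Y i j))"
        using Dh by (simp add: JD h2 ber2_def)
      moreover have "h J = ber2 n m (\<lambda>i j. P i j x) (\<lambda>i j. Y i j x) + \<eta> * vf X J x"
        using x by (simp add: h_def J_def srestrict_def)
      ultimately have J': "ber2 n m (\<lambda>i j. P i j x + \<eta> * vf X (P i j) x) (\<lambda>i j. Y i j x + \<eta> * vf X (Y i j) x) =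
          ber2 n m (\<lambda>i j. P i j x) (\<lambda>i j. Y i j x) + \<eta> * vf X J x"
        by (simp add: h_def)
      have hp: "gparity p (h f)" if "sparity p f" for p f
      proof -
        have "gparity (q + p) (vf X f x)" using vf_parity[OF X(2) that] by (simp add: sparity_def)
        then have "gparity p (\<eta> * vf X f x)"
          unfolding \<eta>_def by (rule gparity_mult_cong[OF gparity_infinitesimal]) presburger
        then show ?thesis using that unfolding h_def by (auto simp: sparity_def intro: gparity_add)
      qed
      have hinv: "smat_inverse n m (\<lambda>i j. h (P i j)) (\<lambda>i j. h (Y i j))"
      proof -
        have "(\<Sum>l<?N. h (P i l) * h (Y l j)) = (if i = j then 1 else 0)"
          "(\<Sum>l<?N. h (Y i l) * h (P l j)) = (if i = j then 1 else 0)" if "i < ?N" "j < ?N" for i j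
        proof -
          have "(\<Sum>l<?N. h (P i l) * h (Y l j)) = h (\<Sum>l<?N. P i l * Y l j)"
            "(\<Sum>l<?N. h (Y i l) * h (P l j)) = h (\<Sum>l<?N. Y i l * P l j)"
            by (subst hs, use that PS S_mult in auto, use that PS in \<open>auto simp: h2\<close>)+
          then show "(\<Sum>l<?N. h (P i l) * h (Y l j)) = (if i = j then 1 else 0)"
            "(\<Sum>l<?N. h (Y i l) * h (P l j)) = (if i = j then 1 else 0)"
            using that by (simp_all add: inv h3 h0)
        qed
        then show ?thesis using hp ev by (auto simp: smat_inverse_def smat_even_def smat_mult_def)
      qed
      have sup: "smat_supp n m {..<?N} (\<lambda>i j. Q i j x)" if "!!i j. i < ?N ==> j < ?N ==> Q i j \<in> S" for Q
        using S_supp[OF that] by (auto simp: smat_supp_def intro!: gsupp_mono[of L _ "{..<?N}"])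
      have dP: "gparity (q + spar n i + spar n j) (vf X (P i j) x)" if "i < ?N" "j < ?N" for i j
        using vf_parity[OF X(2) ev(1)[OF that]] by (simp add: sparity_def add.assoc)
      have "vf X J x = (\<Sum>a<?N. (-1) ^ spar n a * smat_mult ?N (\<lambda>i j. vf X (P i j) x) (\<lambda>i j. Y i j x) a a) *
          ber2 n m (\<lambda>i j. P i j x) (\<lambda>i j. Y i j x)"
        by (rule ber2_liouville[OF inv_at[OF x] hinv[unfolded h_def \<eta>_def] dP sup[OF PS(1)] sup[OF PS(2)] sup[OF vf_S[OF X(1) PS(1)]] J'[unfolded \<eta>_def]])
          (use S_supp[OF vf_S[OF X(1) JS]] in \<open>auto intro: gsupp_mono[of L]\<close>)
      then show ?thesis
        using x by (simp add: sfun_apply smat_mult_def J_def srestrict_def)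
    qed (use S_outside[OF JS] S_outside[OF vf_S[OF X(1) JS]] in \<open>simp add: sfun_apply\<close>)
  qed
qed

end

section \<open>Changes of coordinates\<close>

lemma grassmann_even_left_commute: "gparity 0 f ==> f * (g * h) = g * (f * h)"
  by (metis grassmann_even_commute mult.assoc)

lemma sfun_even_left_commute: "sparity 0 f ==> f * (g * h) = g * (f * h :: sfun)"
  by (simp only: mult.assoc[symmetric] sfun_even_commute[of f g])

section \<open>Charts of a supermanifold\<close>

locale supermfd =
  fixes M :: "('p, 'c) superatlas"
  assumes sm: "supermanifold M"
begin

abbreviation n :: nat where "n \<equiv> evdim M"
abbreviation m :: nat where "m \<equiv> odddim M"
abbreviation opn :: "'p set => bool" where "opn W \<equiv> openin (underlying M) W"
abbreviation T where "T \<equiv> trans M"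
abbreviation im :: "'c => 'p set => (nat => real) set" where "im c W \<equiv> crd M c ` W"
abbreviation ovl :: "'c => 'c => 'p set" where "ovl c d \<equiv> dom M c \<inter> dom M d"
abbreviation Sec :: "'c => 'p set => sfun set" where "Sec c W \<equiv> superfunctions n m (im c W)"
abbreviation one :: "'c => 'p set => sfun" where "one c W \<equiv> srestrict (im c W) 1"
abbreviation rs :: "'c => 'p set => sfun => sfun" where "rs c W \<equiv> srestrict (im c W)"
abbreviation D :: "'c => 'p set => nat => sfun => sfun" where "D c W \<equiv> sderiv n (im c W)"
abbreviation X :: "'c => 'p set => nat => sfun" where "X c W \<equiv> scoord n (im c W)"

lemma dom_open: "c \<in> charts M ==> opn (dom M c)"
  and dom_image_open: "c \<in> charts M ==> openin (Euclidean_space n) (im c (dom M c))"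
  and dom_homeo: "c \<in> charts M ==> homeomorphic_map (subtopology (underlying M) (dom M c))
          (subtopology (Euclidean_space n) (im c (dom M c))) (crd M c)"
  and haus: "Hausdorff_space (underlying M)"
  and cover: "(\<Union>c\<in>charts M. dom M c) = topspace (underlying M)"
  using sm by (auto simp: supermanifold_def)

lemma opn_ovl: "c \<in> charts M ==> d \<in> charts M ==> opn (ovl c d)"
  by (intro openin_Int dom_open)

lemma dom_topspace: "c \<in> charts M ==> dom M c \<subseteq> topspace (underlying M)"
  by (rule openin_subset[OF dom_open])

lemma crd_inj: "c \<in> charts M ==> inj_on (crd M c) (dom M c)"
  using homeomorphic_imp_injective_map[OF dom_homeo] dom_topspace by (simp add: Int_absorb1)

lemma crd_mem: "c \<in> charts M ==> W \<subseteq> dom M c ==> p \<in> dom M c ==> crd M c p \<in> im c W \<longleftrightarrow> p \<in> W"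
  using crd_inj[of c] by (auto dest: inj_onD)

lemma im_open: "c \<in> charts M ==> opn W ==> W \<subseteq> dom M c ==> openin (Euclidean_space n) (im c W)"
proof -
  assume a: "c \<in> charts M" "opn W" "W \<subseteq> dom M c"
  then have "openin (subtopology (underlying M) (dom M c)) W"
    by (simp add: openin_subtopology_Int2 openin_open_subtopology dom_open)
  then have "openin (subtopology (Euclidean_space n) (im c (dom M c))) (im c W)"
    using homeomorphic_imp_open_map[OF dom_homeo[OF a(1)]] by (simp add: open_map_def)
  then show ?thesis by (simp add: openin_open_subtopology dom_image_open a)
qed

lemma preimage_open:
  assumes "c \<in> charts M" "openin (Euclidean_space n) U"
  shows "opn {p \<in> dom M c. crd M c p \<in> U}"
proof -
  have "continuous_map (subtopology (underlying M) (dom M c)) (Euclidean_space n) (crd M c)"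
    using homeomorphic_imp_continuous_map[OF dom_homeo[OF assms(1)]] by (simp add: continuous_map_in_subtopology)
  then have "openin (subtopology (underlying M) (dom M c)) {p \<in> topspace (subtopology (underlying M) (dom M c)). crd M c p \<in> U}"
    using assms(2) by (rule openin_continuous_map_preimage)
  then show ?thesis
    using dom_topspace[OF assms(1)] by (simp add: openin_open_subtopology dom_open assms Int_absorb1)
qed

lemma superdomain_im: "c \<in> charts M ==> opn W ==> W \<subseteq> dom M c ==> superdomain n (im c W)"
  unfolding superdomain_def coord_domain_def by (rule im_open)

lemma sections_restrict:
  assumes "c \<in> charts M" "opn W" "opn W'" "W' \<subseteq> W" "W \<subseteq> dom M c"
  shows "f \<in> Sec c W ==> rs c W' f \<in> Sec c W'" "D c W' a (rs c W' f) = rs c W' (D c W a f)"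
    "rs c W' (X c W b) = X c W' b" "rs c W' (one c W) = one c W'"
proof -
  have sub: "im c W' \<subseteq> im c W" using assms by auto
  have o: "openin (Euclidean_space n) (im c W')" using assms by (intro im_open) auto
  show "f \<in> Sec c W ==> rs c W' f \<in> Sec c W'" "D c W' a (rs c W' f) = rs c W' (D c W a f)"
    using superdomain_subset[OF superdomain_im[OF assms(1,2,5)] o sub] by auto
  show "rs c W' (X c W b) = X c W' b" "rs c W' (one c W) = one c W'"
    using sub by (auto simp: scoord_def srestrict_srestrict Int_absorb2)
qed

lemma trans_pullback:
  assumes "c \<in> charts M" "d \<in> charts M" "opn W" "W \<subseteq> ovl c d"
  shows "superalgebra_pullback M c d W (T c d W)"
    and "!!W' f. opn W' ==> W' \<subseteq> W ==> f \<in> Sec d W ==> T c d W' (rs d W' f) = rs c W' (T c d W f)"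
  using sm assms unfolding supermanifold_def sections_def by metis+

lemma trans_id: "c \<in> charts M ==> opn W ==> W \<subseteq> dom M c ==> f \<in> Sec c W ==> T c c W f = f"
  using sm unfolding supermanifold_def sections_def by blast

lemma trans_trans:
  "c \<in> charts M ==> d \<in> charts M ==> e \<in> charts M ==> opn W ==> W \<subseteq> dom M c \<inter> dom M d \<inter> dom M e ==> f \<in> Sec e W ==>
    T c d W (T d e W f) = T c e W f"
  using sm[unfolded supermanifold_def sections_def, THEN conjunct2, THEN conjunct2, THEN conjunct2, THEN conjunct2,
      THEN conjunct2, THEN conjunct2] by simp

end

section \<open>Pullback under a change of coordinates and the chain rule\<close>

locale chart_change = supermfd +
  fixes c d W
  assumes cd: "c \<in> charts M" "d \<in> charts M" "opn W" "W \<subseteq> ovl c d"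
begin

lemma Wc: "W \<subseteq> dom M c" and Wd: "W \<subseteq> dom M d"
  using cd by auto

sublocale C: superdomain n "im c W" m
  by (rule superdomain_im[OF cd(1,3) Wc])
sublocale E: superdomain n "im d W" m
  by (rule superdomain_im[OF cd(2,3) Wd])

abbreviation t :: "sfun => sfun" where "t \<equiv> T c d W"

lemma t_S: "f \<in> E.S ==> t f \<in> C.S"
  and t_add: "f \<in> E.S ==> g \<in> E.S ==> t (f + g) = t f + t g"
  and t_mult: "f \<in> E.S ==> g \<in> E.S ==> t (f * g) = t f * t g"
  and t_scale: "f \<in> E.S ==> t (r *\<^sub>S f) = r *\<^sub>S t f"
  and t_one: "t (one d W) = one c W"
  and t_parity: "f \<in> E.S ==> sparity p f ==> sparity p (t f)"
  and t_body: "f \<in> E.S ==> z \<in> W ==> gbody (t f (crd M c z)) = gbody (f (crd M d z))"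
  using trans_pullback(1)[OF cd] by (simp_all add: superalgebra_pullback_def sections_def)

lemmas t_restrict = trans_pullback(2)[OF cd]

lemma t_0 [simp]: "t 0 = 0"
  using t_scale[of 0 0] by (simp add: sscale_simps)
lemma t_uminus: "f \<in> E.S ==> t (- f) = - t f"
  using t_scale[of f "-1"] by (simp add: sscale_def fun_Compl_def)
lemma t_diff: "f \<in> E.S ==> g \<in> E.S ==> t (f - g) = t f - t g"
  using t_add[OF _ E.S_uminus, of f g] t_uminus[of g] by simp
lemma t_sign: "f \<in> E.S ==> t ((-1) ^ k * f) = (-1) ^ k * t f"
  by (cases "even k") (simp_all add: t_uminus)
lemma t_sum: "(!!a. a \<in> A ==> f a \<in> E.S) ==> t (\<Sum>a\<in>A. f a) = (\<Sum>a\<in>A. t (f a))"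
  by (induction A rule: infinite_finite_induct) (auto simp: t_add E.S_sum)

lemma t_spart: assumes f: "f \<in> E.S" shows "t (spart q f) = spart q (t f)"
proof -
  have s: "sparity r (t (spart r f))" for r by (rule t_parity[OF E.S_part[OF f] sparity_spart])
  have "t f = t (spart 0 f) + t (spart 1 f)"
    using t_add[OF E.S_part[OF f] E.S_part[OF f], of 0 1] by (simp only: spart_sum[symmetric])
  then have "spart q (t f) = spart q (t (spart 0 f)) + spart q (t (spart 1 f))" by (simp add: spart_add)
  also have "\<dots> = t (spart q f)"
  proof -
    have "spart q f = (if even q then spart 0 f else spart 1 f)"
      by (auto simp: spart_def fun_eq_iff intro!: gpart_mod)
    then show ?thesis by (simp add: spart_same[OF s])
  qed
  finally show ?thesis by simp
qed

lemma gsign_spart: "(\<lambda>x. gsign k (f x)) = spart 0 f + (-1) ^ k * spart 1 f"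
  by (rule ext) (simp add: spart_def gsign_gpart sfun_apply)

lemma t_gsign: "f \<in> E.S ==> t (\<lambda>x. gsign k (f x)) = (\<lambda>x. gsign k (t f x))"
  unfolding gsign_spart by (simp add: t_add t_sign E.S_part E.S_sign t_spart)

text \<open>Compatibility with restriction makes the pullback local: its value at a point depends
  only on the function near the corresponding point.\<close>

lemma t_local:
  assumes "f \<in> E.S" "g \<in> E.S" "opn W'" "W' \<subseteq> W" "!!p. p \<in> W' ==> f (crd M d p) = g (crd M d p)" "p \<in> W'"
  shows "t f (crd M c p) = t g (crd M c p)"
proof -
  have "rs d W' f = rs d W' g" using assms(5) by (auto simp: srestrict_eq_iff)
  then have "rs c W' (t f) = rs c W' (t g)" using t_restrict[OF assms(3,4)] assms(1,2) by metis
  then show ?thesis using assms(6) by (auto simp: srestrict_eq_iff)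
qed

text \<open>
  The failure of the chain rule is a derivation along \<open>t\<close> that vanishes on the coordinates.  By Hadamard's
  lemma it maps functions of the even coordinates to arbitrarily high powers of the nilpotents.
\<close>

definition chain_defect :: "nat => (nat => real) => sfun => grassmann" where
  "chain_defect a x f = C.d a (t f) x - (\<Sum>b<n + m. C.d a (t (X d W b)) x * t (E.d b f) x)"

lemma chain_defect_add: "f \<in> E.S ==> g \<in> E.S ==> chain_defect a x (f + g) = chain_defect a x f + chain_defect a x g"
proof -
  assume f: "f \<in> E.S" and g: "g \<in> E.S"
  have "t (E.d b (f + g)) x = t (E.d b f) x + t (E.d b g) x" if "b < n + m" for b
    using E.d_plus[OF f g] t_add[OF E.d_S[OF f that] E.d_S[OF g that]] by (simp add: sfun_apply)
  then show ?thesis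
    using C.d_plus[OF t_S[OF f] t_S[OF g]] by (simp add: chain_defect_def t_add f g sfun_apply distrib_left sum.distrib)
qed

text \<open>Each derivative in direction b yields the sign operator of b. Moving it past the
  Jacobian entry, of parity a + b, leaves that of a in every term, which is also the sign in the
  derivative of t f.\<close>

lemma chain_defect_mult:
  assumes f: "f \<in> E.S" and g: "g \<in> E.S"
  shows "chain_defect a x (f * g) = chain_defect a x f * t g x + gsign (spar n a) (t f x) * chain_defect a x g"
proof -
  let ?P = "\<lambda>b. C.d a (t (X d W b)) x"
  have 1: "C.d a (t (f * g)) x = C.d a (t f) x * t g x + gsign (spar n a) (t f x) * C.d a (t g) x"
    using C.d_mult_sloc[OF C.S_sloc[OF t_S[OF f]] C.S_sloc[OF t_S[OF g]], of a]
    by (simp add: t_mult f g times_fun_def[of "t f"] sfun_apply)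
  have 2: "?P b * t (E.d b (f * g)) x = ?P b * t (E.d b f) x * t g x + gsign (spar n a) (t f x) * (?P b * t (E.d b g) x)"
    if b: "b < n + m" for b
  proof -
    have "E.d b (f * g) = E.d b f * g + (\<lambda>x. gsign (spar n b) (f x)) * E.d b g"
      using E.d_mult_sloc[OF E.S_sloc[OF f] E.S_sloc[OF g], of b] by (simp add: times_fun_def[of f])
    then have e: "t (E.d b (f * g)) x = t (E.d b f) x * t g x + gsign (spar n b) (t f x) * t (E.d b g) x"
      using E.d_S[OF f b] E.d_S[OF g b] g E.S_gsign[OF f]
      by (simp add: t_add t_mult E.S_mult t_gsign f sfun_apply)
    have "sparity (spar n b) (X d W b)"
      using b by (auto simp: sparity_def scoord_def srestrict_def spar_def gparity_ggen[unfolded One_nat_def])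
    then have "sparity (spar n b + spar n a) (C.d a (t (X d W b)))"
      by (intro C.d_parity t_parity E.S_scoord b)
    then have "?P b * gsign (spar n b) (t f x) = gsign (spar n b + spar n a + spar n b) (t f x) * ?P b"
      by (simp add: sparity_def gsign_commute[of "spar n b + spar n a"] gsign_gsign)
    also have "gsign (spar n b + spar n a + spar n b) (t f x) = gsign (spar n a) (t f x)"
      by (rule gsign_mod) presburger
    finally show ?thesis unfolding e by (simp add: distrib_left mult.assoc[symmetric])
  qed
  have "(\<Sum>b<n + m. ?P b * t (E.d b (f * g)) x) =
      (\<Sum>b<n + m. ?P b * t (E.d b f) x * t g x + gsign (spar n a) (t f x) * (?P b * t (E.d b g) x))"
    by (rule sum.cong) (use 2 in auto)
  then show ?thesis
    unfolding chain_defect_def 1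
    by (simp add: sum.distrib sum_distrib_left sum_distrib_right left_diff_distrib right_diff_distrib)
qed

lemma chain_defect_const: "chain_defect a x (rs d W (\<lambda>_. of_real r)) = 0"
proof -
  have e: "rs d W (\<lambda>_. of_real r) = r *\<^sub>S one d W" by (auto simp: srestrict_def fun_eq_iff sfun_apply of_real_def)
  have "C.d a (r *\<^sub>S one c W) = 0" "E.d b (r *\<^sub>S one d W) = 0" for b
    by (simp_all add: C.d_scale C.S_one C.d_one E.d_scale E.S_one E.d_one sscale_simps)
  then show ?thesis by (simp add: chain_defect_def e t_scale E.S_one t_one sfun_apply)
qed

lemma chain_defect_coord: "b < n + m ==> a < n + m ==> chain_defect a x (X d W b) = 0"
proof -
  assume b: "b < n + m" and a: "a < n + m"
  have "C.d a (t (X d W l)) x * t (E.d l (X d W b)) x = (if l = b then C.d a (t (X d W b)) x else 0)" if "l < n + m" for l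
    using C.S_one_mult(2)[OF C.d_S[OF t_S[OF E.S_scoord[OF b]] a]]
    by (auto simp: E.d_scoord t_one sfun_apply fun_eq_iff)
  then show ?thesis using b by (simp add: chain_defect_def)
qed

lemma chain_defect_supp: "f \<in> E.S ==> a < n + m ==> gsupp {n..<n + m} (chain_defect a x f)"
  unfolding chain_defect_def
  by (intro gsupp_diff gsupp_sum gsupp_mult C.S_supp C.d_S t_S E.S_scoord E.d_S) auto

text \<open>Induction on the filtration degree for all f at once. Freezing one coordinate at q
  changes f by (x_i - q_i) * g. The first factor has zero defect and a pullback without body at the
  point, so the defect of the product gains one degree over that of g. After all coordinates are
  frozen f is constant.\<close>

lemma chain_defect_real:
  assumes B: "im d W = open_box n q r" "r > 0" and p: "p \<in> W" "q = crd M d p" and a: "a < n + m"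
    and f: "smooth_fun n (im d W) f"
  shows "chain_defect a (crd M c p) (rs d W (\<lambda>x. of_real (f x))) = 0"
proof -
  let ?x = "crd M c p" and ?r = "\<lambda>f. rs d W (\<lambda>x. of_real (f x) :: grassmann)"
  have rS: "?r f \<in> E.S" if "smooth_fun n (im d W) f" for f
    unfolding E.srestrict_S by (rule E.sloc_of_real[OF that])
  have q: "q \<in> espace n" using openin_Euclidean_subset[OF im_open[OF cd(2,3) Wd]] p by blast
  have "glow k (chain_defect a ?x (?r f))" if "smooth_fun n (im d W) f" for k f
    using that
  proof (induction k arbitrary: f)
    case (Suc k)
    note outer = Suc.IH
    \<comment> \<open>The first i coordinates are frozen, so \<open>fz 0\<close> is f and
      \<open>fz n\<close> is constant on the domain.\<close>
    define fz where "fz i x = f (\<lambda>j. if j < i then q j else x j)" for i and x :: "nat => real"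
    have fz: "smooth_fun n (im d W) (fz i) \<and> glow (Suc k) (chain_defect a ?x (?r f) - chain_defect a ?x (?r (fz i)))"
      if "i \<le> n" for i
      using that
    proof (induction i)
      case 0
      have "fz 0 = f" by (rule ext) (simp add: fz_def)
      then show ?case using Suc.prems by simp
    next
      case (Suc i)
      then have i: "i < n" and IH: "smooth_fun n (im d W) (fz i)"
        "glow (Suc k) (chain_defect a ?x (?r f) - chain_defect a ?x (?r (fz i)))" by auto
      have fS: "fz (Suc i) = (\<lambda>x. fz i (x(i := q i)))"
      proof
        fix x
        have "(\<lambda>j. if j < Suc i then q j else x j) = (\<lambda>j. if j < i then q j else (x(i := q i)) j)"
          by (auto simp: less_Suc_eq)
        then show "fz (Suc i) x = fz i (x(i := q i))" by (simp only: fz_def)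
      qed
      obtain g where g': "smooth_fun n (open_box n q r) g" "smooth_fun n (open_box n q r) (\<lambda>x. fz i (x(i := q i)))"
        "!!x. x \<in> open_box n q r ==> fz i x = fz i (x(i := q i)) + (x i - q i) * g x"
        by (rule hadamard[OF q B(2) i IH(1)[unfolded B(1)]]) (rule that)
      have g: "smooth_fun n (im d W) g" "smooth_fun n (im d W) (fz (Suc i))"
        "!!x. x \<in> im d W ==> fz i x = fz (Suc i) x + (x i - q i) * g x"
        unfolding B(1) fS by (fact g')+
      let ?h = "X d W i - rs d W (\<lambda>_. of_real (q i))"
      have cS: "rs d W (\<lambda>_. of_real (q i)) \<in> E.S" by (rule rS[OF E.smooth_const])
      have hS: "?h \<in> E.S" using i by (intro E.S_diff E.S_scoord cS) simp
      have e: "?r (fz i) = ?r (fz (Suc i)) + ?h * ?r g"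
        using i g(3) by (auto simp: fun_eq_iff sfun_apply srestrict_def scoord_def)
      have "chain_defect a ?x (?h + rs d W (\<lambda>_. of_real (q i))) = chain_defect a ?x ?h + 0"
        unfolding chain_defect_const[of a ?x "q i", symmetric] by (rule chain_defect_add[OF hS cS])
      then have h0: "chain_defect a ?x ?h = 0" using chain_defect_coord[of i a] i a by simp
      \<comment> \<open>The pullback preserves bodies, and x_i - q_i vanishes at q.\<close>
      have "gbody (t ?h ?x) = 0"
        using t_body[OF hS p(1)] p i by (simp add: sfun_apply scoord_def srestrict_def)
      then have "glow 1 (gsign (spar n a) (t ?h ?x))"
        by (simp add: glow_1_iff[unfolded One_nat_def] gbody_def)
      then have "glow (1 + k) (gsign (spar n a) (t ?h ?x) * chain_defect a ?x (?r g))"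
        by (rule glow_mult[OF _ outer[OF g(1)]])
      then have "glow (Suc k) (chain_defect a ?x (?r (fz i)) - chain_defect a ?x (?r (fz (Suc i))))"
        unfolding e by (simp add: chain_defect_add[OF rS[OF g(2)] E.S_mult[OF hS rS[OF g(1)]]] chain_defect_mult[OF hS rS[OF g(1)]] h0)
      from glow_add[OF IH(2) this] g(2) show ?case by simp
    qed
    have "?r (fz n) = rs d W (\<lambda>_. of_real (f q))"
    proof -
      have "(\<lambda>j. if j < n then q j else x j) = q" if "x \<in> im d W" for x
        using that q unfolding B(1) by (auto simp: not_less)
      then show ?thesis by (auto simp: srestrict_def fun_eq_iff fz_def)
    qed
    then show ?case using fz[of n] chain_defect_const[of a ?x "f q"] by simp
  qed simp
  \<comment> \<open>Degree m + 1 exceeds the number m of odd coordinates.\<close>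
  from this[OF f, of "Suc m"] chain_defect_supp[OF rS[OF f] a, of ?x]
  show ?thesis by (intro glow_eq_0[of "{n..<n + m}" _ "Suc m"]) auto
qed

text \<open>Induction over the odd labels that occur in f. With f = (f - \<xi> g) + \<xi> g, both f
  - \<xi> g and g have one label fewer and \<xi> has zero defect. When no labels are left, f is a
  real function.\<close>

lemma chain_defect_box:
  assumes B: "im d W = open_box n q r" "r > 0" and p: "p \<in> W" "q = crd M d p" and a: "a < n + m"
    and f: "f \<in> E.S"
  shows "chain_defect a (crd M c p) f = 0"
proof -
  let ?x = "crd M c p"
  have "chain_defect a ?x f = 0" if "finite A" "A \<subseteq> {n..<n + m}" "f \<in> E.S" "!!y. gsupp A (f y)" for A f
    using that
  proof (induction A arbitrary: f rule: finite_induct)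
    case empty
    have "f = rs d W (\<lambda>x. of_real (gbody (f x)))"
    proof (rule ext)
      fix y
      have "f y = of_real (gbody (f y))" by (rule gderiv_all_0[OF finite.emptyI empty(3)]) simp
      then show "f y = rs d W (\<lambda>x. of_real (gbody (f x))) y"
        using E.S_outside[OF empty(2), of y] by (auto simp: srestrict_def)
    qed
    then show ?case
      using chain_defect_real[OF B p a E.sloc_body[OF E.S_sloc[OF empty(2)]]] by simp
  next
    case (insert b A)
    have b: "b < n + m" "b \<ge> n" using insert by auto
    let ?\<xi> = "X d W b" and ?g = "E.d b f"
    have gS: "?g \<in> E.S" and xS: "?\<xi> \<in> E.S" using insert b by (auto intro: E.d_S E.S_scoord)
    have eq: "?g y = (if y \<in> im d W then gderiv b (f y) else 0)" for y
      using b by (simp add: E.d_odd E.d_outside)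
    have ins: "insert b A - {b} = A" using insert by auto
    have gA: "gsupp A (?g y)" for y
    proof -
      have "gderiv b (gderiv b (f y)) = 0"
        using gderiv_gderiv[of b b "f y"] by (metis add_eq_0_iff scaleR_2 scaleR_eq_0_iff zero_neq_numeral)
      then have "gsupp (insert b A - {b}) (gderiv b (f y))"
        by (rule gsupp_gderiv_eq_0[OF gsupp_gderiv[OF insert.prems(3)]])
      then show ?thesis using ins by (simp add: eq)
    qed
    have rS: "f - ?\<xi> * ?g \<in> E.S" by (intro E.S_diff E.S_mult xS gS insert)
    have rA: "gsupp A ((f - ?\<xi> * ?g) y)" for y
      using gsupp_remainder[OF insert.prems(3)[of y], of b] ins b E.S_outside[OF insert.prems(2), of y]
      by (auto simp: sfun_apply eq scoord_def srestrict_def)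
    have A: "A \<subseteq> {n..<n + m}" using insert by auto
    have "chain_defect a ?x ((f - ?\<xi> * ?g) + ?\<xi> * ?g) = 0"
      unfolding chain_defect_add[OF rS E.S_mult[OF xS gS]] chain_defect_mult[OF xS gS]
        insert.IH[OF A rS rA] insert.IH[OF A gS gA] chain_defect_coord[OF b(1) a] by simp
    then show ?case by (simp only: diff_add_cancel)
  qed
  from this[of "{n..<n + m}" f] f E.S_supp show ?thesis by auto
qed

end

context chart_change
begin

text \<open>The assertion is pointwise and all of its terms are compatible with restriction, so W
  may be shrunk to a set whose image under the chart d is a box, as Hadamard's lemma
  requires.\<close>

theorem chain_rule:
  assumes f: "f \<in> E.S" and a: "a < n + m"
  shows "C.d a (t f) = (\<Sum>b<n + m. C.d a (t (X d W b)) * t (E.d b f))"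
proof (rule ext)
  fix x
  show "C.d a (t f) x = (\<Sum>b<n + m. C.d a (t (X d W b)) * t (E.d b f)) x"
  proof (cases "x \<in> im c W")
    case True
    then obtain p where p: "p \<in> W" "x = crd M c p" by auto
    obtain r where r: "r > 0" "closed_box n (crd M d p) r \<subseteq> im d W"
      using box_in_open[OF im_open[OF cd(2,3) Wd], of "crd M d p"] p by blast
    let ?B = "open_box n (crd M d p) r"
    define W' where "W' = {p' \<in> dom M d. crd M d p' \<in> ?B}"
    have W'o: "opn W'" unfolding W'_def by (rule preimage_open[OF cd(2) openin_open_box])
    have BW: "?B \<subseteq> im d W"
    proof -
      have "?B \<subseteq> closed_box n (crd M d p) r" by auto
      from order_trans[OF this r(2)] show ?thesis .
    qed
    have W'W: "W' \<subseteq> W"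
      using BW crd_mem[OF cd(2) Wd] unfolding W'_def by blast
    have imW': "im d W' = ?B"
    proof -
      have "?B \<subseteq> im d (dom M d)" using BW Wd by blast
      then show ?thesis unfolding W'_def by blast
    qed
    have pE: "crd M d p \<in> espace n" using openin_Euclidean_subset[OF im_open[OF cd(2,3) Wd]] p by blast
    have pd: "p \<in> dom M d" using p Wd by auto
    have pW': "p \<in> W'"
      using pE pd r(1) unfolding W'_def by simp
    interpret R: chart_change M c d W'
      by unfold_locales (use cd W'o W'W in auto)
    have "R.chain_defect a (crd M c p) (rs d W' f) = 0"
      using sections_restrict(1)[OF cd(2,3) W'o W'W Wd f]
      by (intro R.chain_defect_box[OF imW' r(1) pW' refl a])
    then have e: "R.C.d a (R.t (rs d W' f)) x = (\<Sum>b<n + m. R.C.d a (R.t (X d W' b)) x * R.t (R.E.d b (rs d W' f)) x)"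
      by (simp add: R.chain_defect_def p(2))
    have xW': "x \<in> im c W'" using p pW' by auto
    have 1: "R.t (rs d W' g) = rs c W' (t g)" if "g \<in> E.S" for g
      using t_restrict[OF W'o W'W that] .
    have 2: "R.C.d a (rs c W' g) = rs c W' (C.d a g)" for g
      by (rule sections_restrict(2)[OF cd(1,3) W'o W'W Wc])
    have 3: "R.E.d b (rs d W' f) = rs d W' (E.d b f)" for b
      by (rule sections_restrict(2)[OF cd(2,3) W'o W'W Wd])
    have 4: "X d W' b = rs d W' (X d W b)" for b
      using sections_restrict(3)[OF cd(2,3) W'o W'W Wd] by simp
    have "(\<Sum>b<n + m. R.C.d a (R.t (X d W' b)) x * R.t (R.E.d b (rs d W' f)) x) =
        (\<Sum>b<n + m. C.d a (t (X d W b)) x * t (E.d b f) x)"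
      unfolding 3 4 by (rule sum.cong[OF refl])
        (simp add: 1[OF E.S_scoord] 1[OF E.d_S[OF f]] 2 srestrict_apply[OF xW'])
    with e show ?thesis by (simp add: 1[OF f] 2 sfun_apply srestrict_apply[OF xW'])
  qed (simp add: sfun_apply C.d_outside)
qed

text \<open>Being a homomorphism does not by itself give compatibility with real powers. Let h be
  the product of the pulled back power with the power -w of the pulled back function. By
  \<open>chain_rule\<close> and \<open>d_powr\<close> its derivatives vanish after multiplication by
  the invertible t g, and the body of h is 1.\<close>

lemma t_powr:
  assumes g: "g \<in> E.S" "sparity 0 g" and nz: "!!x. x \<in> im d W ==> gbody (g x) \<noteq> 0"
  shows "t (rs d W (\<lambda>x. gabs_powr m (g x) w)) = rs c W (\<lambda>x. gabs_powr m (t g x) w)"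
proof -
  let ?G = "rs d W (\<lambda>x. gabs_powr m (g x) w)"
  let ?u = "t ?G" and ?v = "\<lambda>w. rs c W (\<lambda>x. gabs_powr m (t g x) w)"
  have GS: "?G \<in> E.S" by (rule E.S_powr[OF E.S_sloc[OF g(1)] nz])
  have tg: "t g \<in> C.S" "sparity 0 (t g)" using t_S t_parity g by auto
  have tnz: "gbody (t g x) \<noteq> 0" if "x \<in> im c W" for x
    using that nz t_body[OF g(1)] by auto
  have uS: "?u \<in> C.S" and vS: "?v w \<in> C.S" for w
    by (rule t_S[OF GS], rule C.S_powr[OF C.S_sloc[OF tg(1)] tnz])
  have ev: "gparity 0 (g x)" "gparity 0 (t g x)" for x using g tg by (auto simp: sparity_def)
  have Gev: "sparity 0 ?G" by (auto simp: sparity_def srestrict_def intro: C.gparity_gabs_powr ev)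
  have vev: "gparity 0 (?v w x)" for w x by (auto simp: srestrict_def intro: C.gparity_gabs_powr ev)
  have uev: "sparity 0 ?u" by (rule t_parity[OF GS Gev])
  have dG: "g * E.d b ?G = w *\<^sub>S (?G * E.d b g)" for b
  proof (rule ext)
    fix x
    show "(g * E.d b ?G) x = (w *\<^sub>S (?G * E.d b g)) x"
    proof (cases "x \<in> im d W")
      case True
      have "E.d b ?G = E.d b (\<lambda>x. gabs_powr m (g x) w)" by (rule E.d_cong) (simp add: srestrict_def)
      then show ?thesis
        using E.d_powr[OF E.S_sloc[OF g(1)] ev(1) nz True, of b w] True by (simp add: sfun_apply srestrict_def)
    qed (simp add: sfun_apply E.d_outside)
  qed
  have du: "t g x * C.d a ?u x = w *\<^sub>R (?u x * C.d a (t g) x)" if a: "a < n + m" for a x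
  proof -
    have tgG: "t g * t (E.d b ?G) = w *\<^sub>S (?u * t (E.d b g))" if "b < n + m" for b
      using arg_cong[OF dG[of b], of t] E.d_S[OF GS that] E.d_S[OF g(1) that]
      by (simp add: t_mult g(1) GS t_scale E.S_mult)
    have "t g * C.d a ?u = (\<Sum>b<n + m. C.d a (t (X d W b)) * (t g * t (E.d b ?G)))"
      unfolding chain_rule[OF GS a] sum_distrib_left
      by (intro sum.cong refl sfun_even_left_commute[OF tg(2)])
    also have "\<dots> = (\<Sum>b<n + m. w *\<^sub>S (?u * (C.d a (t (X d W b)) * t (E.d b g))))"
    proof (rule sum.cong[OF refl])
      fix b assume "b \<in> {..<n + m}"
      then have "t g * t (E.d b ?G) = w *\<^sub>S (?u * t (E.d b g))" using tgG by simp
      then show "C.d a (t (X d W b)) * (t g * t (E.d b ?G)) = w *\<^sub>S (?u * (C.d a (t (X d W b)) * t (E.d b g)))"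
        by (simp only: sscale_simps sfun_even_left_commute[OF uev, of "C.d a (t (X d W b))"])
    qed
    also have "\<dots> = w *\<^sub>S (?u * C.d a (t g))"
      unfolding chain_rule[OF g(1) a] by (simp add: sscale_sum sum_distrib_left)
    finally show ?thesis by (simp add: fun_eq_iff sfun_apply)
  qed
  define h where "h = ?u * ?v (- w)"
  have hS: "h \<in> C.S" unfolding h_def by (rule C.S_mult[OF uS vS])
  have dh: "C.d a h x = 0" if a: "a < n + m" and x: "x \<in> im c W" for a x
  proof -
    have vd: "C.d a (?v (- w)) x = C.d a (\<lambda>x. gabs_powr m (t g x) (- w)) x"
      by (rule fun_cong[OF C.d_cong]) (simp add: srestrict_def)
    have dv: "t g x * C.d a (?v (- w)) x = - w *\<^sub>R (?v (- w) x * C.d a (t g) x)"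
      using C.d_powr[OF C.S_sloc[OF tg(1)] ev(2) tnz x, of a "- w"] x vd by (simp add: srestrict_def)
    have "C.d a h x = C.d a ?u x * ?v (- w) x + ?u x * C.d a (?v (- w)) x"
      using C.d_mult[OF uS vS uev, of a "- w"] by (simp add: h_def sfun_apply)
    then have "t g x * C.d a h x = (t g x * C.d a ?u x) * ?v (- w) x + ?u x * (t g x * C.d a (?v (- w)) x)"
      by (simp only: distrib_left mult.assoc grassmann_even_left_commute[OF ev(2), of x "?u x"])
    also have "\<dots> = 0"
      unfolding du[OF a] dv using grassmann_even_commute[OF vev, of "- w" x] by (simp add: mult.assoc)
    finally have z: "t g x * C.d a h x = 0" .
    obtain k where "k * t g x = 1" using grassmann_inverse[OF C.S_supp[OF tg(1)] _ tnz[OF x]] by auto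
    then show ?thesis using z by (metis mult.assoc mult_1_left mult_zero_right)
  qed
  \<comment> \<open>Vanishing odd derivatives reduce h x to its body, and bodies are preserved by
    the pullback.\<close>
  have h1: "h x = 1" if x: "x \<in> im c W" for x
  proof -
    have "h x = of_real (gbody (h x))"
      by (rule gderiv_all_0[of "{n..<n + m}"]) (use C.S_supp[OF hS] dh[OF _ x] x in \<open>auto simp: C.d_odd[symmetric]\<close>)
    moreover obtain p where p: "p \<in> W" "x = crd M c p" using x by auto
    have "gbody (h x) = 1"
      using t_body[OF GS p(1)] t_body[OF g(1) p(1)] p x nz[of "crd M d p"]
      by (simp add: h_def sfun_apply srestrict_def C.gbody_gabs_powr powr_minus)
    ultimately show ?thesis by simp
  qed
  show ?thesis
  proof (rule ext)
    fix x
    show "?u x = ?v w x"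
    proof (cases "x \<in> im c W")
      case x: True
      have "?v (- w) x * ?v w x = 1"
        using C.gabs_powr_add[OF C.S_supp[OF tg(1)] tnz[OF x], of "- w" w] x tnz[OF x] by (simp add: srestrict_def C.gabs_powr_0)
      then have "?u x = ?u x * ?v (- w) x * ?v w x" by (simp add: mult.assoc)
      also have "\<dots> = ?v w x" using h1[OF x] by (simp add: h_def sfun_apply)
      finally show ?thesis .
    qed (use C.S_outside[OF uS, of x] in \<open>simp add: srestrict_def[of "im c W"]\<close>)
  qed
qed

end

section \<open>Jacobian matrices and their Berezinians\<close>

context chart_change
begin

definition Pm :: "nat => nat => sfun" where
  "Pm a b = C.d a (t (X d W b))"

text \<open>The Jacobian matrix of the inverse change, re-expressed in the coordinates of c. With it
  the Berezinian takes the form \<open>ber2\<close>.\<close>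

definition Ym :: "nat => nat => sfun" where
  "Ym a b = t (E.d a (T d c W (X c W b)))"

lemma inverse_change: "chart_change M d c W"
  by unfold_locales (use cd in auto)

lemma t_t_inverse: "f \<in> C.S ==> t (T d c W f) = f"
  using trans_trans[OF cd(1,2,1,3)] trans_id[OF cd(1,3) Wc] cd(4) by auto

lemma inverse_S: "f \<in> C.S ==> T d c W f \<in> E.S"
  by (rule chart_change.t_S[OF inverse_change])

lemma sparity_scoord: "b < n + m ==> sparity (spar n b) (scoord n V b)"
  by (auto simp: sparity_def scoord_def srestrict_def spar_def gparity_ggen[unfolded One_nat_def])

lemma Pm_S: "a < n + m ==> b < n + m ==> Pm a b \<in> C.S"
  unfolding Pm_def by (intro C.d_S t_S E.S_scoord)
lemma Ym_S: "a < n + m ==> b < n + m ==> Ym a b \<in> C.S"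
  unfolding Ym_def by (intro E.d_S t_S inverse_S C.S_scoord)
lemma Pm_parity: "b < n + m ==> sparity (spar n a + spar n b) (Pm a b)"
  unfolding Pm_def
  using C.d_parity[OF t_parity[OF E.S_scoord sparity_scoord], of b a] by (simp add: add.commute)
lemma Ym_parity: "a < n + m ==> b < n + m ==> sparity (spar n a + spar n b) (Ym a b)"
  unfolding Ym_def
  using t_parity[OF E.d_S[OF inverse_S[OF C.S_scoord]] E.d_parity[OF chart_change.t_parity[OF inverse_change C.S_scoord sparity_scoord]], of b a]
  by (simp add: add.commute)

lemma Pm_Ym: "a < n + m ==> b < n + m ==> (\<Sum>l<n + m. Pm a l * Ym l b) = (if a = b then one c W else 0)"
  unfolding Pm_def Ym_def
  using chain_rule[OF inverse_S[OF C.S_scoord], of b a] by (simp add: t_t_inverse C.S_scoord C.d_scoord)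

text \<open>\<open>Pm_Ym\<close> for the inverse change, pulled back by t: this exchanges the roles
  of the two matrices.\<close>

lemma Ym_Pm: assumes a: "a < n + m" and b: "b < n + m"
  shows "(\<Sum>l<n + m. Ym a l * Pm l b) = (if a = b then one c W else 0)"
proof -
  interpret I: chart_change M d c W by (rule inverse_change)
  have 1: "t (I.Pm a l * I.Ym l b) = Ym a l * Pm l b" if l: "l < n + m" for l
  proof -
    have "t (I.Pm a l) = Ym a l" by (simp add: I.Pm_def Ym_def)
    moreover have "t (I.Ym l b) = Pm l b"
      using t_t_inverse[OF Pm_S[OF l b]] by (simp add: I.Ym_def Pm_def)
    ultimately show ?thesis using t_mult[OF I.Pm_S[OF a l] I.Ym_S[OF l b]] by simp
  qed
  have "t (\<Sum>l<n + m. I.Pm a l * I.Ym l b) = (\<Sum>l<n + m. t (I.Pm a l * I.Ym l b))"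
    using a b by (intro t_sum E.S_mult I.Pm_S I.Ym_S) auto
  also have "\<dots> = (\<Sum>l<n + m. Ym a l * Pm l b)" by (rule sum.cong) (use 1 in auto)
  finally show ?thesis unfolding I.Pm_Ym[OF a b] by (cases "a = b") (simp_all add: t_one)
qed

lemma smat_inverse_at: "x \<in> im c W ==> smat_inverse n m (\<lambda>i j. Pm i j x) (\<lambda>i j. Ym i j x)"
  using Pm_parity Ym_parity fun_cong[OF Pm_Ym, of _ _ x] fun_cong[OF Ym_Pm, of _ _ x]
  by (auto simp: smat_inverse_def smat_even_def smat_mult_def sparity_def sfun_apply srestrict_def)

lemma smat_supp_at: "smat_supp n m {n..<n + m} (\<lambda>i j. Pm i j x)" "smat_supp n m {n..<n + m} (\<lambda>i j. Ym i j x)"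
  using C.S_supp[OF Pm_S] C.S_supp[OF Ym_S] by (auto simp: smat_supp_def)

end

context supermfd
begin

lemma chart_changeI: "c \<in> charts M ==> d \<in> charts M ==> opn W ==> W \<subseteq> ovl c d ==> chart_change M c d W"
  by unfold_locales auto

lemma Pm_restrict:
  assumes "chart_change M c d W" "opn W'" "W' \<subseteq> W" "a < n + m" "b < n + m"
  shows "chart_change.Pm M c d W' a b = rs c W' (chart_change.Pm M c d W a b)"
    "chart_change.Ym M c d W' a b = rs c W' (chart_change.Ym M c d W a b)"
proof -
  interpret A: chart_change M c d W by fact
  interpret B: chart_change M c d W' by (rule chart_changeI) (use A.cd assms in auto)
  interpret I: chart_change M d c W by (rule A.inverse_change)
  note rc = sections_restrict[OF A.cd(1,3) assms(2,3) A.Wc] and rd = sections_restrict[OF A.cd(2,3) assms(2,3) A.Wd]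
  note rt = A.t_restrict[OF assms(2,3), symmetric] and ri = I.t_restrict[OF assms(2,3), symmetric]
  show "B.Pm a b = rs c W' (A.Pm a b)"
    unfolding A.Pm_def B.Pm_def rc(2)[symmetric] using assms by (simp add: rt A.E.S_scoord rd(3))
  show "B.Ym a b = rs c W' (A.Ym a b)"
    unfolding A.Ym_def B.Ym_def using assms
    by (simp add: rt A.E.d_S A.inverse_S A.C.S_scoord rd(2)[symmetric] ri rc(3))
qed

end

context chart_change
begin

text \<open>\<open>jacobian\<close> refers to the full overlap; on W its values are those of the
  restricted matrices.\<close>

lemma jacobian_ber2:
  assumes x: "x \<in> im c W"
  shows "jacobian M c d x = ber2 n m (\<lambda>i j. Pm i j x) (\<lambda>i j. Ym i j x)"
proof -
  interpret Q: chart_change M c d "ovl c d" by (rule chart_changeI) (use cd opn_ovl in auto)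
  have x': "x \<in> im c (ovl c d)" using x cd by auto
  have "jacobian M c d x = berezinian n m (\<lambda>i j. Q.Pm i j x)"
    by (simp add: jacobian_def Q.Pm_def Let_def)
  also have "\<dots> = ber2 n m (\<lambda>i j. Q.Pm i j x) (\<lambda>i j. Q.Ym i j x)"
    by (rule berezinian_ber2[OF Q.smat_inverse_at[OF x'] Q.smat_supp_at])
  also have "\<dots> = ber2 n m (\<lambda>i j. Pm i j x) (\<lambda>i j. Ym i j x)"
    using Pm_restrict[OF Q.chart_change_axioms cd(3,4)] by (intro ber2_cong) (simp_all add: srestrict_apply[OF x])
  finally show ?thesis .
qed

definition J :: sfun where "J = rs c W (jacobian M c d)"

lemma J_ber2: "J = rs c W (\<lambda>x. ber2 n m (\<lambda>i j. Pm i j x) (\<lambda>i j. Ym i j x))"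
  unfolding J_def srestrict_eq_iff using jacobian_ber2 by blast

lemma J_S: "J \<in> C.S" and J_even: "sparity 0 J"
  using C.vf_liouville(1,2)[of "\<lambda>_. 0" 0 Pm Ym] Pm_S Ym_S Pm_parity Ym_parity Pm_Ym Ym_Pm
  unfolding J_ber2 by simp_all

lemma J_liouville:
  assumes "!!a. a < n + m ==> Z a \<in> C.S" "!!a. a < n + m ==> sparity (q + spar n a) (Z a)"
  shows "C.vf Z J = (\<Sum>a<n + m. (-1) ^ spar n a * (\<Sum>l<n + m. C.vf Z (Pm a l) * Ym l a)) * J"
  using C.vf_liouville(3)[of Z q Pm Ym] assms Pm_S Ym_S Pm_parity Ym_parity Pm_Ym Ym_Pm
  unfolding J_ber2 by simp

lemma J_body: "x \<in> im c W ==> gbody (J x) \<noteq> 0"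
proof -
  assume x: "x \<in> im c W"
  have "gbody (J x * ber2 n m (\<lambda>i j. Ym i j x) (\<lambda>i j. Pm i j x)) = 1"
    using ber2_inverse[OF smat_inverse_at[OF x] smat_supp_at] x by (simp add: J_ber2 srestrict_def)
  then show ?thesis by auto
qed

definition Jw :: "real => sfun" where
  "Jw w = rs c W (\<lambda>x. gabs_powr m (jacobian M c d x) w)"

lemma Jw_alt: "Jw w = rs c W (\<lambda>x. gabs_powr m (J x) w)"
  by (auto simp: Jw_def J_def srestrict_def)

lemma Jw_S: "Jw w \<in> C.S"
  unfolding Jw_alt by (rule C.S_powr[OF C.S_sloc[OF J_S] J_body])

lemma Jw_even: "sparity 0 (Jw w)"
  using J_even unfolding Jw_alt by (auto simp: sparity_def srestrict_def intro: C.gparity_gabs_powr)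

lemma Jw_add: "Jw (u + v) = Jw u * Jw v"
  using C.gabs_powr_add[OF C.S_supp[OF J_S] J_body] by (auto simp: Jw_alt srestrict_def fun_eq_iff sfun_apply)

lemma Jw_0: "Jw 0 = one c W"
  using C.gabs_powr_0[OF J_body] by (auto simp: Jw_alt srestrict_def fun_eq_iff sfun_apply)

lemma Jw_inverse: "Jw w * Jw (- w) = one c W"
  using Jw_add[of w "- w"] by (simp add: Jw_0)

text \<open>The sign of the Jacobian, by which \<open>\<bar>J\<bar>\<close> differs from \<open>J\<close>, is locally constant and hence invisible here.\<close>

lemma Jw_1_liouville:
  assumes Z: "!!a. a < n + m ==> Z a \<in> C.S" "!!a. a < n + m ==> sparity (q + spar n a) (Z a)"
  shows "C.vf Z (Jw 1) = (\<Sum>a<n + m. (-1) ^ spar n a * (\<Sum>l<n + m. C.vf Z (Pm a l) * Ym l a)) * Jw 1"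
    (is "_ = ?s * _")
proof (rule ext)
  fix x
  show "C.vf Z (Jw 1) x = (?s * Jw 1) x"
  proof (cases "x \<in> im c W")
    case x: True
    have ev: "gparity 0 (J x)" "gparity 0 (Jw 1 x)" for x using J_even Jw_even by (auto simp: sparity_def)
    have d1: "J x * C.d a (Jw 1) x = Jw 1 x * C.d a J x" for a
    proof -
      have "C.d a (Jw 1) = C.d a (\<lambda>x. gabs_powr m (J x) 1)"
        by (rule C.d_cong) (simp add: Jw_alt srestrict_def)
      then show ?thesis
        using C.d_powr[OF C.S_sloc[OF J_S] ev(1) J_body x, of a 1] x by (simp add: Jw_alt srestrict_def)
    qed
    have "J x * C.vf Z (Jw 1) x = (\<Sum>a<n + m. Z a x * (J x * C.d a (Jw 1) x))"
      by (simp add: C.vf_def sfun_apply sum_distrib_left grassmann_even_left_commute[OF ev(1)])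
    also have "\<dots> = Jw 1 x * C.vf Z J x"
      unfolding d1 by (simp add: C.vf_def sfun_apply sum_distrib_left grassmann_even_left_commute[OF ev(2), of x])
    also have "\<dots> = J x * (?s * Jw 1) x"
    proof -
      have "C.vf Z J x = ?s x * J x" using J_liouville[OF Z, unfolded fun_eq_iff, THEN spec, of x] by (simp only: times_fun_apply)
      then have "Jw 1 x * C.vf Z J x = (?s x * J x) * Jw 1 x" using grassmann_even_commute[OF ev(2)] by simp
      also have "\<dots> = (J x * ?s x) * Jw 1 x" using grassmann_even_commute[OF ev(1)] by simp
      finally show ?thesis by (simp only: times_fun_apply mult.assoc)
    qed
    finally have e: "J x * C.vf Z (Jw 1) x = J x * (?s * Jw 1) x" .
    obtain k where k: "k * J x = 1" using grassmann_inverse[OF C.S_supp[OF J_S] _ J_body[OF x]] by auto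
    have "k * (J x * C.vf Z (Jw 1) x) = k * (J x * (?s * Jw 1) x)" by (simp only: e)
    then show ?thesis by (simp only: mult.assoc[symmetric] k mult_1_left)
  qed (use C.S_outside[OF Jw_S] C.S_outside[OF C.vf_S[OF Z(1) Jw_S]] in \<open>simp add: sfun_apply\<close>)
qed

text \<open>Here the polynomial form of \<open>ber2\<close> pays off: \<open>hom_gdet\<close>
  applies to the pullback followed by evaluation at x.\<close>

lemma t_ber2:
  assumes P: "!!i j. i < n + m ==> j < n + m ==> P i j \<in> E.S" "!!i j. i < n + m ==> j < n + m ==> Y i j \<in> E.S"
    and x: "x \<in> im c W"
  shows "t (rs d W (\<lambda>x. ber2 n m (\<lambda>i j. P i j x) (\<lambda>i j. Y i j x))) x = ber2 n m (\<lambda>i j. t (P i j) x) (\<lambda>i j. t (Y i j) x)"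
proof -
  let ?u = "one d W" and ?h = "\<lambda>f. t f x"
  let ?D1 = "(\<lambda>x. gdet n (\<lambda>i j. P i j x)) * ?u" and ?D2 = "(\<lambda>x. gdet m (\<lambda>i j. Y (n + i) (n + j) x)) * ?u"
  have h: "?h (f + g) = ?h f + ?h g" "?h (f * g) = ?h f * ?h g" "?h ?u = 1" if "f \<in> E.S" "g \<in> E.S" for f g
    using that by (simp_all add: t_add t_mult t_one srestrict_apply[OF x] plus_fun_apply times_fun_apply one_fun_apply)
  have 1: "?D1 \<in> E.S" "?h ?D1 = gdet n (\<lambda>i j. ?h (P i j))"
    by (rule E.hom_gdet[of ?h n P]; use P h h(3)[of 0 0] in simp)+
  have 2: "?D2 \<in> E.S" "?h ?D2 = gdet m (\<lambda>i j. ?h (Y (n + i) (n + j)))"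
    by (rule E.hom_gdet[of ?h m "\<lambda>i j. Y (n + i) (n + j)"]; use P h h(3)[of 0 0] in simp)+
  have "rs d W (\<lambda>x. ber2 n m (\<lambda>i j. P i j x) (\<lambda>i j. Y i j x)) = ?D1 * ?D2"
    by (auto simp: ber2_def srestrict_def fun_eq_iff sfun_apply)
  then show ?thesis using 1 2 by (simp add: h ber2_def)
qed

end

section \<open>The cocycle property of the Jacobian\<close>

context supermfd
begin

text \<open>By the chain rule the matrices \<open>Pm\<close> multiply, and the matrices
  \<open>Ym\<close> multiply in the reverse order, which is the situation of
  \<open>ber2_mult\<close>. The statement on powers then needs \<open>t_powr\<close> and
  \<open>gabs_powr_mult\<close>.\<close>

lemma J_cocycle:
  assumes cde: "c \<in> charts M" "d \<in> charts M" "e \<in> charts M" "opn W" "W \<subseteq> dom M c \<inter> dom M d \<inter> dom M e"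
  shows "chart_change.J M c e W = chart_change.J M c d W * T c d W (chart_change.J M d e W)"
    "chart_change.Jw M c e W w = chart_change.Jw M c d W w * T c d W (chart_change.Jw M d e W w)"
proof -
  interpret A: chart_change M c d W by (rule chart_changeI) (use cde in auto)
  interpret B: chart_change M d e W by (rule chart_changeI) (use cde in auto)
  interpret C: chart_change M c e W by (rule chart_changeI) (use cde in auto)
  interpret B': chart_change M e d W by (rule chart_changeI) (use cde in auto)
  have tt: "A.t (B.t f) = C.t f" if "f \<in> Sec e W" for f
    using trans_trans[OF cde that] .
  have P: "C.Pm i j = (\<Sum>l<n + m. A.Pm i l * A.t (B.Pm l j))" if "i < n + m" "j < n + m" for i j
    using A.chain_rule[OF B.t_S[OF B.E.S_scoord], of j i] that
    by (simp add: C.Pm_def A.Pm_def B.Pm_def tt B.E.S_scoord)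
  \<comment> \<open>The inverse change factors through d; the chain rule is used for the change from
    e to d before everything is pulled back to c.\<close>
  have Y: "C.Ym i j = (\<Sum>l<n + m. A.t (B.Ym i l) * A.Ym l j)" if ij: "i < n + m" "j < n + m" for i j
  proof -
    have f: "T d c W (X c W j) \<in> Sec d W" by (rule A.inverse_S[OF A.C.S_scoord[OF ij(2)]])
    have "T e c W (X c W j) = B'.t (T d c W (X c W j))"
      using trans_trans[of e d c W "X c W j"] cde A.C.S_scoord[OF ij(2)] by auto
    then have "C.Ym i j = C.t (D e W i (B'.t (T d c W (X c W j))))" by (simp add: C.Ym_def)
    also have "\<dots> = C.t (\<Sum>l<n + m. D e W i (B'.t (X d W l)) * B'.t (A.E.d l (T d c W (X c W j))))"
      by (subst B'.chain_rule[OF f ij(1)]) simp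
    also have "\<dots> = (\<Sum>l<n + m. C.t (D e W i (B'.t (X d W l))) * C.t (B'.t (A.E.d l (T d c W (X c W j)))))"
      using ij f by (subst C.t_sum) (auto simp: C.t_mult B'.t_S B.E.d_S A.E.d_S A.E.S_scoord B.E.S_mult intro!: sum.cong)
    also have "\<dots> = (\<Sum>l<n + m. A.t (B.Ym i l) * A.Ym l j)"
    proof (rule sum.cong[OF refl])
      fix l assume "l \<in> {..<n + m}"
      then have l: "l < n + m" by simp
      have g: "A.E.d l (T d c W (X c W j)) \<in> Sec d W" by (rule A.E.d_S[OF f l])
      have 1: "C.t (B'.t (A.E.d l (T d c W (X c W j)))) = A.Ym l j"
        using trans_trans[of c e d W, OF _ _ _ _ _ g] cde by (auto simp: A.Ym_def)
      have "D e W i (B'.t (X d W l)) \<in> Sec e W" by (intro B.E.d_S B'.t_S A.E.S_scoord l ij)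
      then have 2: "C.t (D e W i (B'.t (X d W l))) = A.t (B.Ym i l)" by (simp add: B.Ym_def tt)
      show "C.t (D e W i (B'.t (X d W l))) * C.t (B'.t (A.E.d l (T d c W (X c W j)))) = A.t (B.Ym i l) * A.Ym l j"
        unfolding 1 2 ..
    qed
    finally show ?thesis .
  qed
  have "C.J x = (A.J * A.t B.J) x" for x
  proof (cases "x \<in> im c W")
    case x: True
    have tB: "A.t B.J x = ber2 n m (\<lambda>i j. A.t (B.Pm i j) x) (\<lambda>i j. A.t (B.Ym i j) x)"
      unfolding B.J_ber2 by (rule A.t_ber2[OF B.Pm_S B.Ym_S x])
    have inv: "smat_inverse n m (\<lambda>i j. A.t (B.Pm i j) x) (\<lambda>i j. A.t (B.Ym i j) x)"
    proof -
      have s: "(\<Sum>l<n + m. A.t (F i l) * A.t (G l j)) = (if i = j then one c W else 0)"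
        if "i < n + m" "j < n + m" "(\<Sum>l<n + m. F i l * G l j) = (if i = j then one d W else 0)"
          "!!i j. i < n + m ==> j < n + m ==> F i j \<in> Sec d W" "!!i j. i < n + m ==> j < n + m ==> G i j \<in> Sec d W" for i j F G
      proof -
        have "A.t (\<Sum>l<n + m. F i l * G l j) = (\<Sum>l<n + m. A.t (F i l) * A.t (G l j))"
          using that by (subst A.t_sum) (auto simp: A.t_mult A.E.S_mult intro!: sum.cong)
        then show ?thesis unfolding that(3) by (auto simp: A.t_one)
      qed
      have "(\<Sum>l<n + m. A.t (B.Pm i l) x * A.t (B.Ym l j) x) = (if i = j then 1 else 0)"
        "(\<Sum>l<n + m. A.t (B.Ym i l) x * A.t (B.Pm l j) x) = (if i = j then 1 else 0)" if "i < n + m" "j < n + m" for i j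
        using fun_cong[OF s[where F = B.Pm and G = B.Ym, OF that B.Pm_Ym[OF that] B.Pm_S B.Ym_S], of x]
          fun_cong[OF s[where F = B.Ym and G = B.Pm, OF that B.Ym_Pm[OF that] B.Ym_S B.Pm_S], of x] x
        by (simp_all add: sfun_apply srestrict_def)
      moreover have "gparity (spar n i + spar n j) (A.t (B.Pm i j) x)" "gparity (spar n i + spar n j) (A.t (B.Ym i j) x)"
        if "i < n + m" "j < n + m" for i j
        using A.t_parity[OF B.Pm_S B.Pm_parity] A.t_parity[OF B.Ym_S B.Ym_parity] that by (auto simp: sparity_def)
      ultimately show ?thesis by (auto simp: smat_inverse_def smat_even_def smat_mult_def)
    qed
    have sup: "smat_supp n m {n..<n + m} (\<lambda>i j. A.t (B.Pm i j) x)"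
      using A.C.S_supp[OF A.t_S[OF B.Pm_S]] by (auto simp: smat_supp_def)
    have "C.J x = ber2 n m (\<lambda>i j. C.Pm i j x) (\<lambda>i j. C.Ym i j x)" using x by (simp add: C.J_ber2 srestrict_def)
    also have "\<dots> = ber2 n m (smat_mult (n + m) (\<lambda>i j. A.Pm i j x) (\<lambda>i j. A.t (B.Pm i j) x))
        (smat_mult (n + m) (\<lambda>i j. A.t (B.Ym i j) x) (\<lambda>i j. A.Ym i j x))"
      by (rule ber2_cong) (simp_all add: P Y smat_mult_def sfun_apply)
    also have "\<dots> = (A.J * A.t B.J) x"
      unfolding ber2_mult[OF A.smat_inverse_at[OF x] inv A.smat_supp_at(1) sup]
      using x by (simp add: sfun_apply tB A.J_ber2 srestrict_def)
    finally show ?thesis .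
  qed (use A.C.S_outside[OF A.J_S] A.C.S_outside[OF C.J_S] in \<open>simp add: sfun_apply\<close>)
  then show J: "C.J = A.J * A.t B.J" by (rule ext)
  have "C.Jw w x = (A.Jw w * A.t (B.Jw w)) x" for x
  proof (cases "x \<in> im c W")
    case x: True
    obtain p where p: "p \<in> W" "x = crd M c p" using x by auto
    have tb: "gbody (A.t B.J x) \<noteq> 0" using A.t_body[OF B.J_S p(1)] B.J_body p by auto
    have "A.t (B.Jw w) = rs c W (\<lambda>x. gabs_powr m (A.t B.J x) w)"
      unfolding B.Jw_alt by (rule A.t_powr[OF B.J_S B.J_even B.J_body])
    moreover have "gabs_powr m (A.J x * A.t B.J x) w = gabs_powr m (A.J x) w * gabs_powr m (A.t B.J x) w"
      by (rule A.C.gabs_powr_mult[OF A.C.S_supp[OF A.J_S] A.J_body[OF x] A.C.S_supp[OF A.t_S[OF B.J_S]] tb])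
        (use A.J_even in \<open>simp add: sparity_def\<close>)
    ultimately show ?thesis using x by (simp add: C.Jw_alt A.Jw_alt J sfun_apply srestrict_def)
  qed (use A.C.S_outside[OF A.Jw_S] A.C.S_outside[OF C.Jw_S] in \<open>simp add: sfun_apply\<close>)
  then show "C.Jw w = A.Jw w * A.t (B.Jw w)" by (rule ext)
qed

text \<open>The cocycle property with equal charts makes it idempotent, and it is
  invertible.\<close>

lemma Jw_same:
  assumes "c \<in> charts M" "opn W" "W \<subseteq> dom M c" shows "chart_change.Jw M c c W w = one c W"
proof -
  interpret A: chart_change M c c W by (rule chart_changeI) (use assms in auto)
  have "A.Jw w = A.Jw w * A.Jw w"
    using J_cocycle(2)[of c c c W w] assms trans_id[OF assms A.Jw_S[of w]] by auto
  then have "A.Jw (- w) * A.Jw w = A.Jw (- w) * (A.Jw w * A.Jw w)" by simp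
  then show ?thesis using A.Jw_inverse[of "- w"] A.C.S_one_mult[OF A.Jw_S] by (simp flip: mult.assoc)
qed

lemma Jw_restrict:
  "W' \<subseteq> W ==> rs c W' (srestrict (im c W) F) = rs c W' F"
  by (simp add: srestrict_srestrict Int_absorb2 image_mono)

section \<open>Densities\<close>

lemma image_inverse_eq: "B \<subseteq> f ` A ==> (!!p. p \<in> A ==> g (f p) = p) ==> g ` B = {p \<in> A. f p \<in> B}"
  by force

abbreviation jw :: "'c => 'c => real => sfun" where
  "jw c d w \<equiv> (\<lambda>x. gabs_powr m (jacobian M c d x) w)"

lemma densitiesI:
  assumes "!!c. c \<notin> charts M ==> f c = 0" "!!c. c \<in> charts M ==> f c \<in> Sec c (dom M c)"
    and "!!c d p. c \<in> charts M ==> d \<in> charts M ==> p \<in> ovl c d ==>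
      f c (crd M c p) = (T c d (ovl c d) (rs d (ovl c d) (f d)) * jw c d w) (crd M c p)"
  shows "f \<in> densities M w"
proof -
  have "rs c (ovl c d) (f c) = T c d (ovl c d) (rs d (ovl c d) (f d)) * jw c d w"
    if cd: "c \<in> charts M" "d \<in> charts M" for c d
  proof (rule ext)
    fix x
    interpret A: chart_change M c d "ovl c d" by (rule chart_changeI) (use cd opn_ovl in auto)
    have "rs d (ovl c d) (f d) \<in> Sec d (ovl c d)"
      by (rule sections_restrict(1)[OF cd(2) dom_open[OF cd(2)] A.cd(3) _ _ assms(2)[OF cd(2)]]) auto
    from A.C.S_outside[OF A.t_S[OF this]]
    show "rs c (ovl c d) (f c) x = (T c d (ovl c d) (rs d (ovl c d) (f d)) * jw c d w) x"
      using assms(3)[OF cd] by (cases "x \<in> im c (ovl c d)") (auto simp: srestrict_def[of "im c (ovl c d)"] sfun_apply)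
  qed
  then show ?thesis
    using assms(1,2) by (auto simp: densities_def sections_def)
qed

lemma density_outside: "f \<in> densities M w ==> c \<notin> charts M ==> f c = 0"
  and density_section: "f \<in> densities M w ==> c \<in> charts M ==> f c \<in> Sec c (dom M c)"
  by (auto simp: densities_def sections_def)

lemma density_transform:
  assumes f: "f \<in> densities M w" and A: "chart_change M c d W"
  shows "rs c W (f c) = T c d W (rs d W (f d)) * chart_change.Jw M c d W w"
proof -
  interpret A: chart_change M c d W by fact
  interpret Q: chart_change M c d "ovl c d" by (rule chart_changeI) (use A.cd opn_ovl in auto)
  have "rs c (ovl c d) (f c) = Q.t (rs d (ovl c d) (f d)) * jw c d w"
    using f A.cd by (auto simp: densities_def Let_def)
  then have "rs c W (rs c (ovl c d) (f c)) = rs c W (Q.t (rs d (ovl c d) (f d))) * A.Jw w"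
    by (simp add: A.Jw_def)
  moreover have "rs d (ovl c d) (f d) \<in> Q.E.S"
    by (rule sections_restrict(1)[OF A.cd(2) dom_open[OF A.cd(2)] Q.cd(3) _ _ density_section[OF f A.cd(2)]]) auto
  from Q.t_restrict[OF A.cd(3,4) this]
  have "rs c W (Q.t (rs d (ovl c d) (f d))) = A.t (rs d W (f d))" by (simp add: Jw_restrict[OF A.cd(4)])
  ultimately show ?thesis by (simp add: Jw_restrict[OF A.cd(4)])
qed

lemma density_section_restrict:
  "f \<in> densities M w ==> c \<in> charts M ==> opn W ==> W \<subseteq> dom M c ==> rs c W (f c) \<in> Sec c W"
  by (rule sections_restrict(1)[OF _ dom_open _ _ order_refl density_section])

text \<open>The transformation law may be verified on a neighbourhood of each point instead of the
  full overlap. Objects known only near a point, such as cut-off densities, can then be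
  used.\<close>

lemma densities_eqI:
  assumes "!!c. c \<notin> charts M ==> f c = 0" "!!c. c \<in> charts M ==> f c \<in> Sec c (dom M c)"
    and "!!c d p. c \<in> charts M ==> d \<in> charts M ==> p \<in> ovl c d ==> \<exists>W. opn W \<and> p \<in> W \<and> W \<subseteq> ovl c d \<and>
      f c (crd M c p) = (T c d W (rs d W (f d)) * chart_change.Jw M c d W w) (crd M c p)"
  shows "f \<in> densities M w"
proof (rule densitiesI[OF assms(1,2)])
  fix c d p assume cd: "c \<in> charts M" "d \<in> charts M" "p \<in> ovl c d"
  obtain W where W: "opn W" "p \<in> W" "W \<subseteq> ovl c d"
    "f c (crd M c p) = (T c d W (rs d W (f d)) * chart_change.Jw M c d W w) (crd M c p)" using assms(3)[OF cd] by (elim exE conjE)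
  interpret A: chart_change M c d W by (rule chart_changeI) (use cd W in auto)
  interpret Q: chart_change M c d "ovl c d" by (rule chart_changeI) (use A.cd opn_ovl in auto)
  have "rs d (ovl c d) (f d) \<in> Q.E.S"
    by (rule sections_restrict(1)[OF cd(2) dom_open[OF cd(2)] Q.cd(3) _ _ assms(2)[OF cd(2)]]) auto
  from Q.t_restrict[OF A.cd(3,4) this]
  have "A.t (rs d W (f d)) = rs c W (Q.t (rs d (ovl c d) (f d)))" by (simp add: Jw_restrict[OF A.cd(4)])
  then show "f c (crd M c p) = (Q.t (rs d (ovl c d) (f d)) * jw c d w) (crd M c p)"
    using W(2,4) by (simp add: sfun_apply A.Jw_def srestrict_def)
qed auto

lemma density_chartwise:
  assumes out: "!!c. c \<notin> charts M ==> h c = 0"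
    and S: "!!c. c \<in> charts M ==> h c \<in> Sec c (dom M c)"
    and tr: "!!c d. chart_change M c d (ovl c d) ==> rs c (ovl c d) (h c) = T c d (ovl c d) (rs d (ovl c d) (h d)) * chart_change.Jw M c d (ovl c d) w"
  shows "h \<in> densities M w"
proof (rule densities_eqI[OF out S])
  fix c d p assume p: "c \<in> charts M" "d \<in> charts M" "p \<in> ovl c d"
  then have A: "chart_change M c d (ovl c d)" by (intro chart_changeI) (use opn_ovl in auto)
  have "crd M c p \<in> im c (ovl c d)" using p by auto
  from fun_cong[OF tr[OF A], of "crd M c p"] srestrict_apply[OF this, of "h c"]
  show "\<exists>W. opn W \<and> p \<in> W \<and> W \<subseteq> ovl c d \<and> h c (crd M c p) = (T c d W (rs d W (h d)) * chart_change.Jw M c d W w) (crd M c p)"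
    using p by (intro exI[of _ "ovl c d"]) (simp add: opn_ovl)
qed auto

lemma density_0 [simp]: "0 \<in> densities M w"
proof (rule density_chartwise)
  fix c d assume "chart_change M c d (ovl c d)"
  then interpret A: chart_change M c d "ovl c d" .
  show "rs c (ovl c d) ((0 :: 'c => sfun) c) = A.t (rs d (ovl c d) ((0 :: 'c => sfun) d)) * A.Jw w"
    by (simp add: zero_fun_apply)
qed (simp_all add: zero_fun_apply superdomain.S_0[OF superdomain_im[OF _ dom_open order_refl]])

lemma density_add: "f \<in> densities M w ==> g \<in> densities M w ==> f + g \<in> densities M w"
  and density_diff: "f \<in> densities M w ==> g \<in> densities M w ==> f - g \<in> densities M w"
  and density_mult: "f \<in> densities M u ==> g \<in> densities M v ==> f * g \<in> densities M (u + v)"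
  and density_sscale: "f \<in> densities M w ==> (\<lambda>c. r *\<^sub>S f c) \<in> densities M w"
  and density_spart: "f \<in> densities M w ==> (\<lambda>c. spart q (f c)) \<in> densities M w"
proof -
  have S: "superdomain n (im c (dom M c))" if "c \<in> charts M" for c using that by (intro superdomain_im dom_open) auto
  note cls = superdomain.S_add[OF S] superdomain.S_diff[OF S] superdomain.S_mult[OF S] superdomain.S_scale[OF S] superdomain.S_part[OF S]
  have rS: "rs d (ovl c d) (f d) \<in> Sec d (ovl c d)" if "chart_change M c d (ovl c d)" "f \<in> densities M w" for c d f w
    by (rule density_section_restrict[OF that(2)]) (use chart_change.cd[OF that(1)] in auto)
  show "f + g \<in> densities M w" if f: "f \<in> densities M w" and g: "g \<in> densities M w"
    by (rule density_chartwise)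
      (use f g density_outside density_section cls in \<open>auto simp: plus_fun_apply density_transform[OF f] density_transform[OF g]
        chart_change.t_add rS[OF _ f] rS[OF _ g] distrib_right\<close>)
  show "f - g \<in> densities M w" if f: "f \<in> densities M w" and g: "g \<in> densities M w"
    by (rule density_chartwise)
      (use f g density_outside density_section cls in \<open>auto simp: minus_apply density_transform[OF f] density_transform[OF g]
        chart_change.t_diff rS[OF _ f] rS[OF _ g] left_diff_distrib\<close>)
  show "f * g \<in> densities M (u + v)" if f: "f \<in> densities M u" and g: "g \<in> densities M v"
  proof (rule density_chartwise)
    fix c d assume A: "chart_change M c d (ovl c d)"
    interpret A: chart_change M c d "ovl c d" by fact
    have "rs c (ovl c d) ((f * g) c) = (A.t (rs d (ovl c d) (f d)) * A.Jw u) * (A.t (rs d (ovl c d) (g d)) * A.Jw v)"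
      by (simp add: times_fun_apply[of f g] density_transform[OF f A] density_transform[OF g A])
    also have "\<dots> = A.t (rs d (ovl c d) (f d)) * A.t (rs d (ovl c d) (g d)) * (A.Jw u * A.Jw v)"
      by (simp only: mult.assoc sfun_even_left_commute[OF A.Jw_even[of u], of "A.t (rs d (ovl c d) (g d))"])
    finally show "rs c (ovl c d) ((f * g) c) = A.t (rs d (ovl c d) ((f * g) d)) * A.Jw (u + v)"
      by (simp add: times_fun_apply[of f g] A.t_mult rS[OF A f] rS[OF A g] A.Jw_add)
  qed (use f g density_outside density_section cls in \<open>auto simp: times_fun_apply[of f g]\<close>)
  show "(\<lambda>c. r *\<^sub>S f c) \<in> densities M w" if f: "f \<in> densities M w"
    by (rule density_chartwise)
      (use f density_outside density_section cls in \<open>auto simp: sscale_simps density_transform[OF f] chart_change.t_scale rS[OF _ f]\<close>)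
  show "(\<lambda>c. spart q (f c)) \<in> densities M w" if f: "f \<in> densities M w"
  proof (rule density_chartwise)
    fix c d assume A: "chart_change M c d (ovl c d)"
    interpret A: chart_change M c d "ovl c d" by fact
    have r: "srestrict U (spart q h) = spart q (srestrict U h)" for U h by (auto simp: srestrict_def spart_def fun_eq_iff)
    show "rs c (ovl c d) (spart q (f c)) = A.t (rs d (ovl c d) (spart q (f d))) * A.Jw w"
      using spart_mult_right[OF A.Jw_even, of q "A.t (rs d (ovl c d) (f d))" w]
      by (simp add: r density_transform[OF f A] A.t_spart rS[OF A f])
  qed (use f density_outside density_section cls in auto)
qed

text \<open>Extension by zero. In a chart e the density is the transform of h on the overlap with c
  and zero off K, which is closed because the manifold is Hausdorff. At points of
  \<open>dom M c\<close> the transformation law is the cocycle property; elsewhere both sides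
  vanish.\<close>

lemma extend_density:
  assumes c: "c \<in> charts M" and h: "h \<in> Sec c (dom M c)" and K: "compactin (underlying M) K" "K \<subseteq> dom M c"
    and z: "!!p. p \<in> dom M c - K ==> h (crd M c p) = 0"
  obtains \<phi> where "\<phi> \<in> densities M w" "\<phi> c = h" "compact_support_in M c \<phi>"
    "!!q. sparity q h ==> (\<forall>e. sparity q (\<phi> e))"
proof -
  define \<phi> where "\<phi> e = (if e \<in> charts M then T e c (ovl e c) (rs c (ovl e c) h) * chart_change.Jw M e c (ovl e c) w else 0)" for e
  have Kc: "closedin (underlying M) K" by (rule compactin_imp_closedin[OF haus K(1)])
  have cc: "chart_change M e c (ovl e c)" if "e \<in> charts M" for e
    by (rule chart_changeI) (use that c opn_ovl in auto)
  have hr: "rs c W h \<in> Sec c W" if "opn W" "W \<subseteq> dom M c" for W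
    by (rule sections_restrict(1)[OF c dom_open[OF c] that order_refl h])
  have \<phi>r: "rs e W (\<phi> e) = T e c W (rs c W h) * chart_change.Jw M e c W w"
    if e: "e \<in> charts M" and W: "opn W" "W \<subseteq> ovl e c" for e W
  proof -
    interpret Q: chart_change M e c "ovl e c" by (rule cc[OF e])
    interpret A: chart_change M e c W by (rule chart_changeI) (use e c W in auto)
    have "rs e W (\<phi> e) = rs e W (Q.t (rs c (ovl e c) h)) * rs e W (Q.Jw w)" using e by (simp add: \<phi>_def)
    also have "rs e W (Q.t (rs c (ovl e c) h)) = A.t (rs c W h)"
      using Q.t_restrict[OF W hr[OF Q.cd(3)]] by (simp add: Jw_restrict[OF W(2)])
    also have "rs e W (Q.Jw w) = A.Jw w" by (simp add: Q.Jw_def A.Jw_def Jw_restrict[OF W(2)])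
    finally show ?thesis .
  qed
  have \<phi>z: "\<phi> e (crd M e p) = 0" if e: "e \<in> charts M" and p: "p \<in> dom M e - K" for e p
  proof (cases "p \<in> dom M c")
    case True
    interpret Q: chart_change M e c "ovl e c" by (rule cc[OF e])
    have o: "opn (ovl e c - K)" by (intro openin_diff Kc Q.cd)
    have "Q.t (rs c (ovl e c) h) (crd M e p) = Q.t 0 (crd M e p)"
      by (rule Q.t_local[OF hr[OF Q.cd(3)] Q.E.S_0 o]) (use z True p in \<open>auto simp: srestrict_def zero_fun_apply\<close>)
    then show ?thesis using e by (simp add: \<phi>_def sfun_apply)
  next
    case False
    interpret Q: chart_change M e c "ovl e c" by (rule cc[OF e])
    have "crd M e p \<notin> im e (ovl e c)" using crd_mem[OF e, of "ovl e c" p] p False by auto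
    then show ?thesis using e Q.C.S_outside[OF Q.Jw_S] by (simp add: \<phi>_def sfun_apply)
  qed
  have r1: "\<phi> c = h"
    using trans_id[OF c dom_open[OF c] order_refl h] Jw_same[OF c dom_open[OF c] order_refl, of w]
      superdomain.S_restrict[OF superdomain_im[OF c dom_open[OF c] order_refl] h]
      superdomain.S_one_mult(2)[OF superdomain_im[OF c dom_open[OF c] order_refl] h] c
    by (simp add: \<phi>_def)
  have r2: "\<phi> \<in> densities M w"
  proof (rule densities_eqI)
    show "\<phi> e \<in> Sec e (dom M e)" if e: "e \<in> charts M" for e
    proof -
      interpret Q: chart_change M e c "ovl e c" by (rule cc[OF e])
      \<comment> \<open>K lies in \<open>dom M c\<close>, so the overlap and the complement of K
        cover \<open>dom M e\<close>, and smoothness is glued from these two pieces.\<close>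
      let ?U = "im e (ovl e c)" and ?V = "im e (dom M e - K)"
      have oV: "opn (dom M e - K)" by (intro openin_diff Kc dom_open e)
      have QS: "\<phi> e \<in> Q.C.S"
        using e Q.C.S_mult[OF Q.t_S[OF hr[OF Q.cd(3)]] Q.Jw_S] by (simp add: \<phi>_def)
      have UV: "?U \<union> ?V = im e (dom M e)" using K by auto
      have "\<phi> e \<in> superfunctions n m (?U \<union> ?V)"
      proof (rule superfunctions_Un)
        show "srestrict ?U (\<phi> e) \<in> superfunctions n m ?U" using QS Q.C.S_restrict[OF QS] by simp
        have "srestrict ?V (\<phi> e) = 0" using \<phi>z[OF e] by (auto simp: srestrict_def fun_eq_iff sfun_apply)
        then show "srestrict ?V (\<phi> e) \<in> superfunctions n m ?V"
          using superdomain.S_0[OF superdomain_im[OF e oV]] by simp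
        show "\<phi> e x = 0" if "x \<notin> ?U \<union> ?V" for x using Q.C.S_outside[OF QS] that by auto
      qed (use im_open[OF e] oV Q.cd in auto)
      then show ?thesis unfolding UV .
    qed
    fix e e' p assume e: "e \<in> charts M" "e' \<in> charts M" and p: "p \<in> ovl e e'"
    show "\<exists>W. opn W \<and> p \<in> W \<and> W \<subseteq> ovl e e' \<and>
       \<phi> e (crd M e p) = (T e e' W (rs e' W (\<phi> e')) * chart_change.Jw M e e' W w) (crd M e p)"
    proof (cases "p \<in> dom M c")
      case True
      define W where "W = ovl e e' \<inter> dom M c"
      have W: "opn W" "W \<subseteq> ovl e e'" "p \<in> W" unfolding W_def using e c p True by (auto intro!: openin_Int dom_open)
      interpret A: chart_change M e e' W by (rule chart_changeI) (use e W in auto)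
      interpret B: chart_change M e' c W by (rule chart_changeI) (use e W c in \<open>auto simp: W_def\<close>)
      have Wc: "W \<subseteq> dom M c" by (auto simp: W_def)
      have "rs e W (\<phi> e) = T e c W (rs c W h) * chart_change.Jw M e c W w"
        by (rule \<phi>r[OF e(1) W(1)]) (auto simp: W_def)
      also have "\<dots> = A.t (B.t (rs c W h)) * (A.Jw w * A.t (B.Jw w))"
        using trans_trans[OF e c W(1) _ hr[OF W(1) Wc]] J_cocycle(2)[OF e c W(1), of w] by (simp add: W_def)
      also have "\<dots> = A.t (B.t (rs c W h)) * A.t (B.Jw w) * A.Jw w"
        by (simp add: mult.assoc sfun_even_commute[OF A.Jw_even])
      also have "A.t (B.t (rs c W h)) * A.t (B.Jw w) = A.t (rs e' W (\<phi> e'))"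
        unfolding \<phi>r[OF e(2) W(1) B.cd(4)] by (rule A.t_mult[OF B.t_S[OF hr[OF W(1) Wc]] B.Jw_S, symmetric])
      finally have "rs e W (\<phi> e) = A.t (rs e' W (\<phi> e')) * A.Jw w" .
      from fun_cong[OF this, of "crd M e p"] W(1-3) show ?thesis by (intro exI[of _ W]) (auto simp: srestrict_def[of "im e W"])
    next
      case False
      define W where "W = ovl e e' - K"
      have W: "opn W" "W \<subseteq> ovl e e'" "p \<in> W" unfolding W_def
        using e p False K by (auto intro!: openin_diff openin_Int dom_open Kc)
      interpret A: chart_change M e e' W by (rule chart_changeI) (use e W in auto)
      have "rs e' W (\<phi> e') = 0" using \<phi>z[OF e(2)] by (auto simp: srestrict_def fun_eq_iff sfun_apply W_def)
      moreover have "\<phi> e (crd M e p) = 0" by (rule \<phi>z[OF e(1)]) (use W(3) in \<open>auto simp: W_def\<close>)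
      ultimately show ?thesis using W by (intro exI[of _ W]) (simp add: sfun_apply)
    qed
  qed (simp add: \<phi>_def)
  have r3: "compact_support_in M c \<phi>"
    unfolding compact_support_in_def using K \<phi>z by (intro exI[of _ K]) auto
  have r4: "\<forall>e. sparity q (\<phi> e)" if q: "sparity q h" for q
  proof
    fix e
    show "sparity q (\<phi> e)"
    proof (cases "e \<in> charts M")
      case True
      interpret Q: chart_change M e c "ovl e c" by (rule cc[OF True])
      show ?thesis
        using True sparity_mult[OF Q.t_parity[OF hr[OF Q.cd(3)] sparity_restrict[OF q]] Q.Jw_even, of w] by (simp add: \<phi>_def)
    qed (simp add: \<phi>_def)
  qed
  show ?thesis by (rule that[OF r2 r1 r3 r4])
qed

text \<open>Any section of a chart agrees near p with a global density of compact support, of any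
  prescribed weight and without loss of parity. In this way operators and brackets that act on
  global densities are tested against local functions.\<close>

lemma local_density:
  assumes c: "c \<in> charts M" and p: "p \<in> dom M c" and W0: "opn W0" "p \<in> W0"
  obtains \<beta> W where "opn W" "p \<in> W" "W \<subseteq> dom M c \<inter> W0" "smooth_fun n (im c (dom M c)) \<beta>" "!!x. 0 \<le> \<beta> x" "!!x. x \<in> im c W ==> \<beta> x = 1"
    "!!x. x \<in> im c (dom M c) ==> \<beta> x \<noteq> 0 ==> x \<in> im c (W0 \<inter> dom M c)"
    "!!w h. h \<in> Sec c (dom M c) ==> \<exists>\<phi>. \<phi> \<in> densities M w \<and> \<phi> c = (\<lambda>x. \<beta> x *\<^sub>R h x) \<and> compact_support_in M c \<phi> \<and>
        (\<forall>q. sparity q h \<longrightarrow> (\<forall>e. sparity q (\<phi> e)))"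
proof -
  interpret superdomain n "im c (dom M c)" m by (rule superdomain_im[OF c dom_open[OF c] order_refl])
  let ?q = "crd M c p" and ?V = "im c (W0 \<inter> dom M c)"
  have oV: "openin (Euclidean_space n) ?V" by (rule im_open[OF c openin_Int[OF W0(1) dom_open[OF c]]]) auto
  have pV: "?q \<in> ?V" using p W0 by auto
  obtain r where r: "r > 0" "closed_box n ?q r \<subseteq> ?V" by (rule box_in_open[OF oV pV]) (rule that)
  obtain \<beta> where \<beta>: "!!V. openin (Euclidean_space n) V ==> smooth_fun n V \<beta>" "!!x. 0 \<le> \<beta> x"
    "!!x. x \<in> espace n ==> x \<notin> closed_box n ?q r ==> \<beta> x = 0" "!!x. x \<in> closed_box n ?q (r / 2) ==> \<beta> x = 1"
    by (rule bump_function[OF r(1), of n ?q]) (rule that)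
  define W where "W = {p' \<in> dom M c. crd M c p' \<in> open_box n ?q (r / 2)}"
  have qE: "?q \<in> espace n" using openin_Euclidean_subset[OF oV] pV by blast
  have bb: "open_box n ?q (r / 2) \<subseteq> closed_box n ?q (r / 2)" "closed_box n ?q (r / 2) \<subseteq> closed_box n ?q r"
    using r(1) by force+
  have inj: "p' \<in> W0" if "p' \<in> dom M c" "crd M c p' \<in> ?V" for p'
    using crd_mem[OF c, of "W0 \<inter> dom M c" p'] that by auto
  have WW: "W \<subseteq> dom M c \<inter> W0"
  proof
    fix p' assume p': "p' \<in> W"
    then have "crd M c p' \<in> closed_box n ?q (r / 2)" using subsetD[OF bb(1)] unfolding W_def by blast
    then have "crd M c p' \<in> ?V" by (rule subsetD[OF r(2), OF subsetD[OF bb(2)]])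
    then show "p' \<in> dom M c \<inter> W0" using inj p' unfolding W_def by blast
  qed
  have Wo: "opn W" unfolding W_def by (rule preimage_open[OF c openin_open_box])
  have pW: "p \<in> W" using p qE r(1) by (simp add: W_def)
  have Vs: "im c (dom M c) \<subseteq> espace n" by (rule openin_Euclidean_subset[OF openV])
  \<comment> \<open>Compact as the image of a closed box under the inverse of the coordinate
    homeomorphism.\<close>
  define K where "K = {p' \<in> dom M c. crd M c p' \<in> closed_box n ?q r}"
  have K1: "compactin (underlying M) K"
  proof -
    have inv: "homeomorphic_map (subtopology (underlying M) (dom M c)) (subtopology (Euclidean_space n) (im c (dom M c))) (crd M c)"
      by (rule dom_homeo[OF c])
    obtain g where g: "homeomorphic_maps (subtopology (underlying M) (dom M c)) (subtopology (Euclidean_space n) (im c (dom M c))) (crd M c) g"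
      using inv homeomorphic_map_maps by blast
    have bV: "closed_box n ?q r \<subseteq> im c (dom M c)" using r(2) by blast
    have "compactin (subtopology (Euclidean_space n) (im c (dom M c))) (closed_box n ?q r)"
      using compactin_closed_box bV by (simp add: compactin_subtopology)
    moreover have "continuous_map (subtopology (Euclidean_space n) (im c (dom M c))) (subtopology (underlying M) (dom M c)) g"
      using g by (simp add: homeomorphic_maps_def)
    ultimately have "compactin (subtopology (underlying M) (dom M c)) (g ` closed_box n ?q r)"
      by (rule image_compactin)
    moreover have gc: "g (crd M c p') = p'" if "p' \<in> dom M c" for p'
      using g that dom_topspace[OF c] by (auto simp: homeomorphic_maps_def)
    have "g ` closed_box n ?q r = K" unfolding K_def by (rule image_inverse_eq[where g = g, OF bV gc])
    ultimately show ?thesis by (simp add: compactin_subtopology)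
  qed
  show ?thesis
  proof (rule that[OF Wo pW WW \<beta>(1)[OF openV] \<beta>(2)])
    show "\<beta> x = 1" if "x \<in> im c W" for x
      using that bb(1) by (intro \<beta>(4)) (auto simp: W_def)
    show "x \<in> ?V" if "x \<in> im c (dom M c)" "\<beta> x \<noteq> 0" for x
      using \<beta>(3)[of x] that Vs r(2) by blast
    fix w h assume h: "h \<in> Sec c (dom M c)"
    have hS: "(\<lambda>x. \<beta> x *\<^sub>R h x) \<in> S"
      unfolding S_iff using sloc_real_mult[OF \<beta>(1)[OF openV] S_sloc[OF h]] S_outside[OF h] by simp
    have z: "\<beta> (crd M c p') *\<^sub>R h (crd M c p') = 0" if "p' \<in> dom M c - K" for p'
      using \<beta>(3)[of "crd M c p'"] that Vs unfolding K_def by fastforce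
    obtain \<phi> where "\<phi> \<in> densities M w" "\<phi> c = (\<lambda>x. \<beta> x *\<^sub>R h x)" "compact_support_in M c \<phi>"
      "!!q. sparity q (\<lambda>x. \<beta> x *\<^sub>R h x) ==> (\<forall>e. sparity q (\<phi> e))"
      by (rule extend_density[OF c hS K1 _ z]) (auto simp: K_def)
    then show "\<exists>\<phi>. \<phi> \<in> densities M w \<and> \<phi> c = (\<lambda>x. \<beta> x *\<^sub>R h x) \<and> compact_support_in M c \<phi> \<and>
        (\<forall>q. sparity q h \<longrightarrow> (\<forall>e. sparity q (\<phi> e)))"
      by (intro exI[of _ \<phi>]) (auto simp: sparity_def gparity_scaleR)
  qed
qed

end

section \<open>Integration\<close>

abbreviation (input) single where "single \<equiv> Poly_Mapping.single"
abbreviation (input) lookup where "lookup \<equiv> Poly_Mapping.lookup"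

text \<open>Points of the product measure are \<open>undefined\<close> beyond the first n
  coordinates, points of a domain are zero there.\<close>

definition trunc :: "nat => (nat => real) => nat => real" where
  "trunc n x = (\<lambda>i. if i < n then x i else 0)"

abbreviation lebn :: "nat => (nat => real) measure" where
  "lebn n \<equiv> Pi\<^sub>M {..<n} (\<lambda>_. lborel)"

lemma trunc_espace: "trunc n x \<in> espace n"
  by (simp add: trunc_def)

lemma trunc_trunc: "trunc n (trunc n x) = trunc n x"
  by (auto simp: trunc_def)

lemma trunc_update: "i < n ==> trunc n (x(i := s)) = (trunc n x)(i := s)"
  by (auto simp: trunc_def fun_eq_iff)

lemma measurable_trunc:
  fixes h :: "(nat => real) => real"
  assumes "continuous_on (espace n) h"
  shows "(\<lambda>x. h (trunc n x)) \<in> borel_measurable (lebn n)"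
proof -
  have "continuous_on UNIV (\<lambda>x. trunc n x i)" for i
    unfolding trunc_def by (cases "i < n") (simp_all add: continuous_on_coord)
  then have "continuous_on UNIV (\<lambda>x. trunc n x)" by (rule continuous_on_coordinatewise_then_product)
  then have "continuous_on UNIV (\<lambda>x. h (trunc n x))"
    by (rule continuous_on_compose2[OF assms]) (auto simp: trunc_def)
  then have 1: "(\<lambda>x. h (trunc n x)) \<in> borel_measurable borel" by (rule borel_measurable_continuous_onI)
  have "(\<lambda>x i. trunc n x i) \<in> measurable (lebn n) (Pi\<^sub>M UNIV (\<lambda>_. borel))"
  proof (rule measurable_PiM_single')
    fix i :: nat
    show "(\<lambda>x. trunc n x i) \<in> borel_measurable (lebn n)"
    proof (cases "i < n")
      case True
      then have "(\<lambda>x. x i) \<in> measurable (lebn n) lborel" by (intro measurable_component_singleton) simp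
      then show ?thesis using True by (simp add: trunc_def)
    qed (simp add: trunc_def)
  qed auto
  then have "trunc n \<in> measurable (lebn n) borel"
    using sets_PiM_equal_borel measurable_cong_sets by blast
  from measurable_comp[OF this 1] show ?thesis by (simp add: comp_def trunc_trunc)
qed

lemma compactin_Euclidean_bounded:
  assumes K: "compactin (Euclidean_space n) K"
  obtains r where "r > 0" "K \<subseteq> closed_box n 0 r"
proof -
  have c: "compact K" and sub: "K \<subseteq> espace n"
    using K by (auto simp: Euclidean_space_def compactin_subtopology euclidean_product_topology)
  have "bounded ((\<lambda>x. x i) ` K)" for i
    by (intro compact_imp_bounded compact_continuous_image[OF continuous_on_coord c])
  then have "\<exists>B. \<forall>x\<in>K. \<bar>x i\<bar> \<le> B" for i by (auto simp: bounded_iff)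
  then obtain B where B: "!!i x. x \<in> K ==> \<bar>x i\<bar> \<le> B i" by metis
  define r where "r = 1 + (\<Sum>i<n. \<bar>B i\<bar>)"
  have "\<bar>x i\<bar> \<le> r" if "x \<in> K" "i < n" for x i
  proof -
    have "\<bar>B i\<bar> \<le> (\<Sum>i<n. \<bar>B i\<bar>)" using that by (intro member_le_sum) auto
    then show ?thesis using B[OF that(1), of i] by (simp add: r_def)
  qed
  moreover have "r > 0" using sum_nonneg[of "{..<n}" "\<lambda>i. \<bar>B i\<bar>"] unfolding r_def by (intro add_pos_nonneg sum_nonneg) auto
  ultimately show ?thesis using sub by (intro that[of r]) (auto simp: zero_fun_apply)
qed

text \<open>Compactness of the box bounds h, and its measure is finite.\<close>

lemma integrable_compact_support:
  fixes h :: "(nat => real) => real"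
  assumes h: "continuous_on (espace n) h" and z: "!!x. x \<in> espace n ==> x \<notin> closed_box n 0 r ==> h x = 0"
  shows "integrable (lebn n) (\<lambda>x. h (trunc n x))"
proof -
  interpret product_sigma_finite "\<lambda>_ :: nat. lborel :: real measure" ..
  let ?A = "PiE {..<n} (\<lambda>_. {-r..r})"
  have "compact (closed_box n 0 r)"
    using compactin_closed_box[of n 0 r] by (auto simp: Euclidean_space_def compactin_subtopology euclidean_product_topology)
  then have "bounded (h ` closed_box n 0 r)"
    by (intro compact_imp_bounded compact_continuous_image continuous_on_subset[OF h]) auto
  then obtain B where "\<forall>y\<in>h ` closed_box n 0 r. norm y \<le> B" unfolding bounded_iff by (rule exE)
  then have B: "\<bar>h x\<bar> \<le> B" if "x \<in> closed_box n 0 r" for x using imageI[OF that, of h] unfolding real_norm_def by (rule bspec)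
  have bd: "norm (h x) \<le> max B 0" if "x \<in> espace n" for x
  proof (cases "x \<in> closed_box n 0 r")
    case True
    then show ?thesis using B[OF True] by simp
  qed (use z[OF that] in simp)
  show ?thesis
  proof (rule integrableI_bounded_set[where A = ?A and B = "max B 0"])
    show "?A \<in> sets (lebn n)" by (intro sets_PiM_I_finite) auto
    show "(\<lambda>x. h (trunc n x)) \<in> borel_measurable (lebn n)" by (rule measurable_trunc[OF h])
    have "emeasure (lebn n) ?A = (\<Prod>i<n. emeasure lborel {-r..r})"
      by (intro emeasure_PiM) auto
    also have "\<dots> < \<infinity>" by (simp add: emeasure_lborel_Icc_eq ennreal_power)
    finally show "emeasure (lebn n) ?A < \<infinity>" .
    show "AE x in lebn n. x \<in> ?A \<longrightarrow> norm (h (trunc n x)) \<le> max B 0"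
      using bd[OF trunc_espace] by (intro AE_I2) simp
    have "trunc n x \<notin> closed_box n 0 r" if "x \<in> space (lebn n)" "x \<notin> ?A" for x
    proof
      assume "trunc n x \<in> closed_box n 0 r"
      then have "\<bar>x i\<bar> \<le> r" if "i < n" for i using that by (simp add: trunc_def zero_fun_apply)
      then have "x i \<in> {-r..r}" if "i < n" for i using that by (simp add: abs_le_iff minus_le_iff)
      then show False using that by (auto simp: space_PiM PiE_def Pi_def)
    qed
    then have "h (trunc n x) = 0" if "x \<in> space (lebn n)" "x \<notin> ?A" for x
      using that by (intro z[OF trunc_espace])
    then show "AE x in lebn n. x \<notin> ?A \<longrightarrow> h (trunc n x) = 0" by (intro AE_I2) simp
  qed
qed

text \<open>Fubini with coordinate i innermost, and the fundamental theorem of calculus along that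
  line.\<close>

lemma integral_partial_eq_0:
  assumes h: "smooth_fun n (espace n) h" and z: "!!x. x \<in> espace n ==> x \<notin> closed_box n 0 r ==> h x = 0" and i: "i < n"
    and z': "!!x. x \<in> espace n ==> x \<notin> closed_box n 0 r ==> partial i h x = 0" and r: "r > 0"
  shows "(\<integral>x. partial i h (trunc n x) \<partial>lebn n) = 0"
proof -
  interpret product_sigma_finite "\<lambda>_ :: nat. lborel :: real measure" ..
  interpret coord_domain n "espace n" by unfold_locales (auto simp: openin_Euclidean_space)
  let ?f = "\<lambda>x. partial i h (trunc n x)"
  have c: "continuous_on (espace n) (partial i h)" by (intro smooth_continuous smooth_partial h i)
  have "{..<n} = insert i ({..<n} - {i})" using i by auto
  then have I: "integral\<^sup>L (lebn n) ?f = (\<integral>x. (\<integral>y. ?f (x(i := y)) \<partial>lborel) \<partial>Pi\<^sub>M ({..<n} - {i}) (\<lambda>_. lborel))"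
    using product_integral_insert[of "{..<n} - {i}" i ?f] integrable_compact_support[OF c z'] by simp
  have "(\<integral>y. ?f (x(i := y)) \<partial>lborel) = 0" for x
  proof -
    let ?z = "trunc n x" and ?g = "\<lambda>y. partial i h ((trunc n x)(i := y))"
    have mem: "?z(i := y) \<in> espace n" for y using i by (simp add: trunc_def)
    have out: "?z(i := y) \<notin> closed_box n 0 r" if "\<bar>y\<bar> > r" for y
      using that i by (auto simp: zero_fun_apply)
    \<comment> \<open>The end points at distance r + 1 lie strictly outside the support, so the
      boundary values vanish.\<close>
    have "(\<integral>y. ?f (x(i := y)) \<partial>lborel) = (\<integral>y. ?g y * indicator {-(r+1)..r+1} y \<partial>lborel)"
    proof (rule Bochner_Integration.integral_cong[OF refl])
      fix y
      show "?f (x(i := y)) = ?g y * indicator {-(r+1)..r+1} y"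
        using z'[OF mem out, of y] r unfolding trunc_update[OF i] indicator_def
        by (cases "\<bar>y\<bar> > r") (simp, auto simp: abs_le_iff)
    qed
    also have "\<dots> = h (?z(i := r + 1)) - h (?z(i := -(r+1)))"
    proof (rule integral_FTC_Icc_real)
      show "- (r + 1) \<le> r + 1" using r by simp
      show "((\<lambda>y. h (?z(i := y))) has_real_derivative ?g y) (at y)" for y
        using smooth_has_derivative[OF h i mem, of y] by simp
      have "continuous_on UNIV ?g"
        by (rule continuous_on_compose2[OF c continuous_on_update[OF continuous_on_const continuous_on_id]]) (use mem in auto)
      then show "isCont ?g y" for y by (simp add: continuous_on_eq_continuous_at)
    qed
    also have "\<dots> = 0" using z[OF mem out] r by simp
    finally show ?thesis .
  qed
  then show ?thesis unfolding I by simp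
qed

lemma sintegral_alt: "sintegral n m f = (\<integral>x. gcoeff (f (trunc n x)) {n..<n + m} \<partial>lebn n)"
  by (simp add: sintegral_def trunc_def)

lemma sintegral_scale: "sintegral n m (r *\<^sub>S f) = r * sintegral n m f"
  by (simp add: sintegral_alt sfun_apply)

lemma sintegral_0 [simp]: "sintegral n m 0 = 0"
  by (simp add: sintegral_alt sfun_apply)

section \<open>The Berezin integral of compactly supported superfunctions\<close>

context superdomain
begin

definition csupp :: "sfun => bool" where
  "csupp f \<longleftrightarrow> f \<in> S \<and> (\<exists>K. compactin (Euclidean_space n) K \<and> K \<subseteq> V \<and> (\<forall>x. x \<notin> K \<longrightarrow> f x = 0))"

lemma csupp_S: "csupp f ==> f \<in> S"
  by (simp add: csupp_def)

lemma csuppI: "csupp f ==> g \<in> S ==> (!!x. f x = 0 ==> g x = 0) ==> csupp g"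
  unfolding csupp_def by blast

lemma csupp_mult: "csupp f ==> g \<in> S ==> csupp (f * g)" and csupp_mult2: "csupp f ==> g \<in> S ==> csupp (g * f)"
  by (rule csuppI, assumption; simp add: csupp_S S_mult sfun_apply)+

lemma csupp_scale: "csupp f ==> csupp (r *\<^sub>S f)"
  by (rule csuppI, assumption; simp add: csupp_S S_scale sfun_apply)

lemma csupp_0 [simp]: "csupp 0"
  by (auto simp: csupp_def sfun_apply intro!: exI[of _ "{}"])

lemma csupp_add: assumes "csupp f" "csupp g" shows "csupp (f + g)"
proof -
  obtain K K' where "compactin (Euclidean_space n) K" "K \<subseteq> V" "\<forall>x. x \<notin> K \<longrightarrow> f x = 0"
    "compactin (Euclidean_space n) K'" "K' \<subseteq> V" "\<forall>x. x \<notin> K' \<longrightarrow> g x = 0"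
    using assms unfolding csupp_def by blast
  then show ?thesis
    unfolding csupp_def using assms
    by (intro conjI S_add csupp_S exI[of _ "K \<union> K'"] compactin_Un) (auto simp: sfun_apply)
qed

lemma csupp_sum: "(!!a. a \<in> A ==> csupp (f a)) ==> csupp (\<Sum>a\<in>A. f a)"
  by (induction A rule: infinite_finite_induct) (auto intro: csupp_add)

lemma csupp_closed:
  assumes "csupp f"
  obtains K where "compactin (Euclidean_space n) K" "K \<subseteq> V" "!!x. x \<notin> K ==> f x = 0"
    "openin (Euclidean_space n) (espace n - K)" "(espace n - K) \<union> V = espace n"
proof -
  obtain K where K: "compactin (Euclidean_space n) K" "K \<subseteq> V" "\<forall>x. x \<notin> K \<longrightarrow> f x = 0"
    using assms unfolding csupp_def by blast
  have "closedin (Euclidean_space n) K"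
    by (rule compactin_imp_closedin[OF _ K(1)]) (simp add: Hausdorff_Euclidean_space)
  moreover have "topspace (Euclidean_space n) = espace n" by (simp add: topspace_Euclidean_space)
  ultimately have "openin (Euclidean_space n) (espace n - K)"
    by (metis openin_diff openin_topspace)
  moreover have "V \<subseteq> espace n" by (rule openin_Euclidean_subset[OF openV])
  then have "(espace n - K) \<union> V = espace n" using K(2) by blast
  ultimately show ?thesis using K by (intro that) auto
qed

text \<open>Glued from V and the complement of the support, where the function is zero. Partial
  integration can then take place on the whole coordinate space.\<close>

lemma csupp_smooth:
  assumes f: "csupp f" shows "smooth_fun n (espace n) (\<lambda>x. gcoeff (f x) I)"
proof -
  obtain K where K: "!!x. x \<notin> K ==> f x = 0" "openin (Euclidean_space n) (espace n - K)" "(espace n - K) \<union> V = espace n"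
    by (rule csupp_closed[OF f]) (rule that)
  interpret U: coord_domain n "espace n - K" by unfold_locales (rule K)
  have "smooth_fun n (espace n - K) (\<lambda>x. gcoeff (f x) I)"
    by (rule U.smooth_cong[OF U.smooth_const[of 0]]) (simp add: K)
  from smooth_Un[OF U.coord_domain_axioms coord_domain_axioms this sloc_smooth[OF S_sloc[OF csupp_S[OF f]]]]
  show ?thesis unfolding K(3) .
qed

lemma csupp_d: assumes f: "csupp f" and a: "a < n + m" shows "csupp (d a f)"
proof -
  obtain K where K: "compactin (Euclidean_space n) K" "K \<subseteq> V" "!!x. x \<notin> K ==> f x = 0"
    "openin (Euclidean_space n) (espace n - K)" "(espace n - K) \<union> V = espace n"
    by (rule csupp_closed[OF f]) (rule that)
  interpret U: coord_domain n "espace n - K" by unfold_locales (rule K)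
  have "d a f x = 0" if "x \<notin> K" for x
  proof (cases "x \<in> V")
    case x: True
    then have xU: "x \<in> espace n - K" using that K(5) by blast
    show ?thesis
    proof (cases "a < n")
      case True
      have "partial a (\<lambda>y. gcoeff (f y) I) x = 0" for I
        using U.partial_cong[of "\<lambda>y. gcoeff (f y) I" "\<lambda>y. 0" a x] K(3) True xU by simp
      then show ?thesis using x True by (intro grassmann_eqI) (simp add: d_even_coeff)
    next
      case False
      then show ?thesis using K(3)[OF that] x by (simp add: d_odd)
    qed
  qed (rule d_outside)
  then show ?thesis unfolding csupp_def using K(1,2) d_S[OF csupp_S[OF f] a] by blast
qed

lemma csupp_bounded:
  assumes "csupp f" obtains r where "r > 0" "!!x. x \<notin> closed_box n 0 r ==> f x = 0"
proof -
  obtain K where "compactin (Euclidean_space n) K" "\<forall>x. x \<notin> K \<longrightarrow> f x = 0"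
    using assms unfolding csupp_def by blast
  moreover from this(1) obtain r where "r > 0" "K \<subseteq> closed_box n 0 r" by (rule compactin_Euclidean_bounded)
  ultimately show ?thesis by (intro that[of r]) (use subsetD in \<open>blast+\<close>)
qed

lemma csupp_integrable:
  assumes f: "csupp f" shows "integrable (lebn n) (\<lambda>x. gcoeff (f (trunc n x)) I)"
proof -
  interpret U: coord_domain n "espace n" by unfold_locales (auto simp: openin_Euclidean_space)
  obtain r where "!!x. x \<notin> closed_box n 0 r ==> f x = 0" by (rule csupp_bounded[OF f]) (rule that)
  then show ?thesis
    by (intro integrable_compact_support[where h = "\<lambda>x. gcoeff (f x) I" and r = r] U.smooth_continuous csupp_smooth f) simp
qed

lemma sintegral_add: "csupp f ==> csupp g ==> sintegral n m (f + g) = sintegral n m f + sintegral n m g"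
  using csupp_integrable by (simp add: sintegral_alt sfun_apply)

lemma sintegral_sum: "(!!a. a \<in> A ==> csupp (f a)) ==> sintegral n m (\<Sum>a\<in>A. f a) = (\<Sum>a\<in>A. sintegral n m (f a))"
  by (induction A rule: infinite_finite_induct) (auto simp: sintegral_add csupp_sum)

text \<open>For an even coordinate this is partial integration; for an odd one the derivative
  contains no term with that coordinate and hence no top term.\<close>

lemma sintegral_d:
  assumes f: "csupp f" and a: "a < n + m" shows "sintegral n m (d a f) = 0"
proof (cases "a < n")
  case True
  let ?h = "\<lambda>x. gcoeff (f x) L"
  obtain r where r: "r > 0" "!!x. x \<notin> closed_box n 0 r ==> f x = 0" by (rule csupp_bounded[OF f]) (rule that)
  have cl: "closedin (Euclidean_space n) (closed_box n 0 r)"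
    by (rule compactin_imp_closedin[OF _ compactin_closed_box]) (simp add: Hausdorff_Euclidean_space)
  have "openin (Euclidean_space n) (topspace (Euclidean_space n) - closed_box n 0 r)"
    by (rule openin_diff[OF openin_topspace cl])
  then interpret B: coord_domain n "espace n - closed_box n 0 r"
    by unfold_locales (simp add: topspace_Euclidean_space)
  have p0: "partial a ?h x = 0" if "x \<in> espace n" "x \<notin> closed_box n 0 r" for x
  proof -
    have "x \<in> espace n - closed_box n 0 r" using that by (rule DiffI)
    from B.partial_cong[of ?h "\<lambda>y. 0", OF _ True this] show ?thesis using r(2) by simp
  qed
  obtain K where K: "K \<subseteq> V" "!!x. x \<notin> K ==> f x = 0" "openin (Euclidean_space n) (espace n - K)"
    by (rule csupp_closed[OF f]) (rule that)
  interpret U: coord_domain n "espace n - K" by unfold_locales (rule K)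
  have "gcoeff (d a f x) L = partial a ?h x" if x: "x \<in> espace n" for x
  proof (cases "x \<in> V")
    case False
    then have "x \<in> espace n - K" using x K(1) by blast
    from U.partial_cong[of ?h "\<lambda>y. 0", OF _ True this] K(2) show ?thesis using False by (simp add: d_outside)
  qed (simp add: d_even_coeff True)
  then have "sintegral n m (d a f) = (\<integral>x. partial a ?h (trunc n x) \<partial>lebn n)"
    unfolding sintegral_alt using trunc_espace by (intro Bochner_Integration.integral_cong refl) blast
  also have "\<dots> = 0"
    by (rule integral_partial_eq_0[OF csupp_smooth[OF f] _ True p0 r(1)]) (use r(2) in auto)
  finally show ?thesis .
next
  case False
  have "gcoeff (d a f x) L = 0" for x
    using False a by (cases "x \<in> V") (simp_all add: d_odd d_outside gderiv_def gcoeff_of)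
  then show ?thesis by (simp add: sintegral_alt)
qed

end

context supermfd
begin

lemma csupp_density:
  assumes "c \<in> charts M" "f \<in> densities M w" "compact_support_in M c f"
  shows "superdomain.csupp n (im c (dom M c)) m (f c)"
proof -
  interpret superdomain n "im c (dom M c)" m by (rule superdomain_im[OF assms(1) dom_open[OF assms(1)] order_refl])
  obtain K where K: "compactin (underlying M) K" "K \<subseteq> dom M c" "\<forall>x\<in>dom M c - K. f c (crd M c x) = 0"
    using assms(1,3) unfolding compact_support_in_def by blast
  have "compactin (subtopology (underlying M) (dom M c)) K" using K by (simp add: compactin_subtopology)
  from image_compactin[OF this homeomorphic_imp_continuous_map[OF dom_homeo[OF assms(1)]]]
  have "compactin (Euclidean_space n) (im c K)" by (simp add: compactin_subtopology)
  moreover have "f c x = 0" if "x \<notin> im c K" for x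
    using K(3) that S_outside[OF density_section[OF assms(2,1)], of x] by (cases "x \<in> im c (dom M c)") auto
  ultimately show ?thesis
    unfolding csupp_def using density_section[OF assms(2,1)] K(2) by blast
qed

text \<open>A Grassmann number is detected by its products with the monomials, one of which moves any coefficient to the top.\<close>

lemma fundamental_lemma:
  assumes c: "c \<in> charts M" and h: "h \<in> Sec c (dom M c)"
    and int: "!!g p. g \<in> densities M w ==> compact_support_in M c g ==> (!!e. sparity p (g e)) ==> sintegral n m (h * g c) = 0"
  shows "h = 0"
proof (rule ccontr)
  interpret superdomain n "im c (dom M c)" m by (rule superdomain_im[OF c dom_open[OF c] order_refl])
  let ?V = "im c (dom M c)"
  assume "h \<noteq> 0"
  then obtain x where x: "h x \<noteq> 0" by (auto simp: fun_eq_iff sfun_apply)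
  then obtain I where I: "gcoeff (h x) I \<noteq> 0" using grassmann_eqI[of "h x" 0] by auto
  have IL: "I \<subseteq> L" using I S_supp[OF h] by (auto simp: gsupp_def)
  have fin: "finite I" "finite (L - I)" using IL by (auto intro: finite_subset)
  have xV: "x \<in> ?V" using x S_outside[OF h] by blast
  then obtain p where p: "p \<in> dom M c" "x = crd M c p" by blast
  \<comment> \<open>The sign is fitted so that the top coefficient of h times the complementary
    monomial is the absolute value of the chosen coefficient at x.\<close>
  define s where "s = (-1) ^ inversions I (L - I) * sgn (gcoeff (h x) I)"
  define a where "a y = s * (-1) ^ inversions I (L - I) * gcoeff (h y) I" for y
  have asm: "smooth_fun n ?V a"
    unfolding a_def using smooth_cmult[OF sloc_smooth[OF S_sloc[OF h]]] by simp
  have "continuous_map (subtopology (Euclidean_space n) ?V) euclideanreal a"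
    using smooth_continuous[OF asm] Euclidean_continuous_map_iff[OF openV] by blast
  then have "openin (subtopology (Euclidean_space n) ?V) {y \<in> topspace (subtopology (Euclidean_space n) ?V). a y \<in> {0<..}}"
    by (rule openin_continuous_map_preimage) simp
  moreover have "topspace (subtopology (Euclidean_space n) ?V) = ?V"
    using openin_subset[OF openV] by auto
  ultimately have "openin (subtopology (Euclidean_space n) ?V) {y \<in> ?V. a y \<in> {0<..}}" by (simp only:)
  then have Po: "openin (Euclidean_space n) {y \<in> ?V. a y > 0}"
    by (simp add: openin_open_subtopology openV)
  \<comment> \<open>The cutoff is supported where \<open>a\<close> is positive, so the integrand is
    nonnegative everywhere and a zero integral forces it to vanish almost everywhere.\<close>
  define W0 where "W0 = {q \<in> dom M c. crd M c q \<in> {y \<in> ?V. a y > 0}}"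
  have W0: "opn W0" unfolding W0_def by (rule preimage_open[OF c Po])
  have ax: "a x > 0" using I by (simp add: a_def s_def sgn_if flip: power_add)
  have pW0: "p \<in> W0" using p xV ax by (simp add: W0_def)
  obtain \<beta> W where W: "opn W" "p \<in> W" "W \<subseteq> dom M c \<inter> W0" and \<beta>: "smooth_fun n ?V \<beta>" "!!x. 0 \<le> \<beta> x" "!!x. x \<in> im c W ==> \<beta> x = 1"
    "!!x. x \<in> ?V ==> \<beta> x \<noteq> 0 ==> x \<in> im c (W0 \<inter> dom M c)"
    "!!w h. h \<in> Sec c (dom M c) ==> \<exists>\<phi>. \<phi> \<in> densities M w \<and> \<phi> c = (\<lambda>x. \<beta> x *\<^sub>R h x) \<and> compact_support_in M c \<phi> \<and>
        (\<forall>q. sparity q h \<longrightarrow> (\<forall>e. sparity q (\<phi> e)))"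
    by (rule local_density[OF c p(1) W0 pW0]) (rule that)
  define k where "k = srestrict ?V (\<lambda>_. grassmann_of (\<lambda>J. if J = L - I then s else 0))"
  have kS: "k \<in> S"
    unfolding k_def srestrict_S by (rule sloc_const) (auto simp: gsupp_def gcoeff_of split: if_splits)
  have kp: "sparity (card (L - I)) k"
    using fin by (auto simp: k_def sparity_def srestrict_def gparity_def gcoeff_of split: if_splits)
  obtain g where g: "g \<in> densities M w" "g c = (\<lambda>x. \<beta> x *\<^sub>R k x)" "compact_support_in M c g" "!!e. sparity (card (L - I)) (g e)"
    using \<beta>(5)[OF kS, of w] kp by blast
  have gs: "csupp (g c)" by (rule csupp_density[OF c g(1,3)])
  have hg: "csupp (h * g c)" by (rule csupp_mult2[OF gs h])
  have top: "gcoeff ((h * g c) y) L = \<beta> y * a y" if y: "y \<in> ?V" for y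
  proof -
    have kc: "gcoeff (k y) (L - J) = (if J = I then s else 0)" if "J \<in> Pow L" for J
    proof -
      have "L - J = L - I \<longleftrightarrow> J = I" using that IL by auto
      then show ?thesis using srestrict_apply[OF y] fin unfolding k_def by (simp add: gcoeff_of)
    qed
    have "gcoeff (h y * k y) L = (\<Sum>J\<in>Pow L. (-1) ^ inversions J (L - J) * gcoeff (h y) J * gcoeff (k y) (L - J))"
      by (simp add: gcoeff_mult)
    also have "\<dots> = (\<Sum>J\<in>Pow L. if J = I then (-1) ^ inversions I (L - I) * gcoeff (h y) I * s else 0)"
      by (rule sum.cong[OF refl]) (simp only: kc mult_zero_right split: if_split, simp)
    also have "\<dots> = a y" using IL by (simp add: a_def)
    finally show ?thesis by (simp add: g(2) sfun_apply)
  qed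
  have nn: "0 \<le> gcoeff ((h * g c) y) L" for y
  proof (cases "y \<in> ?V")
    case True
    show ?thesis
    proof (cases "\<beta> y = 0")
      case False
      then have "y \<in> im c (W0 \<inter> dom M c)" using \<beta>(4) True by blast
      then have "a y > 0" unfolding W0_def by auto
      then show ?thesis using top[OF True] \<beta>(2)[of y] by simp
    qed (simp add: top[OF True])
  qed (use S_outside[OF csupp_S[OF hg]] in simp)
  have AE0: "AE y in lebn n. gcoeff ((h * g c) (trunc n y)) L = 0"
    using int[OF g(1,3,4)] integral_nonneg_eq_0_iff_AE[OF csupp_integrable[OF hg, of L]] nn by (simp add: sintegral_alt)
  have Wo: "openin (Euclidean_space n) (im c W)" by (rule im_open[OF c W(1)]) (use W in auto)
  have xW: "x \<in> im c W" using p W by blast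
  obtain r where r: "r > 0" "closed_box n x r \<subseteq> im c W" by (rule box_in_open[OF Wo xW]) (rule that)
  have pos: "gcoeff ((h * g c) y) L > 0" if "y \<in> im c W" for y
  proof -
    have "y \<in> ?V" "a y > 0" using that W unfolding W0_def by auto
    then show ?thesis using top[of y] \<beta>(3)[OF that] by simp
  qed
  have imp: "y \<notin> PiE {..<n} (\<lambda>i. {x i - r..x i + r})" if "gcoeff ((h * g c) (trunc n y)) L = 0" for y
  proof
    assume y: "y \<in> PiE {..<n} (\<lambda>i. {x i - r..x i + r})"
    have "\<bar>y i - x i\<bar> \<le> r" if "i < n" for i
      using PiE_mem[OF y, of i] that by (simp add: abs_le_iff algebra_simps)
    then have "trunc n y \<in> closed_box n x r" by (simp add: trunc_def)
    from pos[OF subsetD[OF r(2) this]] that show False by simp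
  qed
  have "AE y in lebn n. y \<notin> PiE {..<n} (\<lambda>i. {x i - r..x i + r})"
    using AE0 by (rule AE_mp) (use imp in \<open>intro AE_I2 impI\<close>)
  moreover have A: "PiE {..<n} (\<lambda>i. {x i - r..x i + r}) \<in> sets (lebn n)" by (intro sets_PiM_I_finite) auto
  ultimately have "emeasure (lebn n) (PiE {..<n} (\<lambda>i. {x i - r..x i + r})) = 0"
    by (subst (asm) AE_iff_measurable[OF A]) (use sets.sets_into_space[OF A] in auto)
  moreover interpret product_sigma_finite "\<lambda>_ :: nat. lborel :: real measure" ..
  have "emeasure (lebn n) (PiE {..<n} (\<lambda>i. {x i - r..x i + r})) = (\<Prod>i<n. emeasure lborel {x i - r..x i + r})"
    by (intro emeasure_PiM) auto
  \<comment> \<open>Positive volume, also for n = 0 where it is 1, contradicts the null set.\<close>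
  moreover have "\<dots> = ennreal ((2 * r) ^ n)" using r(1) by (simp add: emeasure_lborel_Icc_eq ennreal_power)
  ultimately show False using r(1) by simp
qed

text \<open>The exponents -2, w and 1 - w add up to -1, the one that the residue picks out.\<close>

lemma scalar_product_single:
  "scalar_product M c (single w f) (single (1 - w) g) = sintegral n m (f c * g c)"
proof -
  have lr: "local_rep c (single u f) = single u (f c)" for u f
    by (simp add: local_rep_def map_single zero_fun_apply)
  have "single (- 2) 1 * local_rep c (single w f) * local_rep c (single (1 - w) g)
      = single (-1) (f c * g c)"
    by (simp add: lr mult_single)
  then show ?thesis by (simp add: scalar_product_def)
qed

end

section \<open>Second order operators on a superdomain\<close>

lemma sign_sscale: "(-1) ^ k * f = (-1) ^ k *\<^sub>S (f :: sfun)"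
  by (cases "even k") (simp_all add: sscale_simps sscale_def fun_eq_iff sfun_apply)

lemma sscale_cong: "r = s ==> r *\<^sub>S f = s *\<^sub>S f"
  by simp

lemma sfun_sscale_commute: "sparity p f ==> sparity q g ==> f * g = (-1) ^ (p * q) *\<^sub>S (g * f)"
  unfolding sign_sscale[symmetric] by (rule sfun_supercommute)

lemma neg_one_power_cong: "even (j + k) ==> (-1 :: real) ^ j = (-1) ^ k"
  by (auto simp: minus_one_power_iff)

context superdomain
begin

lemma d_mult_scale: "f \<in> S ==> g \<in> S ==> sparity p f ==> d a (f * g) = d a f * g + (-1) ^ (spar n a * p) *\<^sub>S (f * d a g)"
  by (simp add: d_mult sign_sscale)

lemma d_commute_scale: "f \<in> S ==> a < n + m ==> b < n + m ==> d a (d b f) = (-1) ^ (spar n a * spar n b) *\<^sub>S d b (d a f)"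
  unfolding sign_sscale[symmetric] by (rule d_commute)

lemma vf_mult_scale:
  assumes "!!a. a < n + m ==> sparity (q + spar n a) (X a)" "f \<in> S" "sparity p f" "g \<in> S"
  shows "vf X (f * g) = vf X f * g + (-1) ^ (q * p) *\<^sub>S (f * vf X g)"
  using vf_mult[OF assms] by (simp add: sign_sscale)

text \<open>The bracket of f t^u and g t^w with the power of t removed, for f of parity p. The
  derivatives in t become the factors u and w; in the third term \<gamma> has been moved past
  f.\<close>

definition brk :: "nat => (nat => nat => sfun) => (nat => sfun) => sfun => real => nat => sfun => real => sfun => sfun" where
  "brk \<epsilon> \<sigma> \<gamma> \<theta> u p f w g =
     (\<Sum>a<n + m. \<Sum>b<n + m. (-1) ^ (spar n a * p) *\<^sub>S (\<sigma> a b * d b f * d a g)) +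
     w *\<^sub>S (vf \<gamma> f * g) + (u * (-1) ^ (\<epsilon> * p)) *\<^sub>S (f * vf \<gamma> g) + (u * w) *\<^sub>S (\<theta> * f * g)"

text \<open>A quadratic pencil without zero order term at weight 0, so that it annihilates the unit
  (\<open>lop_one\<close>).\<close>

definition lop :: "(nat => nat => sfun) => (nat => sfun) => (nat => sfun) => sfun => sfun => real => sfun => sfun" where
  "lop D2 D1 A1 A0 B0 w f =
     (\<Sum>a<n + m. \<Sum>b<n + m. D2 a b * d b (d a f)) + vf D1 f + w *\<^sub>S (vf A1 f + A0 * f) + w\<^sup>2 *\<^sub>S (B0 * f)"

lemma second_order_mult:
  assumes D: "D \<in> S" "sparity (\<epsilon> + spar n a + spar n b) D" and f: "f \<in> S" "sparity p f" and g: "g \<in> S"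
    and a: "a < n + m" and b: "b < n + m"
  shows "D * d b (d a (f * g)) = D * d b (d a f) * g + (-1) ^ (spar n b * (p + spar n a)) *\<^sub>S (D * d a f * d b g) +
    (-1) ^ (spar n a * p) *\<^sub>S (D * d b f * d a g) + (-1) ^ (\<epsilon> * p) *\<^sub>S (f * (D * d b (d a g)))"
proof -
  note cl = d_S S_mult S_scale f g a b
  have "d b (d a (f * g)) = d b (d a f * g) + (-1) ^ (spar n a * p) *\<^sub>S d b (f * d a g)"
    by (subst d_mult_scale[OF f(1) g f(2)]) (simp add: d_plus d_scale cl)
  also have "d b (d a f * g) = d b (d a f) * g + (-1) ^ (spar n b * (p + spar n a)) *\<^sub>S (d a f * d b g)"
    by (rule d_mult_scale[OF _ _ d_parity[OF f(2)]]) (simp_all add: cl)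
  also have "d b (f * d a g) = d b f * d a g + (-1) ^ (spar n b * p) *\<^sub>S (f * d b (d a g))"
    by (rule d_mult_scale[OF _ _ f(2)]) (simp_all add: cl)
  finally have "D * d b (d a (f * g)) = D * d b (d a f) * g + (-1) ^ (spar n b * (p + spar n a)) *\<^sub>S (D * d a f * d b g) +
    (-1) ^ (spar n a * p) *\<^sub>S (D * d b f * d a g) + ((-1) ^ (spar n a * p) * (-1) ^ (spar n b * p)) *\<^sub>S (D * f * d b (d a g))"
    by (simp add: distrib_left sscale_simps mult.assoc add.assoc)
  also have "D * f = (-1) ^ ((\<epsilon> + spar n a + spar n b) * p) *\<^sub>S (f * D)"
    by (rule sfun_sscale_commute[OF D(2) f(2)])
  also have "((-1) ^ (spar n a * p) * (-1) ^ (spar n b * p)) *\<^sub>S ((-1) ^ ((\<epsilon> + spar n a + spar n b) * p) *\<^sub>S (f * D) * d b (d a g))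
      = (-1) ^ (\<epsilon> * p) *\<^sub>S (f * (D * d b (d a g)))"
    unfolding sscale_simps mult.assoc power_add[symmetric]
    by (rule sscale_cong, rule neg_one_power_cong) auto
  finally show ?thesis .
qed

text \<open>The failure of the Leibniz rule. \<open>D2\<close> enters symmetrised, \<open>A1\<close>
  through the mixed terms of (u + w) times a derivation, and \<open>B0\<close> with the factor 2
  from (u + w)^2 - u^2 - w^2 = 2 * u * w. \<open>D1\<close> and \<open>A0\<close> drop out.\<close>

lemma lop_mult:
  assumes D2: "!!a b. a < n + m ==> b < n + m ==> D2 a b \<in> S \<and> sparity (\<epsilon> + spar n a + spar n b) (D2 a b)"
    and D1: "!!a. a < n + m ==> D1 a \<in> S \<and> sparity (\<epsilon> + spar n a) (D1 a)"
    and A1: "!!a. a < n + m ==> A1 a \<in> S \<and> sparity (\<epsilon> + spar n a) (A1 a)"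
    and A0: "sparity \<epsilon> A0" and B0: "sparity \<epsilon> B0"
    and f: "f \<in> S" "sparity p f" and g: "g \<in> S"
  shows "lop D2 D1 A1 A0 B0 (u + w) (f * g) = lop D2 D1 A1 A0 B0 u f * g + (-1) ^ (\<epsilon> * p) *\<^sub>S (f * lop D2 D1 A1 A0 B0 w g) +
    brk \<epsilon> (\<lambda>a b. D2 a b + (-1) ^ (spar n a * spar n b) *\<^sub>S D2 b a) A1 (2 *\<^sub>S B0) u p f w g"
proof -
  let ?s = "(-1 :: real) ^ (\<epsilon> * p)" and ?N = "{..<n + m}"
  let ?T = "\<lambda>f. \<Sum>a<n + m. \<Sum>b<n + m. D2 a b * d b (d a f)"
  let ?\<sigma> = "\<lambda>a b. D2 a b + (-1) ^ (spar n a * spar n b) *\<^sub>S D2 b a"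
  let ?C = "\<Sum>a<n + m. \<Sum>b<n + m. (-1) ^ (spar n a * p) *\<^sub>S (?\<sigma> a b * d b f * d a g)"
  have "?T (f * g) = (\<Sum>a<n + m. \<Sum>b<n + m. D2 a b * d b (d a f) * g) +
      (\<Sum>a<n + m. \<Sum>b<n + m. (-1) ^ (spar n b * (p + spar n a)) *\<^sub>S (D2 a b * d a f * d b g)) +
      (\<Sum>a<n + m. \<Sum>b<n + m. (-1) ^ (spar n a * p) *\<^sub>S (D2 a b * d b f * d a g)) +
      (\<Sum>a<n + m. \<Sum>b<n + m. ?s *\<^sub>S (f * (D2 a b * d b (d a g))))"
    unfolding sum.distrib[symmetric]
    by (intro sum.cong refl second_order_mult) (use D2 f g in auto)
  also have "(\<Sum>a<n + m. \<Sum>b<n + m. (-1) ^ (spar n b * (p + spar n a)) *\<^sub>S (D2 a b * d a f * d b g)) =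
      (\<Sum>a<n + m. \<Sum>b<n + m. (-1) ^ (spar n a * (p + spar n b)) *\<^sub>S (D2 b a * d b f * d a g))"
    by (rule sum.swap)
  finally have T: "?T (f * g) = ?T f * g + ?s *\<^sub>S (f * ?T g) + ?C"
    by (simp add: sum_distrib_left sum_distrib_right sscale_sum sum.distrib[symmetric] distrib_right sscale_simps
        power_add distrib_left mult.assoc add_ac)
  have V: "vf D1 (f * g) = vf D1 f * g + ?s *\<^sub>S (f * vf D1 g)" "vf A1 (f * g) = vf A1 f * g + ?s *\<^sub>S (f * vf A1 g)"
    using D1 A1 by (intro vf_mult_scale f g; blast)+
  have c: "A0 * f = ?s *\<^sub>S (f * A0)" "B0 * f = ?s *\<^sub>S (f * B0)"
    by (rule sfun_sscale_commute[OF A0 f(2)] sfun_sscale_commute[OF B0 f(2)])+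
  have ca: "A0 * (f * g) = ?s *\<^sub>S (f * (A0 * g))" "B0 * (f * g) = ?s *\<^sub>S (f * (B0 * g))"
    by (simp_all add: mult.assoc[symmetric] c sscale_simps)
  have w: "w *\<^sub>S (A0 * f * g) = w *\<^sub>S (?s *\<^sub>S (f * (A0 * g)))" "r *\<^sub>S (B0 * f * g) = r *\<^sub>S (?s *\<^sub>S (f * (B0 * g)))" for r
    by (simp_all add: mult.assoc ca)
  show ?thesis
    unfolding lop_def T V brk_def
    by (rule ext) (simp add: sfun_apply ca[THEN fun_cong, unfolded sfun_apply] mult.assoc
        distrib_left distrib_right scaleR_add_right scaleR_add_left power2_eq_square algebra_simps)
qed

text \<open>The divergence form. The sum over b together with w \<gamma> f is the vector field of f
  without its sign (-1)^(a p); absorbing that sign turns the exponent \<epsilon> + p + 1 of the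
  superdivergence into \<epsilon> + 1, so the parity of f does not enter. The term with w - 1
  offsets the scalar term of the bracket with a factor of weight 1 - w.\<close>

definition can :: "nat => (nat => nat => sfun) => (nat => sfun) => sfun => real => sfun => sfun" where
  "can \<epsilon> \<sigma> \<gamma> \<theta> w f =
     (1 / 2) *\<^sub>S ((\<Sum>a<n + m. (-1) ^ (spar n a * (\<epsilon> + 1)) *\<^sub>S d a ((\<Sum>b<n + m. \<sigma> a b * d b f) + w *\<^sub>S (\<gamma> a * f))) +
       (w - 1) *\<^sub>S (vf \<gamma> f + w *\<^sub>S (\<theta> * f)))"

end

section \<open>The canonical pencil in one chart\<close>

locale bracket_matrix = superdomain +
  fixes \<epsilon> :: nat and \<sigma> \<gamma> \<theta>
  assumes \<sigma>: "!!a b. a < n + m ==> b < n + m ==> \<sigma> a b \<in> S" "!!a b. a < n + m ==> b < n + m ==> sparity (\<epsilon> + spar n a + spar n b) (\<sigma> a b)"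
      "!!a b. a < n + m ==> b < n + m ==> \<sigma> a b = (-1) ^ (spar n a * spar n b) *\<^sub>S \<sigma> b a"
    and \<gamma>: "!!a. a < n + m ==> \<gamma> a \<in> S" "!!a. a < n + m ==> sparity (\<epsilon> + spar n a) (\<gamma> a)"
    and \<theta>: "\<theta> \<in> S" "sparity \<epsilon> \<theta>"
begin

abbreviation bracket where "bracket \<equiv> brk \<epsilon> \<sigma> \<gamma> \<theta>"
abbreviation canonical where "canonical \<equiv> can \<epsilon> \<sigma> \<gamma> \<theta>"
abbreviation (input) flux where "flux w f a \<equiv> (\<Sum>b<n + m. \<sigma> a b * d b f) + w *\<^sub>S (\<gamma> a * f)"
abbreviation (input) can1 where "can1 a \<equiv> (1 / 2) *\<^sub>S ((\<Sum>b<n + m. (-1) ^ (spar n b * (\<epsilon> + 1)) *\<^sub>S d b (\<sigma> b a)) - \<gamma> a)"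
abbreviation (input) can0 where "can0 \<equiv> (1 / 2) *\<^sub>S ((\<Sum>a<n + m. (-1) ^ (spar n a * (\<epsilon> + 1)) *\<^sub>S d a (\<gamma> a)) - \<theta>)"

text \<open>\<open>bvec\<close> and \<open>bscal\<close> are the components X_f and \<lambda>_f of
  the bracket with f, of weight u and parity p, regarded as a derivation.\<close>

definition bvec :: "real => nat => sfun => nat => sfun" where
  "bvec u p f a = (-1) ^ (spar n a * p) *\<^sub>S (flux u f a)"

definition bscal :: "real => sfun => sfun" where
  "bscal u f = vf \<gamma> f + u *\<^sub>S (\<theta> * f)"

lemma bvec_S: "f \<in> S ==> a < n + m ==> bvec u p f a \<in> S"
  unfolding bvec_def by (intro S_scale S_add S_sum S_mult \<sigma> \<gamma> d_S) auto

lemma bscal_S: "f \<in> S ==> bscal u f \<in> S"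
  unfolding bscal_def by (intro S_scale S_add S_mult vf_S \<gamma> \<theta>) auto

lemma bvec_parity: "sparity p f ==> a < n + m ==> sparity (\<epsilon> + p + spar n a) (bvec u p f a)"
  unfolding bvec_def
  by (intro sparity_scale sparity_add sparity_sum sparity_mult_cong[OF \<sigma>(2) d_parity] sparity_mult_cong[OF \<gamma>(2)]) auto

lemma bracket_vf:
  assumes f: "sparity p f" "f \<in> S" shows "bracket u p f w g = vf (bvec u p f) g + w *\<^sub>S (bscal u f * g)"
proof -
  have c: "(-1) ^ (spar n a * p) *\<^sub>S (\<gamma> a * f) = (-1) ^ (\<epsilon> * p) *\<^sub>S (f * \<gamma> a)" if "a < n + m" for a
    unfolding sfun_sscale_commute[OF \<gamma>(2)[OF that] f(1)] sscale_simps power_add[symmetric]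
    by (rule sscale_cong, rule neg_one_power_cong) auto
  have "vf (bvec u p f) g = (\<Sum>a<n + m. (\<Sum>b<n + m. (-1) ^ (spar n a * p) *\<^sub>S (\<sigma> a b * d b f * d a g)) +
      u *\<^sub>S ((-1) ^ (spar n a * p) *\<^sub>S (\<gamma> a * f)) * d a g)"
    unfolding vf_def bvec_def
    by (simp add: sscale_simps distrib_right sum_distrib_right sscale_sum mult.assoc mult.commute[of u] mult.left_commute[of u])
  also have "\<dots> = (\<Sum>a<n + m. (\<Sum>b<n + m. (-1) ^ (spar n a * p) *\<^sub>S (\<sigma> a b * d b f * d a g)) +
      (u * (-1) ^ (\<epsilon> * p)) *\<^sub>S (f * (\<gamma> a * d a g)))"
    by (intro sum.cong refl) (simp add: c sscale_simps mult.assoc)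
  finally show ?thesis
    by (simp add: brk_def bscal_def sum.distrib vf_def[of \<gamma> g] sum_distrib_left sscale_sum distrib_right sscale_simps add_ac mult.assoc mult.commute[of u w])
qed

lemma canonical_bvec:
  assumes f: "f \<in> S"
  shows "canonical w f = (1 / 2) *\<^sub>S ((\<Sum>a<n + m. (-1) ^ (spar n a * (\<epsilon> + p + 1)) *\<^sub>S d a (bvec w p f a)) + (w - 1) *\<^sub>S bscal w f)"
proof -
  have "(-1) ^ (spar n a * (\<epsilon> + p + 1)) *\<^sub>S d a (bvec w p f a) =
      (-1) ^ (spar n a * (\<epsilon> + 1)) *\<^sub>S d a (flux w f a)" if a: "a < n + m" for a
  proof -
    have "flux w f a \<in> S" using a f by (intro S_scale S_add S_sum S_mult \<sigma> \<gamma> d_S) auto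
    from d_scale[OF this] show ?thesis
      unfolding bvec_def sscale_simps(3)
      by (simp only: sscale_simps(3) power_add[symmetric]) (rule sscale_cong, rule neg_one_power_cong, auto)
  qed
  then show ?thesis by (simp add: can_def bscal_def)
qed

text \<open>The product rule applied to the divergence. The factor w from the flux and w - 1 from
  the scalar part add up to 2 * w - 1, and the symmetry of \<sigma> absorbs the sign of the second
  order term.\<close>

lemma canonical_alt:
  assumes f: "f \<in> S"
  shows "canonical w f = (1 / 2) *\<^sub>S
       ((\<Sum>a<n + m. \<Sum>b<n + m. \<sigma> a b * d b (d a f)) +
        (\<Sum>a<n + m. ((\<Sum>b<n + m. (-1) ^ (spar n b * (\<epsilon> + 1)) *\<^sub>S d b (\<sigma> b a)) + (2 * w - 1) *\<^sub>S \<gamma> a) * d a f) +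
        w *\<^sub>S (\<Sum>a<n + m. (-1) ^ (spar n a * (\<epsilon> + 1)) *\<^sub>S d a (\<gamma> a)) * f + (w * (w - 1)) *\<^sub>S \<theta> * f)"
proof -
  let ?s = "\<lambda>a. (-1 :: real) ^ (spar n a * (\<epsilon> + 1))"
  have 1: "?s a *\<^sub>S d a (\<sigma> a b * d b f) = ?s a *\<^sub>S d a (\<sigma> a b) * d b f + \<sigma> b a * d a (d b f)" if "a < n + m" "b < n + m" for a b
  proof -
    have "\<sigma> b a * d a (d b f) = (-1) ^ (spar n a * spar n b) *\<^sub>S (\<sigma> a b * d a (d b f))"
      using \<sigma>(3)[of b a] that by (simp add: sscale_simps mult.commute)
    moreover have "?s a *\<^sub>S ((-1) ^ (spar n a * (\<epsilon> + spar n a + spar n b)) *\<^sub>S (\<sigma> a b * d a (d b f))) = (-1) ^ (spar n a * spar n b) *\<^sub>S (\<sigma> a b * d a (d b f))"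
      unfolding sscale_simps(3) power_add[symmetric]
      by (rule sscale_cong, rule neg_one_power_cong) auto
    ultimately show ?thesis
      using that f by (simp only: d_mult_scale[OF \<sigma>(1) _ \<sigma>(2)] d_S sscale_simps)
  qed
  have 2: "?s a *\<^sub>S d a (\<gamma> a * f) = ?s a *\<^sub>S d a (\<gamma> a) * f + \<gamma> a * d a f" if "a < n + m" for a
  proof -
    have "?s a *\<^sub>S ((-1) ^ (spar n a * (\<epsilon> + spar n a)) *\<^sub>S (\<gamma> a * d a f)) = (-1) ^ 0 *\<^sub>S (\<gamma> a * d a f)"
      unfolding sscale_simps(3) power_add[symmetric]
      by (rule sscale_cong, rule neg_one_power_cong) auto
    then show ?thesis using that f by (simp add: d_mult_scale[OF \<gamma>(1) _ \<gamma>(2)] sscale_simps)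
  qed
  have "?s a *\<^sub>S d a (flux w f a) =
      (\<Sum>b<n + m. ?s a *\<^sub>S d a (\<sigma> a b) * d b f) + (\<Sum>b<n + m. \<sigma> b a * d a (d b f)) + w *\<^sub>S (?s a *\<^sub>S d a (\<gamma> a) * f) + w *\<^sub>S (\<gamma> a * d a f)"
    if a: "a < n + m" for a
  proof -
    have "d a (flux w f a) = (\<Sum>b<n + m. d a (\<sigma> a b * d b f)) + w *\<^sub>S d a (\<gamma> a * f)"
    proof (subst d_plus)
      show "(\<Sum>b<n + m. \<sigma> a b * d b f) \<in> S" "w *\<^sub>S (\<gamma> a * f) \<in> S"
        using a f by (auto intro!: S_sum S_mult S_scale \<sigma> \<gamma> d_S)
      have "d a (\<Sum>b<n + m. \<sigma> a b * d b f) = (\<Sum>b<n + m. d a (\<sigma> a b * d b f))"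
        by (rule d_sum) (use a f in \<open>auto intro!: S_mult \<sigma> d_S\<close>)
      moreover have "d a (w *\<^sub>S (\<gamma> a * f)) = w *\<^sub>S d a (\<gamma> a * f)" by (intro d_scale S_mult \<gamma> a f)
      ultimately show "d a (\<Sum>b<n + m. \<sigma> a b * d b f) + d a (w *\<^sub>S (\<gamma> a * f)) = (\<Sum>b<n + m. d a (\<sigma> a b * d b f)) + w *\<^sub>S d a (\<gamma> a * f)" by simp
    qed
    moreover have "(\<Sum>b<n + m. ?s a *\<^sub>S d a (\<sigma> a b * d b f)) = (\<Sum>b<n + m. ?s a *\<^sub>S d a (\<sigma> a b) * d b f + \<sigma> b a * d a (d b f))"
      by (rule sum.cong[OF refl], rule 1) (use a in auto)
    moreover have "?s a *\<^sub>S (w *\<^sub>S d a (\<gamma> a * f)) = w *\<^sub>S (?s a *\<^sub>S d a (\<gamma> a * f))" by (simp only: sscale_simps(3) mult.commute)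
    ultimately show ?thesis
      using 2[OF a] by (simp add: sscale_simps(1) sscale_sum sum.distrib add.assoc)
  qed
  then have "(\<Sum>a<n + m. ?s a *\<^sub>S d a (flux w f a)) =
     (\<Sum>a<n + m. \<Sum>b<n + m. ?s a *\<^sub>S d a (\<sigma> a b) * d b f) + (\<Sum>a<n + m. \<Sum>b<n + m. \<sigma> b a * d a (d b f)) +
     (\<Sum>a<n + m. w *\<^sub>S (?s a *\<^sub>S d a (\<gamma> a) * f)) + (\<Sum>a<n + m. w *\<^sub>S (\<gamma> a * d a f))"
    by (simp add: sum.distrib)
  also have "(\<Sum>a<n + m. \<Sum>b<n + m. ?s a *\<^sub>S d a (\<sigma> a b) * d b f) = (\<Sum>a<n + m. \<Sum>b<n + m. ?s b *\<^sub>S d b (\<sigma> b a) * d a f)"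
    by (rule sum.swap)
  also have "(\<Sum>a<n + m. \<Sum>b<n + m. \<sigma> b a * d a (d b f)) = (\<Sum>a<n + m. \<Sum>b<n + m. \<sigma> a b * d b (d a f))"
    by (rule sum.swap)
  finally have e: "(\<Sum>a<n + m. ?s a *\<^sub>S d a (flux w f a)) =
     (\<Sum>a<n + m. \<Sum>b<n + m. ?s b *\<^sub>S d b (\<sigma> b a) * d a f) + (\<Sum>a<n + m. \<Sum>b<n + m. \<sigma> a b * d b (d a f)) +
     (\<Sum>a<n + m. w *\<^sub>S (?s a *\<^sub>S d a (\<gamma> a) * f)) + (\<Sum>a<n + m. w *\<^sub>S (\<gamma> a * d a f))" .
  have r: "w *\<^sub>S F + (w - 1) *\<^sub>S F = (2 * w - 1) *\<^sub>S F" for F :: sfun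
    by (simp flip: sscale_simps(2))
  have "(\<Sum>a<n + m. w *\<^sub>S (\<gamma> a * d a f)) + (w - 1) *\<^sub>S vf \<gamma> f = (\<Sum>a<n + m. (2 * w - 1) *\<^sub>S \<gamma> a * d a f)"
    by (simp add: vf_def sscale_sum sscale_simps r flip: sum.distrib)
  then have D: "(\<Sum>a<n + m. w *\<^sub>S (\<gamma> a * d a f)) = (\<Sum>a<n + m. (2 * w - 1) *\<^sub>S \<gamma> a * d a f) - (w - 1) *\<^sub>S vf \<gamma> f"
    by (simp add: eq_diff_eq)
  have C: "w *\<^sub>S (\<Sum>a<n + m. ?s a *\<^sub>S d a (\<gamma> a)) * f = (\<Sum>a<n + m. w *\<^sub>S (?s a *\<^sub>S d a (\<gamma> a) * f))"
    by (simp only: sscale_sum sum_distrib_right sscale_simps(7))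
  have Q: "(w - 1) *\<^sub>S (w *\<^sub>S (\<theta> * f)) = (w * (w - 1)) *\<^sub>S \<theta> * f" by (simp only: sscale_simps mult.commute)
  have E: "(\<Sum>a<n + m. ((\<Sum>b<n + m. ?s b *\<^sub>S d b (\<sigma> b a)) + (2 * w - 1) *\<^sub>S \<gamma> a) * d a f) =
    (\<Sum>a<n + m. \<Sum>b<n + m. ?s b *\<^sub>S d b (\<sigma> b a) * d a f) + (\<Sum>a<n + m. (2 * w - 1) *\<^sub>S \<gamma> a * d a f)"
    by (simp only: distrib_right sum.distrib sum_distrib_right)
  show ?thesis
    unfolding can_def e sscale_simps(1)[of "w - 1"] C D Q E by (simp add: algebra_simps)
qed

text \<open>The expanded form sorted by powers of w: (2 * w - 1) / 2 splits into w - 1/2, and w * (w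
  - 1) / 2 into w^2 / 2 - w / 2.\<close>

lemma canonical_lop:
  assumes f: "f \<in> S"
  shows "canonical w f = lop (\<lambda>a b. (1 / 2) *\<^sub>S \<sigma> a b)
     can1 \<gamma>
     can0 ((1 / 2) *\<^sub>S \<theta>) w f"
proof -
  have r: "r * (1 / 2) = r / 2" for r :: real by simp
  have h1: "(1 / 2) *\<^sub>S (\<Sum>a<n + m. (F a + (2 * w - 1) *\<^sub>S \<gamma> a) * d a f) = (\<Sum>a<n + m. (1 / 2) *\<^sub>S (F a - \<gamma> a) * d a f) + w *\<^sub>S vf \<gamma> f" for F
  proof -
    have "(1 / 2) *\<^sub>S ((F a + (2 * w - 1) *\<^sub>S \<gamma> a) * d a f) = (1 / 2) *\<^sub>S (F a - \<gamma> a) * d a f + w *\<^sub>S (\<gamma> a * d a f)" for a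
      by (rule ext) (simp add: sfun_apply algebra_simps scaleR_add_left scaleR_left_diff_distrib)
    then show ?thesis by (simp add: sscale_sum vf_def flip: sum.distrib)
  qed
  have h2: "(1 / 2) *\<^sub>S (w *\<^sub>S C * f + (w * (w - 1)) *\<^sub>S \<theta> * f) = w *\<^sub>S ((1 / 2) *\<^sub>S (C - \<theta>) * f) + w\<^sup>2 *\<^sub>S ((1 / 2) *\<^sub>S \<theta> * f)" for C
    by (rule ext) (simp add: sfun_apply algebra_simps scaleR_add_left scaleR_left_diff_distrib power2_eq_square)
  have h3: "(1 / 2) *\<^sub>S (\<Sum>a<n + m. \<Sum>b<n + m. \<sigma> a b * d b (d a f)) = (\<Sum>a<n + m. \<Sum>b<n + m. (1 / 2) *\<^sub>S \<sigma> a b * d b (d a f))"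
    by (simp only: sscale_sum sscale_simps(7))
  have s: "(1 / 2) *\<^sub>S (a + b + c + e) = (1 / 2) *\<^sub>S a + (1 / 2) *\<^sub>S b + (1 / 2) *\<^sub>S (c + e)" for a b c e
    by (simp only: sscale_simps(1) add.assoc)
  show ?thesis
    unfolding canonical_alt[OF f] s h1 h2 h3 lop_def vf_def[of "\<lambda>a. (1 / 2) *\<^sub>S (_ a)"] sscale_simps(1)[of w]
    by (simp only: add_ac)
qed

lemma canonical_coefficients:
  shows "a < n + m ==> b < n + m ==> (1 / 2) *\<^sub>S \<sigma> a b \<in> S \<and> sparity (\<epsilon> + spar n a + spar n b) ((1 / 2) *\<^sub>S \<sigma> a b)"
    and "a < n + m ==> can1 a \<in> S \<and>
      sparity (\<epsilon> + spar n a) (can1 a)"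
    and "can0 \<in> S \<and>
      sparity \<epsilon> can0"
    and "(1 / 2) *\<^sub>S \<theta> \<in> S \<and> sparity \<epsilon> ((1 / 2) *\<^sub>S \<theta>)"
  by (auto intro!: S_scale sparity_scale S_diff sparity_diff S_sum sparity_sum d_S \<sigma> \<gamma> \<theta>
      sparity_cong[OF _ d_parity[OF \<sigma>(2)]] sparity_cong[OF _ d_parity[OF \<gamma>(2)]])

text \<open>\<open>lop_mult\<close> for the coefficients of the canonical pencil. Symmetrising
  \<sigma>/2 gives \<sigma>, and twice \<theta>/2 is \<theta>, so the generated bracket has the
  matrix one started from; this fixes the overall factor 1/2.\<close>

lemma canonical_mult:
  assumes f: "f \<in> S" "sparity p f" and g: "g \<in> S"
  shows "canonical (u + w) (f * g) = canonical u f * g + (-1) ^ (\<epsilon> * p) *\<^sub>S (f * canonical w g) + bracket u p f w g"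
proof -
  have "bracket u p f w g = brk \<epsilon> (\<lambda>a b. (1 / 2) *\<^sub>S \<sigma> a b + (-1) ^ (spar n a * spar n b) *\<^sub>S (1 / 2) *\<^sub>S \<sigma> b a) \<gamma> (2 *\<^sub>S (1 / 2) *\<^sub>S \<theta>) u p f w g"
  proof -
    have "(1 / 2) *\<^sub>S \<sigma> a b + (-1) ^ (spar n a * spar n b) *\<^sub>S (1 / 2) *\<^sub>S \<sigma> b a = \<sigma> a b" if "a < n + m" "b < n + m" for a b
    proof -
      have "(-1) ^ (spar n a * spar n b) *\<^sub>S (1 / 2) *\<^sub>S \<sigma> b a = (1 / 2) *\<^sub>S \<sigma> a b"
        using \<sigma>(3)[OF that] by (simp add: sscale_simps mult.commute)
      then show ?thesis by (simp flip: sscale_simps(2)) (simp add: sscale_simps)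
    qed
    then have "(\<Sum>a<n + m. \<Sum>b<n + m. (-1) ^ (spar n a * p) *\<^sub>S (((1 / 2) *\<^sub>S \<sigma> a b + (-1) ^ (spar n a * spar n b) *\<^sub>S (1 / 2) *\<^sub>S \<sigma> b a) * d b f * d a g)) =
        (\<Sum>a<n + m. \<Sum>b<n + m. (-1) ^ (spar n a * p) *\<^sub>S (\<sigma> a b * d b f * d a g))"
      by (intro sum.cong refl) simp
    then show ?thesis by (simp add: brk_def sscale_simps)
  qed
  then show ?thesis
    using canonical_coefficients
    unfolding canonical_lop[OF S_mult[OF f(1) g]] canonical_lop[OF f(1)] canonical_lop[OF g]
    by (subst lop_mult[OF _ _ _ _ _ f g, where \<epsilon> = \<epsilon>]) (use \<gamma> in auto)
qed

lemma canonical_S: "f \<in> S ==> canonical w f \<in> S"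
  unfolding can_def by (intro S_scale S_add S_sum S_mult vf_S d_S \<sigma> \<gamma> \<theta>) auto

lemma canonical_parity: "f \<in> S ==> sparity p f ==> sparity (\<epsilon> + p) (canonical w f)"
proof -
  assume f: "f \<in> S" "sparity p f"
  have "sparity (\<epsilon> + p) (d a (bvec w p f a))" if "a < n + m" for a
    by (rule sparity_cong[OF _ d_parity[OF bvec_parity[OF f(2) that]]]) auto
  then show ?thesis
    unfolding canonical_bvec[OF f(1), of w p] bscal_def
    by (intro sparity_scale sparity_add sparity_sum vf_parity sparity_mult \<gamma> \<theta> f) auto
qed

lemma canonical_add: "f \<in> S ==> g \<in> S ==> canonical w (f + g) = canonical w f + canonical w g"
proof -
  assume f: "f \<in> S" and g: "g \<in> S"
  have "d a (flux w (f + g) a) =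
      d a (flux w f a) + d a (flux w g a)" if a: "a < n + m" for a
  proof -
    have "flux w h a \<in> S" if "h \<in> S" for h using a that by (intro S_scale S_add S_sum S_mult \<sigma> \<gamma> d_S) auto
    from d_plus[OF this[OF f] this[OF g]] show ?thesis
      by (simp add: d_plus[OF f g] distrib_left sum.distrib sscale_simps add_ac)
  qed
  then show ?thesis
    by (simp add: can_def vf_add[OF f g] distrib_left sscale_simps sum.distrib add_ac)
qed

lemma canonical_scale: "f \<in> S ==> canonical w (r *\<^sub>S f) = r *\<^sub>S canonical w f"
proof -
  assume f: "f \<in> S"
  have "d a (flux w (r *\<^sub>S f) a) =
      r *\<^sub>S d a (flux w f a)" if a: "a < n + m" for a
  proof -
    have "flux w f a \<in> S" using a f by (intro S_scale S_add S_sum S_mult \<sigma> \<gamma> d_S) auto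
    from d_scale[OF this] show ?thesis
      by (simp add: d_scale[OF f] sscale_simps sscale_sum mult.commute)
  qed
  then show ?thesis
    by (simp add: can_def vf_scale[OF f] sscale_simps sscale_sum mult_ac)
qed

lemma bracket_csupp: "csupp f ==> g \<in> S ==> csupp (bracket u p f w g)"
proof -
  assume f: "csupp f" and g: "g \<in> S"
  have "csupp (\<sigma> a b * d b f * d a g)" if "a < n + m" "b < n + m" for a b
    by (rule csupp_mult[OF csupp_mult2[OF csupp_d[OF f that(2)] \<sigma>(1)[OF that]] d_S[OF g that(1)]])
  moreover have "csupp (vf \<gamma> f * g)" unfolding vf_def
    by (rule csupp_mult[OF csupp_sum[OF csupp_mult2[OF csupp_d[OF f]]] g]) (use \<gamma> in auto)
  moreover have "csupp (f * vf \<gamma> g)" by (rule csupp_mult[OF f vf_S[OF \<gamma>(1) g]])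
  moreover have "csupp (\<theta> * f * g)" by (rule csupp_mult[OF csupp_mult2[OF f \<theta>(1)] g])
  ultimately show ?thesis unfolding brk_def by (intro csupp_add csupp_sum csupp_scale) auto
qed

lemma bracket_csupp2: "csupp g ==> f \<in> S ==> csupp (bracket u p f w g)"
proof -
  assume g: "csupp g" and f: "f \<in> S"
  have "csupp (\<sigma> a b * d b f * d a g)" if "a < n + m" "b < n + m" for a b
    by (rule csupp_mult2[OF csupp_d[OF g that(1)] S_mult[OF \<sigma>(1)[OF that] d_S[OF f that(2)]]])
  moreover have "csupp (vf \<gamma> f * g)" by (rule csupp_mult2[OF g vf_S[OF \<gamma>(1) f]])
  moreover have "csupp (f * vf \<gamma> g)" unfolding vf_def
    by (rule csupp_mult2[OF csupp_sum[OF csupp_mult2[OF csupp_d[OF g]]] f]) (use \<gamma> in auto)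
  moreover have "csupp (\<theta> * f * g)" by (rule csupp_mult2[OF g S_mult[OF \<theta>(1) f]])
  ultimately show ?thesis unfolding brk_def by (intro csupp_add csupp_sum csupp_scale) auto
qed

lemma canonical_csupp: "csupp f ==> csupp (canonical w f)"
proof -
  assume f: "csupp f"
  have "csupp (\<sigma> a b * d b f)" "csupp (\<gamma> a * f)" "csupp (\<gamma> a * d a f)" if "a < n + m" "b < n + m" for a b
    by (intro csupp_mult2[OF csupp_d[OF f]] csupp_mult2[OF f] \<sigma>(1) \<gamma>(1) that)+
  then show ?thesis unfolding can_def vf_def
    by (intro csupp_add csupp_sum csupp_scale csupp_d csupp_mult2[OF f \<theta>(1)]) auto
qed

text \<open>Twice the pencil applied to f, times g, plus the bracket is the total divergence of the
  vector field X_f multiplied by g. The terms in \<lambda>_f cancel since the weights w and 1 - w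
  are complementary.\<close>

lemma integral_canonical:
  assumes f: "f \<in> S" "sparity p f" and g: "g \<in> S" and c: "csupp f \<or> csupp g"
  shows "csupp (canonical w f * g)" "csupp (bracket w p f (1 - w) g)"
    "sintegral n m (canonical w f * g) = - (1 / 2) * sintegral n m (bracket w p f (1 - w) g)"
proof -
  let ?s = "\<lambda>a. (-1 :: real) ^ (spar n a * (\<epsilon> + p + 1))" and ?X = "bvec w p f"
  have Xg: "csupp (?X a * g)" if "a < n + m" for a
    using c
  proof
    assume f: "csupp f"
    have "csupp (?X a)" unfolding bvec_def
      by (intro csupp_scale csupp_add csupp_sum csupp_mult2[OF f] csupp_mult2[OF csupp_d[OF f]] \<sigma> \<gamma> that) auto
    then show ?thesis by (rule csupp_mult[OF _ g])
  qed (intro csupp_mult2 bvec_S f that)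
  have e: "?s a *\<^sub>S d a (?X a * g) = ?s a *\<^sub>S d a (?X a) * g + ?X a * d a g" if "a < n + m" for a
  proof -
    have "?s a *\<^sub>S ((-1) ^ (spar n a * (\<epsilon> + p + spar n a)) *\<^sub>S (?X a * d a g)) = (-1) ^ 0 *\<^sub>S (?X a * d a g)"
      unfolding sscale_simps(3) power_add[symmetric]
      by (rule sscale_cong, rule neg_one_power_cong) auto
    then show ?thesis by (simp add: d_mult_scale[OF bvec_S[OF f(1) that] g bvec_parity[OF f(2) that]] sscale_simps)
  qed
  have "2 *\<^sub>S (canonical w f * g) = (\<Sum>a<n + m. ?s a *\<^sub>S d a (?X a) * g) + (w - 1) *\<^sub>S (bscal w f * g)"
    unfolding canonical_bvec[OF f(1), of w p] sscale_simps(7) sscale_simps(3)[of 2]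
    by (simp add: sscale_simps(4,7) distrib_right sum_distrib_right)
  moreover have "bracket w p f (1 - w) g = (\<Sum>a<n + m. ?X a * d a g) - (w - 1) *\<^sub>S (bscal w f * g)"
    unfolding bracket_vf[OF f(2,1)] vf_def by (rule ext) (simp add: sfun_apply algebra_simps scaleR_left_diff_distrib)
  moreover have "(\<Sum>a<n + m. ?s a *\<^sub>S d a (?X a * g)) = (\<Sum>a<n + m. ?s a *\<^sub>S d a (?X a) * g) + (\<Sum>a<n + m. ?X a * d a g)"
    unfolding sum.distrib[symmetric] by (intro sum.cong refl e) simp
  ultimately have main: "2 *\<^sub>S (canonical w f * g) + bracket w p f (1 - w) g = (\<Sum>a<n + m. ?s a *\<^sub>S d a (?X a * g))"
    by simp
  show B: "csupp (bracket w p f (1 - w) g)"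
    using c bracket_csupp[OF _ g] bracket_csupp2[OF _ f(1)] by blast
  show C: "csupp (canonical w f * g)"
    using c csupp_mult[OF canonical_csupp g] csupp_mult2[OF _ canonical_S[OF f(1)]] by blast
  have "2 * sintegral n m (canonical w f * g) + sintegral n m (bracket w p f (1 - w) g) =
      sintegral n m (\<Sum>a<n + m. ?s a *\<^sub>S d a (?X a * g))"
    unfolding main[symmetric] by (simp add: sintegral_add csupp_scale B C sintegral_scale)
  also have "\<dots> = 0"
    by (subst sintegral_sum) (auto simp: sintegral_scale sintegral_d Xg intro!: csupp_scale csupp_d)
  finally show "sintegral n m (canonical w f * g) = - (1 / 2) * sintegral n m (bracket w p f (1 - w) g)" by simp
qed

text \<open>By \<open>canonical_mult\<close> the bracket is the failure of the Leibniz rule, and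
  this is symmetric because the product is.\<close>

lemma bracket_symmetric:
  assumes f: "f \<in> S" "sparity p f" and g: "g \<in> S" "sparity r g"
  shows "bracket u p f w g = (-1) ^ (p * r) *\<^sub>S bracket w r g u f"
proof -
  have 1: "bracket u p f w g = canonical (u + w) (f * g) - canonical u f * g - (-1) ^ (\<epsilon> * p) *\<^sub>S (f * canonical w g)"
    using canonical_mult[OF f g(1)] by simp
  have 2: "bracket w r g u f = canonical (u + w) (g * f) - canonical w g * f - (-1) ^ (\<epsilon> * r) *\<^sub>S (g * canonical u f)"
    using canonical_mult[OF g f(1), of w u] by (simp add: add.commute)
  have 3: "canonical (u + w) (f * g) = (-1) ^ (p * r) *\<^sub>S canonical (u + w) (g * f)"
    unfolding sfun_sscale_commute[OF f(2) g(2)] by (rule canonical_scale[OF S_mult[OF g(1) f(1)]])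
  have 4: "canonical u f * g = (-1) ^ (p * r) *\<^sub>S (-1) ^ (\<epsilon> * r) *\<^sub>S (g * canonical u f)"
    unfolding sfun_sscale_commute[OF canonical_parity[OF f] g(2)] sscale_simps(3) power_add[symmetric]
    by (rule sscale_cong, rule neg_one_power_cong) auto
  have 5: "(-1) ^ (\<epsilon> * p) *\<^sub>S (f * canonical w g) = (-1) ^ (p * r) *\<^sub>S (canonical w g * f)"
    unfolding sfun_sscale_commute[OF f(2) canonical_parity[OF g]] sscale_simps(3) power_add[symmetric]
    by (rule sscale_cong, rule neg_one_power_cong) auto
  show ?thesis unfolding 1 2 3 4 5 by (simp add: sscale_simps(10))
qed

text \<open>Both sides are integrals of brackets with the factor -1/2, and the bracket is symmetric.
  Symmetry needs a parity for g, so g is split into components.\<close>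

lemma canonical_adjoint:
  assumes f: "csupp f" "sparity p f" and g: "g \<in> S"
  shows "sintegral n m (canonical w f * g) = (-1) ^ (\<epsilon> * p) * sintegral n m (f * canonical (1 - w) g)"
proof -
  note fS = csupp_S[OF f(1)]
  have hom: "sintegral n m (canonical w f * g) = (-1) ^ (\<epsilon> * p) * sintegral n m (f * canonical (1 - w) g)"
    if g: "g \<in> S" "sparity r g" for g r
  proof -
    have "f * canonical (1 - w) g = (-1) ^ (p * (\<epsilon> + r)) *\<^sub>S (canonical (1 - w) g * f)"
      by (rule sfun_sscale_commute[OF f(2) canonical_parity[OF g]])
    then have "sintegral n m (f * canonical (1 - w) g) = - (1 / 2) * ((-1) ^ (p * (\<epsilon> + r)) * sintegral n m (bracket (1 - w) r g w f))"
      using integral_canonical(3)[OF g fS, of "1 - w"] f(1) by (simp add: sintegral_scale)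
    moreover have "sintegral n m (canonical w f * g) = - (1 / 2) * ((-1) ^ (p * r) * sintegral n m (bracket (1 - w) r g w f))"
      using integral_canonical(3)[OF fS f(2) g(1), of w] f(1) by (simp add: bracket_symmetric[OF fS f(2) g] sintegral_scale)
    moreover have "(-1 :: real) ^ (p * r) = (-1) ^ (\<epsilon> * p) * (-1) ^ (p * (\<epsilon> + r))"
      unfolding power_add[symmetric] by (rule neg_one_power_cong) auto
    ultimately show ?thesis by simp
  qed
  have s: "g = spart 0 g + spart 1 g" by (rule spart_sum)
  have c: "csupp (canonical w f * spart q g)" "csupp (f * canonical (1 - w) (spart q g))" for q
    using integral_canonical(1)[OF fS f(2) S_part[OF g], where w = w] f(1) csupp_mult[OF f(1) canonical_S[OF S_part[OF g]]] by auto
  have "sintegral n m (canonical w f * g) = sintegral n m (canonical w f * spart 0 g) + sintegral n m (canonical w f * spart 1 g)"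
    by (subst s) (simp only: distrib_left sintegral_add[OF c(1) c(1)])
  also have "\<dots> = (-1) ^ (\<epsilon> * p) * (sintegral n m (f * canonical (1 - w) (spart 0 g)) + sintegral n m (f * canonical (1 - w) (spart 1 g)))"
    by (simp only: hom[OF S_part[OF g] sparity_spart] distrib_left)
  also have "sintegral n m (f * canonical (1 - w) (spart 0 g)) + sintegral n m (f * canonical (1 - w) (spart 1 g)) =
      sintegral n m (f * canonical (1 - w) (spart 0 g + spart 1 g))"
    by (simp only: distrib_left canonical_add[OF S_part[OF g] S_part[OF g]] sintegral_add[OF c(2) c(2)])
  finally show ?thesis by (simp only: s[symmetric])
qed

end

section \<open>Divergence under a change of coordinates\<close>

context chart_change
begin

text \<open>
  The divergence of the vector field \<open>X + \<lambda> t \<partial>\<^sub>t\<close> of weight \<open>w\<close> is a density.  The hypotheses on \<open>J\<close> are the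
  transformation law of \<open>\<lambda>\<close> evaluated on coordinate volumes of weights \<open>1\<close> and \<open>- w\<close>.
\<close>

lemma div_transform:
  assumes X: "!!a. a < n + m ==> Z a \<in> C.S" "!!a. a < n + m ==> sparity (q + spar n a) (Z a)"
    and X': "!!a. a < n + m ==> Z' a \<in> E.S" "!!a. a < n + m ==> sparity (q + spar n a) (Z' a)"
    and l: "l \<in> C.S" "l' \<in> E.S"
    and tr: "!!a. a < n + m ==> C.vf Z (t (X d W a)) = t (Z' a) * Jw w"
    and J1: "C.vf Z (Jw 1) + l * Jw 1 = t l' * Jw (w + 1)"
    and Jmw: "C.vf Z (Jw (- w)) - w *\<^sub>S (l * Jw (- w)) = - w *\<^sub>S t l'"
  shows "(\<Sum>a<n + m. (-1) ^ (spar n a * (q + 1)) *\<^sub>S C.d a (Z a)) + (w - 1) *\<^sub>S l =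
     t ((\<Sum>a<n + m. (-1) ^ (spar n a * (q + 1)) *\<^sub>S E.d a (Z' a)) + (w - 1) *\<^sub>S l') * Jw w"
proof -
  let ?s = "\<lambda>a. (-1 :: real) ^ (spar n a * (q + 1))" and ?u = "Jw (- w)"
  \<comment> \<open>Removing the weight factor turns Z into a genuine vector field: its components
    in the chart d are the pulled back Z'.\<close>
  define K where "K a = Z a * ?u" for a
  have KS: "K a \<in> C.S" if "a < n + m" for a unfolding K_def by (intro C.S_mult X that Jw_S)
  have Kp: "sparity (q + spar n a) (K a)" if "a < n + m" for a
    unfolding K_def using sparity_mult[OF X(2)[OF that] Jw_even] by simp
  have PS: "Pm a b \<in> C.S" "Ym a b \<in> C.S" if "a < n + m" "b < n + m" for a b using Pm_S Ym_S that by auto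
  have uu: "Jw w * ?u = one c W" by (rule Jw_inverse)
  have tZ: "t (Z' a) = (\<Sum>b<n + m. K b * Pm b a)" if a: "a < n + m" for a
  proof -
    have "t (Z' a) = t (Z' a) * (Jw w * ?u)" using C.S_one_mult(2)[OF t_S[OF X'(1)[OF a]]] uu by simp
    also have "\<dots> = C.vf Z (t (X d W a)) * ?u" by (simp add: tr[OF a] mult.assoc)
    also have "\<dots> = (\<Sum>b<n + m. K b * Pm b a)"
      unfolding C.vf_def K_def Pm_def sum_distrib_right
      by (simp only: mult.assoc sfun_even_commute[OF Jw_even, of "- w"])
    finally show ?thesis .
  qed
  \<comment> \<open>The chain rule solved for the derivatives in the chart d.\<close>
  have inv: "t (E.d b g) = (\<Sum>a<n + m. Ym b a * C.d a (t g))" if b: "b < n + m" and g: "g \<in> E.S" for b g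
  proof -
    have "(\<Sum>a<n + m. Ym b a * C.d a (t g)) = (\<Sum>a<n + m. \<Sum>e<n + m. Ym b a * Pm a e * t (E.d e g))"
      by (intro sum.cong refl) (simp add: chain_rule[OF g] Pm_def sum_distrib_left mult.assoc)
    also have "\<dots> = (\<Sum>e<n + m. (\<Sum>a<n + m. Ym b a * Pm a e) * t (E.d e g))"
      by (subst sum.swap) (simp add: sum_distrib_right)
    also have "\<dots> = (\<Sum>e<n + m. if e = b then t (E.d b g) else 0)"
      by (intro sum.cong refl) (use b in \<open>auto simp: Ym_Pm C.S_one_mult t_S E.d_S g\<close>)
    finally show ?thesis using b by simp
  qed
  \<comment> \<open>After summation the first term gives the divergence of K because
    \<open>Pm\<close> and \<open>Ym\<close> are inverse. In the second, derivatives of coordinates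
    commute up to sign, so that K differentiates \<open>Pm\<close> and a supertrace arises.\<close>
  have summand: "?s e *\<^sub>S (Ym e a * C.d a (K b * Pm b e)) =
      ?s a *\<^sub>S (C.d a (K b) * (Pm b e * Ym e a)) + (-1) ^ spar n a *\<^sub>S (K b * C.d b (Pm a e) * Ym e a)"
    if "e < n + m" "a < n + m" "b < n + m" for e a b
  proof -
    have Yp: "sparity (spar n e + spar n a) (Ym e a)" and Pp: "sparity (spar n b + spar n e) (Pm b e)" "sparity (spar n a + spar n e) (Pm a e)"
      using Ym_parity Pm_parity that by auto
    have c: "C.d a (Pm b e) = (-1) ^ (spar n a * spar n b) *\<^sub>S C.d b (Pm a e)"
      unfolding Pm_def by (rule C.d_commute_scale) (use that in \<open>auto intro: t_S E.S_scoord\<close>)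
    have 1: "Ym e a * (C.d a (K b) * Pm b e) = (-1) ^ ((spar n e + spar n a) * (q + spar n b + spar n a + (spar n b + spar n e))) *\<^sub>S (C.d a (K b) * Pm b e * Ym e a)"
      by (rule sfun_sscale_commute[OF Yp sparity_mult[OF C.d_parity[OF Kp] Pp(1)]]) (use that in auto)
    have 2: "Ym e a * (K b * C.d b (Pm a e)) = (-1) ^ ((spar n e + spar n a) * (q + spar n b + (spar n a + spar n e + spar n b))) *\<^sub>S (K b * C.d b (Pm a e) * Ym e a)"
      by (rule sfun_sscale_commute[OF Yp sparity_mult[OF Kp C.d_parity[OF Pp(2)]]]) (use that in auto)
    have "?s e *\<^sub>S (Ym e a * C.d a (K b * Pm b e)) = ?s e *\<^sub>S (Ym e a * (C.d a (K b) * Pm b e)) +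
        (?s e * (-1) ^ (spar n a * (q + spar n b)) * (-1) ^ (spar n a * spar n b)) *\<^sub>S (Ym e a * (K b * C.d b (Pm a e)))"
      using that by (simp add: C.d_mult_scale[OF KS _ Kp] PS c sscale_simps distrib_left mult.assoc)
    also have "?s e *\<^sub>S (Ym e a * (C.d a (K b) * Pm b e)) = ?s a *\<^sub>S (C.d a (K b) * (Pm b e * Ym e a))"
      unfolding 1 sscale_simps(3) power_add[symmetric] mult.assoc
      by (rule sscale_cong, rule neg_one_power_cong) auto
    also have "(?s e * (-1) ^ (spar n a * (q + spar n b)) * (-1) ^ (spar n a * spar n b)) *\<^sub>S (Ym e a * (K b * C.d b (Pm a e))) =
        (-1) ^ spar n a *\<^sub>S (K b * C.d b (Pm a e) * Ym e a)"
      unfolding 2 sscale_simps(3) power_add[symmetric]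
      by (rule sscale_cong, rule neg_one_power_cong) auto
    finally show ?thesis .
  qed
  let ?N = "{..<n + m}"
  define str where "str = (\<Sum>a<n + m. (-1) ^ spar n a *\<^sub>S (\<Sum>e<n + m. C.vf K (Pm a e) * Ym e a))"
  have "t (\<Sum>e<n + m. ?s e *\<^sub>S E.d e (Z' e)) = (\<Sum>e<n + m. ?s e *\<^sub>S t (E.d e (Z' e)))"
    by (subst t_sum) (auto simp: t_scale X' E.d_S intro!: E.S_scale)
  also have "\<dots> = (\<Sum>e<n + m. \<Sum>a<n + m. \<Sum>b<n + m. ?s e *\<^sub>S (Ym e a * C.d a (K b * Pm b e)))"
  proof (intro sum.cong refl)
    fix e assume "e \<in> ?N"
    then have e: "e < n + m" by simp
    have "C.d a (t (Z' e)) = (\<Sum>b<n + m. C.d a (K b * Pm b e))" for a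
      unfolding tZ[OF e] by (rule C.d_sum) (use e in \<open>auto intro!: C.S_mult KS PS\<close>)
    then show "?s e *\<^sub>S t (E.d e (Z' e)) = (\<Sum>a<n + m. \<Sum>b<n + m. ?s e *\<^sub>S (Ym e a * C.d a (K b * Pm b e)))"
      by (simp add: inv[OF e X'(1)[OF e]] sum_distrib_left sscale_sum)
  qed
  also have "\<dots> = (\<Sum>e<n + m. \<Sum>a<n + m. \<Sum>b<n + m. ?s a *\<^sub>S (C.d a (K b) * (Pm b e * Ym e a))) +
      (\<Sum>e<n + m. \<Sum>a<n + m. \<Sum>b<n + m. (-1) ^ spar n a *\<^sub>S (K b * C.d b (Pm a e) * Ym e a))"
    unfolding sum.distrib[symmetric] by (intro sum.cong refl summand) auto
  also have "(\<Sum>e<n + m. \<Sum>a<n + m. \<Sum>b<n + m. (-1) ^ spar n a *\<^sub>S (K b * C.d b (Pm a e) * Ym e a)) = str"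
    unfolding str_def C.vf_def by (subst sum.swap) (simp add: sum_distrib_right sscale_sum)
  also have "(\<Sum>e<n + m. \<Sum>a<n + m. \<Sum>b<n + m. ?s a *\<^sub>S (C.d a (K b) * (Pm b e * Ym e a))) =
      (\<Sum>a<n + m. \<Sum>b<n + m. ?s a *\<^sub>S (C.d a (K b) * (\<Sum>e<n + m. Pm b e * Ym e a)))"
    by (subst sum.swap, rule sum.cong[OF refl], subst sum.swap) (simp add: sum_distrib_left sscale_sum)
  also have "\<dots> = (\<Sum>a<n + m. \<Sum>b<n + m. if b = a then ?s a *\<^sub>S C.d a (K a) else 0)"
    by (intro sum.cong refl) (auto simp: Pm_Ym C.S_one_mult C.d_S KS sscale_simps)
  also have "\<dots> = (\<Sum>a<n + m. ?s a *\<^sub>S C.d a (K a))" by simp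
  also have "\<dots> = (\<Sum>a<n + m. ?s a *\<^sub>S C.d a (Z a)) * ?u + C.vf Z ?u"
    unfolding C.vf_def sum_distrib_right sum.distrib[symmetric]
  proof (intro sum.cong refl)
    fix a assume "a \<in> ?N"
    then have a: "a < n + m" by simp
    have "?s a *\<^sub>S ((-1) ^ (spar n a * (q + spar n a)) *\<^sub>S (Z a * C.d a ?u)) = (-1) ^ 0 *\<^sub>S (Z a * C.d a ?u)"
      unfolding sscale_simps(3) power_add[symmetric] by (rule sscale_cong, rule neg_one_power_cong) auto
    then show "?s a *\<^sub>S C.d a (K a) = ?s a *\<^sub>S C.d a (Z a) * ?u + Z a * C.d a ?u"
      unfolding K_def by (simp add: C.d_mult_scale[OF X(1)[OF a] Jw_S X(2)[OF a]] sscale_simps)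
  qed
  finally have tdiv: "t (\<Sum>e<n + m. ?s e *\<^sub>S E.d e (Z' e)) = (\<Sum>a<n + m. ?s a *\<^sub>S C.d a (Z a)) * ?u + C.vf Z ?u + str" .
  \<comment> \<open>By Liouville's formula \<open>str\<close> is the logarithmic derivative of the
    absolute Jacobian along K. The hypothesis \<open>J1\<close> evaluates the same derivative
    through l and l'.\<close>
  have "C.vf K (Jw 1) = str * Jw 1"
    unfolding str_def using Jw_1_liouville[OF KS Kp] by (simp add: sign_sscale)
  moreover have "C.vf K (Jw 1) = ?u * C.vf Z (Jw 1)"
    unfolding C.vf_def K_def sum_distrib_left
    by (simp only: mult.assoc sfun_even_left_commute[OF Jw_even[of "- w"]] sfun_even_commute[OF Jw_even, of "- w"])
  moreover have "C.vf Z (Jw 1) = t l' * Jw (w + 1) - l * Jw 1" using J1 by (simp add: algebra_simps)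
  ultimately have s1: "str * Jw 1 = ?u * (t l' * Jw (w + 1)) - ?u * (l * Jw 1)" by (simp add: right_diff_distrib)
  have strS: "str \<in> C.S" unfolding str_def by (intro C.S_sum C.S_scale C.S_mult C.vf_S KS PS) auto
  have j1: "Jw 1 * Jw (- 1) = one c W" using Jw_inverse[of 1] by simp
  have "str = str * Jw 1 * Jw (- 1)" using C.S_one_mult(2)[OF strS] by (simp add: mult.assoc j1)
  also have "\<dots> = ?u * t l' * (Jw (w + 1) * Jw (- 1)) - ?u * l * (Jw 1 * Jw (- 1))"
    unfolding s1 by (simp add: left_diff_distrib mult.assoc)
  also have "Jw (w + 1) * Jw (- 1) = Jw w" using Jw_add[of "w + 1" "- 1"] by simp
  also have "?u * l * (Jw 1 * Jw (- 1)) = ?u * l" unfolding j1 by (rule C.S_one_mult(2)) (intro C.S_mult Jw_S l)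
  also have "?u * t l' * Jw w = t l'"
    using uu C.S_one_mult(2)[OF t_S[OF l(2)]] by (simp only: mult.assoc sfun_even_commute[OF Jw_even, of "-w"] uu)
  finally have str: "str = t l' - ?u * l" .
  \<comment> \<open>The derivative of the weight factor in K comes from \<open>Jmw\<close>. With
    \<open>str\<close> it makes the coefficients of l and of t l' combine to w - 1.\<close>
  have vu: "C.vf Z ?u = w *\<^sub>S (?u * l) - w *\<^sub>S t l'"
    using Jmw sfun_even_commute[OF Jw_even, of "- w" l] by (simp add: algebra_simps sscale_def fun_eq_iff sfun_apply)
  have "t ((\<Sum>a<n + m. ?s a *\<^sub>S E.d a (Z' a)) + (w - 1) *\<^sub>S l') = t (\<Sum>a<n + m. ?s a *\<^sub>S E.d a (Z' a)) + (w - 1) *\<^sub>S t l'"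
    by (subst t_add) (auto simp: t_scale l intro!: E.S_sum E.S_scale E.d_S X')
  also have "\<dots> = (\<Sum>a<n + m. ?s a *\<^sub>S C.d a (Z a)) * ?u + (w - 1) *\<^sub>S (?u * l)"
    unfolding tdiv str vu by (rule ext) (simp add: sfun_apply algebra_simps scaleR_left_diff_distrib)
  also have "\<dots> = ((\<Sum>a<n + m. ?s a *\<^sub>S C.d a (Z a)) + (w - 1) *\<^sub>S l) * ?u"
    by (simp add: distrib_right sscale_simps sfun_even_commute[OF Jw_even, of "-w" l])
  finally have "t ((\<Sum>a<n + m. ?s a *\<^sub>S E.d a (Z' a)) + (w - 1) *\<^sub>S l') * Jw w =
      ((\<Sum>a<n + m. ?s a *\<^sub>S C.d a (Z a)) + (w - 1) *\<^sub>S l) * (?u * Jw w)" by (simp add: mult.assoc)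
  also have "?u * Jw w = one c W" using uu sfun_even_commute[OF Jw_even, of w "?u"] by simp
  finally show ?thesis
    by (subst (asm) C.S_one_mult(2)) (auto intro!: C.S_add C.S_sum C.S_scale C.d_S X l)
qed

end

section \<open>The algebra of densities\<close>

lemma single_sum: "single k (\<Sum>a\<in>A. f a) = (\<Sum>a\<in>A. single k (f a))"
  by (induction A rule: infinite_finite_induct) (simp_all add: single_add)

lemma poly_mapping_sum_induct:
  fixes \<psi> :: "'k \<Rightarrow>\<^sub>0 'v :: comm_monoid_add"
  assumes "!!w. R (single w (lookup \<psi> w))" "!!x y. R x ==> R y ==> R (x + y)" "R 0"
  shows "R \<psi>"
proof -
  have "R (\<Sum>w\<in>A. single w (lookup \<psi> w))" for A
    by (induction A rule: infinite_finite_induct) (auto intro: assms)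
  moreover have "\<psi> = (\<Sum>w\<in>Poly_Mapping.keys \<psi>. single w (lookup \<psi> w))"
    by (rule poly_mapping_eqI) (auto simp: lookup_sum lookup_single when_def in_keys_iff)
  ultimately show ?thesis by metis
qed

lemma lookup_map_0: "F 0 = 0 ==> lookup (Poly_Mapping.map F \<psi>) w = F (lookup \<psi> w)"
  by (simp add: Poly_Mapping.map.rep_eq when_def)

lemma lookup_local_rep: "lookup (local_rep c \<psi>) w = lookup \<psi> w c"
  by (simp add: local_rep_def lookup_map_0 zero_fun_apply)

lemma local_rep_single: "local_rep c (single w f) = single w (f c)"
  by (simp add: local_rep_def zero_fun_apply)

lemma local_rep_add: "local_rep c (\<psi> + \<phi>) = local_rep c \<psi> + local_rep c \<phi>"
  by (rule poly_mapping_eqI) (simp add: lookup_local_rep lookup_add plus_fun_apply)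

lemma dens_sscale_0: "(\<lambda>c. r *\<^sub>S (0 :: 'c => sfun) c) = 0"
  by (simp add: zero_fun_apply sscale_simps fun_eq_iff)

lemma lookup_density_scale: "lookup (density_scale r \<psi>) w = (\<lambda>c. r *\<^sub>S lookup \<psi> w c)"
  unfolding density_scale_def by (subst lookup_map_0) (simp_all only: dens_sscale_0)

lemma density_scale_single: "density_scale r (single w f) = single w (\<lambda>c. r *\<^sub>S f c)"
  unfolding density_scale_def by (rule map_single) (rule dens_sscale_0)

lemma density_scale_add: "density_scale r (\<psi> + \<phi>) = density_scale r \<psi> + density_scale r \<phi>"
  by (rule poly_mapping_eqI) (simp add: lookup_density_scale lookup_add plus_fun_def[of "lookup _ _"]
      plus_fun_def[of "\<lambda>c. r *\<^sub>S _ c"] sscale_simps)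

lemma density_sign_0: "(\<lambda>c x. gsign k ((0 :: 'c => sfun) c x)) = 0"
  by (intro ext grassmann_eqI) (simp add: zero_fun_apply gcoeff_gsign)

lemma lookup_density_sign: "lookup (density_sign k \<psi>) w = (\<lambda>c x. gsign k (lookup \<psi> w c x))"
  unfolding density_sign_def by (subst lookup_map_0) (simp_all only: density_sign_0)

lemma density_sign_single: "density_sign k (single w f) = single w (\<lambda>c x. gsign k (f c x))"
  unfolding density_sign_def by (rule map_single) (rule density_sign_0)

lemma density_sign_add: "density_sign k (\<psi> + \<phi>) = density_sign k \<psi> + density_sign k \<phi>"
proof (intro poly_mapping_eqI ext grassmann_eqI)
  fix w c x I
  show "gcoeff (lookup (density_sign k (\<psi> + \<phi>)) w c x) I = gcoeff (lookup (density_sign k \<psi> + density_sign k \<phi>) w c x) I"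
    by (simp add: lookup_density_sign lookup_add plus_fun_apply gcoeff_gsign distrib_left)
qed

lemma gsign_sparity: "sparity p f ==> (\<lambda>x. gsign k (f x)) = (-1) ^ (k * p) *\<^sub>S f"
proof (rule ext)
  fix x assume "sparity p f"
  then have "gsign k (f x) = (-1) ^ (k * p) * f x" by (auto simp: sparity_def gsign_parity)
  then show "gsign k (f x) = ((-1) ^ (k * p) *\<^sub>S f) x" by (cases "even (k * p)") (simp_all add: sfun_apply)
qed

lemma sign_poly_mapping: "(-1) ^ k * \<psi> = density_scale ((-1) ^ k) \<psi>" for \<psi> :: "'c dens"
proof (rule poly_mapping_eqI)
  fix w
  have "- f = (\<lambda>c. - 1 *\<^sub>S f c)" for f :: "'c => sfun" by (simp add: fun_eq_iff sfun_apply uminus_apply)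
  then show "lookup ((-1) ^ k * \<psi>) w = lookup (density_scale ((-1) ^ k) \<psi>) w"
    unfolding lookup_density_scale by (cases "even k") (simp_all add: sscale_simps)
qed

lemma density_parity_single: "density_parity p (single w f) \<longleftrightarrow> (\<forall>c. sparity p (f c))"
  by (auto simp: density_parity_def lookup_single when_def zero_fun_apply)

lemma density_parity_add: "density_parity p \<psi> ==> density_parity p \<phi> ==> density_parity p (\<psi> + \<phi>)"
  by (simp add: density_parity_def lookup_add plus_fun_apply sparity_add)

context supermfd
begin

abbreviation DA where "DA \<equiv> density_algebra M"

lemma DA_lookup: "\<psi> \<in> DA ==> lookup \<psi> w \<in> densities M w"
  by (simp add: density_algebra_def)

lemma DA_single: "f \<in> densities M w ==> single w f \<in> DA"
  by (simp add: density_algebra_def lookup_single when_def)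

lemma DA_0: "0 \<in> DA" and DA_add: "\<psi> \<in> DA ==> \<phi> \<in> DA ==> \<psi> + \<phi> \<in> DA"
  and DA_diff: "\<psi> \<in> DA ==> \<phi> \<in> DA ==> \<psi> - \<phi> \<in> DA" and DA_scale: "\<psi> \<in> DA ==> density_scale r \<psi> \<in> DA"
  by (simp_all add: density_algebra_def lookup_add lookup_minus density_add density_diff lookup_density_scale density_sscale)

text \<open>Reduces additive statements to densities of a single weight and a definite parity; the
  parity may differ from summand to summand.\<close>

lemma DA_induct [consumes 1, case_names single add]:
  assumes "\<psi> \<in> DA" and s: "!!w f p. f \<in> densities M w ==> (!!c. sparity p (f c)) ==> P (single w f)"
    and a: "!!\<psi> \<phi>. \<psi> \<in> DA ==> \<phi> \<in> DA ==> P \<psi> ==> P \<phi> ==> P (\<psi> + \<phi>)"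
  shows "P \<psi>"
proof -
  have single: "P (single w f)" if f: "f \<in> densities M w" for w f
  proof -
    have "f = (\<lambda>c. spart 0 (f c)) + (\<lambda>c. spart 1 (f c))"
      by (rule ext) (simp only: plus_fun_apply, rule spart_sum)
    moreover have "P (single w (\<lambda>c. spart 0 (f c)) + single w (\<lambda>c. spart 1 (f c)))"
      by (intro a DA_single s[OF density_spart[OF f] sparity_spart] density_spart f)
    ultimately show ?thesis by (simp only: single_add[symmetric])
  qed
  have "\<psi> \<in> DA \<and> P \<psi>"
    by (rule poly_mapping_sum_induct)
      (use single[of 0] in \<open>auto intro!: single DA_single DA_lookup[OF assms(1)] a DA_add DA_0\<close>)
  then show ?thesis ..
qed

lemma DA_parity_induct [consumes 2, case_names single add]:
  assumes "\<psi> \<in> DA" "density_parity p \<psi>"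
    and s: "!!w f. f \<in> densities M w ==> (!!c. sparity p (f c)) ==> P (single w f)"
    and a: "!!\<psi> \<phi>. \<psi> \<in> DA ==> \<phi> \<in> DA ==> density_parity p \<psi> ==> density_parity p \<phi> ==> P \<psi> ==> P \<phi> ==> P (\<psi> + \<phi>)"
  shows "P \<psi>"
proof -
  have single: "P (single w (lookup \<psi> w))" for w
    by (rule s[OF DA_lookup[OF assms(1)]]) (use assms(2) in \<open>simp add: density_parity_def\<close>)
  have z: "P 0" using s[OF density_0, of 0] by (simp add: zero_fun_apply)
  have "\<psi> \<in> DA \<and> density_parity p \<psi> \<and> P \<psi>"
  proof (rule poly_mapping_sum_induct)
    fix w
    have "density_parity p (single w (lookup \<psi> w))"
      using assms(2) unfolding density_parity_single by (simp add: density_parity_def)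
    then show "single w (lookup \<psi> w) \<in> DA \<and> density_parity p (single w (lookup \<psi> w)) \<and>
        P (single w (lookup \<psi> w))"
      using single DA_single[OF DA_lookup[OF assms(1)]] by blast
  next
    show "0 \<in> DA \<and> density_parity p 0 \<and> P 0" using z DA_0 by (simp add: density_parity_def zero_fun_apply)
  qed (auto intro: DA_add density_parity_add a)
  then show ?thesis by blast
qed

lemma DA_mult: "\<psi> \<in> DA ==> \<phi> \<in> DA ==> \<psi> * \<phi> \<in> DA"
proof (induction \<psi> rule: DA_induct)
  case (single w f)
  from single(3,1) show ?case
    by (induction \<phi> rule: DA_induct) (auto simp: mult_single distrib_left intro!: DA_single density_mult DA_add)
qed (simp add: distrib_right DA_add)

lemma density_gsign: assumes f: "f \<in> densities M w" shows "(\<lambda>c x. gsign k (f c x)) \<in> densities M w"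
proof -
  have "(\<lambda>c x. gsign k (f c x)) = (\<lambda>c. spart 0 (f c)) + (\<lambda>c. (-1) ^ k *\<^sub>S spart 1 (f c))"
    by (intro ext, cases "even k") (simp_all add: spart_def gsign_gpart sfun_apply)
  then show ?thesis using density_add[OF density_spart[OF f] density_sscale[OF density_spart[OF f]]] by simp
qed

lemma DA_sign: "\<psi> \<in> DA ==> density_sign k \<psi> \<in> DA"
  by (simp add: density_algebra_def lookup_density_sign density_gsign)

lemma density_one_density: "(\<lambda>c. if c \<in> charts M then srestrict (codom M c) 1 else 0) \<in> densities M 0" (is "?o \<in> _")
proof (rule density_chartwise)
  fix c assume c: "c \<in> charts M"
  then show "?o c \<in> Sec c (dom M c)"
    using superdomain.S_one[OF superdomain_im[OF c dom_open[OF c] order_refl]] by (simp add: codom_def)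
next
  fix c d assume "chart_change M c d (ovl c d)"
  then interpret A: chart_change M c d "ovl c d" .
  have "rs e (ovl c d) (one e (dom M e)) = one e (ovl c d)" if "e = c \<or> e = d" for e
    by (rule sections_restrict(4)) (use that A.cd dom_open in auto)
  then show "rs c (ovl c d) (?o c) = A.t (rs d (ovl c d) (?o d)) * A.Jw 0"
    using A.cd by (simp add: codom_def A.t_one A.Jw_0 A.C.S_one_mult A.C.S_one)
qed simp

end

locale chart_domain = supermfd +
  fixes c
  assumes c: "c \<in> charts M"
begin

sublocale superdomain n "im c (dom M c)" m
  by (rule superdomain_im[OF c dom_open[OF c] order_refl])

lemma coords_eq: "coords M = {..<n + m}" and coord_parity_eq: "a < n + m ==> coord_parity M a = spar n a"
  and cderiv_eq: "cderiv M c = d"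
  by (auto simp: coords_def coord_parity_def spar_def cderiv_def codom_def)

lemma hat_deriv_even_odd: "a < n + m ==> hat_deriv M c a F = Poly_Mapping.map (d a) F"
  by (simp add: hat_deriv_def coords_eq cderiv_eq)

lemma lookup_hat_deriv_t:
  "\<not> a < n + m ==> lookup (hat_deriv M c a F) k = (k + 1) *\<^sub>S lookup F (k + 1)"
proof -
  assume a: "\<not> a < n + m"
  have "lookup (hat_deriv M c a F) k = (\<Sum>w\<in>Poly_Mapping.keys F. if w = k + 1 then (k + 1) *\<^sub>S lookup F (k + 1) else 0)"
  proof -
    have "w - 1 = k \<longleftrightarrow> w = k + 1" for w :: real by auto
    then have "(\<Sum>w\<in>Poly_Mapping.keys F. lookup (single (w - 1) (w *\<^sub>S lookup F w)) k) =
       (\<Sum>w\<in>Poly_Mapping.keys F. if w = k + 1 then (k + 1) *\<^sub>S lookup F (k + 1) else 0)"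
      by (intro sum.cong refl) (simp add: lookup_single when_def)
    then show ?thesis using a by (simp add: hat_deriv_def coords_eq lookup_sum)
  qed
  also have "\<dots> = (k + 1) *\<^sub>S lookup F (k + 1)"
    by (simp add: in_keys_iff sscale_simps)
  finally show ?thesis .
qed

lemma hat_deriv_add:
  assumes "!!w. lookup F w \<in> S" "!!w. lookup G w \<in> S"
  shows "hat_deriv M c a (F + G) = hat_deriv M c a F + hat_deriv M c a G"
proof (rule poly_mapping_eqI)
  fix k
  show "lookup (hat_deriv M c a (F + G)) k = lookup (hat_deriv M c a F + hat_deriv M c a G) k"
    using d_plus[OF assms]
    by (cases "a < n + m") (simp_all add: hat_deriv_even_odd lookup_hat_deriv_t lookup_add lookup_map_0 sscale_simps)
qed

lemma hat_deriv_single: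
  shows "a < n + m ==> hat_deriv M c a (single w f) = single w (d a f)"
    and "\<not> a < n + m ==> hat_deriv M c a (single w f) = single (w - 1) (w *\<^sub>S f)"
proof -
  show "a < n + m ==> hat_deriv M c a (single w f) = single w (d a f)"
    by (simp add: hat_deriv_even_odd)
  show "\<not> a < n + m ==> hat_deriv M c a (single w f) = single (w - 1) (w *\<^sub>S f)"
    by (rule poly_mapping_eqI) (auto simp: lookup_hat_deriv_t lookup_single when_def sscale_simps(5))
qed

lemma density_S: "f \<in> densities M w ==> f c \<in> S"
  by (rule density_section[OF _ c])

lemma local_rep_S: "\<psi> \<in> DA ==> lookup (local_rep c \<psi>) w \<in> S"
  by (simp add: lookup_local_rep density_S[OF DA_lookup])

end

lemma minus_one_sscale: "(- 1) *\<^sub>S f = - f"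
  by (rule ext) (simp add: sfun_apply)

lemma single_sign: "single k f * (-1) ^ j = single k ((-1) ^ j *\<^sub>S f)" for f :: sfun
  by (cases "even j") (simp_all add: sscale_simps(4) single_uminus minus_one_sscale)

locale chart_bracket = chart_domain M c + bracket_matrix "evdim M" "crd M c ` dom M c" "odddim M" \<epsilon> \<sigma> \<gamma> \<theta>
  for M :: "('p, 'c) superatlas" and c \<epsilon> \<sigma> \<gamma> \<theta>
begin

definition hat_sum :: "nat => (real \<Rightarrow>\<^sub>0 sfun) => (real \<Rightarrow>\<^sub>0 sfun) => (real \<Rightarrow>\<^sub>0 sfun)" where
  "hat_sum p F G = (\<Sum>a\<in>hat_coords M. \<Sum>b\<in>hat_coords M.
     hat_matrix M \<sigma> \<gamma> \<theta> a b * hat_deriv M c b F * hat_deriv M c a G * (-1) ^ (coord_parity M a * p))"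

lemma hat_sum_add:
  assumes "!!w. lookup F w \<in> S" "!!w. lookup F' w \<in> S"
  shows "hat_sum p (F + F') G = hat_sum p F G + hat_sum p F' G" "hat_sum p G (F + F') = hat_sum p G F + hat_sum p G F'"
  unfolding hat_sum_def hat_deriv_add[OF assms] by (simp_all add: distrib_left distrib_right sum.distrib)

text \<open>Each derivative in t lowers the exponent by one, and the factors t and t^2 in the matrix
  restore it, so everything has weight u + w.\<close>

lemma hat_sum_single:
  assumes f: "f \<in> S" "sparity p f" and g: "g \<in> S"
  shows "hat_sum p (single u f) (single w g) = single (u + w) (bracket u p f w g)"
proof -
  let ?s = "\<lambda>a. (-1 :: real) ^ (spar n a * p)"
  have N: "coord_parity M (n + m) = 0" "n + m \<notin> coords M" "!!a. a < n + m ==> a \<in> coords M"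
    by (auto simp: coord_parity_def coords_eq)
  have "hat_sum p (single u f) (single w g) =
      (\<Sum>a<n + m. (\<Sum>b<n + m. single (u + w) (?s a *\<^sub>S (\<sigma> a b * d b f * d a g))) +
        single (u + w) (?s a *\<^sub>S (\<gamma> a * (u *\<^sub>S f) * d a g))) +
      ((\<Sum>b<n + m. single (u + w) (\<gamma> b * d b f * (w *\<^sub>S g))) + single (u + w) (\<theta> * (u *\<^sub>S f) * (w *\<^sub>S g)))"
    unfolding hat_sum_def hat_coords_def lessThan_Suc_atMost[symmetric] sum.lessThan_Suc
    by (intro arg_cong2[of _ _ _ _ "(+)"] sum.cong refl)
      (simp_all add: hat_matrix_def N hat_deriv_single mult_single coord_parity_eq single_sign)
  also have "\<dots> = single (u + w) ((\<Sum>a<n + m. (\<Sum>b<n + m. ?s a *\<^sub>S (\<sigma> a b * d b f * d a g)) +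
        (?s a *\<^sub>S (\<gamma> a * (u *\<^sub>S f) * d a g))) + ((\<Sum>b<n + m. \<gamma> b * d b f * (w *\<^sub>S g)) + \<theta> * (u *\<^sub>S f) * (w *\<^sub>S g)))"
    by (simp only: single_sum single_add)
  also have "(\<Sum>a<n + m. (\<Sum>b<n + m. ?s a *\<^sub>S (\<sigma> a b * d b f * d a g)) + (?s a *\<^sub>S (\<gamma> a * (u *\<^sub>S f) * d a g))) =
    (\<Sum>a<n + m. (\<Sum>b<n + m. ?s a *\<^sub>S (\<sigma> a b * d b f * d a g)) + (u * (-1) ^ (\<epsilon> * p)) *\<^sub>S (f * (\<gamma> a * d a g)))"
  proof (intro sum.cong refl arg_cong2[of _ _ _ _ "(+)"])
    fix a assume "a \<in> {..<n + m}"
    then have a: "a < n + m" by simp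
    have "?s a *\<^sub>S (\<gamma> a * f) = (-1) ^ (\<epsilon> * p) *\<^sub>S (f * \<gamma> a)"
      unfolding sfun_sscale_commute[OF \<gamma>(2)[OF a] f(2)] sscale_simps(3) power_add[symmetric]
      by (rule sscale_cong, rule neg_one_power_cong) auto
    then have "u *\<^sub>S (?s a *\<^sub>S (\<gamma> a * f) * d a g) = (u * (-1) ^ (\<epsilon> * p)) *\<^sub>S (f * (\<gamma> a * d a g))"
      by (simp add: sscale_simps mult.assoc)
    then show "?s a *\<^sub>S (\<gamma> a * (u *\<^sub>S f) * d a g) = (u * (-1) ^ (\<epsilon> * p)) *\<^sub>S (f * (\<gamma> a * d a g))"
      by (simp add: sscale_simps mult.commute[of u])
  qed
  also have "\<dots> + ((\<Sum>b<n + m. \<gamma> b * d b f * (w *\<^sub>S g)) + \<theta> * (u *\<^sub>S f) * (w *\<^sub>S g)) = bracket u p f w g"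
    unfolding brk_def vf_def sum.distrib
    by (simp add: sscale_simps sscale_sum sum_distrib_left sum_distrib_right add_ac mult.commute[of u w])
  finally show ?thesis .
qed

lemma canonical_pencil_eq: "f \<in> S ==> canonical_pencil M \<epsilon> c \<sigma> \<gamma> \<theta> w f = canonical w f"
proof -
  assume f: "f \<in> S"
  have s: "F * (-1) ^ k = (-1) ^ k *\<^sub>S F" for k and F :: sfun
    by (cases "even k") (simp_all add: sscale_simps(4) minus_one_sscale)
  show ?thesis
    unfolding canonical_alt[OF f] canonical_pencil_def coords_eq cderiv_eq
    by (simp add: s coord_parity_eq cong: sum.cong_simp)
qed

end

context chart_domain
begin

text \<open>Reduces the matrix description, stated for the whole algebra, to \<open>brk\<close> on
  single weights; \<open>has_bracket_matrixI\<close> goes back by additivity.\<close>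

lemma has_bracket_matrixD:
  assumes "has_bracket_matrix M \<epsilon> B c \<sigma> \<gamma> \<theta>"
  shows "chart_bracket M c \<epsilon> \<sigma> \<gamma> \<theta>"
    and "f \<in> densities M u ==> (!!e. sparity p (f e)) ==> g \<in> densities M w ==>
      local_rep c (B (single u f) (single w g)) = single (u + w) (brk \<epsilon> \<sigma> \<gamma> \<theta> u p (f c) w (g c))"
proof -
  note h = assms[unfolded has_bracket_matrix_def coords_eq sections_def]
  show C: "chart_bracket M c \<epsilon> \<sigma> \<gamma> \<theta>"
  proof
    fix a b assume ab: "a < n + m" "b < n + m"
    show "\<sigma> a b \<in> S" using h ab by blast
    have "sparity (\<epsilon> + coord_parity M a + coord_parity M b) (\<sigma> a b)" using h ab by blast
    then show "sparity (\<epsilon> + spar n a + spar n b) (\<sigma> a b)" using ab by (simp only: coord_parity_eq)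
    have "\<sigma> a b = (-1) ^ (coord_parity M a * coord_parity M b) * \<sigma> b a" using h ab by blast
    then show "\<sigma> a b = (-1) ^ (spar n a * spar n b) *\<^sub>S \<sigma> b a" using ab by (simp only: coord_parity_eq sign_sscale)
  next
    fix a assume a: "a < n + m"
    show "\<gamma> a \<in> S" using h a by blast
    have "sparity (\<epsilon> + coord_parity M a) (\<gamma> a)" using h a by blast
    then show "sparity (\<epsilon> + spar n a) (\<gamma> a)" using a by (simp only: coord_parity_eq)
  qed (use h in blast)+
  interpret chart_bracket M c \<epsilon> \<sigma> \<gamma> \<theta> by (rule C)
  assume f: "f \<in> densities M u" "!!e. sparity p (f e)" and g: "g \<in> densities M w"
  have "local_rep c (B (single u f) (single w g)) =
      hat_sum p (local_rep c (single u f)) (local_rep c (single w g))"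
    unfolding hat_sum_def
    by (rule assms[unfolded has_bracket_matrix_def, THEN conjunct2, THEN conjunct2, THEN conjunct2, THEN conjunct2,
          rule_format, OF DA_single[OF f(1)] DA_single[OF g]]) (simp add: density_parity_single f(2))
  then show "local_rep c (B (single u f) (single w g)) = single (u + w) (brk \<epsilon> \<sigma> \<gamma> \<theta> u p (f c) w (g c))"
    by (simp add: local_rep_single hat_sum_single[OF density_S[OF f(1)] f(2) density_S[OF g]])
qed

end

context chart_bracket
begin

lemma has_bracket_matrixI:
  assumes add: "!!\<psi> \<phi> \<omega>. \<psi> \<in> DA ==> \<phi> \<in> DA ==> \<omega> \<in> DA ==> B (\<psi> + \<phi>) \<omega> = B \<psi> \<omega> + B \<phi> \<omega>"
      "!!\<psi> \<phi> \<omega>. \<psi> \<in> DA ==> \<phi> \<in> DA ==> \<omega> \<in> DA ==> B \<psi> (\<phi> + \<omega>) = B \<psi> \<phi> + B \<psi> \<omega>"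
    and single: "!!u f p w g r. f \<in> densities M u ==> (!!e. sparity p (f e)) ==> g \<in> densities M w ==> (!!e. sparity r (g e)) ==>
      local_rep c (B (single u f) (single w g)) = single (u + w) (bracket u p (f c) w (g c))"
  shows "has_bracket_matrix M \<epsilon> B c \<sigma> \<gamma> \<theta>"
proof -
  have main: "local_rep c (B \<psi> \<phi>) = hat_sum p (local_rep c \<psi>) (local_rep c \<phi>)"
    if "\<psi> \<in> DA" "density_parity p \<psi>" "\<phi> \<in> DA" for \<psi> \<phi> p
    using that
  proof (induction \<psi> rule: DA_parity_induct)
    case (single u f)
    note f = single
    from f(3) show ?case
    proof (induction \<phi> rule: DA_induct)
      case (single w g r)
      show ?case
        using assms(3)[OF f(1,2) single] by (simp add: local_rep_single hat_sum_single density_S[OF f(1)] f(2) density_S[OF single(1)])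
    next
      case (add \<phi> \<omega>)
      then show ?case
        using DA_single[OF f(1)] by (simp add: assms(2) local_rep_add hat_sum_add local_rep_S)
    qed
  next
    case (add \<psi> \<phi>')
    then show ?case by (simp add: assms(1) local_rep_add hat_sum_add local_rep_S)
  qed
  have sym: "\<sigma> a b = (-1) ^ (coord_parity M a * coord_parity M b) * \<sigma> b a" if "a < n + m" "b < n + m" for a b
    unfolding coord_parity_eq[OF that(1)] coord_parity_eq[OF that(2)] sign_sscale by (rule \<sigma>(3)[OF that])
  show ?thesis
    unfolding has_bracket_matrix_def hat_sum_def[symmetric] coords_eq sections_def
    by (intro conjI ballI allI impI \<sigma>(1) sym \<gamma>(1) \<theta> main; (assumption | simp only: lessThan_iff coord_parity_eq \<sigma>(2) \<gamma>(2)))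
qed

end

section \<open>Operators on densities and their brackets\<close>

lemma spart_cong: "even (p + q) ==> spart p f = spart q f"
  by (auto simp: spart_def fun_eq_iff intro!: gpart_mod)

context superdomain
begin

definition lop_coeffs :: "nat => (nat => nat => sfun) => (nat => sfun) => (nat => sfun) => sfun => sfun => bool" where
  "lop_coeffs \<epsilon> D2 D1 A1 A0 B0 \<longleftrightarrow>
     (\<forall>a<n + m. \<forall>b<n + m. D2 a b \<in> S \<and> sparity (\<epsilon> + spar n a + spar n b) (D2 a b)) \<and>
     (\<forall>a<n + m. D1 a \<in> S \<and> sparity (\<epsilon> + spar n a) (D1 a)) \<and>
     (\<forall>a<n + m. A1 a \<in> S \<and> sparity (\<epsilon> + spar n a) (A1 a)) \<and>
     A0 \<in> S \<and> sparity \<epsilon> A0 \<and> B0 \<in> S \<and> sparity \<epsilon> B0"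

lemma d_local:
  assumes "openin (Euclidean_space n) U" "U \<subseteq> V" "!!y. y \<in> U ==> f y = g y" "x \<in> U"
  shows "d a f x = d a g x"
proof -
  have "srestrict U f = srestrict U g" using assms(3) by (simp add: srestrict_eq_iff)
  then have "srestrict U (d a f) = srestrict U (d a g)"
    using superdomain_subset(2)[OF _ assms(1,2)] superdomain_axioms by metis
  then show ?thesis using assms(4) by (simp add: srestrict_eq_iff)
qed

lemma lop_local:
  assumes U: "openin (Euclidean_space n) U" "U \<subseteq> V" "!!y. y \<in> U ==> f y = g y" "x \<in> U"
  shows "lop D2 D1 A1 A0 B0 w f x = lop D2 D1 A1 A0 B0 w g x"
proof -
  have 1: "d a f y = d a g y" if "y \<in> U" for a y using d_local[OF U(1,2,3) that] .
  have "d b (d a f) x = d b (d a g) x" for a b using d_local[OF U(1,2) 1 U(4)] .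
  then show ?thesis using 1[OF U(4)] U(3)[OF U(4)] by (simp add: lop_def vf_def sfun_apply)
qed

lemma lop_add: "f \<in> S ==> g \<in> S ==> lop D2 D1 A1 A0 B0 w (f + g) = lop D2 D1 A1 A0 B0 w f + lop D2 D1 A1 A0 B0 w g"
proof -
  assume f: "f \<in> S" and g: "g \<in> S"
  have "(\<Sum>a<n + m. \<Sum>b<n + m. D2 a b * d b (d a (f + g))) = (\<Sum>a<n + m. \<Sum>b<n + m. D2 a b * d b (d a f) + D2 a b * d b (d a g))"
    by (intro sum.cong refl) (simp add: d_plus f g d_S distrib_left)
  then show ?thesis
    by (simp add: lop_def vf_add f g sum.distrib distrib_left sscale_simps add_ac)
qed

lemma lop_scale: "f \<in> S ==> lop D2 D1 A1 A0 B0 w (r *\<^sub>S f) = r *\<^sub>S lop D2 D1 A1 A0 B0 w f"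
proof -
  assume f: "f \<in> S"
  have "(\<Sum>a<n + m. \<Sum>b<n + m. D2 a b * d b (d a (r *\<^sub>S f))) = (\<Sum>a<n + m. \<Sum>b<n + m. r *\<^sub>S (D2 a b * d b (d a f)))"
    by (intro sum.cong refl) (simp add: d_scale f d_S sscale_simps)
  then show ?thesis
    by (simp add: lop_def vf_scale f sscale_sum sscale_simps mult.commute)
qed

lemma lop_one: "lop D2 D1 A1 A0 B0 0 (srestrict V 1) = 0"
  by (simp add: lop_def vf_one d_one sscale_simps)

lemma lop_parity:
  assumes c: "lop_coeffs \<epsilon> D2 D1 A1 A0 B0" and f: "sparity p f"
  shows "sparity (\<epsilon> + p) (lop D2 D1 A1 A0 B0 w f)"
proof -
  have "sparity (\<epsilon> + p) (D2 a b * d b (d a f))" if "a < n + m" "b < n + m" for a b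
    by (rule sparity_mult_cong[OF _ d_parity[OF d_parity[OF f]]]) (use c that in \<open>auto simp: lop_coeffs_def\<close>)
  moreover have "sparity (\<epsilon> + p) (A0 * f)" "sparity (\<epsilon> + p) (B0 * f)"
    using c by (auto simp: lop_coeffs_def intro: sparity_mult f)
  ultimately show ?thesis
    unfolding lop_def using c
    by (intro sparity_add sparity_sum sparity_scale vf_parity f) (auto simp: lop_coeffs_def)
qed

lemma lop_csupp:
  assumes c: "lop_coeffs \<epsilon> D2 D1 A1 A0 B0" and f: "csupp f"
  shows "csupp (lop D2 D1 A1 A0 B0 w f)"
proof -
  have "csupp (D2 a b * d b (d a f))" if "a < n + m" "b < n + m" for a b
    using c that by (intro csupp_mult2[OF csupp_d[OF csupp_d[OF f]]]) (auto simp: lop_coeffs_def)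
  moreover have "csupp (D1 a * d a f)" "csupp (A1 a * d a f)" if "a < n + m" for a
    using c that by (auto simp: lop_coeffs_def intro!: csupp_mult2[OF csupp_d[OF f]])
  moreover have "csupp (A0 * f)" "csupp (B0 * f)"
    using c by (auto simp: lop_coeffs_def intro!: csupp_mult2[OF f])
  ultimately show ?thesis
    unfolding lop_def vf_def by (intro csupp_add csupp_sum csupp_scale) auto
qed

text \<open>The coefficients in \<open>second_order_operators\<close> carry no parity condition. On
  homogeneous arguments, projecting the value amounts to projecting each coefficient to the parity
  it should have.\<close>

lemma lop_spart:
  assumes f: "sparity p f"
  shows "spart (\<epsilon> + p) (lop D2 D1 A1 A0 B0 w f) =
    lop (\<lambda>a b. spart (\<epsilon> + spar n a + spar n b) (D2 a b)) (\<lambda>a. spart (\<epsilon> + spar n a) (D1 a))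
      (\<lambda>a. spart (\<epsilon> + spar n a) (A1 a)) (spart \<epsilon> A0) (spart \<epsilon> B0) w f"
proof -
  have 1: "spart (\<epsilon> + p) (D * d b (d a f)) = spart (\<epsilon> + spar n a + spar n b) D * d b (d a f)" for D a b
    by (subst spart_mult_right[OF d_parity[OF d_parity[OF f]]], subst spart_cong) auto
  have 2: "spart (\<epsilon> + p) (D * d a f) = spart (\<epsilon> + spar n a) D * d a f" for D a
    by (subst spart_mult_right[OF d_parity[OF f]], subst spart_cong) auto
  have 3: "spart (\<epsilon> + p) (D * f) = spart \<epsilon> D * f" for D
    by (subst spart_mult_right[OF f], subst spart_cong) auto
  show ?thesis
    unfolding lop_def vf_def by (simp only: spart_add spart_sum_left spart_scale 1 2 3)
qed

lemma lop_coeffs_spart: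
  assumes "!!a b. a < n + m ==> b < n + m ==> D2 a b \<in> S" "!!a. a < n + m ==> D1 a \<in> S \<and> A1 a \<in> S" "A0 \<in> S" "B0 \<in> S"
  shows "lop_coeffs \<epsilon> (\<lambda>a b. spart (\<epsilon> + spar n a + spar n b) (D2 a b)) (\<lambda>a. spart (\<epsilon> + spar n a) (D1 a))
      (\<lambda>a. spart (\<epsilon> + spar n a) (A1 a)) (spart \<epsilon> A0) (spart \<epsilon> B0)"
  unfolding lop_coeffs_def using assms by (auto intro!: S_part sparity_spart)

lemma lop_coeffs_bracket_matrix:
  assumes c: "lop_coeffs \<epsilon> D2 D1 A1 A0 B0"
  shows "bracket_matrix n V m \<epsilon> (\<lambda>a b. D2 a b + (-1) ^ (spar n a * spar n b) *\<^sub>S D2 b a) A1 (2 *\<^sub>S B0)"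
proof
  fix a b assume ab: "a < n + m" "b < n + m"
  then show "D2 a b + (-1) ^ (spar n a * spar n b) *\<^sub>S D2 b a \<in> S"
    using c by (auto simp: lop_coeffs_def intro!: S_add S_scale)
  have "sparity (\<epsilon> + spar n a + spar n b) (D2 a b)" "sparity (\<epsilon> + spar n b + spar n a) (D2 b a)"
    using c ab by (auto simp: lop_coeffs_def)
  moreover have "\<epsilon> + spar n b + spar n a = \<epsilon> + spar n a + spar n b" by simp
  ultimately show "sparity (\<epsilon> + spar n a + spar n b) (D2 a b + (-1) ^ (spar n a * spar n b) *\<^sub>S D2 b a)"
    by (metis sparity_add sparity_scale)
  have "(-1 :: real) ^ (spar n a * spar n b) * (-1) ^ (spar n b * spar n a) = 1"
    by (auto simp: minus_one_power_iff)
  then show "D2 a b + (-1) ^ (spar n a * spar n b) *\<^sub>S D2 b a =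
      (-1) ^ (spar n a * spar n b) *\<^sub>S (D2 b a + (-1) ^ (spar n b * spar n a) *\<^sub>S D2 a b)"
    by (simp add: sscale_simps(1,3,4) add.commute)
qed (use c in \<open>auto simp: lop_coeffs_def intro: S_scale sparity_scale\<close>)

end

context bracket_matrix
begin

lemma canonical_lop_coeffs:
  "lop_coeffs \<epsilon> (\<lambda>a b. (1 / 2) *\<^sub>S \<sigma> a b)
     can1 \<gamma>
     can0 ((1 / 2) *\<^sub>S \<theta>)"
  unfolding lop_coeffs_def by (intro conjI allI impI \<gamma>(1,2); use canonical_coefficients in blast)

lemma bracket_mult:
  assumes f: "f \<in> S" "sparity p f" and g: "g \<in> S" "sparity r g" and h: "h \<in> S"
  shows "bracket u p f (w + v) (g * h) = bracket u p f w g * h + (-1) ^ ((\<epsilon> + p) * r) *\<^sub>S (g * bracket u p f v h)"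
proof -
  let ?s = "(-1 :: real) ^ ((\<epsilon> + p) * r)" and ?l = "bscal u f"
  have lp: "sparity (\<epsilon> + p) ?l"
    unfolding bscal_def by (intro sparity_add sparity_scale vf_parity sparity_mult \<gamma> \<theta> f)
  have l: "?l * g = ?s *\<^sub>S (g * ?l)" by (rule sfun_sscale_commute[OF lp g(2)])
  have v: "vf (bvec u p f) (g * h) = vf (bvec u p f) g * h + ?s *\<^sub>S (g * vf (bvec u p f) h)"
    by (rule vf_mult_scale[OF bvec_parity[OF f(2)] g h])
  have "v *\<^sub>S (?l * (g * h)) = ?s *\<^sub>S (g * (v *\<^sub>S (?l * h)))"
    by (simp add: mult.assoc[symmetric] l sscale_simps mult.commute)
  then show ?thesis
    unfolding bracket_vf[OF f(2,1)] v by (simp add: distrib_left distrib_right sscale_simps(1,2,7) mult.assoc add_ac)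
qed

lemma bracket_parity:
  assumes "f \<in> S" "sparity p f" "sparity r g" shows "sparity (\<epsilon> + p + r) (bracket u p f w g)"
  unfolding bracket_vf[OF assms(2,1)] bscal_def
  by (intro sparity_add sparity_scale vf_parity[OF bvec_parity] sparity_mult vf_parity \<gamma> \<theta> assms)

end

text \<open>An operator is handled as the family of its restrictions to single weights, with common
  local coefficients for all weights; \<open>oper\<close> reassembles it. The normalisation is built
  into \<open>lop\<close>.\<close>

locale density_operator = supermfd M for M :: "('p, 'c) superatlas" +
  fixes \<epsilon> :: nat and P :: "real => ('c => sfun) => ('c => sfun)"
  assumes P_dens: "f \<in> densities M w ==> P w f \<in> densities M w"
    and P_local: "c \<in> charts M ==> \<exists>D2 D1 A1 A0 B0. superdomain.lop_coeffs n (im c (dom M c)) m \<epsilon> D2 D1 A1 A0 B0 \<and>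
      (\<forall>w. \<forall>f\<in>densities M w. P w f c = superdomain.lop n (im c (dom M c)) m D2 D1 A1 A0 B0 w (f c))"
begin

lemma P_lop:
  assumes "c \<in> charts M"
  obtains D2 D1 A1 A0 B0 where "superdomain.lop_coeffs n (im c (dom M c)) m \<epsilon> D2 D1 A1 A0 B0"
    "!!w f. f \<in> densities M w ==> P w f c = superdomain.lop n (im c (dom M c)) m D2 D1 A1 A0 B0 w (f c)"
  using P_local[OF assms] by blast

lemma P_outside: "f \<in> densities M w ==> c \<notin> charts M ==> P w f c = 0"
  by (rule density_outside[OF P_dens])

lemma P_add: assumes f: "f \<in> densities M w" and g: "g \<in> densities M w" shows "P w (f + g) = P w f + P w g"
proof (rule ext)
  fix c
  show "P w (f + g) c = (P w f + P w g) c"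
  proof (cases "c \<in> charts M")
    case True
    then interpret chart_domain M c by unfold_locales
    show ?thesis
      by (rule P_lop[OF True]) (simp add: f g density_add plus_fun_apply lop_add density_S[OF f] density_S[OF g])
  qed (simp add: P_outside[OF density_add[OF f g]] P_outside[OF f] P_outside[OF g] plus_fun_apply)
qed

lemma P_scale: assumes f: "f \<in> densities M w" shows "P w (\<lambda>c. r *\<^sub>S f c) = (\<lambda>c. r *\<^sub>S P w f c)"
proof (rule ext)
  fix c
  show "P w (\<lambda>c. r *\<^sub>S f c) c = r *\<^sub>S P w f c"
  proof (cases "c \<in> charts M")
    case True
    then interpret chart_domain M c by unfold_locales
    show ?thesis
      by (rule P_lop[OF True]) (simp add: f density_sscale lop_scale density_S[OF f])
  qed (simp add: P_outside[OF density_sscale[OF f]] P_outside[OF f] sscale_simps)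
qed

lemma P_0 [simp]: "P w 0 = 0"
  using P_add[OF density_0 density_0, of w] by simp

lemma P_parity: assumes f: "f \<in> densities M w" "!!e. sparity p (f e)" shows "sparity (\<epsilon> + p) (P w f c)"
proof (cases "c \<in> charts M")
  case True
  then interpret chart_domain M c by unfold_locales
  show ?thesis by (rule P_lop[OF True]) (simp add: f lop_parity)
qed (simp add: P_outside[OF f(1)])

lemma P_one: "P 0 (\<lambda>c. if c \<in> charts M then srestrict (codom M c) 1 else 0) = 0" (is "P 0 ?o = 0")
proof (rule ext)
  fix c
  show "P 0 ?o c = 0 c"
  proof (cases "c \<in> charts M")
    case True
    then interpret chart_domain M c by unfold_locales
    show ?thesis
      by (rule P_lop[OF True]) (simp add: True lop_one density_one_density codom_def zero_fun_apply)
  qed (simp add: P_outside[OF density_one_density] zero_fun_apply)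
qed

definition oper :: "'c dens => 'c dens" where
  "oper = (\<lambda>\<psi>\<in>DA. Poly_Mapping.mapp P \<psi>)"

lemma lookup_oper: "\<psi> \<in> DA ==> lookup (oper \<psi>) w = P w (lookup \<psi> w)"
  by (simp add: oper_def lookup_mapp when_def in_keys_iff)

lemma oper_DA: assumes "\<psi> \<in> DA" shows "oper \<psi> \<in> DA"
  unfolding density_algebra_def mem_Collect_eq lookup_oper[OF assms] by (intro allI P_dens DA_lookup assms)

lemma oper_single: "f \<in> densities M w ==> oper (single w f) = single w (P w f)"
  by (rule poly_mapping_eqI) (simp add: lookup_oper DA_single lookup_single when_def)

lemma oper_add: "\<psi> \<in> DA ==> \<phi> \<in> DA ==> oper (\<psi> + \<phi>) = oper \<psi> + oper \<phi>"
  by (rule poly_mapping_eqI) (simp add: lookup_oper DA_add lookup_add P_add DA_lookup)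

lemma pencil_oper: "f \<in> densities M w ==> pencil oper w f = P w f"
  by (simp add: pencil_def oper_single)

lemma oper_one: "oper (density_one M) = 0"
  unfolding density_one_def by (simp add: oper_single density_one_density P_one)

lemma oper_second_order: "oper \<in> second_order_operators M \<epsilon>"
  unfolding second_order_operators_def
proof (intro CollectI conjI allI ballI impI)
  show "oper \<in> DA \<rightarrow>\<^sub>E DA"
    by (rule PiE_I) (auto simp: oper_DA, simp add: oper_def)
  fix p \<psi> assume "\<psi> \<in> DA" "density_parity p \<psi>"
  then show "density_parity (\<epsilon> + p) (oper \<psi>)"
    using P_parity DA_lookup by (simp add: density_parity_def lookup_oper)
next
  fix c assume c: "c \<in> charts M"
  then interpret chart_domain M c by unfold_locales
  obtain D2 D1 A1 A0 B0 where co: "lop_coeffs \<epsilon> D2 D1 A1 A0 B0" and f: "!!w f. f \<in> densities M w ==> P w f c = lop D2 D1 A1 A0 B0 w (f c)"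
    by (rule P_lop[OF c]) (rule that)
  show "\<exists>D2 D1 D0 A1 A0 B0.
          (\<forall>a\<in>coords M. \<forall>b\<in>coords M. D2 a b \<in> sections M c (dom M c)) \<and>
          (\<forall>a\<in>coords M. D1 a \<in> sections M c (dom M c) \<and> A1 a \<in> sections M c (dom M c)) \<and>
          {D0, A0, B0} \<subseteq> sections M c (dom M c) \<and>
          (\<forall>\<psi>\<in>DA. \<forall>w. let f = lookup \<psi> w c in
             lookup (oper \<psi>) w c =
               ((\<Sum>a\<in>coords M. \<Sum>b\<in>coords M. D2 a b * cderiv M c b (cderiv M c a f)) +
                (\<Sum>a\<in>coords M. D1 a * cderiv M c a f) + D0 * f) +
               w *\<^sub>S ((\<Sum>a\<in>coords M. A1 a * cderiv M c a f) + A0 * f) +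
               w\<^sup>2 *\<^sub>S (B0 * f))"
    unfolding coords_eq cderiv_eq sections_def Let_def
  proof (intro exI conjI)
    show "\<forall>\<psi>\<in>DA. \<forall>w. lookup (oper \<psi>) w c =
        ((\<Sum>a<n + m. \<Sum>b<n + m. D2 a b * d b (d a (lookup \<psi> w c))) +
          (\<Sum>a<n + m. D1 a * d a (lookup \<psi> w c)) + 0 * lookup \<psi> w c) +
        w *\<^sub>S ((\<Sum>a<n + m. A1 a * d a (lookup \<psi> w c)) + A0 * lookup \<psi> w c) +
        w\<^sup>2 *\<^sub>S (B0 * lookup \<psi> w c)"
      by (simp add: lookup_oper f[OF DA_lookup] lop_def vf_def)
  qed (use co in \<open>simp_all add: lop_coeffs_def\<close>)
qed

abbreviation gbr :: "'c dens => 'c dens => 'c dens" where "gbr \<equiv> generated_bracket M \<epsilon> oper"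

definition dbr :: "real => nat => ('c => sfun) => real => ('c => sfun) => 'c => sfun" where
  "dbr u p f w g = P (u + w) (f * g) - P u f * g - (\<lambda>c. (-1) ^ (\<epsilon> * p) *\<^sub>S (f c * P w g c))"

lemma dbr_dens: "f \<in> densities M u ==> g \<in> densities M w ==> dbr u p f w g \<in> densities M (u + w)"
proof -
  assume f: "f \<in> densities M u" and g: "g \<in> densities M w"
  have "(\<lambda>c. (-1) ^ (\<epsilon> * p) *\<^sub>S (f c * P w g c)) = (\<lambda>c. (-1) ^ (\<epsilon> * p) *\<^sub>S (f * P w g) c)"
    by (simp only: times_fun_apply[of f])
  then show ?thesis
    unfolding dbr_def by (simp only:) (intro density_diff density_mult density_sscale P_dens f g)
qed

lemma gbr_apply: "\<psi> \<in> DA ==> \<phi> \<in> DA ==> gbr \<psi> \<phi> = oper (\<psi> * \<phi>) - oper \<psi> * \<phi> - density_sign \<epsilon> \<psi> * oper \<phi>"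
  by (simp add: generated_bracket_def)

lemma gbr_single:
  assumes f: "f \<in> densities M u" "!!e. sparity p (f e)" and g: "g \<in> densities M w"
  shows "gbr (single u f) (single w g) = single (u + w) (dbr u p f w g)"
proof -
  have "(\<lambda>c x. gsign \<epsilon> (f c x)) = (\<lambda>c. (-1) ^ (\<epsilon> * p) *\<^sub>S f c)"
    by (rule ext) (rule gsign_sparity[OF f(2)])
  then have "(\<lambda>c x. gsign \<epsilon> (f c x)) * P w g = (\<lambda>c. (-1) ^ (\<epsilon> * p) *\<^sub>S (f c * P w g c))"
    by (simp add: times_fun_def[of "\<lambda>c. _ *\<^sub>S f c"] sscale_simps)
  then show ?thesis
    by (simp add: gbr_apply DA_single f g mult_single oper_single density_mult density_sign_single dbr_def single_diff)
qed

lemma gbr_DA: "\<psi> \<in> DA ==> \<phi> \<in> DA ==> gbr \<psi> \<phi> \<in> DA"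
  by (simp add: gbr_apply DA_diff DA_mult oper_DA DA_sign)

lemma gbr_add:
  "\<psi> \<in> DA ==> \<phi> \<in> DA ==> \<omega> \<in> DA ==> gbr (\<psi> + \<phi>) \<omega> = gbr \<psi> \<omega> + gbr \<phi> \<omega>"
  "\<psi> \<in> DA ==> \<phi> \<in> DA ==> \<omega> \<in> DA ==> gbr \<psi> (\<phi> + \<omega>) = gbr \<psi> \<phi> + gbr \<psi> \<omega>"
  by (simp_all add: gbr_apply DA_add DA_mult oper_add density_sign_add distrib_left distrib_right)

definition brk_at :: "'c => (nat => nat => sfun) => (nat => sfun) => sfun => bool" where
  "brk_at c \<sigma> \<gamma> \<theta> \<longleftrightarrow> (\<forall>u p f w g. f \<in> densities M u \<longrightarrow> (\<forall>e. sparity p (f e)) \<longrightarrow> g \<in> densities M w \<longrightarrow>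
      dbr u p f w g c = superdomain.brk n (im c (dom M c)) m \<epsilon> \<sigma> \<gamma> \<theta> u p (f c) w (g c))"

lemma brk_atD:
  "brk_at c \<sigma> \<gamma> \<theta> ==> f \<in> densities M u ==> (!!e. sparity p (f e)) ==> g \<in> densities M w ==>
      dbr u p f w g c = superdomain.brk n (im c (dom M c)) m \<epsilon> \<sigma> \<gamma> \<theta> u p (f c) w (g c)"
  unfolding brk_at_def by blast

text \<open>By \<open>lop_mult\<close> a generated bracket has the form \<open>brk\<close> in every
  chart, whatever the self-adjointness of the operator. Symmetry, Leibniz rule and parity of
  \<open>dbr\<close> are then chartwise facts about \<open>bracket_matrix\<close>.\<close>

lemma dbr_local:
  assumes c: "c \<in> charts M"
  obtains \<sigma> \<gamma> \<theta> where "chart_bracket M c \<epsilon> \<sigma> \<gamma> \<theta>" "brk_at c \<sigma> \<gamma> \<theta>"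
proof -
  interpret chart_domain M c by unfold_locales (rule c)
  obtain D2 D1 A1 A0 B0 where co: "lop_coeffs \<epsilon> D2 D1 A1 A0 B0" and P: "!!w f. f \<in> densities M w ==> P w f c = lop D2 D1 A1 A0 B0 w (f c)"
    by (rule P_lop[OF c]) (rule that)
  interpret bracket_matrix n "im c (dom M c)" m \<epsilon> "\<lambda>a b. D2 a b + (-1) ^ (spar n a * spar n b) *\<^sub>S D2 b a" A1 "2 *\<^sub>S B0"
    by (rule lop_coeffs_bracket_matrix[OF co])
  show ?thesis
  proof (rule that)
    show "chart_bracket M c \<epsilon> (\<lambda>a b. D2 a b + (-1) ^ (spar n a * spar n b) *\<^sub>S D2 b a) A1 (2 *\<^sub>S B0)" by unfold_locales
    show "brk_at c (\<lambda>a b. D2 a b + (-1) ^ (spar n a * spar n b) *\<^sub>S D2 b a) A1 (2 *\<^sub>S B0)"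
      unfolding brk_at_def
    proof (intro allI impI)
    fix u p f w g assume f: "f \<in> densities M u" "\<forall>e. sparity p (f e)" and g: "g \<in> densities M w"
    have "lop D2 D1 A1 A0 B0 (u + w) (f c * g c) = lop D2 D1 A1 A0 B0 u (f c) * g c + (-1) ^ (\<epsilon> * p) *\<^sub>S (f c * lop D2 D1 A1 A0 B0 w (g c)) +
      bracket u p (f c) w (g c)"
      by (rule lop_mult) (use co density_S[OF f(1)] density_S[OF g] f(2) in \<open>auto simp: lop_coeffs_def\<close>)
    then show "dbr u p f w g c = bracket u p (f c) w (g c)"
      using P[OF density_mult[OF f(1) g]] P[OF f(1)] P[OF g]
      by (simp add: dbr_def minus_apply[of "_ - _"] minus_apply[of "P _ _"] times_fun_apply[of f g] times_fun_apply[of "P u f" g])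
    qed
  qed
qed

lemma density_eqI: "f \<in> densities M w ==> g \<in> densities M w ==> (!!c. c \<in> charts M ==> f c = g c) ==> f = g"
  by (metis density_outside ext)

lemma dbr_symmetric:
  assumes f: "f \<in> densities M u" "!!e. sparity p (f e)" and g: "g \<in> densities M w" "!!e. sparity r (g e)"
  shows "dbr u p f w g = (\<lambda>c. (-1) ^ (p * r) *\<^sub>S dbr w r g u f c)"
proof (rule density_eqI[OF dbr_dens[OF f(1) g(1)]])
  show "(\<lambda>c. (-1) ^ (p * r) *\<^sub>S dbr w r g u f c) \<in> densities M (u + w)"
    using density_sscale[OF dbr_dens[OF g(1) f(1)]] by (simp add: add.commute)
  fix c assume c: "c \<in> charts M"
  obtain \<sigma> \<gamma> \<theta> where C: "chart_bracket M c \<epsilon> \<sigma> \<gamma> \<theta>" and b: "brk_at c \<sigma> \<gamma> \<theta>" by (rule dbr_local[OF c]) (rule that)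
  interpret chart_bracket M c \<epsilon> \<sigma> \<gamma> \<theta> by (rule C)
  show "dbr u p f w g c = (-1) ^ (p * r) *\<^sub>S dbr w r g u f c"
    unfolding brk_atD[OF b f g(1)] brk_atD[OF b g f(1)] by (rule bracket_symmetric[OF density_S[OF f(1)] f(2) density_S[OF g(1)] g(2)])
qed

lemma dbr_mult:
  assumes f: "f \<in> densities M u" "!!e. sparity p (f e)" and g: "g \<in> densities M w" "!!e. sparity r (g e)" and h: "h \<in> densities M v"
  shows "dbr u p f (w + v) (g * h) = dbr u p f w g * h + (\<lambda>c. (-1) ^ ((\<epsilon> + p) * r) *\<^sub>S (g * dbr u p f v h) c)"
proof (rule density_eqI[OF dbr_dens[OF f(1) density_mult[OF g(1) h]]])
  show "dbr u p f w g * h + (\<lambda>c. (-1) ^ ((\<epsilon> + p) * r) *\<^sub>S (g * dbr u p f v h) c) \<in> densities M (u + (w + v))"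
    using density_mult[OF dbr_dens[OF f(1) g(1)] h] density_sscale[OF density_mult[OF g(1) dbr_dens[OF f(1) h]]]
    by (intro density_add) (simp_all add: add_ac)
  fix c assume c: "c \<in> charts M"
  obtain \<sigma> \<gamma> \<theta> where C: "chart_bracket M c \<epsilon> \<sigma> \<gamma> \<theta>" and b: "brk_at c \<sigma> \<gamma> \<theta>" by (rule dbr_local[OF c]) (rule that)
  interpret chart_bracket M c \<epsilon> \<sigma> \<gamma> \<theta> by (rule C)
  show "dbr u p f (w + v) (g * h) c = (dbr u p f w g * h + (\<lambda>c. (-1) ^ ((\<epsilon> + p) * r) *\<^sub>S (g * dbr u p f v h) c)) c"
    unfolding plus_fun_apply[of "dbr u p f w g * h"] times_fun_apply[of g] times_fun_apply[of "dbr u p f w g"] brk_atD[OF b f density_mult[OF g(1) h]] brk_atD[OF b f g(1)] brk_atD[OF b f h]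
    by (rule bracket_mult[OF density_S[OF f(1)] f(2) density_S[OF g(1)] g(2) density_S[OF h]])
qed

lemma dbr_parity:
  assumes f: "f \<in> densities M u" "!!e. sparity p (f e)" and g: "g \<in> densities M w" "!!e. sparity r (g e)"
  shows "sparity (\<epsilon> + p + r) (dbr u p f w g c)"
proof (cases "c \<in> charts M")
  case True
  obtain \<sigma> \<gamma> \<theta> where C: "chart_bracket M c \<epsilon> \<sigma> \<gamma> \<theta>" and b: "brk_at c \<sigma> \<gamma> \<theta>" by (rule dbr_local[OF True]) (rule that)
  interpret chart_bracket M c \<epsilon> \<sigma> \<gamma> \<theta> by (rule C)
  show ?thesis unfolding brk_atD[OF b f g(1)] by (rule bracket_parity[OF density_S[OF f(1)] f(2) g(2)])
qed (simp add: density_outside[OF dbr_dens[OF f(1) g(1)]])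

lemma gbr_parity:
  assumes "\<psi> \<in> DA" "density_parity p \<psi>" "\<phi> \<in> DA" "density_parity q \<phi>"
  shows "density_parity (\<epsilon> + p + q) (gbr \<psi> \<phi>)"
  using assms(1,2)
proof (induction \<psi> rule: DA_parity_induct)
  case f: (single u f)
  from assms(3,4) show ?case
  proof (induction \<phi> rule: DA_parity_induct)
    case (single w g)
    then show ?case using dbr_parity[OF f] by (simp add: gbr_single[OF f] density_parity_single)
  qed (simp add: gbr_add DA_single f density_parity_add)
qed (simp add: gbr_add assms density_parity_add)

lemma gbr_symmetric:
  assumes "\<psi> \<in> DA" "density_parity p \<psi>" "\<phi> \<in> DA" "density_parity q \<phi>"
  shows "gbr \<psi> \<phi> = (-1) ^ (p * q) * gbr \<phi> \<psi>"
  using assms(1,2)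
proof (induction \<psi> rule: DA_parity_induct)
  case f: (single u f)
  from assms(3,4) show ?case
  proof (induction \<phi> rule: DA_parity_induct)
    case (single w g)
    show ?case
      unfolding gbr_single[OF f single(1)] gbr_single[OF single f(1)] sign_poly_mapping density_scale_single
        dbr_symmetric[OF f single] by (simp add: add.commute)
  qed (simp add: gbr_add DA_single f distrib_left)
qed (simp add: gbr_add assms distrib_left)

lemma gbr_mult:
  assumes "\<psi> \<in> DA" "density_parity p \<psi>" "\<phi> \<in> DA" "density_parity q \<phi>" "\<omega> \<in> DA"
  shows "gbr \<psi> (\<phi> * \<omega>) = gbr \<psi> \<phi> * \<omega> + (-1) ^ ((\<epsilon> + p) * q) * (\<phi> * gbr \<psi> \<omega>)"
  using assms(1,2)
proof (induction \<psi> rule: DA_parity_induct)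
  case f: (single u f)
  from assms(3,4) show ?case
  proof (induction \<phi> rule: DA_parity_induct)
    case g: (single w g)
    from assms(5) show ?case
    proof (induction \<omega> rule: DA_induct)
      case (single v h r)
      show ?case
        unfolding mult_single gbr_single[OF f density_mult[OF g(1) single(1)]] gbr_single[OF f g(1)] gbr_single[OF f single(1)]
          dbr_mult[OF f g single(1)] sign_poly_mapping density_scale_single single_add
        by (simp add: add_ac)
    next
      case (add \<psi> \<phi>)
      then show ?case using f g by (simp add: distrib_left gbr_add DA_single DA_mult add_ac)
    qed
  next
    case (add \<psi> \<phi>)
    then show ?case using f assms(5) by (simp add: distrib_left distrib_right gbr_add DA_single DA_mult add_ac)
  qed
next
  case (add \<psi> \<phi>')
  then show ?case using assms by (simp add: distrib_left distrib_right gbr_add DA_mult add_ac)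
qed

lemma gbr_scale:
  assumes "\<psi> \<in> DA" "\<phi> \<in> DA"
  shows "gbr (density_scale r \<psi>) \<phi> = density_scale r (gbr \<psi> \<phi>) \<and> gbr \<psi> (density_scale r \<phi>) = density_scale r (gbr \<psi> \<phi>)"
  using assms(1)
proof (induction \<psi> rule: DA_induct)
  case f: (single u f p)
  from assms(2) show ?case
  proof (induction \<phi> rule: DA_induct)
    case (single w g q)
    have rf: "(\<lambda>c. r *\<^sub>S f c) \<in> densities M u" "!!e. sparity p (r *\<^sub>S f e)" and rg: "(\<lambda>c. r *\<^sub>S g c) \<in> densities M w"
      using f single by (auto intro: density_sscale sparity_scale)
    have "(\<lambda>c. r *\<^sub>S f c) * g = (\<lambda>c. r *\<^sub>S (f * g) c)" "f * (\<lambda>c. r *\<^sub>S g c) = (\<lambda>c. r *\<^sub>S (f * g) c)"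
      "(\<lambda>c. r *\<^sub>S P u f c) * g = (\<lambda>c. r *\<^sub>S (P u f * g) c)" "P u f * (\<lambda>c. r *\<^sub>S g c) = (\<lambda>c. r *\<^sub>S (P u f * g) c)"
      by (intro ext, simp add: sfun_apply)+
    note e = this
    have "dbr u p (\<lambda>c. r *\<^sub>S f c) w g = (\<lambda>c. r *\<^sub>S dbr u p f w g c)" "dbr u p f w (\<lambda>c. r *\<^sub>S g c) = (\<lambda>c. r *\<^sub>S dbr u p f w g c)"
      unfolding dbr_def e P_scale[OF f(1)] P_scale[OF single(1)] P_scale[OF density_mult[OF f(1) single(1)]]
      by (intro ext, simp add: sfun_apply scaleR_right_diff_distrib mult.commute)+
    then show ?case
      by (simp add: density_scale_single gbr_single[OF rf] gbr_single[OF f] single rg)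
  qed (simp add: density_scale_add gbr_add DA_single f DA_scale density_sscale density_scale_single)
qed (simp add: density_scale_add gbr_add assms DA_scale)

lemma gbr_matrix:
  assumes c: "c \<in> charts M" shows "\<exists>\<sigma> \<gamma> \<theta>. has_bracket_matrix M \<epsilon> gbr c \<sigma> \<gamma> \<theta>"
proof -
  obtain \<sigma> \<gamma> \<theta> where C: "chart_bracket M c \<epsilon> \<sigma> \<gamma> \<theta>" and b: "brk_at c \<sigma> \<gamma> \<theta>" by (rule dbr_local[OF c]) (rule that)
  interpret chart_bracket M c \<epsilon> \<sigma> \<gamma> \<theta> by (rule C)
  have "has_bracket_matrix M \<epsilon> gbr c \<sigma> \<gamma> \<theta>"
  proof (rule has_bracket_matrixI)
    fix u f p w g r assume f: "f \<in> densities M u" "!!e. sparity p (f e)" and g: "g \<in> densities M w"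
    show "local_rep c (gbr (single u f) (single w g)) = single (u + w) (bracket u p (f c) w (g c))"
      by (simp add: gbr_single[OF f g] local_rep_single brk_atD[OF b f g])
  qed (simp_all add: gbr_add)
  then show ?thesis by blast
qed

lemma gbr_keys:
  assumes f: "f \<in> densities M u" and g: "g \<in> densities M w"
  shows "Poly_Mapping.keys (gbr (single u f) (single w g)) \<subseteq> {u + w}"
proof -
  have "gbr (single u f) (single w g) =
      single (u + w) (P (u + w) (f * g) - P u f * g - (\<lambda>c x. gsign \<epsilon> (f c x)) * P w g)"
    by (simp add: gbr_apply DA_single f g mult_single oper_single density_mult density_sign_single single_diff)
  then show ?thesis by simp
qed

lemma gbr_brackets: "gbr \<in> brackets M \<epsilon>"
  unfolding brackets_def
proof (intro CollectI conjI allI ballI impI)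
  show "gbr \<in> DA \<rightarrow>\<^sub>E DA \<rightarrow>\<^sub>E DA"
    using gbr_DA by (auto simp: generated_bracket_def intro!: PiE_I)
qed (auto simp: gbr_add gbr_scale gbr_parity gbr_symmetric[symmetric] gbr_mult gbr_matrix intro: gbr_symmetric dest: subsetD[OF gbr_keys])

end

section \<open>Self-adjointness\<close>

context density_operator
begin

lemma P_locality:
  assumes c: "c \<in> charts M" and W: "opn W" "W \<subseteq> dom M c" and f: "f \<in> densities M w" and g: "g \<in> densities M w"
    and eq: "!!x. x \<in> im c W ==> f c x = g c x" and x: "x \<in> im c W"
  shows "P w f c x = P w g c x"
proof -
  interpret chart_domain M c by unfold_locales (rule c)
  show ?thesis
    by (rule P_lop[OF c]) (simp add: f g lop_local[OF im_open[OF c W] image_mono[OF W(2)] eq x])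
qed

lemma P_csupp:
  assumes c: "c \<in> charts M" and f: "f \<in> densities M w" and s: "superdomain.csupp n (im c (dom M c)) m (f c)"
  shows "superdomain.csupp n (im c (dom M c)) m (P w f c)"
proof -
  interpret chart_domain M c by unfold_locales (rule c)
  show ?thesis by (rule P_lop[OF c]) (simp add: f s lop_csupp)
qed

lemma adjointD:
  assumes "is_adjoint M \<epsilon> w (P w) (P (1 - w))" "c \<in> charts M" "f \<in> densities M w" "!!e. sparity p (f e)"
    "compact_support_in M c f" "g \<in> densities M (1 - w)"
  shows "sintegral n m (P w f c * g c) = (-1) ^ (\<epsilon> * p) * sintegral n m (f c * P (1 - w) g c)"
  using assms unfolding is_adjoint_def density_parity_single scalar_product_single by blast

text \<open>Since \<open>P 1\<close> is adjoint to \<open>P 0\<close>, which kills the unit, its values have integral zero.\<close>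

lemma integral_eq_0:
  assumes sa: "!!w. is_adjoint M \<epsilon> w (P w) (P (1 - w))" and c: "c \<in> charts M"
    and f: "f \<in> densities M 1" "!!e. sparity p (f e)" "compact_support_in M c f"
  shows "sintegral n m (P 1 f c) = 0"
proof -
  interpret chart_domain M c by unfold_locales (rule c)
  let ?o = "\<lambda>c. if c \<in> charts M then srestrict (codom M c) 1 else 0"
  have o: "?o \<in> densities M (1 - 1)" using density_one_density by simp
  have "P (1 - 1) ?o = 0" using P_one by simp
  then have "sintegral n m (P 1 f c * ?o c) = 0"
    using adjointD[OF sa c f o] by (simp add: zero_fun_apply)
  moreover have "P 1 f c * ?o c = P 1 f c"
    using c S_one_mult(2)[OF density_S[OF P_dens[OF f(1)]]] by (simp add: codom_def)
  ultimately show ?thesis by simp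
qed

text \<open>The integral of P 1 (f g) is zero, and by adjointness the remaining two terms of
  \<open>dbr\<close> have equal integrals. The factor 2 here is the reason for the 1/2 in the
  canonical pencil.\<close>

lemma product_integral:
  assumes sa: "!!w. is_adjoint M \<epsilon> w (P w) (P (1 - w))" and c: "c \<in> charts M"
    and f: "f \<in> densities M w" "!!e. sparity p (f e)" "compact_support_in M c f"
    and g: "g \<in> densities M (1 - w)" "!!e. sparity r (g e)"
  shows "2 * sintegral n m (P w f c * g c) = - sintegral n m (dbr w p f (1 - w) g c)"
proof -
  interpret chart_domain M c by unfold_locales (rule c)
  let ?s = "(-1 :: real) ^ (\<epsilon> * p)"
  have fg: "f * g \<in> densities M 1" using density_mult[OF f(1) g(1)] by simp
  have fgc: "(f * g) c = f c * g c" by (rule times_fun_apply)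
  have z: "compact_support_in M c (f * g)"
    using f(3) unfolding compact_support_in_def by (auto simp: sfun_apply)
  have i0: "sintegral n m (P 1 (f * g) c) = 0"
    by (rule integral_eq_0[OF sa c fg _ z, of "p + r"]) (simp add: times_fun_apply[of f g] sparity_mult f g)
  have fs: "csupp (f c)" by (rule csupp_density[OF c f(1,3)])
  have c1: "csupp (P 1 (f * g) c)"
    by (rule P_csupp[OF c fg]) (simp add: fgc csupp_mult[OF fs density_S[OF g(1)]])
  have c2: "csupp (P w f c * g c)" by (rule csupp_mult[OF P_csupp[OF c f(1) fs] density_S[OF g(1)]])
  have c3: "csupp (?s *\<^sub>S (f c * P (1 - w) g c))"
    by (intro csupp_scale csupp_mult[OF fs] density_S[OF P_dens[OF g(1)]])
  have e: "dbr w p f (1 - w) g c = P 1 (f * g) c + ((- 1) *\<^sub>S (P w f c * g c) + (- 1) *\<^sub>S (?s *\<^sub>S (f c * P (1 - w) g c)))"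
    by (rule ext) (simp add: dbr_def sfun_apply)
  have "sintegral n m (dbr w p f (1 - w) g c) = - sintegral n m (P w f c * g c) - sintegral n m (?s *\<^sub>S (f c * P (1 - w) g c))"
    unfolding e by (simp only: sintegral_add csupp_add csupp_scale c1 c2 c3 sintegral_scale i0)
  also have "sintegral n m (?s *\<^sub>S (f c * P (1 - w) g c)) = sintegral n m (P w f c * g c)"
    unfolding adjointD[OF sa c f g(1)] by (rule sintegral_scale)
  finally show ?thesis by simp
qed

end

context supermfd
begin

text \<open>For f with compact support in a chart, \<open>product_integral\<close> and
  \<open>fundamental_lemma\<close> recover P f from the bracket. In general f is replaced near a
  given point by a cut-off copy, which changes neither value there since both operators are
  local.\<close>

lemma self_adjoint_operators_eq:
  assumes PQ: "density_operator M \<epsilon> P" "density_operator M \<epsilon> Q"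
    and sa: "!!w. is_adjoint M \<epsilon> w (P w) (P (1 - w))" "!!w. is_adjoint M \<epsilon> w (Q w) (Q (1 - w))"
    and br: "generated_bracket M \<epsilon> (density_operator.oper M P) = generated_bracket M \<epsilon> (density_operator.oper M Q)"
    and f: "f \<in> densities M w"
  shows "P w f = Q w f"
proof -
  interpret P: density_operator M \<epsilon> P by fact
  interpret Q: density_operator M \<epsilon> Q by fact
  have dbr: "P.dbr u p f w g = Q.dbr u p f w g" if "f \<in> densities M u" "!!e. sparity p (f e)" "g \<in> densities M w" for u p f w g
    using arg_cong[OF fun_cong[OF fun_cong[OF br, of "single u f"], of "single w g"], of "\<lambda>F. lookup F (u + w)"]
    by (simp add: P.gbr_single[OF that] Q.gbr_single[OF that])
  have compact: "P w f c = Q w f c"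
    if c: "c \<in> charts M" and f: "f \<in> densities M w" "!!e. sparity p (f e)" "compact_support_in M c f" for c f w p
  proof -
    interpret chart_domain M c by unfold_locales (rule c)
    have fs: "csupp (f c)" by (rule csupp_density[OF c f(1,3)])
    have "P w f c - Q w f c = 0"
    proof (rule fundamental_lemma[OF c, where w = "1 - w"])
      show "P w f c - Q w f c \<in> S" by (rule S_diff[OF density_S[OF P.P_dens[OF f(1)]] density_S[OF Q.P_dens[OF f(1)]]])
      fix g q assume g: "g \<in> densities M (1 - w)" "!!e. sparity q (g e)"
      have i: "sintegral n m (P w f c * g c) = sintegral n m (Q w f c * g c)"
        using P.product_integral[OF sa(1) c f g] Q.product_integral[OF sa(2) c f g] dbr[OF f(1,2) g(1)] by simp
      have "(P w f c - Q w f c) * g c = P w f c * g c + (- 1) *\<^sub>S (Q w f c * g c)"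
        by (rule ext) (simp add: sfun_apply left_diff_distrib)
      then show "sintegral n m ((P w f c - Q w f c) * g c) = 0"
        using csupp_mult[OF P.P_csupp[OF c f(1) fs] density_S[OF g(1)]] csupp_mult[OF Q.P_csupp[OF c f(1) fs] density_S[OF g(1)]]
        by (simp add: sintegral_add csupp_scale sintegral_scale i)
    qed
    then show ?thesis by simp
  qed
  have hom: "P w f = Q w f" if f: "f \<in> densities M w" "!!e. sparity p (f e)" for f p
  proof (rule P.density_eqI[OF P.P_dens[OF f(1)] Q.P_dens[OF f(1)]])
    fix c assume c: "c \<in> charts M"
    interpret chart_domain M c by unfold_locales (rule c)
    show "P w f c = Q w f c"
    proof (rule ext)
      fix x
      show "P w f c x = Q w f c x"
      proof (cases "x \<in> im c (dom M c)")
        case True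
        then obtain z where z: "z \<in> dom M c" "x = crd M c z" by blast
        obtain \<beta> W where W: "opn W" "z \<in> W" "W \<subseteq> dom M c \<inter> dom M c" and \<beta>: "!!x. x \<in> im c W ==> \<beta> x = 1"
          and ex: "!!w h. h \<in> Sec c (dom M c) ==> \<exists>\<phi>. \<phi> \<in> densities M w \<and> \<phi> c = (\<lambda>x. \<beta> x *\<^sub>R h x) \<and> compact_support_in M c \<phi> \<and>
            (\<forall>q. sparity q h \<longrightarrow> (\<forall>e. sparity q (\<phi> e)))"
          by (rule local_density[OF c z(1) dom_open[OF c] z(1)]) (rule that)
        obtain \<phi> where \<phi>: "\<phi> \<in> densities M w" "\<phi> c = (\<lambda>x. \<beta> x *\<^sub>R f c x)" "compact_support_in M c \<phi>" "!!e. sparity p (\<phi> e)"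
          using ex[OF density_S[OF f(1)], of w] f(2) by blast
        have Wc: "W \<subseteq> dom M c" using W(3) by simp
        have eq: "f c y = \<phi> c y" if "y \<in> im c W" for y using \<beta>[OF that] by (simp add: \<phi>(2))
        have xW: "x \<in> im c W" using z W(2) by blast
        have "P w f c x = P w \<phi> c x" by (rule P.P_locality[OF c W(1) Wc f(1) \<phi>(1) eq xW])
        also have "\<dots> = Q w \<phi> c x" using compact[OF c \<phi>(1,4,3)] by simp
        also have "\<dots> = Q w f c x" by (rule Q.P_locality[OF c W(1) Wc f(1) \<phi>(1) eq xW, symmetric])
        finally show ?thesis .
      qed (simp add: S_outside[OF density_S[OF P.P_dens[OF f(1)]]] S_outside[OF density_S[OF Q.P_dens[OF f(1)]]])
    qed
  qed
  have s: "f = (\<lambda>c. spart 0 (f c)) + (\<lambda>c. spart 1 (f c))"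
    by (rule ext) (simp only: plus_fun_apply, rule spart_sum)
  show ?thesis
    by (subst (1 2) s) (simp only: P.P_add Q.P_add density_spart f hom[OF density_spart[OF f] sparity_spart])
qed

section \<open>Operators as families\<close>

text \<open>Three gaps are closed: the local formula shows that weights are not mixed, the parity of
  \<Delta> allows the coefficients to be projected to the right parity, and \<Delta> 1 = 0 removes
  the projected \<open>D0\<close>.\<close>

lemma second_order_operator:
  assumes \<Delta>: "\<Delta> \<in> second_order_operators M \<epsilon>" and one: "\<Delta> (density_one M) = 0"
  shows "density_operator M \<epsilon> (pencil \<Delta>)" "density_operator.oper M (pencil \<Delta>) = \<Delta>"
proof -
  have DA: "\<Delta> \<in> DA \<rightarrow>\<^sub>E DA" and par: "!!p \<psi>. \<psi> \<in> DA ==> density_parity p \<psi> ==> density_parity (\<epsilon> + p) (\<Delta> \<psi>)"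
    using \<Delta> by (auto simp: second_order_operators_def)
  have dens: "pencil \<Delta> w f \<in> densities M w" if "f \<in> densities M w" for w f
    unfolding pencil_def by (intro DA_lookup PiE_mem[OF DA] DA_single that)
  have loc: "\<exists>D2 D1 D0 A1 A0 B0. (\<forall>a<n + m. \<forall>b<n + m. D2 a b \<in> Sec c (dom M c)) \<and> (\<forall>a<n + m. D1 a \<in> Sec c (dom M c) \<and> A1 a \<in> Sec c (dom M c)) \<and>
      D0 \<in> Sec c (dom M c) \<and> A0 \<in> Sec c (dom M c) \<and> B0 \<in> Sec c (dom M c) \<and>
      (\<forall>\<psi>\<in>DA. \<forall>w. lookup (\<Delta> \<psi>) w c =
        superdomain.lop n (im c (dom M c)) m D2 D1 A1 A0 B0 w (lookup \<psi> w c) + D0 * lookup \<psi> w c)"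
    if c: "c \<in> charts M" for c
  proof -
    interpret chart_domain M c by unfold_locales (rule c)
    show ?thesis
      using \<Delta> c unfolding second_order_operators_def coords_eq sections_def Let_def mem_Collect_eq
      apply (elim conjE)
      apply (drule bspec, assumption)
      apply (elim exE)
      subgoal for D2 D1 D0 A1 A0 B0
        by (rule exI[of _ D2], rule exI[of _ D1], rule exI[of _ D0], rule exI[of _ A1], rule exI[of _ A0], rule exI[of _ B0])
          (simp add: cderiv_eq lop_def vf_def add_ac)
      done
  qed
  \<comment> \<open>The local formula gives the component of weight w in terms of that component of
    the argument alone, so it may be computed on a single weight.\<close>
  have lk: "lookup (\<Delta> \<psi>) w = pencil \<Delta> w (lookup \<psi> w)" if \<psi>: "\<psi> \<in> DA" for \<psi> w
  proof (rule ext)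
    fix c
    have s: "single w (lookup \<psi> w) \<in> DA" by (rule DA_single[OF DA_lookup[OF \<psi>]])
    show "lookup (\<Delta> \<psi>) w c = pencil \<Delta> w (lookup \<psi> w) c"
    proof (cases "c \<in> charts M")
      case True
      then show ?thesis using loc[OF True] \<psi> s unfolding pencil_def by (metis lookup_single_eq)
    next
      case False
      then show ?thesis
        using density_outside[OF DA_lookup[OF PiE_mem[OF DA \<psi>]] False] density_outside[OF dens[OF DA_lookup[OF \<psi>]] False] by simp
    qed
  qed
  show op: "density_operator M \<epsilon> (pencil \<Delta>)"
  proof unfold_locales
    fix c assume c: "c \<in> charts M"
    interpret chart_domain M c by unfold_locales (rule c)
    obtain D2 D1 D0 A1 A0 B0 where D': "\<forall>a<n + m. \<forall>b<n + m. D2 a b \<in> S" "\<forall>a<n + m. D1 a \<in> S \<and> A1 a \<in> S"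
      "D0 \<in> S" "A0 \<in> S" "B0 \<in> S" and form: "\<forall>\<psi>\<in>DA. \<forall>w. lookup (\<Delta> \<psi>) w c =
        lop D2 D1 A1 A0 B0 w (lookup \<psi> w c) + D0 * lookup \<psi> w c"
      using loc[OF c] by (elim exE conjE) (rule that)
    have D: "D2 a b \<in> S" if "a < n + m" "b < n + m" for a b using D'(1) that by simp
    have D1: "D1 a \<in> S \<and> A1 a \<in> S" if "a < n + m" for a using D'(2) that by simp
    have form: "pencil \<Delta> w f c = lop D2 D1 A1 A0 B0 w (f c) + D0 * f c" if "f \<in> densities M w" for w f
      using bspec[OF form DA_single[OF that], THEN spec, of w] by (simp add: pencil_def)
    let ?l = "lop (\<lambda>a b. spart (\<epsilon> + spar n a + spar n b) (D2 a b)) (\<lambda>a. spart (\<epsilon> + spar n a) (D1 a))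
      (\<lambda>a. spart (\<epsilon> + spar n a) (A1 a)) (spart \<epsilon> A0) (spart \<epsilon> B0)"
    have hom: "pencil \<Delta> w f c = ?l w (f c) + spart \<epsilon> D0 * f c" if f: "f \<in> densities M w" "!!e. sparity p (f e)" for w f p
    proof -
      have "density_parity (\<epsilon> + p) (\<Delta> (single w f))"
        by (rule par[OF DA_single[OF f(1)]]) (simp add: density_parity_single f(2))
      then have "sparity (\<epsilon> + p) (pencil \<Delta> w f c)" by (simp add: density_parity_def pencil_def)
      then have "pencil \<Delta> w f c = spart (\<epsilon> + p) (pencil \<Delta> w f c)" by (simp add: spart_same)
      also have "\<dots> = ?l w (f c) + spart (\<epsilon> + p) (D0 * f c)" unfolding form[OF f(1)] spart_add lop_spart[OF f(2)] ..
      also have "spart (\<epsilon> + p) (D0 * f c) = spart \<epsilon> D0 * f c"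
        by (subst spart_mult_right[OF f(2)], subst spart_cong) auto
      finally show ?thesis .
    qed
    let ?o = "\<lambda>c. if c \<in> charts M then srestrict (codom M c) 1 else 0"
    \<comment> \<open>On the unit at weight 0 only the zero order term survives.\<close>
    have "pencil \<Delta> 0 ?o = 0" using one by (simp add: pencil_def density_one_def)
    moreover have "pencil \<Delta> 0 ?o c = ?l 0 (?o c) + spart \<epsilon> D0 * ?o c"
      by (rule hom[OF density_one_density, of 0]) (simp add: sparity_one)
    ultimately have z: "spart \<epsilon> D0 = 0"
      using c S_one_mult(2)[OF S_part[OF D'(3)]] by (simp add: codom_def lop_one zero_fun_apply)
    have co: "lop_coeffs \<epsilon> (\<lambda>a b. spart (\<epsilon> + spar n a + spar n b) (D2 a b)) (\<lambda>a. spart (\<epsilon> + spar n a) (D1 a))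
      (\<lambda>a. spart (\<epsilon> + spar n a) (A1 a)) (spart \<epsilon> A0) (spart \<epsilon> B0)"
      by (rule lop_coeffs_spart) (use D D1 D'(4,5) in auto)
    have fin: "pencil \<Delta> w f c = ?l w (f c)" if f: "f \<in> densities M w" for w f
    proof -
      have s: "f c = spart 0 (f c) + spart 1 (f c)" by (rule spart_sum)
      \<comment> \<open>On each parity component the original and the projected coefficients give
        the same value, and the components are then added.\<close>
      have h: "lop D2 D1 A1 A0 B0 w (spart q (f c)) + D0 * spart q (f c) = ?l w (spart q (f c))" for q
        using hom[OF density_spart[OF f] sparity_spart, of q] form[OF density_spart[OF f], of q] by (simp add: z)
      have "pencil \<Delta> w f c = lop D2 D1 A1 A0 B0 w (spart 0 (f c) + spart 1 (f c)) + D0 * (spart 0 (f c) + spart 1 (f c))"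
        unfolding s[symmetric] by (rule form[OF f])
      also have "\<dots> = (lop D2 D1 A1 A0 B0 w (spart 0 (f c)) + D0 * spart 0 (f c)) + (lop D2 D1 A1 A0 B0 w (spart 1 (f c)) + D0 * spart 1 (f c))"
        unfolding lop_add[OF S_part[OF density_S[OF f]] S_part[OF density_S[OF f]]] by (simp add: distrib_left add_ac)
      also have "\<dots> = ?l w (spart 0 (f c) + spart 1 (f c))"
        unfolding h lop_add[OF S_part[OF density_S[OF f]] S_part[OF density_S[OF f]]] ..
      finally show ?thesis unfolding s[symmetric] .
    qed
    show "\<exists>D2 D1 A1 A0 B0. lop_coeffs \<epsilon> D2 D1 A1 A0 B0 \<and> (\<forall>w. \<forall>f\<in>densities M w. pencil \<Delta> w f c = lop D2 D1 A1 A0 B0 w (f c))"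
      by (rule exI, rule exI, rule exI, rule exI, rule exI, rule conjI[OF co]) (intro allI ballI fin)
  qed (rule dens)
  interpret density_operator M \<epsilon> "pencil \<Delta>" by (rule op)
  show "oper = \<Delta>"
  proof (rule PiE_ext)
    show "oper \<in> DA \<rightarrow>\<^sub>E DA" using oper_second_order by (simp add: second_order_operators_def)
    show "\<Delta> \<in> DA \<rightarrow>\<^sub>E DA" by (rule DA)
    show "oper \<psi> = \<Delta> \<psi>" if "\<psi> \<in> DA" for \<psi>
      by (rule poly_mapping_eqI) (simp add: lookup_oper lk that)
  qed
qed

lemma vf_restrict:
  assumes "c \<in> charts M" "opn W" "W \<subseteq> dom M c"
  shows "rs c W (superdomain.vf n (im c (dom M c)) m Z f) = superdomain.vf n (im c W) m (\<lambda>a. rs c W (Z a)) (rs c W f)"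
  unfolding superdomain.vf_def[OF superdomain_im[OF assms(1) dom_open[OF assms(1)] order_refl]] superdomain.vf_def[OF superdomain_im[OF assms]]
  by (simp add: srestrict_sum sections_restrict(2)[OF assms(1) dom_open[OF assms(1)] assms(2,3) order_refl])

end

section \<open>The canonical pencil\<close>

locale canonical_operator = supermfd M for M :: "('p, 'c) superatlas" +
  fixes \<epsilon> B \<sigma> \<gamma> \<theta>
  assumes B: "B \<in> brackets M \<epsilon>"
    and matrix: "!!c. c \<in> charts M ==> has_bracket_matrix M \<epsilon> B c (\<sigma> c) (\<gamma> c) (\<theta> c)"
begin

lemma chart_bracket: "c \<in> charts M ==> chart_bracket M c \<epsilon> (\<sigma> c) (\<gamma> c) (\<theta> c)"
  by (rule chart_domain.has_bracket_matrixD(1)[OF _ matrix]) unfold_locales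

definition can_op :: "real => ('c => sfun) => ('c => sfun)" where
  "can_op w f = (\<lambda>c. if c \<in> charts M then canonical_pencil M \<epsilon> c (\<sigma> c) (\<gamma> c) (\<theta> c) w (f c) else 0)"

definition bfam :: "real => ('c => sfun) => real => ('c => sfun) => 'c => sfun" where
  "bfam u f w g = lookup (B (single u f) (single w g)) (u + w)"

lemma B_DA: "\<psi> \<in> DA ==> \<phi> \<in> DA ==> B \<psi> \<phi> \<in> DA"
proof -
  assume \<psi>: "\<psi> \<in> DA" and \<phi>: "\<phi> \<in> DA"
  have "B \<in> DA \<rightarrow>\<^sub>E DA \<rightarrow>\<^sub>E DA" using B by (simp add: brackets_def)
  from PiE_mem[OF PiE_mem[OF this \<psi>] \<phi>] show ?thesis .
qed

lemma bfam_dens: "f \<in> densities M u ==> g \<in> densities M w ==> bfam u f w g \<in> densities M (u + w)"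
  unfolding bfam_def by (intro DA_lookup B_DA DA_single)

lemma bfam_local:
  assumes c: "c \<in> charts M" and f: "f \<in> densities M u" "!!e. sparity p (f e)" and g: "g \<in> densities M w"
  shows "bfam u f w g c = superdomain.brk n (im c (dom M c)) m \<epsilon> (\<sigma> c) (\<gamma> c) (\<theta> c) u p (f c) w (g c)"
proof -
  interpret chart_domain M c by unfold_locales (rule c)
  show ?thesis
    using arg_cong[OF has_bracket_matrixD(2)[OF matrix[OF c] f g], of "\<lambda>F. lookup F (u + w)"]
    by (simp add: bfam_def lookup_local_rep)
qed

lemma B_single:
  assumes f: "f \<in> densities M u" and g: "g \<in> densities M w"
  shows "B (single u f) (single w g) = single (u + w) (bfam u f w g)"
proof (rule poly_mapping_eqI)
  fix k
  have "Poly_Mapping.keys (B (single u f) (single w g)) \<subseteq> {u + w}"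
    using B f g unfolding brackets_def by blast
  then show "lookup (B (single u f) (single w g)) k = lookup (single (u + w) (bfam u f w g)) k"
    by (auto simp: lookup_single when_def bfam_def in_keys_iff)
qed

text \<open>That brackets of densities are densities is tested on enough arguments to verify the
  hypotheses of \<open>div_transform\<close> for the field X_f + \<lambda>_f t \<partial>_t in the
  two charts.\<close>

lemma can_op_transform:
  assumes f: "f \<in> densities M w" "!!e. sparity p (f e)" and c: "c \<in> charts M" and d: "d \<in> charts M" and z: "z \<in> ovl c d"
  shows "\<exists>W. opn W \<and> z \<in> W \<and> W \<subseteq> ovl c d \<and> rs c W (can_op w f c) = T c d W (rs d W (can_op w f d)) * chart_change.Jw M c d W w"
proof -
  interpret Cb: chart_bracket M c \<epsilon> "\<sigma> c" "\<gamma> c" "\<theta> c" by (rule chart_bracket[OF c])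
  interpret Db: chart_bracket M d \<epsilon> "\<sigma> d" "\<gamma> d" "\<theta> d" by (rule chart_bracket[OF d])
  have zd: "z \<in> dom M d" using z by blast
  obtain \<beta> W where W: "opn W" "z \<in> W" "W \<subseteq> dom M d \<inter> ovl c d" and \<beta>: "!!x. x \<in> im d W ==> \<beta> x = 1"
    and ex: "!!w h. h \<in> Sec d (dom M d) ==> \<exists>\<phi>. \<phi> \<in> densities M w \<and> \<phi> d = (\<lambda>x. \<beta> x *\<^sub>R h x) \<and> compact_support_in M d \<phi> \<and>
            (\<forall>q. sparity q h \<longrightarrow> (\<forall>e. sparity q (\<phi> e)))"
    by (rule local_density[OF d zd opn_ovl[OF c d] z]) (rule that)
  interpret A: chart_change M c d W by (rule chart_changeI[OF c d W(1)]) (use W(3) in blast)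
  let ?fc = "f c" and ?fd = "f d"
  have fS: "?fc \<in> Cb.S" "?fd \<in> Db.S" by (rule Cb.density_S[OF f(1)], rule Db.density_S[OF f(1)])
  define Zc where "Zc a = rs c W (Cb.bvec w p ?fc a)" for a
  define Zd where "Zd a = rs d W (Db.bvec w p ?fd a)" for a
  define lc where "lc = rs c W (Cb.bscal w ?fc)"
  define ld where "ld = rs d W (Db.bscal w ?fd)"
  have rc: "h \<in> Cb.S ==> rs c W h \<in> A.C.S" and rd: "h \<in> Db.S ==> rs d W h \<in> A.E.S" for h
    by (rule sections_restrict(1)[OF c dom_open[OF c] W(1) A.Wc order_refl], assumption)
      (rule sections_restrict(1)[OF d dom_open[OF d] W(1) A.Wd order_refl], assumption)
  have ZS: "Zc a \<in> A.C.S" "Zd a \<in> A.E.S" "sparity (\<epsilon> + p + spar n a) (Zc a)" "sparity (\<epsilon> + p + spar n a) (Zd a)" if "a < n + m" for a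
    unfolding Zc_def Zd_def using that fS f(2)
    by (auto intro!: rc rd Cb.bvec_S Db.bvec_S sparity_restrict Cb.bvec_parity Db.bvec_parity)
  have lS: "lc \<in> A.C.S" "ld \<in> A.E.S" unfolding lc_def ld_def by (intro rc rd Cb.bscal_S Db.bscal_S fS)+
  \<comment> \<open>The transformation law of the density \<open>bfam w f v \<phi>\<close>, written
    through the vector fields of f in both charts.\<close>
  have bt: "A.C.vf Zc (rs c W (\<phi> c)) + v *\<^sub>S (lc * rs c W (\<phi> c)) =
      A.t (A.E.vf Zd (rs d W (\<phi> d)) + v *\<^sub>S (ld * rs d W (\<phi> d))) * A.Jw (w + v)" if \<phi>: "\<phi> \<in> densities M v" for \<phi> v
  proof -
    have "rs c W (bfam w f v \<phi> c) = A.C.vf Zc (rs c W (\<phi> c)) + v *\<^sub>S (lc * rs c W (\<phi> c))"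
      unfolding bfam_local[OF c f \<phi>] Cb.bracket_vf[OF f(2) fS(1)] Zc_def lc_def by (simp add: vf_restrict[OF c W(1) A.Wc])
    moreover have "rs d W (bfam w f v \<phi> d) = A.E.vf Zd (rs d W (\<phi> d)) + v *\<^sub>S (ld * rs d W (\<phi> d))"
      unfolding bfam_local[OF d f \<phi>] Db.bracket_vf[OF f(2) fS(2)] Zd_def ld_def by (simp add: vf_restrict[OF d W(1) A.Wd])
    ultimately show ?thesis
      using density_transform[OF bfam_dens[OF f(1) \<phi>] A.chart_change_axioms] by simp
  qed
  \<comment> \<open>A cutoff equal to 1 on W makes the law available for every local function h of
    the chart d, at every weight v.\<close>
  have bh: "A.C.vf Zc (A.t (rs d W h) * A.Jw v) + v *\<^sub>S (lc * (A.t (rs d W h) * A.Jw v)) =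
      A.t (A.E.vf Zd (rs d W h) + v *\<^sub>S (ld * rs d W h)) * A.Jw (w + v)" if h: "h \<in> Db.S" for h v
  proof -
    obtain \<phi> where \<phi>: "\<phi> \<in> densities M v" "\<phi> d = (\<lambda>x. \<beta> x *\<^sub>R h x)" using ex[OF h, of v] by blast
    have 1: "rs d W (\<phi> d) = rs d W h" unfolding \<phi>(2) srestrict_eq_iff using \<beta> by simp
    then have 2: "rs c W (\<phi> c) = A.t (rs d W h) * A.Jw v" using density_transform[OF \<phi>(1) A.chart_change_axioms] by simp
    show ?thesis using bt[OF \<phi>(1)] unfolding 1 2 .
  qed
  have od: "rs d W (one d (dom M d)) = one d W" and xd: "rs d W (X d (dom M d) a) = X d W a" for a
    by (rule sections_restrict(4)[OF d dom_open[OF d] W(1) A.Wd order_refl],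
        rule sections_restrict(3)[OF d dom_open[OF d] W(1) A.Wd order_refl])
  \<comment> \<open>Coordinate volumes of weight v. The values v = 1 and v = - w are the ones that
    \<open>div_transform\<close> asks for; for v = - w the factor on the right becomes the
    unit.\<close>
  have v1: "A.C.vf Zc (A.Jw v) + v *\<^sub>S (lc * A.Jw v) = A.t (v *\<^sub>S ld) * A.Jw (w + v)" for v
    using bh[OF Db.S_one, of v] unfolding od
    by (simp add: A.t_one A.C.S_one_mult A.Jw_S A.E.vf_one A.E.S_one_mult lS)
  \<comment> \<open>Coordinate functions have weight 0, so the scalar parts disappear and only the
    vector fields are compared.\<close>
  have tr: "A.C.vf Zc (A.t (X d W a)) = A.t (Zd a) * A.Jw w" if a: "a < n + m" for a
  proof -
    have "A.E.vf Zd (X d W a) = (\<Sum>b<n + m. if b = a then Zd a else 0)"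
      unfolding A.E.vf_def by (intro sum.cong refl) (use a in \<open>auto simp: A.E.d_scoord A.E.S_one_mult ZS\<close>)
    then have "A.E.vf Zd (X d W a) = Zd a" using a by simp
    then show ?thesis
      using bh[OF Db.S_scoord[OF a], of 0] unfolding xd
      by (simp add: A.Jw_0 A.C.S_one_mult A.t_S A.E.S_scoord[OF a] sscale_simps)
  qed
  have D: "(\<Sum>a<n + m. (-1) ^ (spar n a * (\<epsilon> + p + 1)) *\<^sub>S A.C.d a (Zc a)) + (w - 1) *\<^sub>S lc =
     A.t ((\<Sum>a<n + m. (-1) ^ (spar n a * (\<epsilon> + p + 1)) *\<^sub>S A.E.d a (Zd a)) + (w - 1) *\<^sub>S ld) * A.Jw w"
  proof (rule A.div_transform[where Z = Zc and Z' = Zd])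
    show "A.C.vf Zc (A.Jw 1) + lc * A.Jw 1 = A.t ld * A.Jw (w + 1)" using v1[of 1] by (simp add: sscale_simps)
    have "A.C.vf Zc (A.Jw (- w)) + (- w) *\<^sub>S (lc * A.Jw (- w)) = - w *\<^sub>S A.t ld"
      using v1[of "- w"] lS A.C.S_one_mult(2)[OF A.C.S_scale[OF A.t_S[OF lS(2)]], of "- w"] by (simp add: A.Jw_0 A.t_scale)
    then show "A.C.vf Zc (A.Jw (- w)) - w *\<^sub>S (lc * A.Jw (- w)) = - w *\<^sub>S A.t ld"
      by (simp add: sscale_def fun_eq_iff sfun_apply)
  qed (use ZS lS tr in auto)
  have Cc: "rs c W (can_op w f c) = (1 / 2) *\<^sub>S ((\<Sum>a<n + m. (-1) ^ (spar n a * (\<epsilon> + p + 1)) *\<^sub>S A.C.d a (Zc a)) + (w - 1) *\<^sub>S lc)"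
    using c unfolding Zc_def lc_def
    by (simp add: can_op_def Cb.canonical_pencil_eq[OF fS(1)] Cb.canonical_bvec[OF fS(1), of w p] srestrict_sum
        sections_restrict(2)[OF c dom_open[OF c] W(1) A.Wc order_refl])
  have Cd: "rs d W (can_op w f d) = (1 / 2) *\<^sub>S ((\<Sum>a<n + m. (-1) ^ (spar n a * (\<epsilon> + p + 1)) *\<^sub>S A.E.d a (Zd a)) + (w - 1) *\<^sub>S ld)"
    using d unfolding Zd_def ld_def
    by (simp add: can_op_def Db.canonical_pencil_eq[OF fS(2)] Db.canonical_bvec[OF fS(2), of w p] srestrict_sum
        sections_restrict(2)[OF d dom_open[OF d] W(1) A.Wd order_refl])
  have "(\<Sum>a<n + m. (-1) ^ (spar n a * (\<epsilon> + p + 1)) *\<^sub>S A.E.d a (Zd a)) + (w - 1) *\<^sub>S ld \<in> A.E.S"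
    by (intro A.E.S_add A.E.S_sum A.E.S_scale A.E.d_S ZS lS) auto
  from A.t_scale[OF this, of "1 / 2"]
  have "rs c W (can_op w f c) = A.t (rs d W (can_op w f d)) * A.Jw w"
    unfolding Cc Cd D by (simp only: sscale_simps(7))
  then show ?thesis using W by blast
qed

lemma can_op_local: "c \<in> charts M ==> f \<in> densities M w ==> can_op w f c = superdomain.can n (im c (dom M c)) m \<epsilon> (\<sigma> c) (\<gamma> c) (\<theta> c) w (f c)"
proof -
  assume c: "c \<in> charts M" and f: "f \<in> densities M w"
  interpret chart_bracket M c \<epsilon> "\<sigma> c" "\<gamma> c" "\<theta> c" by (rule chart_bracket[OF c])
  show ?thesis using c by (simp add: can_op_def canonical_pencil_eq density_S[OF f])
qed

lemma can_op_dens: assumes f: "f \<in> densities M w" shows "can_op w f \<in> densities M w"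
proof -
  have hom: "can_op w f \<in> densities M w" if f: "f \<in> densities M w" "!!e. sparity p (f e)" for f p
  proof (rule densities_eqI)
    show "can_op w f c = 0" if "c \<notin> charts M" for c using that by (simp add: can_op_def)
    show "can_op w f c \<in> Sec c (dom M c)" if c: "c \<in> charts M" for c
    proof -
      interpret chart_bracket M c \<epsilon> "\<sigma> c" "\<gamma> c" "\<theta> c" by (rule chart_bracket[OF c])
      show ?thesis unfolding can_op_local[OF c f(1)] by (rule canonical_S[OF density_S[OF f(1)]])
    qed
    fix c d z assume c: "c \<in> charts M" "d \<in> charts M" "z \<in> ovl c d"
    obtain W where W: "opn W" "z \<in> W" "W \<subseteq> ovl c d" "rs c W (can_op w f c) = T c d W (rs d W (can_op w f d)) * chart_change.Jw M c d W w"
      using can_op_transform[OF f c] by blast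
    have "crd M c z \<in> im c W" using W(2) by blast
    from fun_cong[OF W(4), of "crd M c z"] srestrict_apply[OF this, of "can_op w f c"] W(1-3)
    show "\<exists>W. opn W \<and> z \<in> W \<and> W \<subseteq> ovl c d \<and> can_op w f c (crd M c z) = (T c d W (rs d W (can_op w f d)) * chart_change.Jw M c d W w) (crd M c z)"
      by (intro exI[of _ W]) simp
  qed
  have "can_op w f = can_op w (\<lambda>c. spart 0 (f c)) + can_op w (\<lambda>c. spart 1 (f c))"
  proof (rule ext)
    fix c
    show "can_op w f c = (can_op w (\<lambda>c. spart 0 (f c)) + can_op w (\<lambda>c. spart 1 (f c))) c"
    proof (cases "c \<in> charts M")
      case True
      interpret chart_bracket M c \<epsilon> "\<sigma> c" "\<gamma> c" "\<theta> c" by (rule chart_bracket[OF True])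
      have fS: "f c \<in> S" by (rule density_S[OF f])
      show ?thesis
        using canonical_add[OF S_part[OF fS] S_part[OF fS], of w 0 1]
        by (simp only: plus_fun_apply[of "can_op _ _"] can_op_local[OF True f] can_op_local[OF True density_spart[OF f]] spart_sum[symmetric])
    qed (simp add: can_op_def plus_fun_apply)
  qed
  then show ?thesis using density_add[OF hom[OF density_spart[OF f] sparity_spart] hom[OF density_spart[OF f] sparity_spart], of 0 1] by simp
qed

sublocale density_operator M \<epsilon> can_op
proof unfold_locales
  fix c assume c: "c \<in> charts M"
  interpret chart_bracket M c \<epsilon> "\<sigma> c" "\<gamma> c" "\<theta> c" by (rule chart_bracket[OF c])
  show "\<exists>D2 D1 A1 A0 B0. lop_coeffs \<epsilon> D2 D1 A1 A0 B0 \<and> (\<forall>w. \<forall>f\<in>densities M w. can_op w f c = lop D2 D1 A1 A0 B0 w (f c))"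
    by (rule exI, rule exI, rule exI, rule exI, rule exI, rule conjI[OF canonical_lop_coeffs])
      (intro allI ballI, simp only: can_op_local[OF c] canonical_lop[OF density_S])
qed (rule can_op_dens)

lemma can_op_adjoint: "is_adjoint M \<epsilon> w (can_op w) (can_op (1 - w))"
  unfolding is_adjoint_def density_parity_single scalar_product_single
proof (intro ballI allI impI)
  fix c p f g assume c: "c \<in> charts M" and f: "f \<in> densities M w" and g: "g \<in> densities M (1 - w)"
    and h: "(\<forall>c. sparity p (f c)) \<and> compact_support_in M c f"
  interpret chart_bracket M c \<epsilon> "\<sigma> c" "\<gamma> c" "\<theta> c" by (rule chart_bracket[OF c])
  show "sintegral n m (can_op w f c * g c) = (-1) ^ (\<epsilon> * p) * sintegral n m (f c * can_op (1 - w) g c)"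
    unfolding can_op_local[OF c f] can_op_local[OF c g]
    by (rule canonical_adjoint) (use h csupp_density[OF c f] density_S[OF g] in auto)
qed

lemma oper_normalized: "oper \<in> normalized_self_adjoint_operators M \<epsilon>"
  using oper_second_order oper_one can_op_adjoint
  by (auto simp: normalized_self_adjoint_operators_def self_adjoint_pencil_def is_adjoint_def pencil_oper)

lemma dbr_bfam: assumes f: "f \<in> densities M u" "!!e. sparity p (f e)" and g: "g \<in> densities M w" shows "dbr u p f w g = bfam u f w g"
proof (rule density_eqI[OF dbr_dens[OF f(1) g] bfam_dens[OF f(1) g]])
  fix c assume c: "c \<in> charts M"
  interpret chart_bracket M c \<epsilon> "\<sigma> c" "\<gamma> c" "\<theta> c" by (rule chart_bracket[OF c])
  have fg: "(f * g) c = f c * g c" by (rule times_fun_apply)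
  have "dbr u p f w g c = can_op (u + w) (f * g) c - can_op u f c * g c - (-1) ^ (\<epsilon> * p) *\<^sub>S (f c * can_op w g c)"
    by (rule ext) (simp add: dbr_def sfun_apply)
  then show "dbr u p f w g c = bfam u f w g c"
    unfolding bfam_local[OF c f g] can_op_local[OF c f(1)] can_op_local[OF c g] can_op_local[OF c density_mult[OF f(1) g]] fg
      canonical_mult[OF density_S[OF f(1)] f(2) density_S[OF g]] by simp
qed

text \<open>Both brackets are biadditive and \<open>undefined\<close> outside the algebra, so
  comparison on single weights of definite parity, that is \<open>dbr_bfam\<close>, is
  enough.\<close>

lemma gbr_eq: "gbr = B"
proof (rule PiE_ext)
  show "gbr \<in> DA \<rightarrow>\<^sub>E DA \<rightarrow>\<^sub>E DA" using gbr_brackets by (simp add: brackets_def)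
  show "B \<in> DA \<rightarrow>\<^sub>E DA \<rightarrow>\<^sub>E DA" using B by (simp add: brackets_def)
  have add: "!!\<psi> \<phi> \<omega>. \<psi> \<in> DA ==> \<phi> \<in> DA ==> \<omega> \<in> DA ==> B (\<psi> + \<phi>) \<omega> = B \<psi> \<omega> + B \<phi> \<omega> \<and> B \<psi> (\<phi> + \<omega>) = B \<psi> \<phi> + B \<psi> \<omega>"
    using B by (simp add: brackets_def)
  fix \<psi> assume \<psi>: "\<psi> \<in> DA"
  show "gbr \<psi> = B \<psi>"
  proof (rule PiE_ext)
    show "gbr \<psi> \<in> DA \<rightarrow>\<^sub>E DA" using gbr_brackets \<psi> by (auto simp: brackets_def dest: PiE_mem)
    show "B \<psi> \<in> DA \<rightarrow>\<^sub>E DA" using B \<psi> by (auto simp: brackets_def dest: PiE_mem)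
    fix \<phi> assume \<phi>: "\<phi> \<in> DA"
    show "gbr \<psi> \<phi> = B \<psi> \<phi>"
      using \<psi>
    proof (induction \<psi> rule: DA_induct)
      case f: (single u f p)
      from \<phi> show ?case
      proof (induction \<phi> rule: DA_induct)
        case (single w g r)
        then show ?case using f by (simp add: gbr_single[OF f] B_single dbr_bfam[OF f])
      qed (simp add: gbr_add add DA_single f)
    qed (simp add: gbr_add add \<phi>)
  qed
qed

end

theorem theorem1:
  fixes M :: "('p, 'c) superatlas" and \<epsilon> :: nat
  assumes "supermanifold M" and "\<epsilon> \<in> {0, 1}"
  shows "bij_betw (generated_bracket M \<epsilon>) (normalized_self_adjoint_operators M \<epsilon>) (brackets M \<epsilon>) \<and>
    (\<forall>B\<in>brackets M \<epsilon>. \<forall>\<Delta>\<in>normalized_self_adjoint_operators M \<epsilon>. generated_bracket M \<epsilon> \<Delta> = B \<longrightarrow>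
       (\<forall>c\<in>charts M. \<forall>S \<gamma> \<theta>. has_bracket_matrix M \<epsilon> B c S \<gamma> \<theta> \<longrightarrow>
          (\<forall>w. \<forall>f\<in>densities M w. pencil \<Delta> w f c = canonical_pencil M \<epsilon> c S \<gamma> \<theta> w (f c))))"
proof -
  interpret supermfd M by unfold_locales (rule assms(1))
  let ?N = "normalized_self_adjoint_operators M \<epsilon>" and ?g = "generated_bracket M \<epsilon>"
  have N: "density_operator M \<epsilon> (pencil \<Delta>)" "density_operator.oper M (pencil \<Delta>) = \<Delta>"
    "\<And>w. is_adjoint M \<epsilon> w (pencil \<Delta> w) (pencil \<Delta> (1 - w))" if "\<Delta> \<in> ?N" for \<Delta>
    using that second_order_operator[of \<Delta>] by (auto simp: normalized_self_adjoint_operators_def self_adjoint_pencil_def)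
  have gen: "?g \<Delta> \<in> brackets M \<epsilon>" if \<Delta>: "\<Delta> \<in> ?N" for \<Delta>
    using density_operator.gbr_brackets[OF N(1)[OF \<Delta>]] by (simp only: N(2)[OF \<Delta>])
  \<comment> \<open>Equal brackets force equal pencils by \<open>self_adjoint_operators_eq\<close>,
    and the operators are reassembled from their pencils.\<close>
  have inj: "\<Delta> = \<Delta>'" if \<Delta>: "\<Delta> \<in> ?N" and \<Delta>': "\<Delta>' \<in> ?N" and eq: "?g \<Delta> = ?g \<Delta>'" for \<Delta> \<Delta>'
  proof -
    interpret P: density_operator M \<epsilon> "pencil \<Delta>" by (rule N(1)[OF \<Delta>])
    interpret Q: density_operator M \<epsilon> "pencil \<Delta>'" by (rule N(1)[OF \<Delta>'])
    have p: "pencil \<Delta> w f = pencil \<Delta>' w f" if "f \<in> densities M w" for w f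
      by (rule self_adjoint_operators_eq[OF N(1)[OF \<Delta>] N(1)[OF \<Delta>'] N(3)[OF \<Delta>] N(3)[OF \<Delta>'] _ that])
        (simp only: N(2)[OF \<Delta>] N(2)[OF \<Delta>'] eq)
    have "P.oper \<psi> = Q.oper \<psi>" for \<psi>
    proof (cases "\<psi> \<in> DA")
      case True
      show ?thesis by (rule poly_mapping_eqI) (simp add: P.lookup_oper Q.lookup_oper True p DA_lookup)
    qed (simp add: P.oper_def Q.oper_def)
    then show ?thesis by (metis N(2) \<Delta> \<Delta>' ext)
  qed
  have can: "canonical_operator M \<epsilon> B \<sigma> \<gamma> \<theta>"
    if "B \<in> brackets M \<epsilon>" "\<And>c. c \<in> charts M \<Longrightarrow> has_bracket_matrix M \<epsilon> B c (\<sigma> c) (\<gamma> c) (\<theta> c)" for B \<sigma> \<gamma> \<theta>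
    by unfold_locales (use that in auto)
  have choice: "\<exists>\<sigma> \<gamma> \<theta>. \<forall>c\<in>charts M. has_bracket_matrix M \<epsilon> B c (\<sigma> c) (\<gamma> c) (\<theta> c)" if "B \<in> brackets M \<epsilon>" for B
  proof -
    have "\<forall>c\<in>charts M. \<exists>S \<gamma> \<theta>. has_bracket_matrix M \<epsilon> B c S \<gamma> \<theta>" using that unfolding brackets_def by blast
    then show ?thesis by metis
  qed
  have surj: "\<exists>\<Delta>\<in>?N. ?g \<Delta> = B" if B: "B \<in> brackets M \<epsilon>" for B
  proof -
    obtain \<sigma> \<gamma> \<theta> where "\<And>c. c \<in> charts M \<Longrightarrow> has_bracket_matrix M \<epsilon> B c (\<sigma> c) (\<gamma> c) (\<theta> c)" using choice[OF B] by blast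
    then interpret canonical_operator M \<epsilon> B \<sigma> \<gamma> \<theta> by (intro can B)
    show ?thesis using oper_normalized gbr_eq by blast
  qed
  have "bij_betw ?g ?N (brackets M \<epsilon>)"
    unfolding bij_betw_def inj_on_def using gen inj surj by blast
  moreover have "pencil \<Delta> w f c = canonical_pencil M \<epsilon> c S \<gamma> \<theta> w (f c)"
    if B: "B \<in> brackets M \<epsilon>" and \<Delta>: "\<Delta> \<in> ?N" "?g \<Delta> = B" and c: "c \<in> charts M"
      and matrix: "has_bracket_matrix M \<epsilon> B c S \<gamma> \<theta>" and f: "f \<in> densities M w" for B \<Delta> c S \<gamma> \<theta> w f
  proof -
    obtain \<sigma>' \<gamma>' \<theta>' where "\<And>c. c \<in> charts M \<Longrightarrow> has_bracket_matrix M \<epsilon> B c (\<sigma>' c) (\<gamma>' c) (\<theta>' c)" using choice[OF B] by blast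
    \<comment> \<open>The matrices in the other charts are arbitrary choices; in c the given one is
      used, so that the operator constructed there is the asserted pencil, and injectivity
      identifies it with \<Delta>.\<close>
    then interpret canonical_operator M \<epsilon> B "\<sigma>'(c := S)" "\<gamma>'(c := \<gamma>)" "\<theta>'(c := \<theta>)"
      using matrix by (intro can B) auto
    have "\<Delta> = oper" by (rule inj[OF \<Delta>(1) oper_normalized]) (simp add: gbr_eq \<Delta>(2))
    then show ?thesis using c by (simp add: pencil_oper f can_op_def)
  qed
  ultimately show ?thesis by blast
qed

end
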